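(* For every real number $\theta>1$ and (Lebesgue-)almost every $\alpha \in \mathbb{R}$, the sequence $(n^\theta \alpha)_{n \geq 1}$ has Poissonian pair correlation.
   Context: For $s \geq 0$ and $N\ge 1$, $\mathbf{1}_{[-s/N,s/N]}$ denotes the indicator function of $[-s/N,s/N]$ extended with period $1$, i.e. $\mathbf{1}_{[-s/N,s/N]}(x)=1$ if the signed difference between $x$ and its nearest integer lies in $[-s/N,s/N]$, and $0$ otherwise. A sequence $(y_n)_{n \geq 1}$ of real numbers has Poissonian pair correlation if for all real $s \geq 0$, $$\lim_{N \to \infty} \frac{1}{N} \sum_{\substack{1 \leq m,n \leq N,\\ m \neq n}} \mathbf{1}_{[-s/N,s/N]} (y_n - y_m) = 2 s.$$ *)

theory Defs
  imports "HOL-Analysis.Analysis"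
begin

definition signed_dist_nearest_int :: "real \<Rightarrow> real"
  where "signed_dist_nearest_int x = x - of_int (round x)"

(* At half-integers round picks the upper neighbour. Intervals [-r, r] are symmetric,
   so this choice does not affect the value. *)
definition periodic_indicator :: "real \<Rightarrow> real \<Rightarrow> real"
  where "periodic_indicator r x = indicator {-r..r} (signed_dist_nearest_int x)"

(* Sequences are indexed from 1; the value y 0 plays no role. The term N = 0 of the
   sequence of averages is irrelevant to the limit. *)
definition poissonian_pair_correlation :: "(nat \<Rightarrow> real) \<Rightarrow> bool"
  where "poissonian_pair_correlation y \<longleftrightarrow>
    (\<forall>s\<ge>0. (\<lambda>N. 1 / real N *
        (\<Sum>(m, n) \<in> {(m, n). m \<in> {1..N} \<and> n \<in> {1..N} \<and> m \<noteq> n}.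
           periodic_indicator (s / real N) (y n - y m)))
      \<longlonglongrightarrow> 2 * s)"

end

theory Submission
  imports Defs "HOL-Probability.Probability"
begin

text \<open>Let \<open>\<alpha>\<close> be a standard Gaussian variable; a null set for it is a Lebesgue null set. Sandwich the
  indicator between trapezoids, whose Fourier coefficients are \<open>O(min (1/N) (N/j\<^sup>2))\<close>. With \<open>x\<^sub>p = n\<^sup>\<theta> - m\<^sup>\<theta>\<close> for
  \<open>p = (n, m)\<close>, the variance of the smoothed count is controlled, for \<open>j, k\<close> in a dyadic block of length \<open>J\<close>, by
  \<open>\<Sum> exp (- 2 \<pi>\<^sup>2 (j x\<^sub>p - k x\<^sub>q)\<^sup>2)\<close>. Passing to logarithms, this is at most a Gaussian mean value of
  \<open>|\<Sum>\<^sub>j j\<^bsup>it\<^esup>|\<^sup>2 |\<Sum>\<^sub>p x\<^sub>p\<^bsup>it\<^esup>|\<^sup>2\<close>. Exponential sum estimates (van der Corput) save a power of \<open>N\<close> in the first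
  factor as soon as \<open>|t| \<ge> N\<^bsup>2/5\<^esup>\<close>; the second factor has mean value governed by the number of pairs \<open>p, q\<close> with
  \<open>x\<^sub>p\<close> and \<open>x\<^sub>q\<close> within \<open>N\<^bsup>\<theta>-2\<^esup>\<close> of each other, which is \<open>O(N\<^bsup>2.3\<^esup>)\<close>: for fixed small increments \<open>u = n' - n\<close>,
  \<open>v = m' - m\<close> the near solutions are lattice points near a smooth curve whose curvature is known.
  Pairs with \<open>m\<close> or \<open>n - m\<close> below \<open>N\<^bsup>1-\<epsilon>\<^esup>\<close> are few and are treated by a first moment bound.
  Hence the smoothed counts converge in mean with a power saving, so almost surely along
  \<open>N = k\<^sup>A\<close>, and monotonicity fills the gaps.\<close>

section \<open>Exponential sums\<close>

text \<open>Against Fourier coefficients of size N / \<open>max J N\<close>^2, the pair sum of a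
  block must be at most \<open>max J N\<close>^2 N^(2 - \<delta>). It is, because the saving
  N^(-8/25) outweighs the excess N^(3/10) of the energy over N^2. Both exponents lie just inside the
  reach of their method: differencing with shifts up to H balances near H = N^(1/3), and the curve
  count stays below N^2 for increments up to about N^(5/7). Frequencies below the cut-off need no
  saving: their share of the Gaussian weight is proportional to the cut-off, and the bound for the
  pairs at that scale is inversely proportional to it. Logarithms enter because j x_p is a product;
  on the logarithmic scale the sum over (j, p) splits into two factors. That \<theta> exceeds 1 is
  felt where all good x_p must exceed N by a power. Gaussian variables and weights are chosen for
  their positive Fourier transform: every kernel is nonnegative, so coefficients may be replaced by
  a common bound and kernels enlarged freely.\<close>

lemma sin_pi_ge:
  fixes x :: real
  assumes "0 \<le> x" "x \<le> 1/2"
  shows "2 * x \<le> sin (pi * x)"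
proof -
  have "convex_on {0..pi} (\<lambda>x. - sin x)"
  proof (rule f''_ge0_imp_convex)
    show "((\<lambda>x. - sin x) has_real_derivative - cos x) (at x)" for x :: real
      by (auto intro!: derivative_eq_intros)
    show "((\<lambda>x. - cos x) has_real_derivative sin x) (at x)" for x :: real
      by (auto intro!: derivative_eq_intros)
  qed (auto intro: sin_ge_zero)
  from convex_onD[OF this, of "2 * x" 0 "pi/2"] assms show ?thesis
    by (auto simp: algebra_simps)
qed

lemma sin_pi_ge':
  fixes x c :: real
  assumes "0 < c" "c \<le> x" "x \<le> 1 - c"
  shows "2 * c \<le> sin (pi * x)"
proof (cases "x \<le> 1/2")
  case True
  then show ?thesis using sin_pi_ge[of x] assms by auto
next
  case False
  have "sin (pi * x) = sin (pi * (1 - x))"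
    by (simp add: algebra_simps sin_diff)
  then show ?thesis using sin_pi_ge[of "1 - x"] assms False by auto
qed

definition ee :: "real \<Rightarrow> complex" where "ee x = cis (2 * pi * x)"

lemma norm_ee [simp]: "norm (ee x) = 1" by (simp add: ee_def)
lemma ee_add: "ee (x + y) = ee x * ee y" by (simp add: ee_def cis_mult distrib_left)
lemma ee_int [simp]: "ee (of_int k) = 1"
  by (simp add: ee_def cis_multiple_2pi)
lemma cnj_ee: "cnj (ee x) = ee (- x)" by (simp add: ee_def cis_cnj)

text \<open>The reciprocal of \<open>1 - ee x\<close> has constant real part 1/2, so all its
  variation is that of a cotangent; the monotonicity of the latter drives
  \<open>Kusmin_Landau\<close>.\<close>

lemma inverse_one_minus_ee:
  assumes "sin (pi * x) \<noteq> 0"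
  shows "(1 - ee x) * Complex (1/2) (cot (pi * x) / 2) = 1"
proof -
  define s c where "s = sin (pi * x)" and "c = cos (pi * x)"
  have 1: "ee x = Complex (1 - 2 * s\<^sup>2) (2 * s * c)"
    using cos_double_sin[of "pi * x"] sin_double[of "pi * x"]
    by (simp add: ee_def cis.ctr s_def c_def mult.assoc)
  have 2: "s * s + c * c = 1" by (simp add: s_def c_def flip: power2_eq_square)
  show ?thesis using assms 2 unfolding 1 cot_def s_def[symmetric] c_def[symmetric]
    by (simp add: complex_eq_iff field_simps power2_eq_square)
qed

lemma cot_pi_antimono:
  fixes x y :: real
  assumes "0 < x" "x \<le> y" "y < 1"
  shows "cot (pi * y) \<le> cot (pi * x)"
proof -
  have s: "sin (pi * x) > 0" "sin (pi * y) > 0" "sin (pi * (y - x)) \<ge> 0"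
    using assms by (auto intro!: sin_gt_zero sin_ge_zero)
  have "cot (pi * x) - cot (pi * y) = sin (pi * (y - x)) / (sin (pi * x) * sin (pi * y))"
    using s by (simp add: cot_def field_simps right_diff_distrib sin_diff)
  also have "\<dots> \<ge> 0" using s by simp
  finally show ?thesis by simp
qed

text \<open>Writing \<open>c n = 1 / (1 - ee (d n))\<close>, each term is \<open>c n * (z n - z (n + 1))\<close>, and the
  \<open>c n\<close> lie on a vertical line and move monotonically, so summation by parts applies.\<close>

lemma Kusmin_Landau:
  fixes g :: "nat \<Rightarrow> real" and k :: int
  assumes \<kappa>: "0 < \<kappa>"
  assumes d: "\<And>n. l \<le> n \<Longrightarrow> n < u \<Longrightarrow> \<kappa> \<le> g (Suc n) - g n - k \<and> g (Suc n) - g n - k \<le> 1 - \<kappa>"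
  assumes mono: "\<And>n. l \<le> n \<Longrightarrow> Suc n < u \<Longrightarrow> g (Suc n) - g n \<le> g (Suc (Suc n)) - g (Suc n)"
  shows "norm (\<Sum>n=l..<u. ee (g n)) \<le> 1 / \<kappa>"
proof (cases "l < u")
  case False
  then show ?thesis using \<kappa> by simp
next
  case True
  define D where "D n = g (Suc n) - g n - k" for n
  define c where "c n = Complex (1/2) (cot (pi * D n) / 2)" for n
  have D: "\<kappa> \<le> D n" "D n \<le> 1 - \<kappa>" if "l \<le> n" "n < u" for n using d[of n] that by (auto simp: D_def)
  have s: "2 * \<kappa> \<le> sin (pi * D n)" if "l \<le> n" "n < u" for n
    using sin_pi_ge'[OF \<kappa> D[OF that]] .
  have cot: "\<bar>cot (pi * D n)\<bar> \<le> 1 / (2 * \<kappa>)" if "l \<le> n" "n < u" for n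
  proof -
    have "\<bar>cot (pi * D n)\<bar> = \<bar>cos (pi * D n)\<bar> / sin (pi * D n)"
      using s[OF that] \<kappa> by (simp add: cot_def)
    also have "\<dots> \<le> 1 / (2 * \<kappa>)" using s[OF that] \<kappa> by (intro frac_le) auto
    finally show ?thesis .
  qed
  have nc: "norm (c n) \<le> 1 / (4 * \<kappa>)" if "l \<le> n" "n < u" for n
  proof -
    have p: "sin (pi * D n) > 0" using s[OF that] \<kappa> by linarith
    have "1 + (cot (pi * D n))\<^sup>2 = (1 / sin (pi * D n))\<^sup>2"
      using p sin_cos_squared_add[of "pi * D n"]
      by (simp add: cot_def field_simps power2_eq_square)
    then have "(norm (c n))\<^sup>2 = (1 / (2 * sin (pi * D n)))\<^sup>2"
      by (simp add: c_def cmod_power2 power_divide power_mult_distrib field_simps)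
    then have "norm (c n) = 1 / (2 * sin (pi * D n))" using p
      by (metis abs_of_nonneg less_eq_real_def norm_ge_zero power2_eq_iff_nonneg zero_less_divide_1_iff zero_less_mult_iff zero_less_numeral)
    also have "\<dots> \<le> 1 / (4 * \<kappa>)" using s[OF that] \<kappa> by (intro frac_le) auto
    finally show ?thesis .
  qed
  have z: "ee (g n) = c n * (ee (g n) - ee (g (Suc n)))" if "l \<le> n" "n < u" for n
  proof -
    have "ee (g (Suc n)) = ee (g n) * ee (D n)"
    proof -
      have "g (Suc n) = (g n + D n) + of_int k" by (simp add: D_def)
      then show ?thesis by (metis ee_add ee_int mult.right_neutral)
    qed
    then have "c n * (ee (g n) - ee (g (Suc n))) = ee (g n) * ((1 - ee (D n)) * c n)"
      by (simp add: algebra_simps)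
    also have "(1 - ee (D n)) * c n = 1"
      unfolding c_def using s[OF that] \<kappa> by (intro inverse_one_minus_ee) auto
    finally show ?thesis by simp
  qed
  \<comment> \<open>Invariant of the summation by parts: \<open>z\<close> telescopes the partial sum
    up to the boundary term \<open>c m * ee (g (Suc m))\<close>, and the total variation of
    \<open>c\<close> telescopes because the cotangents decrease.\<close>
  have main: "norm ((\<Sum>n=l..<Suc m. ee (g n)) + c m * ee (g (Suc m)))
      \<le> norm (c l) + (cot (pi * D l) - cot (pi * D m)) / 2" if "l \<le> m" "m < u" for m
    using that
  proof (induction m rule: dec_induct)
    case base
    have "ee (g l) + c l * ee (g (Suc l)) = c l * ee (g l)"
      using z[of l] True by (simp add: algebra_simps)
    then show ?case by (simp add: norm_mult)
  next
    case (step m)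
    have IH: "norm ((\<Sum>n=l..<Suc m. ee (g n)) + c m * ee (g (Suc m)))
      \<le> norm (c l) + (cot (pi * D l) - cot (pi * D m)) / 2" using step by simp
    have "D m \<le> D (Suc m)" using mono[of m] step by (simp add: D_def)
    then have ct: "cot (pi * D (Suc m)) \<le> cot (pi * D m)"
      using D[of m] D[of "Suc m"] step \<kappa> by (intro cot_pi_antimono) auto
    have "(\<Sum>n=l..<Suc (Suc m). ee (g n)) + c (Suc m) * ee (g (Suc (Suc m)))
       = (\<Sum>n=l..<Suc m. ee (g n)) + (ee (g (Suc m)) + c (Suc m) * ee (g (Suc (Suc m))))"
      using step by simp
    also have "ee (g (Suc m)) + c (Suc m) * ee (g (Suc (Suc m))) = c (Suc m) * ee (g (Suc m))"
      using z[of "Suc m"] step by (simp add: algebra_simps)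
    also have "(\<Sum>n=l..<Suc m. ee (g n)) + c (Suc m) * ee (g (Suc m)) =
       ((\<Sum>n=l..<Suc m. ee (g n)) + c m * ee (g (Suc m))) + (c (Suc m) - c m) * ee (g (Suc m))"
      by (simp add: algebra_simps)
    also have "norm \<dots> \<le> norm (c l) + (cot (pi * D l) - cot (pi * D m)) / 2 + norm (c (Suc m) - c m)"
      by (rule order_trans[OF norm_triangle_ineq], rule add_mono[OF IH]) (simp add: norm_mult)
    also have "c (Suc m) - c m = Complex 0 ((cot (pi * D (Suc m)) - cot (pi * D m)) / 2)"
      by (simp add: c_def complex_eq_iff field_simps)
    also have "norm \<dots> = (cot (pi * D m) - cot (pi * D (Suc m))) / 2"
      using ct by (simp add: cmod_def)
    finally show ?case by (simp add: field_simps)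
  qed
  obtain m where m: "u = Suc m" "l \<le> m" using True by (cases u) auto
  have "norm (\<Sum>n=l..<u. ee (g n)) \<le> norm ((\<Sum>n=l..<Suc m. ee (g n)) + c m * ee (g (Suc m))) + norm (c m * ee (g (Suc m)))"
    unfolding m by (metis add_diff_cancel_right' norm_triangle_ineq4)
  also have "\<dots> \<le> norm (c l) + (cot (pi * D l) - cot (pi * D m)) / 2 + norm (c m)"
    unfolding norm_mult norm_ee mult_1_right using main[OF m(2)] m(1) by (intro add_mono) (auto simp only:)
  also have "\<dots> \<le> 1 / (4 * \<kappa>) + (1 / (2 * \<kappa>) + 1 / (2 * \<kappa>)) / 2 + 1 / (4 * \<kappa>)"
    using nc[of l] nc[of m] cot[of l] cot[of m] m True by (intro add_mono divide_right_mono) auto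
  also have "\<dots> = 1 / \<kappa>" using \<kappa> by (simp add: field_simps)
  finally show ?thesis .
qed

section \<open>The second derivative test\<close>

lemma card_spaced_le:
  fixes d :: "nat \<Rightarrow> real"
  assumes lo: "lo > 0" and A: "A \<subseteq> {a..<b}"
  assumes sp: "\<And>n. a \<le> n \<Longrightarrow> Suc n < b \<Longrightarrow> lo \<le> d (Suc n) - d n"
  assumes I: "\<And>n. n \<in> A \<Longrightarrow> x \<le> d n \<and> d n \<le> x + w" and w: "w \<ge> 0"
  shows "real (card A) \<le> w / lo + 1"
proof (cases "A = {}")
  case True
  then show ?thesis using w lo by simp
next
  case False
  have fin: "finite A" using A finite_subset by blast
  define l u where "l = Min A" and "u = Max A"
  have lu: "l \<in> A" "u \<in> A" "l \<le> u" "A \<subseteq> {l..u}" using False fin by (auto simp: l_def u_def)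
  have grow: "(real m - real l) * lo \<le> d m - d l" if "l \<le> m" "m < b" for m
    using that
  proof (induction m rule: dec_induct)
    case (step m)
    have "lo \<le> d (Suc m) - d m" using lu A step by (intro sp) auto
    then show ?case using step by (simp add: algebra_simps)
  qed simp
  have "(real u - real l) * lo \<le> w" using grow[of u] I[of u] I[of l] lu A by (auto simp: subset_iff)
  then have "real u - real l \<le> w / lo" using lo by (simp add: field_simps)
  moreover have "card A \<le> u - l + 1" using card_mono[of "{l..u}" A] lu by simp
  ultimately show ?thesis using lu by linarith
qed

text \<open>Sort the indices by the integer part of the increasing first difference; this gives at
  most (b - a) \<open>hi\<close> + 2 classes. In each class the indices whose slope is within
  \<kappa> of an integer are counted one by one, their slopes being \<open>lo\<close>-spaced, and on
  the rest \<open>Kusmin_Landau\<close> applies.\<close>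

lemma second_difference_test:
  fixes g :: "nat \<Rightarrow> real"
  assumes lo: "0 < lo" "lo \<le> hi"
  assumes d2: "\<And>n. a \<le> n \<Longrightarrow> Suc n < b \<Longrightarrow>
     lo \<le> g (Suc (Suc n)) - 2 * g (Suc n) + g n \<and> g (Suc (Suc n)) - 2 * g (Suc n) + g n \<le> hi"
  shows "norm (\<Sum>n=a..<b. ee (g n)) \<le> 5 * (real (b - a) * hi + 2) / sqrt lo"
proof (cases "lo \<le> 1 \<and> a < b")
  case False
  show ?thesis
  proof (cases "a < b")
    case True
    \<comment> \<open>For \<open>lo > 1\<close> the claim is weaker than the trivial bound b - a,
      since \<open>sqrt lo\<close> is then at most \<open>lo\<close>, hence at most
      \<open>hi\<close>.\<close>
    then have "lo > 1" using False by simp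
    then have "sqrt lo * 1 \<le> sqrt lo * sqrt lo" by (intro mult_left_mono) auto
    then have "sqrt lo \<le> lo" using lo by simp
    then have "1 * sqrt lo \<le> 5 * hi" using lo by linarith
    then have "real (b - a) * sqrt lo \<le> real (b - a) * (5 * hi)" by (intro mult_left_mono) auto
    then have "real (b - a) \<le> 5 * (real (b - a) * hi + 2) / sqrt lo" using lo by (simp add: field_simps)
    moreover have "norm (\<Sum>n=a..<b. ee (g n)) \<le> real (b - a)"
      using norm_sum[of "\<lambda>n. ee (g n)" "{a..<b}"] by simp
    ultimately show ?thesis by linarith
  qed (use lo in auto)
next
  case True
  define d where "d n = g (Suc n) - g n" for n
  have sp: "lo \<le> d (Suc n) - d n" "d (Suc n) - d n \<le> hi" if "a \<le> n" "Suc n < b" for n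
    using d2[OF that] by (auto simp: d_def)
  \<comment> \<open>This width balances the count \<kappa> / \<open>lo\<close> of slopes near an
    integer against the bound 1 / \<kappa> for the others; both become multiples of 1 /
    \<open>sqrt lo\<close>.\<close>
  define \<kappa> where "\<kappa> = sqrt lo / 2"
  have \<kappa>: "0 < \<kappa>" "\<kappa> \<le> 1/2" using lo True by (auto simp: \<kappa>_def)
  have dmono: "d m \<le> d n" if "a \<le> m" "m \<le> n" "n < b" for m n
    using that(2,1,3)
  proof (induction n rule: dec_induct)
    case (step n)
    then show ?case using sp(1)[of n] lo by auto
  qed simp
  define S where "S k = {n\<in>{a..<b}. \<lfloor>d n\<rfloor> = k}" for k
  have Sb: "norm (\<Sum>n\<in>S k. ee (g n)) \<le> 5 / sqrt lo" for k
  proof -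
    define A where "A = {n\<in>S k. d n < k + \<kappa>}"
    define C where "C = {n\<in>S k. d n > k + (1 - \<kappa>)}"
    define B where "B = {n\<in>S k. k + \<kappa> \<le> d n \<and> d n \<le> k + (1 - \<kappa>)}"
    have fin: "finite A" "finite B" "finite C" by (auto simp: A_def B_def C_def S_def)
    have bnd: "k \<le> d n" "d n < k + 1" if "n \<in> S k" for n
      using that by (auto simp: S_def)
    have Sk: "S k = A \<union> B \<union> C" by (auto simp: A_def B_def C_def)
    have dj: "A \<inter> B = {}" "(A \<union> B) \<inter> C = {}" using \<kappa> by (auto simp: A_def B_def C_def)
    have "real (card A) \<le> \<kappa> / lo + 1"
      using lo(1) sp(1) \<kappa> bnd by (intro card_spaced_le[of lo A a b d k]) (auto simp: A_def S_def)
    moreover have "real (card C) \<le> \<kappa> / lo + 1"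
    proof (intro card_spaced_le[of lo C a b d "k + (1 - \<kappa>)"])
      fix n assume "n \<in> C"
      then show "k + (1 - \<kappa>) \<le> d n \<and> d n \<le> k + (1 - \<kappa>) + \<kappa>" using bnd[of n] by (auto simp: C_def)
    qed (use lo sp \<kappa> in \<open>auto simp: C_def S_def\<close>)
    moreover have "\<kappa> / lo + 1 \<le> 3 / 2 / sqrt lo"
    proof -
      define q where "q = sqrt lo"
      have "q > 0" "lo = q * q" "q \<le> 1" using True lo by (simp_all add: q_def)
      then show ?thesis unfolding \<kappa>_def q_def[symmetric] by (simp add: field_simps)
    qed
    moreover have "norm (\<Sum>n\<in>B. ee (g n)) \<le> 1 / \<kappa>"
    proof (cases "B = {}")
      case False
      define l' u' where "l' = Min B" and "u' = Suc (Max B)"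
      \<comment> \<open>Monotone slopes make the middle class an interval of indices, as
        \<open>Kusmin_Landau\<close> requires.\<close>
      have Beq: "B = {l'..<u'}"
      proof (intro equalityI subsetI)
        fix n assume n: "n \<in> {l'..<u'}"
        obtain x y where xy: "x \<in> B" "y \<in> B" "x = Min B" "y = Max B" using False fin by auto
        have n': "x \<le> n" "n \<le> y" using n xy(3,4) by (auto simp: l'_def u'_def)
        have xy': "a \<le> x" "y < b" "k + \<kappa> \<le> d x" "d y \<le> k + (1 - \<kappa>)"
          using xy(1,2) by (auto simp: B_def S_def)
        have "d x \<le> d n" "d n \<le> d y" using n' xy' by (auto intro!: dmono)
        with n' xy' \<kappa> show "n \<in> B" unfolding B_def S_def
          by (auto simp: floor_eq_iff)
      qed (use fin in \<open>auto simp: less_Suc_eq_le l'_def u'_def\<close>)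
      have "(\<Sum>n\<in>B. ee (g n)) = (\<Sum>n=l'..<u'. ee (g n))" unfolding Beq ..
      also have "norm \<dots> \<le> 1 / \<kappa>"
      proof (rule Kusmin_Landau[OF \<kappa>(1), of _ _ g k])
        fix n assume "l' \<le> n" "n < u'"
        then have "n \<in> B" unfolding Beq by auto
        then show "\<kappa> \<le> g (Suc n) - g n - k \<and> g (Suc n) - g n - k \<le> 1 - \<kappa>" by (auto simp: B_def d_def)
      next
        fix n assume n: "l' \<le> n" "Suc n < u'"
        then have "n \<in> B" "Suc n \<in> B" unfolding Beq by auto
        then show "g (Suc n) - g n \<le> g (Suc (Suc n)) - g (Suc n)"
          using dmono[of n "Suc n"] by (auto simp: B_def S_def d_def)
      qed
      finally show ?thesis .
    qed (use \<kappa> in auto)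
    moreover have "1 / \<kappa> = 2 / sqrt lo" by (simp add: \<kappa>_def)
    moreover have "norm (\<Sum>n\<in>S k. ee (g n)) \<le> real (card A) + norm (\<Sum>n\<in>B. ee (g n)) + real (card C)"
    proof -
      have "(\<Sum>n\<in>S k. ee (g n)) = (\<Sum>n\<in>A. ee (g n)) + (\<Sum>n\<in>B. ee (g n)) + (\<Sum>n\<in>C. ee (g n))"
        unfolding Sk using fin dj by (simp add: sum.union_disjoint)
      also have "norm \<dots> \<le> norm (\<Sum>n\<in>A. ee (g n)) + norm (\<Sum>n\<in>B. ee (g n)) + norm (\<Sum>n\<in>C. ee (g n))"
        by (meson add_mono norm_triangle_ineq order_refl order_trans)
      also have "\<dots> \<le> real (card A) + norm (\<Sum>n\<in>B. ee (g n)) + real (card C)"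
        using norm_sum[of "\<lambda>n. ee (g n)" A] norm_sum[of "\<lambda>n. ee (g n)" C] by simp
      finally show ?thesis .
    qed
    ultimately show ?thesis by simp
  qed
  have ab: "a \<le> b - 1" "b - 1 < b" using True by auto
  have grow: "d n - d a \<le> (real n - real a) * hi" if "a \<le> n" "n < b" for n
    using that
  proof (induction n rule: dec_induct)
    case (step n)
    then show ?case using sp(2)[of n] by (simp add: algebra_simps)
  qed simp
  define R where "R = {\<lfloor>d a\<rfloor>..\<lfloor>d (b - 1)\<rfloor>}"
  have "{a..<b} = (\<Union>k\<in>R. S k)"
  proof -
    have "\<lfloor>d n\<rfloor> \<in> R" if "n \<in> {a..<b}" for n
      using that by (auto simp: R_def intro!: floor_mono dmono)
    then show ?thesis by (auto simp: S_def)
  qed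
  then have "(\<Sum>n=a..<b. ee (g n)) = (\<Sum>k\<in>R. \<Sum>n\<in>S k. ee (g n))"
    by (simp only:) (intro sum.UNION_disjoint, auto simp: S_def R_def)
  also have "norm \<dots> \<le> (\<Sum>k\<in>R. 5 / sqrt lo)" by (intro sum_norm_le Sb)
  also have "\<dots> = real (card R) * (5 / sqrt lo)" by simp
  also have "real (card R) \<le> real (b - a) * hi + 2"
  proof -
    have "real (card R) = of_int (\<lfloor>d (b - 1)\<rfloor> - \<lfloor>d a\<rfloor> + 1)"
      using floor_mono[OF dmono[OF order_refl ab]] by (simp add: R_def)
    also have "\<dots> \<le> d (b - 1) - d a + 2" by linarith
    also have "d (b - 1) - d a \<le> (real (b - 1) - real a) * hi" using grow[OF ab] .
    also have "\<dots> \<le> real (b - a) * hi" using True lo by (intro mult_right_mono) auto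
    finally show ?thesis by simp
  qed
  finally show ?thesis using lo by (simp add: mult_right_mono divide_right_mono algebra_simps add_divide_distrib)
qed

section \<open>Differencing of exponential sums\<close>

lemma sum_abs_diff_le:
  fixes c :: "nat \<Rightarrow> real"
  assumes c: "\<And>h. 0 \<le> c h"
  shows "(\<Sum>k<H. \<Sum>k'<H. c (if k' \<le> k then k - k' else k' - k)) \<le> real H * (c 0 + 2 * (\<Sum>h\<in>{1..<H}. c h))"
proof -
  define S where "S = (\<Sum>h\<in>{1..<H}. c h)"
  \<comment> \<open>A distance h > 0 from \<open>k\<close> is attained at most twice, once on either
    side.\<close>
  have row: "(\<Sum>k'<H. c (if k' \<le> k then k - k' else k' - k)) \<le> c 0 + 2 * S" if "k < H" for k
  proof -
    have sp: "sum F {..<H} = F k + sum F {..<k} + sum F {k<..<H}" for F :: "nat \<Rightarrow> real"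
    proof -
      have "{..<H} = {..k} \<union> {k<..<H}" using that by (simp add: ivl_disj_un)
      then have "sum F {..<H} = sum F ({..k} \<union> {k<..<H})" by (rule arg_cong)
      also have "\<dots> = sum F {..k} + sum F {k<..<H}"
        by (rule sum.union_disjoint) (auto simp: disjoint_iff)
      also have "{..k} = insert k {..<k}" by auto
      finally show ?thesis by simp
    qed
    have "(\<Sum>k'<H. c (if k' \<le> k then k - k' else k' - k)) =
       c 0 + (\<Sum>k'<k. c (k - k')) + (\<Sum>k'\<in>{k<..<H}. c (k' - k))"
      unfolding sp by (intro arg_cong2[where f = "(+)"] sum.cong) auto
    also have "(\<Sum>k'<k. c (k - k')) = (\<Sum>h\<in>{1..k}. c h)"
      by (intro sum.reindex_bij_witness[of _ "\<lambda>h. k - h" "\<lambda>h. k - h"]) auto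
    also have "\<dots> \<le> S" unfolding S_def using that by (intro sum_mono2) (auto simp: c)
    also have "(\<Sum>k'\<in>{k<..<H}. c (k' - k)) = (\<Sum>h\<in>{1..<H - k}. c h)"
      by (intro sum.reindex_bij_witness[of _ "\<lambda>h. h + k" "\<lambda>h. h - k"]) auto
    also have "\<dots> \<le> S" unfolding S_def using that by (intro sum_mono2) (auto simp: c)
    finally show ?thesis by simp
  qed
  have "(\<Sum>k<H. \<Sum>k'<H. c (if k' \<le> k then k - k' else k' - k)) \<le> (\<Sum>k<H. c 0 + 2 * S)"
    by (intro sum_mono row) auto
  then show ?thesis by (simp add: S_def)
qed

text \<open>The sum is averaged over H shifts, the order of summation is exchanged, and
  Cauchy-Schwarz is applied over the L + H positions; expanding the square produces the correlations
  of \<open>z\<close> with its translates.\<close>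

lemma Weyl_van_der_Corput:
  fixes z :: "nat \<Rightarrow> complex"
  assumes z: "\<And>n. n < L \<Longrightarrow> norm (z n) \<le> 1"
  shows "real H * (norm (\<Sum>n<L. z n))\<^sup>2
     \<le> (real L + real H) * (real L + 2 * (\<Sum>h\<in>{1..<H}. norm (\<Sum>n<L - h. z (n + h) * cnj (z n))))"
proof (cases "H = 0")
  case False
  \<comment> \<open>Padding with H zeros in front keeps all indices m + k natural and lets every
    shift k < H see the whole of \<open>z\<close>; entries past the end vanish as well.\<close>
  define Z where "Z m = (if H \<le> m \<and> m < H + L then z (m - H) else 0)" for m
  define c where "c h = norm (\<Sum>n<L - h. z (n + h) * cnj (z n))" for h
  define S where "S = (\<Sum>h\<in>{1..<H}. c h)"
  have c0: "c 0 \<le> L"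
  proof -
    have "c 0 \<le> (\<Sum>n<L. norm (z n * cnj (z n)))" unfolding c_def by simp (rule norm_sum)
    also have "\<dots> \<le> (\<Sum>n<L. 1)" using z by (intro sum_mono) (auto simp: norm_mult intro!: mult_le_one)
    finally show ?thesis by simp
  qed
  have shift: "(\<Sum>m<L + H. Z (m + k)) = (\<Sum>n<L. z n)" if "k < H" for k
  proof -
    have "(\<Sum>m<L + H. Z (m + k)) = (\<Sum>m\<in>{H - k..<H - k + L}. Z (m + k))"
      using that by (intro sum.mono_neutral_right) (auto simp: Z_def)
    also have "\<dots> = (\<Sum>n<L. z n)"
      using that by (intro sum.reindex_bij_witness[of _ "\<lambda>n. n + (H - k)" "\<lambda>m. m - (H - k)"]) (auto simp: Z_def)
    finally show ?thesis .
  qed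
  have corr: "(\<Sum>m<L + H. Z (m + k) * cnj (Z (m + k'))) = (\<Sum>n<L - (k - k'). z (n + (k - k')) * cnj (z n))"
    if "k' \<le> k" "k < H" for k k'
  proof -
    have "(\<Sum>m<L + H. Z (m + k) * cnj (Z (m + k'))) = (\<Sum>m\<in>{H - k'..<H + L - k}. Z (m + k) * cnj (Z (m + k')))"
      using that by (intro sum.mono_neutral_right) (auto simp: Z_def)
    also have "\<dots> = (\<Sum>n<L - (k - k'). z (n + (k - k')) * cnj (z n))"
      using that by (intro sum.reindex_bij_witness[of _ "\<lambda>n. n + (H - k')" "\<lambda>m. m - (H - k')"])
        (auto simp: Z_def algebra_simps)
    finally show ?thesis .
  qed
  have corrn: "norm (\<Sum>m<L + H. Z (m + k) * cnj (Z (m + k'))) = c (if k' \<le> k then k - k' else k' - k)"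
    if "k < H" "k' < H" for k k'
  proof (cases "k' \<le> k")
    case False
    have "(\<Sum>m<L + H. Z (m + k) * cnj (Z (m + k'))) = cnj (\<Sum>m<L + H. Z (m + k') * cnj (Z (m + k)))"
      by (simp add: mult.commute)
    also have "norm \<dots> = c (k' - k)" using False that
      unfolding complex_mod_cnj c_def by (subst corr) auto
    finally show ?thesis using False by simp
  qed (use that corr in \<open>auto simp: c_def\<close>)
  have sw: "(\<Sum>m<L + H. \<Sum>k<H. F m k) = (\<Sum>k<H. \<Sum>m<L + H. F m k)" for F :: "nat \<Rightarrow> nat \<Rightarrow> complex"
    by (rule sum.swap)
  have "of_nat H * (\<Sum>n<L. z n) = (\<Sum>k<H. \<Sum>m<L + H. Z (m + k))" by (simp add: shift)
  also have "\<dots> = (\<Sum>m<L + H. \<Sum>k<H. Z (m + k))" by (rule sum.swap)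
  finally have "real H * norm (\<Sum>n<L. z n) = norm (\<Sum>m<L + H. \<Sum>k<H. Z (m + k))"
    by (metis norm_mult norm_of_nat)
  also have "\<dots> \<le> (\<Sum>m<L + H. norm (\<Sum>k<H. Z (m + k)))" by (rule norm_sum)
  finally have "(real H * norm (\<Sum>n<L. z n))\<^sup>2 \<le> (\<Sum>m<L + H. 1 * norm (\<Sum>k<H. Z (m + k)))\<^sup>2"
    by (intro power_mono) auto
  also have "\<dots> \<le> (\<Sum>m<L + H. 1\<^sup>2) * (\<Sum>m<L + H. (norm (\<Sum>k<H. Z (m + k)))\<^sup>2)"
    by (rule Cauchy_Schwarz_ineq_sum)
  also have "\<dots> = (real L + real H) * (\<Sum>m<L + H. (norm (\<Sum>k<H. Z (m + k)))\<^sup>2)" by simp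
  finally have 1: "(real H * norm (\<Sum>n<L. z n))\<^sup>2
    \<le> (real L + real H) * (\<Sum>m<L + H. (norm (\<Sum>k<H. Z (m + k)))\<^sup>2)" .
  have 2: "(\<Sum>m<L + H. (norm (\<Sum>k<H. Z (m + k)))\<^sup>2) \<le> real H * (c 0 + 2 * S)"
  proof -
    have "complex_of_real (\<Sum>m<L + H. (norm (\<Sum>k<H. Z (m + k)))\<^sup>2)
       = (\<Sum>m<L + H. (\<Sum>k<H. Z (m + k)) * cnj (\<Sum>k<H. Z (m + k)))"
      by (simp only: of_real_sum complex_norm_square)
    also have "\<dots> = (\<Sum>m<L + H. \<Sum>k<H. \<Sum>k'<H. Z (m + k) * cnj (Z (m + k')))"
      by (simp add: sum_product)
    also have "\<dots> = (\<Sum>k<H. \<Sum>k'<H. \<Sum>m<L + H. Z (m + k) * cnj (Z (m + k')))"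
      by (simp only: sw)
    finally have "norm (complex_of_real (\<Sum>m<L + H. (norm (\<Sum>k<H. Z (m + k)))\<^sup>2)) =
      norm (\<Sum>k<H. \<Sum>k'<H. \<Sum>m<L + H. Z (m + k) * cnj (Z (m + k')))"
      by (rule arg_cong)
    then have "\<bar>\<Sum>m<L + H. (norm (\<Sum>k<H. Z (m + k)))\<^sup>2\<bar> =
      norm (\<Sum>k<H. \<Sum>k'<H. \<Sum>m<L + H. Z (m + k) * cnj (Z (m + k')))"
      by (simp only: norm_of_real)
    also have "\<dots> \<le> (\<Sum>k<H. \<Sum>k'<H. norm (\<Sum>m<L + H. Z (m + k) * cnj (Z (m + k'))))"
      by (intro order_trans[OF norm_sum] sum_mono norm_sum)
    also have "\<dots> = (\<Sum>k<H. \<Sum>k'<H. c (if k' \<le> k then k - k' else k' - k))"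
      by (intro sum.cong refl corrn) auto
    also have "\<dots> \<le> real H * (c 0 + 2 * S)"
      unfolding S_def by (rule sum_abs_diff_le) (simp add: c_def)
    finally show ?thesis by simp
  qed
  have "real H * (real H * (norm (\<Sum>n<L. z n))\<^sup>2) = (real H * norm (\<Sum>n<L. z n))\<^sup>2"
    by (simp add: power2_eq_square)
  also have "\<dots> \<le> (real L + real H) * (real H * (c 0 + 2 * S))"
    by (rule order_trans[OF 1 mult_left_mono[OF 2]]) simp
  also have "\<dots> = real H * ((real L + real H) * (c 0 + 2 * S))" by simp
  finally have "real H * (norm (\<Sum>n<L. z n))\<^sup>2 \<le> (real L + real H) * (c 0 + 2 * S)"
    using False by (simp only: mult_le_cancel_left_pos of_nat_0_less_iff neq0_conv)
  also have "\<dots> \<le> (real L + real H) * (real L + 2 * S)" using c0 by (intro mult_left_mono) auto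
  finally show ?thesis by (simp add: S_def c_def)
qed (auto intro!: mult_nonneg_nonneg)

text \<open>Both f - lo y^2 / 2 and hi y^2 / 2 - f are convex, and midpoint convexity on an interval
  of length 2 is a bound on the second difference.\<close>

lemma second_difference_bounds:
  fixes f f' f'' :: "real \<Rightarrow> real"
  assumes f': "\<And>y. y \<in> {x..x + 2} \<Longrightarrow> (f has_real_derivative f' y) (at y)"
  assumes f'': "\<And>y. y \<in> {x..x + 2} \<Longrightarrow> (f' has_real_derivative f'' y) (at y)"
  assumes b: "\<And>y. y \<in> {x..x + 2} \<Longrightarrow> lo \<le> f'' y \<and> f'' y \<le> hi"
  shows "lo \<le> f (x + 2) - 2 * f (x + 1) + f x" "f (x + 2) - 2 * f (x + 1) + f x \<le> hi"
proof -
  have "convex_on {x..x + 2} (\<lambda>y. f y - lo * y\<^sup>2 / 2)"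
    by (rule f''_ge0_imp_convex[where f' = "\<lambda>y. f' y - lo * y" and f'' = "\<lambda>y. f'' y - lo"])
       (use b in \<open>auto intro!: derivative_eq_intros f' f''\<close>)
  from convex_onD[OF this, of "1/2" x "x + 2"]
  show "lo \<le> f (x + 2) - 2 * f (x + 1) + f x" by (simp add: algebra_simps power2_eq_square add_divide_distrib)
  have "convex_on {x..x + 2} (\<lambda>y. hi * y\<^sup>2 / 2 - f y)"
    by (rule f''_ge0_imp_convex[where f' = "\<lambda>y. hi * y - f' y" and f'' = "\<lambda>y. hi - f'' y"])
       (use b in \<open>auto intro!: derivative_eq_intros f' f''\<close>)
  from convex_onD[OF this, of "1/2" x "x + 2"]
  show "f (x + 2) - 2 * f (x + 1) + f x \<le> hi" by (simp add: algebra_simps power2_eq_square add_divide_distrib)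
qed

lemma second_derivative_test:
  fixes f f' f'' :: "real \<Rightarrow> real"
  assumes lo: "0 < lo" "lo \<le> hi"
  assumes f': "\<And>y. y \<in> {real a..real b} \<Longrightarrow> (f has_real_derivative f' y) (at y)"
  assumes f'': "\<And>y. y \<in> {real a..real b} \<Longrightarrow> (f' has_real_derivative f'' y) (at y)"
  assumes bd: "\<And>y. y \<in> {real a..real b} \<Longrightarrow> lo \<le> f'' y \<and> f'' y \<le> hi"
  shows "norm (\<Sum>n=a..<b. ee (f (real n))) \<le> 5 * (real (b - a) * hi + 2) / sqrt lo"
proof (rule second_difference_test[OF lo])
  fix n assume n: "a \<le> n" "Suc n < b"
  have sub: "{real n..real n + 2} \<subseteq> {real a..real b}" using n by auto
  have e: "real (Suc n) = real n + 1" "real (Suc (Suc n)) = real n + 2" by auto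
  show "lo \<le> f (real (Suc (Suc n))) - 2 * f (real (Suc n)) + f (real n) \<and>
      f (real (Suc (Suc n))) - 2 * f (real (Suc n)) + f (real n) \<le> hi"
    unfolding e using second_difference_bounds[of "real n" f f' f'' lo hi] f' f'' bd sub by blast
qed

section \<open>Sums of j^(it) over dyadic blocks\<close>

definition dirichlet_block :: "nat \<Rightarrow> real \<Rightarrow> complex"
  where "dirichlet_block J t = (\<Sum>j=J..<2 * J. cis (t * ln (real j)))"

lemma norm_dirichlet_block_le: "norm (dirichlet_block J t) \<le> real J"
  unfolding dirichlet_block_def using norm_sum[of "\<lambda>j. cis (t * ln (real j))" "{J..<2*J}"] by simp

lemma norm_sum_ee_minus: "norm (\<Sum>n\<in>A. ee (- g n)) = norm (\<Sum>n\<in>A. ee (g n))"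
proof -
  have "(\<Sum>n\<in>A. ee (- g n)) = cnj (\<Sum>n\<in>A. ee (g n))" by (simp add: cnj_ee)
  then show ?thesis by (metis complex_mod_cnj)
qed

lemma dirichlet_block_uminus: "norm (dirichlet_block J (- t)) = norm (dirichlet_block J t)"
proof -
  have "dirichlet_block J (- t) = cnj (dirichlet_block J t)"
    by (simp add: dirichlet_block_def cis_cnj)
  then show ?thesis by simp
qed

text \<open>The phase t ln y / (2 pi) has second derivative of size t / J^2 on the block. The bound
  says something only for t up to about J^2 and serves the smaller t.\<close>

lemma dirichlet_block_second:
  assumes t: "t > 0" and J: "J \<ge> 1"
  shows "norm (dirichlet_block J t) \<le> 60 * (sqrt t + real J / sqrt t)"
proof -
  \<comment> \<open>The sign makes the second derivative positive; conjugation undoes it.\<close>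
  define f where "f y = - (t / (2 * pi)) * ln y" for y :: real
  have "norm (dirichlet_block J t) = norm (\<Sum>n=J..<2*J. ee (- f (real n)))"
    unfolding dirichlet_block_def ee_def f_def by simp
  also have "\<dots> = norm (\<Sum>n=J..<2*J. ee (f (real n)))"
    by (rule norm_sum_ee_minus)
  also have "\<dots> \<le> 5 * (real (2 * J - J) * (t / (2 * pi * J\<^sup>2)) + 2) / sqrt (t / (8 * pi * J\<^sup>2))"
  proof (rule second_derivative_test[where f' = "\<lambda>y. - (t / (2 * pi)) / y" and f'' = "\<lambda>y. t / (2 * pi * y\<^sup>2)"])
    fix y assume y: "y \<in> {real J..real (2 * J)}"
    then have y0: "y > 0" using J by auto
    show "(f has_real_derivative - (t / (2 * pi)) / y) (at y)"
      unfolding f_def using y0 by (auto intro!: derivative_eq_intros simp: field_simps)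
    show "((\<lambda>y. - (t / (2 * pi)) / y) has_real_derivative t / (2 * pi * y\<^sup>2)) (at y)"
      using y0 by (auto intro!: derivative_eq_intros simp: field_simps power2_eq_square)
    have "(real J)\<^sup>2 \<le> y\<^sup>2" by (rule power_mono) (use y in auto)
    moreover have "y\<^sup>2 \<le> (2 * real J)\<^sup>2" by (rule power_mono) (use y y0 in auto)
    ultimately
    show "t / (8 * pi * J\<^sup>2) \<le> t / (2 * pi * y\<^sup>2) \<and> t / (2 * pi * y\<^sup>2) \<le> t / (2 * pi * J\<^sup>2)"
      using t J y0 by (auto intro!: divide_left_mono mult_pos_pos simp: power_mult_distrib)
  qed (use t J in \<open>auto intro!: divide_left_mono mult_pos_pos\<close>)
  also have "\<dots> \<le> 60 * (sqrt t + real J / sqrt t)"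
  proof -
    define q where "q = sqrt t"
    have q: "q > 0" "t = q * q" using t by (auto simp: q_def)
    define r where "r = sqrt (8 * pi)"
    have r: "0 < r" "r \<le> 6" unfolding r_def using pi_less_4 by (auto intro!: real_le_lsqrt)
    have s: "sqrt (t / (8 * pi * J\<^sup>2)) = q / (r * J)"
      unfolding q_def r_def by (simp add: real_sqrt_divide real_sqrt_mult)
    have "5 * (real (2 * J - J) * (t / (2 * pi * J\<^sup>2)) + 2) / sqrt (t / (8 * pi * J\<^sup>2))
       = 5 * r * (q / (2 * pi) + 2 * J / q)"
      unfolding s using q r J by (simp add: field_simps power2_eq_square)
    also have "\<dots> \<le> 5 * 6 * (2 * q + 2 * J / q)"
    proof (intro mult_mono add_mono)
      have "q / (2 * pi) \<le> q / 1" using pi_gt3 q by (intro divide_left_mono) auto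
      then show "q / (2 * pi) \<le> 2 * q" using q by auto
    qed (use q r in auto)
    finally show ?thesis by (simp add: q_def field_simps)
  qed
  finally show ?thesis .
qed

lemma sum_inverse_sqrt_le: "(\<Sum>h\<in>{1..H}. 1 / sqrt (real h)) \<le> 2 * sqrt (real H)"
proof (induction H)
  case (Suc H)
  define a b where "a = sqrt (real H)" and "b = sqrt (real (Suc H))"
  have ab: "0 \<le> a" "a \<le> b" "0 < b" "b * b - a * a = 1" by (auto simp: a_def b_def)
  have "1 = (b - a) * (b + a)" using ab(4) by (simp add: algebra_simps)
  also have "\<dots> \<le> (b - a) * (2 * b)" using ab by (intro mult_left_mono) auto
  finally have "1 / b \<le> 2 * (b - a)" using ab by (simp add: field_simps)
  then show ?case using Suc unfolding a_def b_def by simp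
qed simp

text \<open>After one differencing step the phase is t (ln (y + h) - ln y) / (2 pi), with second
  derivative of size t h / J^3, so the second derivative test applies to each correlation. This
  remains nontrivial beyond t = J^2, where \<open>dirichlet_block_second\<close> gives
  nothing.\<close>

lemma dirichlet_block_third:
  assumes t: "t > 0" and H: "1 \<le> H" "H \<le> J"
  shows "(norm (dirichlet_block J t))\<^sup>2 \<le> 2 * (real J)\<^sup>2 / H
     + 360 * sqrt (t * H * J) + 720 * (real J)\<^sup>2 * sqrt J / sqrt (t * H)"
proof -
  have J: "J \<ge> 1" using H by auto
  define z where "z n = cis (t * ln (real (J + n)))" for n
  have D: "dirichlet_block J t = (\<Sum>n<J. z n)" unfolding dirichlet_block_def z_def
    by (intro sum.reindex_bij_witness[of _ "\<lambda>n. J + n" "\<lambda>j. j - J"]) auto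
  define q where "q = sqrt t"
  have q: "q > 0" "t = q * q" using t by (auto simp: q_def)
  define s where "s = sqrt (real J)"
  have s: "s > 0" "real J = s * s" using J by (auto simp: s_def)
  have c: "norm (\<Sum>n<J - h. z (n + h) * cnj (z n)) \<le> 90 * (q * sqrt H / s + s ^ 3 / q * (1 / sqrt h))"
    if h: "h \<in> {1..<H}" for h
  proof -
    define f where "f y = (t / (2 * pi)) * (ln (y + h) - ln y)" for y :: real
    have "(\<Sum>n<J - h. z (n + h) * cnj (z n)) = (\<Sum>n=J..<2 * J - h. ee (f (real n)))"
      unfolding z_def ee_def f_def
      by (intro sum.reindex_bij_witness[of _ "\<lambda>n. n - J" "\<lambda>n. J + n"])
         (auto simp: cis_cnj cis_mult algebra_simps)
    also have "norm \<dots> \<le> 5 * (real (2 * J - h - J) * (t * h / (pi * real J ^ 3)) + 2) / sqrt (t * h / (24 * pi * real J ^ 3))"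
    proof (rule second_derivative_test[where f' = "\<lambda>y. (t / (2 * pi)) * (1 / (y + h) - 1 / y)"
            and f'' = "\<lambda>y. (t / (2 * pi)) * (1 / y\<^sup>2 - 1 / (y + h)\<^sup>2)"])
      fix y assume y: "y \<in> {real J..real (2 * J - h)}"
      then have y0: "y > 0" "y + h > 0" "y \<le> 2 * real J" using J by auto
      have hJ: "0 < real h" "real h \<le> real J" using h H by auto
      show "(f has_real_derivative (t / (2 * pi)) * (1 / (y + h) - 1 / y)) (at y)"
        unfolding f_def using y0 by (auto intro!: derivative_eq_intros)
      show "((\<lambda>y. (t / (2 * pi)) * (1 / (y + h) - 1 / y)) has_real_derivative (t / (2 * pi)) * (1 / y\<^sup>2 - 1 / (y + h)\<^sup>2)) (at y)"
        using y0 by (intro DERIV_cmult) (auto intro!: derivative_eq_intros simp: power2_eq_square)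
      \<comment> \<open>Over a common denominator every factor except h is comparable to J, because
        h \<le> J \<le> y \<le> 2 J.\<close>
      have e: "1 / y\<^sup>2 - 1 / (y + h)\<^sup>2 = h * (2 * y + h) / (y\<^sup>2 * (y + h)\<^sup>2)"
      proof -
        have 1: "(y + h)\<^sup>2 - y\<^sup>2 = h * (2 * y + h)" by (simp add: power2_eq_square algebra_simps)
        show ?thesis using y0 by (subst diff_frac_eq) (simp_all add: 1)
      qed
      have canc: "p * a / (b * a\<^sup>2) = p / (b * a)" if "a \<noteq> 0" for a b p :: real
        using that by (simp add: power2_eq_square)
      have u: "h * (2 * y + h) / (y\<^sup>2 * (y + h)\<^sup>2) \<le> 2 * h / real J ^ 3"
      proof -
        have "h * (2 * y + h) \<le> 2 * h * (y + h)"
          using y0 hJ by (simp add: algebra_simps)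
        then have "h * (2 * y + h) / (y\<^sup>2 * (y + h)\<^sup>2) \<le> 2 * h * (y + h) / (y\<^sup>2 * (y + h)\<^sup>2)"
          by (intro divide_right_mono) auto
        also have "\<dots> = 2 * h / (y\<^sup>2 * (y + h))" using y0 by (intro canc) auto
        also have "\<dots> \<le> 2 * h / ((real J)\<^sup>2 * real J)"
          using y y0 J by (intro divide_left_mono mult_mono power_mono) auto
        finally show ?thesis by (simp add: power2_eq_square power3_eq_cube)
      qed
      have l: "h / (12 * real J ^ 3) \<le> h * (2 * y + h) / (y\<^sup>2 * (y + h)\<^sup>2)"
      proof -
        have "h / (12 * real J ^ 3) = h / ((2 * real J)\<^sup>2 * (3 * real J))"
          by (simp add: power2_eq_square power3_eq_cube)
        also have "\<dots> \<le> h / (y\<^sup>2 * (y + h))"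
          using y0 hJ J by (intro divide_left_mono mult_mono power_mono mult_pos_pos) auto
        also have "\<dots> = h * (y + h) / (y\<^sup>2 * (y + h)\<^sup>2)" using y0 by (intro canc[symmetric]) auto
        also have "\<dots> \<le> h * (2 * y + h) / (y\<^sup>2 * (y + h)\<^sup>2)"
          using y0 hJ by (intro divide_right_mono mult_left_mono) auto
        finally show ?thesis .
      qed
      have "t * h / (24 * pi * real J ^ 3) = t / (2 * pi) * (h / (12 * real J ^ 3))" by simp
      also have "\<dots> \<le> t / (2 * pi) * (1 / y\<^sup>2 - 1 / (y + h)\<^sup>2)"
        unfolding e using t l by (intro mult_left_mono) auto
      finally have 1: "t * h / (24 * pi * real J ^ 3) \<le> t / (2 * pi) * (1 / y\<^sup>2 - 1 / (y + h)\<^sup>2)" .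
      have "t / (2 * pi) * (1 / y\<^sup>2 - 1 / (y + h)\<^sup>2) \<le> t / (2 * pi) * (2 * h / real J ^ 3)"
        unfolding e using t u by (intro mult_left_mono) auto
      then show "t * h / (24 * pi * real J ^ 3) \<le> t / (2 * pi) * (1 / y\<^sup>2 - 1 / (y + h)\<^sup>2) \<and>
         t / (2 * pi) * (1 / y\<^sup>2 - 1 / (y + h)\<^sup>2) \<le> t * h / (pi * real J ^ 3)" using 1 by simp
    qed (use t J h in \<open>auto intro!: divide_left_mono mult_pos_pos\<close>)
    also have "\<dots> \<le> 5 * (real J * (t * h / (pi * real J ^ 3)) + 2) / sqrt (t * h / (24 * pi * real J ^ 3))"
      using t by (intro divide_right_mono mult_left_mono add_mono mult_right_mono) auto
    also have "\<dots> \<le> 90 * (q * sqrt H / s + s ^ 3 / q * (1 / sqrt h))"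
    proof -
      define w where "w = sqrt (real h)"
      have w: "w > 0" "real h = w * w" "w \<le> sqrt H" using h by (auto simp: w_def)
      define r where "r = sqrt (24 * pi)"
      have r: "0 < r" "r \<le> 9" unfolding r_def using pi_less_4 pi_approx by (auto intro!: real_le_lsqrt)
      have e: "sqrt (t * h / (24 * pi * real J ^ 3)) = q * w / (r * s ^ 3)"
        unfolding q_def r_def w_def s_def by (simp add: real_sqrt_divide real_sqrt_mult real_sqrt_power)
      have "5 * (real J * (t * h / (pi * real J ^ 3)) + 2) / sqrt (t * h / (24 * pi * real J ^ 3))
         = 5 * r * (q * w / s * (1 / pi) + 2 * (s ^ 3 / q * (1 / w)))"
        unfolding e unfolding s(2) q(2) w(2) using q(1) s(1) w(1) r by (simp add: divide_simps power3_eq_cube)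
      also have "\<dots> \<le> 5 * 9 * (q * sqrt H / s + 2 * (s ^ 3 / q * (1 / w)))"
      proof (rule mult_mono)
        have "q * w / s * (1 / pi) \<le> q * w / s * 1"
          using q(1) s(1) w(1) pi_gt3 by (intro mult_left_mono) (auto simp: field_simps)
        also have "\<dots> \<le> q * sqrt H / s"
          unfolding mult_1_right using q(1) s(1) w(3) by (intro divide_right_mono mult_left_mono) auto
        finally show "q * w / s * (1 / pi) + 2 * (s ^ 3 / q * (1 / w)) \<le> q * sqrt H / s + 2 * (s ^ 3 / q * (1 / w))"
          by simp
        show "0 \<le> q * w / s * (1 / pi) + 2 * (s ^ 3 / q * (1 / w))" using q(1) s(1) w(1)
          by (intro add_nonneg_nonneg mult_nonneg_nonneg divide_nonneg_pos zero_le_power) auto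
      qed (use r in auto)
      also have "\<dots> \<le> 90 * (q * sqrt H / s + s ^ 3 / q * (1 / w))"
      proof -
        have "0 \<le> q * sqrt H / s" using q(1) s(1) by simp
        then show ?thesis by argo
      qed
      finally show ?thesis by (simp add: w_def)
    qed
    finally show ?thesis .
  qed
  have sumc: "(\<Sum>h\<in>{1..<H}. norm (\<Sum>n<J - h. z (n + h) * cnj (z n)))
     \<le> 90 * (H * (q * sqrt H / s) + s ^ 3 / q * (2 * sqrt H))"
  proof -
    define A B where "A = q * sqrt H / s" and "B = s ^ 3 / q"
    have AB: "0 \<le> A" "0 \<le> B" using q(1) s(1) by (auto simp: A_def B_def)
    have "(\<Sum>h\<in>{1..<H}. norm (\<Sum>n<J - h. z (n + h) * cnj (z n)))
       \<le> (\<Sum>h\<in>{1..<H}. 90 * (A + B * (1 / sqrt (real h))))"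
      unfolding A_def B_def by (rule sum_mono[OF c])
    also have "\<dots> \<le> (\<Sum>h\<in>{1..H}. 90 * (A + B * (1 / sqrt (real h))))"
      using AB by (intro sum_mono2) auto
    also have "\<dots> = 90 * (H * A + B * (\<Sum>h\<in>{1..H}. 1 / sqrt (real h)))"
      by (simp only: sum_distrib_left[symmetric] sum.distrib sum_constant card_atLeastAtMost) simp
    also have "\<dots> \<le> 90 * (H * A + B * (2 * sqrt H))"
      using AB by (intro mult_left_mono add_left_mono sum_inverse_sqrt_le) auto
    finally show ?thesis unfolding A_def B_def .
  qed
  have "real H * (norm (dirichlet_block J t))\<^sup>2
     \<le> (real J + real H) * (real J + 2 * (\<Sum>h\<in>{1..<H}. norm (\<Sum>n<J - h. z (n + h) * cnj (z n))))"
    unfolding D by (rule Weyl_van_der_Corput) (auto simp: z_def)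
  also have "\<dots> \<le> (2 * real J) * (real J + 2 * (90 * (H * (q * sqrt H / s) + s ^ 3 / q * (2 * sqrt H))))"
  proof (rule mult_mono)
    show "real J + 2 * (\<Sum>h\<in>{1..<H}. norm (\<Sum>n<J - h. z (n + h) * cnj (z n)))
      \<le> real J + 2 * (90 * (H * (q * sqrt H / s) + s ^ 3 / q * (2 * sqrt H)))" using sumc by linarith
    have "0 \<le> (\<Sum>h\<in>{1..<H}. norm (\<Sum>n<J - h. z (n + h) * cnj (z n)))" by (intro sum_nonneg) auto
    then show "0 \<le> real J + 2 * (\<Sum>h\<in>{1..<H}. norm (\<Sum>n<J - h. z (n + h) * cnj (z n)))" by linarith
  qed (use H in auto)
  finally have "(norm (dirichlet_block J t))\<^sup>2 \<le> (2 * real J) * (real J + 2 * (90 * (H * (q * sqrt H / s) + s ^ 3 / q * (2 * sqrt H)))) / H"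
    using H by (metis mult.commute of_nat_0_less_iff order_less_le_trans pos_le_divide_eq zero_less_one)
  also have "\<dots> = 2 * (real J)\<^sup>2 / H + 360 * sqrt (t * H * J) + 720 * (real J)\<^sup>2 * sqrt J / sqrt (t * H)"
  proof -
    define r where "r = sqrt (real H)"
    have r: "r > 0" "real H = r * r" using H by (auto simp: r_def)
    have 1: "sqrt (t * H * J) = q * r * s" "sqrt (t * H) = q * r" "sqrt (real J) = s"
      by (auto simp: q_def r_def s_def real_sqrt_mult)
    \<comment> \<open>With a, b, c the square roots of t, J, H the identity becomes
      rational.\<close>
    have gen: "(2 * (b * b)) * ((b * b) + 2 * (90 * ((c * c) * (a * c / b) + b ^ 3 / a * (2 * c)))) / (c * c)
        = 2 * (b * b)\<^sup>2 / (c * c) + 360 * (a * c * b) + 720 * (b * b)\<^sup>2 * b / (a * c)"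
      if "a > 0" "b > 0" "c > 0" for a b c :: real
    proof -
    have "(2 * (b * b)) * ((b * b) + 2 * (90 * ((c * c) * (a * c / b) + b ^ 3 / a * (2 * c)))) / (c * c) = (2 * (b * b)) * (b * b) / (c * c) + 360 * (b*b) * ((c * c) * (a * c / b)) / (c * c) + 360 * (b*b) * (b ^ 3 / a * (2 * c)) / (c * c)"
    by (simp add: add_divide_distrib distrib_left mult.assoc)
    also have "360 * (b*b) * ((c * c) * (a * c / b)) / (c * c) = 360 * (a * c * b)" using that by simp
    also have "360 * (b*b) * (b ^ 3 / a * (2 * c)) / (c * c) = 720 * (b * b)\<^sup>2 * b / (a * c)" using that by (simp add: power2_eq_square power3_eq_cube)
    also have "(2 * (b * b)) * (b * b) / (c * c) = 2 * (b * b)\<^sup>2 / (c * c) " by (simp add: power2_eq_square)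
    finally show ?thesis .
    qed
    show ?thesis unfolding 1 r_def[symmetric] unfolding s(2) r(2)
      using q(1) s(1) r(1) by (rule gen)
  qed
  finally show ?thesis .
qed

section \<open>The equal-increment curve\<close>

lemma sinh_bounds:
  fixes x :: real
  assumes "0 \<le> x" "x \<le> 1"
  shows "x \<le> sinh x" "sinh x \<le> 2 * x"
proof -
  have "convex_on {0..1} (sinh :: real \<Rightarrow> real)"
    by (rule f''_ge0_imp_convex[where f' = cosh and f'' = sinh])
       (auto intro!: derivative_eq_intros)
  from convex_onD[OF this, of x 0 1] assms have 1: "sinh x \<le> x * sinh 1" by simp
  have 2: "sinh 1 \<le> (2 :: real)"
    using exp_le by (simp add: sinh_def) (smt (verit) exp_gt_zero)
  show "sinh x \<le> 2 * x" using 1 mult_left_mono[OF 2 assms(1)] by simp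
  have "sinh 0 - 0 \<le> sinh x - x"
    by (rule DERIV_nonneg_imp_nondecreasing[OF assms(1), of "\<lambda>x. sinh x - x"])
       (auto intro!: exI derivative_eq_intros cosh_real_ge_1)
  then show "x \<le> sinh x" by simp
qed

lemma deriv_between_squares:
  fixes f f' :: "real \<Rightarrow> real"
  assumes "a \<le> b" "0 \<le> a"
    and f: "\<And>x. a \<le> x \<Longrightarrow> x \<le> b \<Longrightarrow> (f has_real_derivative f' x) (at x)"
    and bd: "\<And>x. a \<le> x \<Longrightarrow> x \<le> b \<Longrightarrow> c * x \<le> f' x \<and> f' x \<le> d * x"
  shows "c * (b\<^sup>2 - a\<^sup>2) / 2 \<le> f b - f a" "f b - f a \<le> d * (b\<^sup>2 - a\<^sup>2) / 2"
proof -
  have "f a - c * a\<^sup>2 / 2 \<le> f b - c * b\<^sup>2 / 2"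
  proof (rule DERIV_nonneg_imp_nondecreasing[OF assms(1), of "\<lambda>x. f x - c * x\<^sup>2 / 2"])
    fix x assume x: "a \<le> x" "x \<le> b"
    show "\<exists>y. ((\<lambda>x. f x - c * x\<^sup>2 / 2) has_real_derivative y) (at x) \<and> 0 \<le> y"
      by (rule exI[of _ "f' x - c * x"]) (use bd[OF x] in \<open>auto intro!: derivative_eq_intros f[OF x]\<close>)
  qed
  then show "c * (b\<^sup>2 - a\<^sup>2) / 2 \<le> f b - f a" by (simp add: algebra_simps diff_divide_distrib)
  have "d * a\<^sup>2 / 2 - f a \<le> d * b\<^sup>2 / 2 - f b"
  proof (rule DERIV_nonneg_imp_nondecreasing[OF assms(1), of "\<lambda>x. d * x\<^sup>2 / 2 - f x"])
    fix x assume x: "a \<le> x" "x \<le> b"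
    show "\<exists>y. ((\<lambda>x. d * x\<^sup>2 / 2 - f x) has_real_derivative y) (at x) \<and> 0 \<le> y"
      by (rule exI[of _ "d * x - f' x"]) (use bd[OF x] in \<open>auto intro!: derivative_eq_intros f[OF x]\<close>)
  qed
  then show "f b - f a \<le> d * (b\<^sup>2 - a\<^sup>2) / 2" by (simp add: algebra_simps diff_divide_distrib)
qed

text \<open>With \<open>w\<close> half of ln (b / a) this is (b^g - a^g) / (b - a), made scale
  invariant by the factor (a b)^((1 - g) / 2).\<close>

definition sinh_ratio :: "real \<Rightarrow> real \<Rightarrow> real" where "sinh_ratio g w = sinh (g * w) / sinh w"

lemma sinh_ratio_bounds:
  assumes g: "g > 0" and w: "0 < w" "w \<le> 1" "g * w \<le> 1"
  shows "g / 2 \<le> sinh_ratio g w" "sinh_ratio g w \<le> 2 * g"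
proof -
  have 1: "g * w \<le> sinh (g * w)" "sinh (g * w) \<le> 2 * (g * w)" "w \<le> sinh w" "sinh w \<le> 2 * w"
    using sinh_bounds[of "g * w"] sinh_bounds[of w] g w by auto
  have "g / 2 = (g * w) / (2 * w)" using w by simp
  also have "\<dots> \<le> sinh_ratio g w" unfolding sinh_ratio_def using 1 g w by (intro frac_le) auto
  finally show "g / 2 \<le> sinh_ratio g w" .
  have "sinh_ratio g w \<le> (2 * (g * w)) / w" unfolding sinh_ratio_def using 1 g w by (intro frac_le) auto
  then show "sinh_ratio g w \<le> 2 * g" using w by simp
qed

text \<open>The derivative of sinh (g w) / sinh w is a quotient over (sinh w)^2 whose numerator
  vanishes at 0 and has derivative (g^2 - 1) sinh (g w) sinh w, of size (g^2 - 1) g w^2. Integrating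
  twice gives the claim; dividing by g^2 - 1 makes the signs agree for g < 1 and g > 1.\<close>

lemma sinh_ratio_diff_bounds:
  assumes g: "g > 0" "g \<noteq> 1" and w: "0 < w1" "w1 \<le> w2" "w2 \<le> 1" "g * w2 \<le> 1"
  shows "g / 24 * (w2\<^sup>2 - w1\<^sup>2) \<le> (sinh_ratio g w2 - sinh_ratio g w1) / (g\<^sup>2 - 1)"
        "(sinh_ratio g w2 - sinh_ratio g w1) / (g\<^sup>2 - 1) \<le> g * (w2\<^sup>2 - w1\<^sup>2)"
proof -
  have g1: "g\<^sup>2 - 1 \<noteq> 0" using g by (simp add: power2_eq_1_iff)
  define n where "n w = (g * cosh (g * w) * sinh w - sinh (g * w) * cosh w) / (g\<^sup>2 - 1)" for w
  have n_der: "(n has_real_derivative sinh (g * w) * sinh w) (at w)" for w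
  proof -
    have "((\<lambda>w. g * cosh (g * w) * sinh w - sinh (g * w) * cosh w) has_real_derivative
        (g\<^sup>2 - 1) * (sinh (g * w) * sinh w)) (at w)"
      by (auto intro!: derivative_eq_intros simp: algebra_simps power2_eq_square)
    from DERIV_cdivide[OF this, of "g\<^sup>2 - 1"] show ?thesis using g1 by (simp add: n_def[abs_def])
  qed
  have n: "g * w ^ 3 / 3 \<le> n w" "n w \<le> 4 * g * w ^ 3 / 3" if "0 < w" "w \<le> w2" for w
  proof -
    have b: "g * x\<^sup>2 \<le> sinh (g * x) * sinh x" "sinh (g * x) * sinh x \<le> 4 * g * x\<^sup>2" if "0 \<le> x" "x \<le> w" for x
    proof -
      have "x \<le> w2" using that \<open>w \<le> w2\<close> by simp
      then have "g * x \<le> 1" using mult_left_mono[of x w2 g] g w by linarith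
      then have 1: "g * x \<le> sinh (g * x)" "sinh (g * x) \<le> 2 * (g * x)" "x \<le> sinh x" "sinh x \<le> 2 * x"
        using sinh_bounds[of "g * x"] sinh_bounds[of x] that g w \<open>x \<le> w2\<close> by auto
      have "(g * x) * x \<le> sinh (g * x) * sinh x" using 1 that g by (intro mult_mono) auto
      then show "g * x\<^sup>2 \<le> sinh (g * x) * sinh x" by (simp add: power2_eq_square)
      have "sinh (g * x) * sinh x \<le> (2 * (g * x)) * (2 * x)" using 1 that g by (intro mult_mono) auto
      then show "sinh (g * x) * sinh x \<le> 4 * g * x\<^sup>2" by (simp add: power2_eq_square)
    qed
    have "n 0 - g * 0 ^ 3 / 3 \<le> n w - g * w ^ 3 / 3"
    proof (rule DERIV_nonneg_imp_nondecreasing[of 0 w "\<lambda>w. n w - g * w ^ 3 / 3"])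
      fix x assume "0 \<le> x" "x \<le> w"
      then show "\<exists>y. ((\<lambda>w. n w - g * w ^ 3 / 3) has_real_derivative y) (at x) \<and> 0 \<le> y"
        by (intro exI[of _ "sinh (g * x) * sinh x - g * x\<^sup>2"])
           (use b[of x] in \<open>auto intro!: derivative_eq_intros n_der\<close>)
    qed (use that in auto)
    then show "g * w ^ 3 / 3 \<le> n w" by (simp add: n_def)
    have "4 * g * 0 ^ 3 / 3 - n 0 \<le> 4 * g * w ^ 3 / 3 - n w"
    proof (rule DERIV_nonneg_imp_nondecreasing[of 0 w "\<lambda>w. 4 * g * w ^ 3 / 3 - n w"])
      fix x assume "0 \<le> x" "x \<le> w"
      then show "\<exists>y. ((\<lambda>w. 4 * g * w ^ 3 / 3 - n w) has_real_derivative y) (at x) \<and> 0 \<le> y"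
        by (intro exI[of _ "4 * g * x\<^sup>2 - sinh (g * x) * sinh x"])
           (use b[of x] in \<open>auto intro!: derivative_eq_intros n_der\<close>)
    qed (use that in auto)
    then show "n w \<le> 4 * g * w ^ 3 / 3" by (simp add: n_def)
  qed
  have q_der: "((\<lambda>w. sinh_ratio g w / (g\<^sup>2 - 1)) has_real_derivative n w / (sinh w)\<^sup>2) (at w)" if "0 < w" for w
  proof -
    have s: "sinh w \<noteq> 0" using that by simp
    have "((\<lambda>w. sinh_ratio g w) has_real_derivative (g * cosh (g * w) * sinh w - sinh (g * w) * cosh w) / (sinh w)\<^sup>2) (at w)"
      unfolding sinh_ratio_def using s by (auto intro!: derivative_eq_intros simp: power2_eq_square)
    from DERIV_cdivide[OF this, of "g\<^sup>2 - 1"] show ?thesis by (simp add: n_def mult.commute)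
  qed
  have qb: "g / 12 * x \<le> n x / (sinh x)\<^sup>2 \<and> n x / (sinh x)\<^sup>2 \<le> 2 * g * x" if "w1 \<le> x" "x \<le> w2" for x
  proof
    have x: "0 < x" "x \<le> 1" using that w by auto
    have s: "x\<^sup>2 \<le> (sinh x)\<^sup>2" "(sinh x)\<^sup>2 \<le> (2 * x)\<^sup>2"
      by (rule power_mono; use sinh_bounds[of x] x in simp)+
    have "g / 12 * x = (g * x ^ 3 / 3) / (2 * x)\<^sup>2" using x by (simp add: power2_eq_square power3_eq_cube)
    also have "\<dots> \<le> n x / (sinh x)\<^sup>2" using n[of x] s x that g by (intro frac_le) auto
    finally show "g / 12 * x \<le> n x / (sinh x)\<^sup>2" .
    have "n x / (sinh x)\<^sup>2 \<le> (4 * g * x ^ 3 / 3) / x\<^sup>2" using n[of x] s x that g by (intro frac_le) auto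
    also have "\<dots> \<le> 2 * g * x" using x g by (simp add: power2_eq_square power3_eq_cube)
    finally show "n x / (sinh x)\<^sup>2 \<le> 2 * g * x" .
  qed
  have "g / 12 * (w2\<^sup>2 - w1\<^sup>2) / 2 \<le> sinh_ratio g w2 / (g\<^sup>2 - 1) - sinh_ratio g w1 / (g\<^sup>2 - 1)"
    using w qb by (intro deriv_between_squares(1)[where f' = "\<lambda>x. n x / (sinh x)\<^sup>2" and d = "2 * g"] q_der) auto
  then show "g / 24 * (w2\<^sup>2 - w1\<^sup>2) \<le> (sinh_ratio g w2 - sinh_ratio g w1) / (g\<^sup>2 - 1)" by (simp add: diff_divide_distrib)
  have "sinh_ratio g w2 / (g\<^sup>2 - 1) - sinh_ratio g w1 / (g\<^sup>2 - 1) \<le> 2 * g * (w2\<^sup>2 - w1\<^sup>2) / 2"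
    using w qb by (intro deriv_between_squares(2)[where f' = "\<lambda>x. n x / (sinh x)\<^sup>2" and c = "g / 12"] q_der) auto
  then show "(sinh_ratio g w2 - sinh_ratio g w1) / (g\<^sup>2 - 1) \<le> g * (w2\<^sup>2 - w1\<^sup>2)" by (simp add: diff_divide_distrib)
qed

text \<open>These inverse squares are what \<open>incr_identity\<close> leaves of the second
  derivative in \<open>incr_curve\<close>, so this is the source of the curvature bounds. It follows
  from the preceding lemma and 1/a^2 - 1/b^2 = (b - a) (a + b) / (a^2 b^2).\<close>

lemma sinh_ratio_inverse_square_diff_bounds:
  assumes g: "g > 0" "g \<noteq> 1" and w: "0 < w1" "w1 \<le> w2" "w2 \<le> 1" "g * w2 \<le> 1"
  shows "(w2\<^sup>2 - w1\<^sup>2) / (384 * g\<^sup>2) \<le> (1 / (sinh_ratio g w1)\<^sup>2 - 1 / (sinh_ratio g w2)\<^sup>2) / (g\<^sup>2 - 1)"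
        "(1 / (sinh_ratio g w1)\<^sup>2 - 1 / (sinh_ratio g w2)\<^sup>2) / (g\<^sup>2 - 1) \<le> 64 * (w2\<^sup>2 - w1\<^sup>2) / g\<^sup>2"
proof -
  define a b where "a = sinh_ratio g w1" and "b = sinh_ratio g w2"
  have "g * w1 \<le> 1" using mult_left_mono[of w1 w2 g] g w by linarith
  then have ab: "g / 2 \<le> a" "a \<le> 2 * g" "g / 2 \<le> b" "b \<le> 2 * g"
    using sinh_ratio_bounds[of g w1] sinh_ratio_bounds[of g w2] g w by (auto simp: a_def b_def)
  have pos: "a > 0" "b > 0" using ab g by linarith+
  have W: "0 \<le> w2\<^sup>2 - w1\<^sup>2" using w by (simp add: power_mono)
  define D where "D = (b - a) / (g\<^sup>2 - 1)"
  have D: "g / 24 * (w2\<^sup>2 - w1\<^sup>2) \<le> D" "D \<le> g * (w2\<^sup>2 - w1\<^sup>2)"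
    using sinh_ratio_diff_bounds[OF g w] by (auto simp: D_def a_def b_def)
  have D0: "D \<ge> 0" using D(1) W g by (smt (verit) divide_nonneg_pos mult_nonneg_nonneg)
  have e: "(1 / a\<^sup>2 - 1 / b\<^sup>2) / (g\<^sup>2 - 1) = D * ((a + b) / (a\<^sup>2 * b\<^sup>2))"
  proof -
    have "1 / a\<^sup>2 - 1 / b\<^sup>2 = (b - a) * ((a + b) / (a\<^sup>2 * b\<^sup>2))"
      using pos by (simp add: divide_simps power2_eq_square) (simp add: algebra_simps)
    then show ?thesis by (simp add: D_def)
  qed
  have sq: "a\<^sup>2 \<le> (2 * g)\<^sup>2" "b\<^sup>2 \<le> (2 * g)\<^sup>2" "(g / 2)\<^sup>2 \<le> a\<^sup>2" "(g / 2)\<^sup>2 \<le> b\<^sup>2"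
    by (rule power_mono; use ab pos g in linarith)+
  have up: "a\<^sup>2 * b\<^sup>2 \<le> (2 * g)\<^sup>2 * (2 * g)\<^sup>2" "(g / 2)\<^sup>2 * (g / 2)\<^sup>2 \<le> a\<^sup>2 * b\<^sup>2"
    by (rule mult_mono[OF sq(1,2)]; simp) (rule mult_mono[OF sq(3,4)]; simp)
  have "(w2\<^sup>2 - w1\<^sup>2) / (384 * g\<^sup>2) = (g / 24 * (w2\<^sup>2 - w1\<^sup>2)) * (g / ((2 * g)\<^sup>2 * (2 * g)\<^sup>2))"
    using g by (simp add: power2_eq_square)
  also have "\<dots> \<le> D * ((a + b) / (a\<^sup>2 * b\<^sup>2))"
  proof (rule mult_mono[OF D(1)])
    show "g / ((2 * g)\<^sup>2 * (2 * g)\<^sup>2) \<le> (a + b) / (a\<^sup>2 * b\<^sup>2)"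
      by (rule frac_le[OF _ _ _ up(1)]) (use ab pos in auto)
  qed (use D0 g in auto)
  finally show "(w2\<^sup>2 - w1\<^sup>2) / (384 * g\<^sup>2) \<le> (1 / (sinh_ratio g w1)\<^sup>2 - 1 / (sinh_ratio g w2)\<^sup>2) / (g\<^sup>2 - 1)"
    unfolding a_def[symmetric] b_def[symmetric] e .
  have "D * ((a + b) / (a\<^sup>2 * b\<^sup>2)) \<le> (g * (w2\<^sup>2 - w1\<^sup>2)) * ((4 * g) / ((g / 2)\<^sup>2 * (g / 2)\<^sup>2))"
  proof (rule mult_mono[OF D(2)])
    show "(a + b) / (a\<^sup>2 * b\<^sup>2) \<le> (4 * g) / ((g / 2)\<^sup>2 * (g / 2)\<^sup>2)"
      by (rule frac_le[OF _ _ _ up(2)]) (use ab g in auto)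
  qed (use W g pos in auto)
  also have "\<dots> = 64 * (w2\<^sup>2 - w1\<^sup>2) / g\<^sup>2" using g by (simp add: power2_eq_square)
  finally show "(1 / (sinh_ratio g w1)\<^sup>2 - 1 / (sinh_ratio g w2)\<^sup>2) / (g\<^sup>2 - 1) \<le> 64 * (w2\<^sup>2 - w1\<^sup>2) / g\<^sup>2"
    unfolding a_def[symmetric] b_def[symmetric] e .
qed

section \<open>Increments of power functions\<close>

definition incr :: "real \<Rightarrow> real \<Rightarrow> real \<Rightarrow> real" where "incr c u y = (y + u) powr c - y powr c"

lemma incr_deriv:
  assumes "y > 0" "u \<ge> 0"
  shows "((\<lambda>y. incr c u y) has_real_derivative c * incr (c - 1) u y) (at y)"
  unfolding incr_def using assms by (auto intro!: derivative_eq_intros simp: algebra_simps)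

lemma incr_mvt:
  assumes "y > 0" "u > 0"
  obtains \<xi> where "y < \<xi>" "\<xi> < y + u" "incr c u y = c * u * \<xi> powr (c - 1)"
proof -
  have "\<exists>\<xi>. y < \<xi> \<and> \<xi> < y + u \<and> (y + u) powr c - y powr c = (y + u - y) * (c * \<xi> powr (c - 1))"
    by (rule MVT2) (use assms in \<open>auto intro!: derivative_eq_intros\<close>)
  then show ?thesis using that by (auto simp: incr_def mult_ac)
qed

lemma incr_pos: "c > 0 \<Longrightarrow> u > 0 \<Longrightarrow> y > 0 \<Longrightarrow> incr c u y > 0"
  by (auto simp: incr_def intro!: powr_less_mono2)

lemma incr_mono_u: "c > 0 \<Longrightarrow> 0 \<le> u \<Longrightarrow> u \<le> v \<Longrightarrow> y > 0 \<Longrightarrow> incr c u y \<le> incr c v y"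
  by (auto simp: incr_def intro!: powr_mono2)

text \<open>With the absolute value in the exponent of \<open>L\<close> one statement serves
  exponents of either sign; g - 1 is negative for \<theta> < 2.\<close>

lemma powr_range:
  fixes N L \<xi> c :: real
  assumes "N > 0" "L \<ge> 1" "N / L \<le> \<xi>" "\<xi> \<le> N * L"
  shows "N powr c * L powr (- \<bar>c\<bar>) \<le> \<xi> powr c" "\<xi> powr c \<le> N powr c * L powr \<bar>c\<bar>"
proof -
  have x: "\<xi> > 0" using assms by (smt (verit) divide_pos_pos)
  have l: "\<bar>ln \<xi> - ln N\<bar> \<le> ln L"
  proof -
    have "ln (N / L) \<le> ln \<xi>" "ln \<xi> \<le> ln (N * L)" using assms x by auto
    then show ?thesis using assms by (simp add: ln_div ln_mult abs_le_iff)
  qed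
  have "\<bar>c * (ln \<xi> - ln N)\<bar> \<le> \<bar>c\<bar> * ln L" unfolding abs_mult using l by (intro mult_left_mono) auto
  then have b: "c * ln N - \<bar>c\<bar> * ln L \<le> c * ln \<xi>" "c * ln \<xi> \<le> c * ln N + \<bar>c\<bar> * ln L"
    by (auto simp: abs_le_iff algebra_simps)
  show "N powr c * L powr (- \<bar>c\<bar>) \<le> \<xi> powr c" "\<xi> powr c \<le> N powr c * L powr \<bar>c\<bar>"
    using b assms x by (auto simp: powr_def simp flip: exp_add)
qed

lemma incr_bounds:
  fixes N L y u c :: real
  assumes "N > 0" "L \<ge> 1" "N / L \<le> y" "y + u \<le> N * L" "u > 0" "c > 0"
  shows "c * u * (N powr (c - 1) * L powr (- \<bar>c - 1\<bar>)) \<le> incr c u y"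
    "incr c u y \<le> c * u * (N powr (c - 1) * L powr \<bar>c - 1\<bar>)"
proof -
  have "y > 0" using assms by (smt (verit) divide_pos_pos)
  then obtain \<xi> where x: "y < \<xi>" "\<xi> < y + u" "incr c u y = c * u * \<xi> powr (c - 1)"
    using incr_mvt[of y u c] assms by blast
  have "N / L \<le> \<xi>" "\<xi> \<le> N * L" using x assms by auto
  from powr_range[OF assms(1,2) this, of "c - 1"] show
    "c * u * (N powr (c - 1) * L powr (- \<bar>c - 1\<bar>)) \<le> incr c u y"
    "incr c u y \<le> c * u * (N powr (c - 1) * L powr \<bar>c - 1\<bar>)"
    unfolding x(3) using assms by (auto intro!: mult_left_mono)
qed

text \<open>Taking out (a b)^(c / 2), a power of the geometric mean, turns a difference of powers
  into a hyperbolic sine of half the logarithmic distance.\<close>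

lemma two_sinh_half_log:
  fixes a b c :: real
  assumes "a > 0" "b > 0"
  shows "2 * sinh (c * ((ln b - ln a) / 2)) * (a powr (c / 2) * b powr (c / 2)) = b powr c - a powr c"
proof -
  define x y where "x = c * ln a / 2" and "y = c * ln b / 2"
  have "c * ((ln b - ln a) / 2) = y - x" by (simp add: x_def y_def algebra_simps diff_divide_distrib)
  moreover have "a powr (c / 2) = exp x" "b powr (c / 2) = exp y" "a powr c = exp (x + x)" "b powr c = exp (y + y)"
    using assms by (auto simp: powr_def x_def y_def)
  moreover have "2 * sinh (y - x) * (exp x * exp y) = exp (y + y) - exp (x + x)"
  proof -
    have "exp (y - x) * (exp x * exp y) = exp (y + y)" "exp (- (y - x)) * (exp x * exp y) = exp (x + x)"
      by (simp_all flip: exp_add)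
    then show ?thesis by (simp only: sinh_def) (simp add: left_diff_distrib)
  qed
  ultimately show ?thesis by (simp only:)
qed

text \<open>With \<open>a = y\<close>, \<open>b = y + u\<close> this rests on
  \<open>(b\<^sup>2 Q - a\<^sup>2 P) (Q - P) = (b Q - a P)\<^sup>2 - P Q (b - a)\<^sup>2\<close>.\<close>

lemma incr_identity:
  assumes y: "y > 0" and u: "u > 0" and g: "g > 0"
  shows "incr (g + 1) u y * incr (g - 1) u y =
    (incr g u y)\<^sup>2 * (1 - 1 / (sinh_ratio g ((ln (y + u) - ln y) / 2))\<^sup>2)"
proof -
  define a b where "a = y" and "b = y + u"
  have ab: "a > 0" "b > 0" "a < b" using y u by (auto simp: a_def b_def)
  define w where "w = (ln b - ln a) / 2"
  define P Q where "P = a powr (g - 1)" and "Q = b powr (g - 1)"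
  have PQ: "P > 0" "Q > 0" using ab by (auto simp: P_def Q_def)
  have pw: "a powr g = a * P" "b powr g = b * Q" "a powr (g + 1) = a * a * P" "b powr (g + 1) = b * b * Q"
    using ab powr_add[of a "g - 1" 1] powr_add[of b "g - 1" 1] powr_add[of a "g - 1" 2] powr_add[of b "g - 1" 2]
    by (auto simp: P_def Q_def powr_numeral power2_eq_square mult_ac add.commute[of g 1])
  have d: "b * Q - a * P > 0" using powr_less_mono2[of g a b] ab g unfolding pw by simp
  have w0: "w > 0" using ab by (simp add: w_def)
  have sg: "sinh (g * w) > 0" using w0 g by simp
  have s: "sinh w > 0" using w0 by simp
  have half: "a powr (c / 2) * a powr (c / 2) = a powr c" "b powr (c / 2) * b powr (c / 2) = b powr c" for c
    by (auto simp flip: powr_add)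
  have 1: "4 * (sinh (g * w))\<^sup>2 * (a * P * (b * Q)) = (b * Q - a * P)\<^sup>2"
  proof -
    have "(b * Q - a * P)\<^sup>2 = (2 * sinh (g * w) * (a powr (g / 2) * b powr (g / 2)))\<^sup>2"
      using two_sinh_half_log[OF ab(1,2), of g] by (simp add: w_def pw)
    also have "\<dots> = 4 * (sinh (g * w))\<^sup>2 * ((a powr (g / 2) * a powr (g / 2)) * (b powr (g / 2) * b powr (g / 2)))"
      by (simp add: power2_eq_square mult_ac)
    finally show ?thesis unfolding half pw by simp
  qed
  have 2: "4 * (sinh w)\<^sup>2 * (a * b) = (b - a)\<^sup>2"
  proof -
    have "(b - a)\<^sup>2 = (2 * sinh w * (a powr (1 / 2) * b powr (1 / 2)))\<^sup>2"
      using two_sinh_half_log[OF ab(1,2), of 1] ab by (simp add: w_def)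
    also have "\<dots> = 4 * (sinh w)\<^sup>2 * ((a powr (1 / 2) * a powr (1 / 2)) * (b powr (1 / 2) * b powr (1 / 2)))"
      by (simp add: power2_eq_square mult_ac)
    finally show ?thesis unfolding half using ab by simp
  qed
  have "(sinh w)\<^sup>2 * (b * Q - a * P)\<^sup>2 * (4 * (a * b)) = (4 * (sinh w)\<^sup>2 * (a * b)) * (b * Q - a * P)\<^sup>2" by simp
  also have "\<dots> = (b - a)\<^sup>2 * (4 * (sinh (g * w))\<^sup>2 * (a * P * (b * Q)))" unfolding 1 2 ..
  also have "\<dots> = (sinh (g * w))\<^sup>2 * (P * Q * (b - a)\<^sup>2) * (4 * (a * b))" by simp
  finally have 3: "(sinh w)\<^sup>2 * (b * Q - a * P)\<^sup>2 = (sinh (g * w))\<^sup>2 * (P * Q * (b - a)\<^sup>2)"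
    using ab by simp
  have "(b * Q - a * P)\<^sup>2 * (1 - 1 / (sinh_ratio g w)\<^sup>2) = (b * Q - a * P)\<^sup>2 - (sinh w)\<^sup>2 * (b * Q - a * P)\<^sup>2 / (sinh (g * w))\<^sup>2"
    using s sg by (simp add: sinh_ratio_def power_divide right_diff_distrib)
  also have "\<dots> = (b * Q - a * P)\<^sup>2 - P * Q * (b - a)\<^sup>2"
    unfolding 3 by (subst nonzero_mult_div_cancel_left) (use sg in auto)
  also have "\<dots> = (b * b * Q - a * a * P) * (Q - P)" by (simp add: power2_eq_square algebra_simps)
  finally show ?thesis
    unfolding incr_def b_def[symmetric]
    unfolding a_def[symmetric] pw P_def[symmetric] Q_def[symmetric] w_def[symmetric] by (rule sym)
qed

lemma incr_strict_mono:
  assumes "g > 0" "u > 0" "0 < y" "y < z"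
  shows "incr (g + 1) u y < incr (g + 1) u z"
proof (rule DERIV_pos_imp_increasing[OF assms(4)])
  fix x assume "y \<le> x" "x \<le> z"
  then have "x > 0" using assms by simp
  then show "\<exists>d. ((\<lambda>x. incr (g + 1) u x) has_real_derivative d) (at x) \<and> 0 < d"
    using incr_deriv[of x u "g + 1"] incr_pos[of g u x] assms by (intro exI[of _ "(g + 1) * incr g u x"]) auto
qed

lemma isCont_incr: "y > 0 \<Longrightarrow> u \<ge> 0 \<Longrightarrow> isCont (\<lambda>y. incr c u y) y"
  using incr_deriv DERIV_isCont by blast

lemma DERIV_inverse_strong:
  fixes f g :: "real \<Rightarrow> real"
  assumes "(f has_real_derivative D) (at (g y))" "D \<noteq> 0" "open S" "continuous_on S f" "g y \<in> S"
    "f (g y) = y" "\<And>z. z \<in> S \<Longrightarrow> g (f z) = z"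
  shows "(g has_real_derivative inverse D) (at y)"
  unfolding has_field_derivative_def
  by (rule has_derivative_inverse_strong_x[OF assms(3,5,4,7) assms(1)[unfolded has_field_derivative_def]])
     (use assms(2,6) in auto)

text \<open>For fixed \<open>u\<close>, \<open>v\<close> the near-solutions \<open>(y, n)\<close> of
  \<open>(n + u)\<^bsup>g+1\<^esup> - n\<^bsup>g+1\<^esup> = (y + v)\<^bsup>g+1\<^esup> - y\<^bsup>g+1\<^esup>\<close> lie close to a curve \<open>n = \<Psi> y\<close>
  whose second derivative has size \<open>u\<^sup>2 / N\<^sup>3\<close> up to powers of \<open>L\<close>. For \<open>g = 1\<close> the curve is a line.\<close>

lemma incr_curve:
  fixes g N L u v a b :: real
  defines "c \<equiv> 3 * \<bar>g - 1\<bar> + g + 6"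
  assumes g: "g > 0" "g \<noteq> 1" and N: "N > 0" and L: "L \<ge> 2" and u: "u > 0" "u \<le> v" "v \<le> L * u"
    and dom: "\<And>y. y \<in> {a..b} \<Longrightarrow> N / L \<le> y \<and> y + v \<le> N * L"
    and low: "\<And>y. y \<in> {a..b} \<Longrightarrow> incr (g + 1) u (y + N / L) \<le> incr (g + 1) v y"
    and upp: "\<And>y. y \<in> {a..b} \<Longrightarrow> incr (g + 1) v y \<le> incr (g + 1) u (N * L - u)"
    and uN: "u < N * L / 2"
    and sm: "L\<^sup>2 * u \<le> 2 * N" "g * (L\<^sup>2 * u) \<le> 2 * N"
  obtains \<Psi> \<Psi>' \<Psi>'' :: "real \<Rightarrow> real" where
    "\<And>y. y \<in> {a..b} \<Longrightarrow> N / L \<le> \<Psi> y \<and> \<Psi> y + u \<le> N * L \<and> incr (g + 1) u (\<Psi> y) = incr (g + 1) v y"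
    "\<And>y. y \<in> {a..b} \<Longrightarrow> (\<Psi> has_real_derivative \<Psi>' y) (at y)"
    "\<And>y. y \<in> {a..b} \<Longrightarrow> (\<Psi>' has_real_derivative \<Psi>'' y) (at y)"
    "\<And>y. y \<in> {a..b} \<Longrightarrow> u\<^sup>2 / (6144 * (g + 1) * N ^ 3 * L powr c) \<le> \<Psi>'' y / (g\<^sup>2 - 1) \<and>
        \<Psi>'' y / (g\<^sup>2 - 1) \<le> 16 * u\<^sup>2 * L powr c / ((g + 1) * N ^ 3)"
proof -
  \<comment> \<open>The curve is obtained as \<open>h (incr (g + 1) v y)\<close>, with
    \<open>h\<close> the inverse of the strictly increasing function
    \<open>incr (g + 1) u\<close>.\<close>
  define h where "h = the_inv_into {0<..} (incr (g + 1) u)"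
  have inj: "inj_on (incr (g + 1) u) {0<..}"
    by (rule linorder_inj_onI) (use incr_strict_mono[OF g(1) u(1)] in force)+
  have h: "h (incr (g + 1) u z) = z" if "z > 0" for z
    unfolding h_def using inj that by (intro the_inv_into_f_f) auto
  define \<Psi> where "\<Psi> y = h (incr (g + 1) v y)" for y
  define \<Psi>' where "\<Psi>' y = incr g v y / incr g u (\<Psi> y)" for y
  define \<Psi>'' where "\<Psi>'' y = (g * incr (g - 1) v y * incr g u (\<Psi> y) - incr g v y * (g * incr (g - 1) u (\<Psi> y) * \<Psi>' y)) / (incr g u (\<Psi> y))\<^sup>2" for y
  have v: "v > 0" using u by simp
  have NL: "N / L > 0" using N L by simp
  \<comment> \<open>The hypotheses \<open>low\<close> and \<open>upp\<close> bracket the value, so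
    the intermediate value theorem places the solution at least N / L to the right of y. This
    separation keeps the curvature away from 0.\<close>
  have P: "\<Psi> y \<ge> y + N / L \<and> \<Psi> y \<le> N * L - u \<and> incr (g + 1) u (\<Psi> y) = incr (g + 1) v y" if y: "y \<in> {a..b}" for y
  proof -
    have d: "N / L \<le> y" "y > 0" using dom[OF y] NL by linarith+
    have le: "y + N / L \<le> N * L - u"
    proof (rule ccontr)
      assume "\<not> y + N / L \<le> N * L - u"
      then have "incr (g + 1) u (N * L - u) < incr (g + 1) u (y + N / L)"
        using g u uN by (intro incr_strict_mono) (auto simp: field_simps)
      then show False using low[OF y] upp[OF y] by linarith
    qed
    have "\<exists>x\<ge>y + N / L. x \<le> N * L - u \<and> incr (g + 1) u x = incr (g + 1) v y"
      using low[OF y] upp[OF y] le d NL u by (intro IVT) (auto intro!: isCont_incr)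
    then obtain x where x: "y + N / L \<le> x" "x \<le> N * L - u" "incr (g + 1) u x = incr (g + 1) v y" by blast
    then have "\<Psi> y = x" using h[of x] d NL unfolding \<Psi>_def by auto
    then show ?thesis using x by auto
  qed
  have pos: "y > 0" "\<Psi> y > 0" if "y \<in> {a..b}" for y using dom[OF that] P[OF that] NL by linarith+
  have D1: "(\<Psi> has_real_derivative \<Psi>' y) (at y)" if y: "y \<in> {a..b}" for y
  proof -
    have 1: "(h has_real_derivative inverse ((g + 1) * incr g u (\<Psi> y))) (at (incr (g + 1) v y))"
    proof (rule DERIV_inverse_strong[where S = "{0<..}" and f = "incr (g + 1) u"])
      have "((\<lambda>y. incr (g + 1) u y) has_real_derivative (g + 1) * incr g u (\<Psi> y)) (at (\<Psi> y))"
        using incr_deriv[of "\<Psi> y" u "g + 1"] pos[OF y] u by simp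
      then show "(incr (g + 1) u has_real_derivative (g + 1) * incr g u (\<Psi> y)) (at (h (incr (g + 1) v y)))"
        by (simp add: \<Psi>_def)
      show "(g + 1) * incr g u (\<Psi> y) \<noteq> 0" using incr_pos[of g u "\<Psi> y"] g u pos[OF y] by auto
      show "continuous_on {0<..} (incr (g + 1) u)"
        by (intro continuous_at_imp_continuous_on) (use u isCont_incr in auto)
      show "h (incr (g + 1) v y) \<in> {0<..}" using pos[OF y] by (simp add: \<Psi>_def)
      show "incr (g + 1) u (h (incr (g + 1) v y)) = incr (g + 1) v y" using P[OF y] by (simp add: \<Psi>_def)
    qed (use h in auto)
    have 2: "((\<lambda>y. incr (g + 1) v y) has_real_derivative (g + 1) * incr g v y) (at y)"
      using incr_deriv[of y v "g + 1"] pos[OF y] v by simp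
    have "((\<lambda>y. h (incr (g + 1) v y)) has_real_derivative inverse ((g + 1) * incr g u (\<Psi> y)) * ((g + 1) * incr g v y)) (at y)"
      by (rule DERIV_chain2[OF 1 2])
    moreover have "inverse (k * Y) * (k * X) = X / Y" if "k \<noteq> 0" for k X Y :: real
      using that by (simp add: field_simps)
    ultimately show ?thesis using g unfolding \<Psi>_def[symmetric] \<Psi>'_def by simp
  qed
  have D2: "(\<Psi>' has_real_derivative \<Psi>'' y) (at y)" if y: "y \<in> {a..b}" for y
  proof -
    have 1: "((\<lambda>y. incr g v y) has_real_derivative g * incr (g - 1) v y) (at y)"
      using incr_deriv[of y v g] pos[OF y] v by simp
    have 2: "((\<lambda>y. incr g u (\<Psi> y)) has_real_derivative g * incr (g - 1) u (\<Psi> y) * \<Psi>' y) (at y)"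
      using DERIV_chain2[OF incr_deriv[of "\<Psi> y" u g] D1[OF y]] pos[OF y] u by simp
    have nz: "incr g u (\<Psi> y) \<noteq> 0" using incr_pos[of g u "\<Psi> y"] g u pos[OF y] by auto
    show ?thesis using DERIV_divide[OF 1 2 nz] by (simp add: \<Psi>'_def[abs_def] \<Psi>''_def power2_eq_square)
  qed
  have B: "u\<^sup>2 / (6144 * (g + 1) * N ^ 3 * L powr c) \<le> \<Psi>'' y / (g\<^sup>2 - 1) \<and>
        \<Psi>'' y / (g\<^sup>2 - 1) \<le> 16 * u\<^sup>2 * L powr c / ((g + 1) * N ^ 3)" if y: "y \<in> {a..b}" for y
  proof -
    define n where "n = \<Psi> y"
    have n: "y + N / L \<le> n" "n \<le> N * L - u" "incr (g + 1) u n = incr (g + 1) v y" using P[OF y] by (auto simp: n_def)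
    have y0: "y > 0" "n > 0" using pos[OF y] by (auto simp: n_def)
    have yN: "N / L \<le> y" "y + v \<le> N * L" using dom[OF y] by auto
    define w1 w2 where "w1 = (ln (n + u) - ln n) / 2" and "w2 = (ln (y + v) - ln y) / 2"
    define X Y Z where "X = incr g v y" and "Y = incr g u n" and "Z = incr (g + 1) v y"
    have XYZ: "X > 0" "Y > 0" "Z > 0" unfolding X_def Y_def Z_def using g u v y0 by (auto intro!: incr_pos)
    have i1: "incr (g - 1) v y = X\<^sup>2 * (1 - 1 / (sinh_ratio g w2)\<^sup>2) / Z"
      using incr_identity[OF y0(1) v g(1)] XYZ unfolding X_def[symmetric] Z_def[symmetric] w2_def[symmetric]
      by (simp add: field_simps)
    have i2: "incr (g - 1) u n = Y\<^sup>2 * (1 - 1 / (sinh_ratio g w1)\<^sup>2) / Z"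
      using incr_identity[OF y0(2) u(1) g(1)] XYZ unfolding Y_def[symmetric] n(3) Z_def[symmetric] w1_def[symmetric]
      by (simp add: field_simps)
    \<comment> \<open>\<open>incr_identity\<close> at both ends replaces the increments of exponent
      g - 1; because both ends share the value \<open>Z\<close>, the two contributions combine into
      a difference of inverse squares.\<close>
    have e: "\<Psi>'' y = g * X\<^sup>2 / (Y * Z) * (1 / (sinh_ratio g w1)\<^sup>2 - 1 / (sinh_ratio g w2)\<^sup>2)"
    proof -
      have "\<Psi>'' y = (g * (X\<^sup>2 * (1 - 1 / (sinh_ratio g w2)\<^sup>2) / Z) * Y - X * (g * (Y\<^sup>2 * (1 - 1 / (sinh_ratio g w1)\<^sup>2) / Z) * (X / Y))) / Y\<^sup>2"
        unfolding \<Psi>''_def \<Psi>'_def n_def[symmetric] i1 i2 X_def[symmetric] Y_def[symmetric] ..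
      also have "\<dots> = g * X\<^sup>2 / (Y * Z) * ((1 - 1 / (sinh_ratio g w2)\<^sup>2) - (1 - 1 / (sinh_ratio g w1)\<^sup>2))"
      proof -
        have "(g * (X\<^sup>2 * \<alpha> / Z) * Y - X * (g * (Y\<^sup>2 * \<beta> / Z) * (X / Y))) / Y\<^sup>2 = g * X\<^sup>2 / (Y * Z) * (\<alpha> - \<beta>)" for \<alpha> \<beta>
          using XYZ by (simp add: power2_eq_square field_simps)
        then show ?thesis .
      qed
      finally show ?thesis by simp
    qed
    have w1: "w1 > 0" using y0 u by (simp add: w1_def)
    have w2u: "w2 \<le> L\<^sup>2 * u / (2 * N)"
    proof -
      have "1 + v / y = (y + v) / y" using y0 by (simp add: field_simps)
      then have "ln (1 + v / y) = ln (y + v) - ln y" using y0 v by (simp add: ln_div)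
      then have "w2 = ln (1 + v / y) / 2" by (simp add: w2_def)
      also have "\<dots> \<le> v / y / 2" using ln_add_one_self_le_self[of "v / y"] y0 v by simp
      also have "\<dots> \<le> (L * u) / (N / L) / 2" using u yN NL v by (intro divide_right_mono frac_le) auto
      finally show ?thesis using N L by (simp add: power2_eq_square field_simps)
    qed
    \<comment> \<open>A lower bound for u (n - y) / (y (n + u)): n - y is at least N / L, and both
      factors of the denominator are at most N L.\<close>
    define x0 where "x0 = u / (L ^ 3 * N)"
    have L3: "8 \<le> L ^ 3" using power_mono[of 2 L 3] L by simp
    have x0: "0 < x0" "x0 \<le> 1 / 2"
    proof -
      show "0 < x0" using u N L by (simp add: x0_def)
      have "4 \<le> L\<^sup>2" using power_mono[of 2 L 2] L by simp
      then have "4 * u \<le> L\<^sup>2 * u" using u by (intro mult_right_mono) auto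
      then have "2 * u \<le> 1 * N" using sm by linarith
      also have "\<dots> \<le> L ^ 3 * N" using L3 N by (intro mult_right_mono) auto
      finally show "x0 \<le> 1 / 2" using N L by (simp add: x0_def field_simps)
    qed
    \<comment> \<open>On the logarithmic scale an increment v \<ge> u weighs more at the smaller
      argument y: the logarithm of (y + v) n / (y (n + u)) is exactly 2 (w2 - w1).\<close>
    have wd: "w2 - w1 \<ge> x0 / 4"
    proof -
      have "1 + x0 \<le> (y + v) * n / (y * (n + u))"
      proof -
        have "(y + u) * n = y * (n + u) + u * (n - y)" by (simp add: algebra_simps)
        then have "(y + u) * n / (y * (n + u)) = y * (n + u) / (y * (n + u)) + u * (n - y) / (y * (n + u))"
          by (simp only: add_divide_distrib)
        moreover have "y * (n + u) / (y * (n + u)) = 1" using y0 u by (intro divide_self) auto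
        ultimately have "(y + u) * n / (y * (n + u)) = 1 + u * (n - y) / (y * (n + u))" by simp
        moreover have "x0 = u * (N / L) / ((N * L) * (N * L))"
          using N L by (simp add: x0_def power3_eq_cube)
        moreover have "\<dots> \<le> u * (n - y) / (y * (n + u))"
          using n y0 u yN v NL by (intro frac_le mult_left_mono mult_mono) (auto intro!: mult_nonneg_nonneg)
        moreover have "(y + u) * n / (y * (n + u)) \<le> (y + v) * n / (y * (n + u))"
          using u y0 by (intro divide_right_mono mult_right_mono) auto
        ultimately show ?thesis by linarith
      qed
      then have "ln (1 + x0) \<le> ln ((y + v) * n / (y * (n + u)))" using x0 by (subst ln_le_cancel_iff) auto
      also have "\<dots> = ln (y + v) + ln n - (ln y + ln (n + u))" using y0 u v by (simp add: ln_mult ln_div)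
      also have "\<dots> = 2 * (w2 - w1)" by (simp add: w1_def w2_def field_simps)
      finally have 1: "ln (1 + x0) \<le> 2 * (w2 - w1)" .
      have 2: "x0 - x0\<^sup>2 \<le> ln (1 + x0)" using x0 by (intro ln_one_plus_pos_lower_bound) auto
      have "x0\<^sup>2 \<le> x0 / 2" using x0 mult_left_mono[of x0 "1/2" x0] by (simp add: power2_eq_square)
      then have "x0 / 2 \<le> x0 - x0\<^sup>2" by simp
      from order_trans[OF this order_trans[OF 2 1]] show ?thesis by simp
    qed
    have W: "0 < w1" "w1 \<le> w2" "w2 \<le> 1" "g * w2 \<le> 1"
    proof -
      show "w1 \<le> w2" using wd x0 by linarith
      show "w2 \<le> 1" using w2u sm(1) N by (smt (verit) divide_le_eq_1_pos)
      have "g * w2 \<le> g * (L\<^sup>2 * u / (2 * N))" using w2u g by (intro mult_left_mono) auto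
      also have "\<dots> \<le> 1" using sm(2) N by (simp add: field_simps)
      finally show "g * w2 \<le> 1" .
    qed (rule w1)
    have Wl: "u\<^sup>2 / (16 * L ^ 6 * N\<^sup>2) \<le> w2\<^sup>2 - w1\<^sup>2"
    proof -
      have "u\<^sup>2 / (16 * L ^ 6 * N\<^sup>2) = (x0 / 4)\<^sup>2" by (simp add: x0_def power2_eq_square power_numeral_reduce)
      also have "\<dots> \<le> (w2 - w1)\<^sup>2" using wd x0 by (intro power_mono) auto
      also have "\<dots> \<le> w2\<^sup>2 - w1\<^sup>2"
        using mult_left_mono[of w1 w2 w1] W by (simp add: power2_eq_square algebra_simps)
      finally show ?thesis .
    qed
    have Wu: "w2\<^sup>2 - w1\<^sup>2 \<le> L ^ 4 * u\<^sup>2 / (4 * N\<^sup>2)"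
    proof -
      have "w2\<^sup>2 - w1\<^sup>2 \<le> w2\<^sup>2" by simp
      also have "\<dots> \<le> (L\<^sup>2 * u / (2 * N))\<^sup>2" using w2u W by (intro power_mono) auto
      also have "\<dots> = L ^ 4 * u\<^sup>2 / (4 * N\<^sup>2)" by (simp add: power2_eq_square power_numeral_reduce)
      finally show ?thesis .
    qed
    define E where "E = \<bar>g - 1\<bar>"
    define M where "M = N powr (g - 1)"
    have M: "M > 0" using N by (simp add: M_def)
    have Ng: "N powr g = N * M" using N powr_add[of N "g - 1" 1] by (simp add: M_def mult.commute)
    have "L \<ge> 1" using L by simp
    have Xb: "g * v * (M * L powr (- E)) \<le> X" "X \<le> g * v * (M * L powr E)"
      unfolding X_def M_def E_def using incr_bounds[OF N \<open>L \<ge> 1\<close> yN v g(1)] by auto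
    have "N / L \<le> n" "n + u \<le> N * L" using n y0 by linarith+
    then have Yb: "g * u * (M * L powr (- E)) \<le> Y" "Y \<le> g * u * (M * L powr E)"
      unfolding Y_def M_def E_def using incr_bounds[OF N \<open>L \<ge> 1\<close> _ _ u(1) g(1)] by auto
    have Zb: "(g + 1) * v * (N * M * L powr (- g)) \<le> Z" "Z \<le> (g + 1) * v * (N * M * L powr g)"
      unfolding Z_def Ng[symmetric] using incr_bounds[OF N \<open>L \<ge> 1\<close> yN v, of "g + 1"] g by auto
    \<comment> \<open>The prefactor has size g^2 / ((g + 1) N) up to powers of L: \<open>X\<close>
      and \<open>Y\<close> are about g v N^(g - 1) and g u N^(g - 1), \<open>Z\<close> is about (g +
      1) v N^g, and v / u lies between 1 and L.\<close>
    define F where "F = g * X\<^sup>2 / (Y * Z)"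
    have Lp: "L powr t > 0" for t using L by simp
    have gg: "g + 1 > 0" using g by simp
    have gen: "g\<^sup>2 / (k * N) * (v * v / (u * v)) * (A * A / (B * C)) =
        g * (g * v * (M * A))\<^sup>2 / ((g * u * (M * B)) * (k * v * (N * M * C)))"
      if "B > 0" "C > 0" "k > 0" for A B C k :: real
      using that g N u v M by (simp add: divide_simps power2_eq_square)
    have Fl: "g\<^sup>2 / ((g + 1) * N) * L powr (- (3 * E + g)) \<le> F"
    proof -
      have "g\<^sup>2 / ((g + 1) * N) * L powr (- (3 * E + g)) = g\<^sup>2 / ((g + 1) * N) * (u * v / (u * v)) * L powr (- (3 * E + g))"
        using u v by simp
      also have "\<dots> \<le> g\<^sup>2 / ((g + 1) * N) * (v * v / (u * v)) * L powr (- (3 * E + g))"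
        using u v g N gg by (intro mult_right_mono mult_left_mono divide_right_mono) auto
      also have "\<dots> = g * (g * v * (M * L powr (- E)))\<^sup>2 / ((g * u * (M * L powr E)) * ((g + 1) * v * (N * M * L powr g)))"
      proof -
        have "L powr (- (3 * E + g)) = L powr (- E) * L powr (- E) / (L powr E * L powr g)"
          by (simp flip: powr_add powr_diff)
        then show ?thesis using gen[OF Lp Lp gg] by (simp only:)
      qed
      also have "\<dots> \<le> F" unfolding F_def
        by (rule frac_le[OF _ mult_left_mono[OF power_mono[OF Xb(1)]] _ mult_mono[OF Yb(2) Zb(2)]])
           (use XYZ g u v M N gg in auto)
      finally show ?thesis .
    qed
    have Fu: "F \<le> g\<^sup>2 / ((g + 1) * N) * L powr (3 * E + g + 1)"
    proof -
      have "F \<le> g * (g * v * (M * L powr E))\<^sup>2 / ((g * u * (M * L powr (- E))) * ((g + 1) * v * (N * M * L powr (- g))))"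
        unfolding F_def
        by (rule frac_le[OF _ mult_left_mono[OF power_mono[OF Xb(2)]] _ mult_mono[OF Yb(1) Zb(1)]])
           (use XYZ g u v M N gg Lp in auto)
      also have "\<dots> = g\<^sup>2 / ((g + 1) * N) * (v / u) * L powr (3 * E + g)"
      proof -
        have "L powr (3 * E + g) = L powr E * L powr E / (L powr (- E) * L powr (- g))"
          by (simp flip: powr_add powr_diff)
        moreover have "v / u = v * v / (u * v)" using v by simp
        ultimately show ?thesis using gen[OF Lp Lp gg] by (simp only:)
      qed
      also have "\<dots> \<le> g\<^sup>2 / ((g + 1) * N) * L * L powr (3 * E + g)"
        using u v g N gg by (intro mult_right_mono mult_left_mono) (auto simp: field_simps)
      also have "\<dots> = g\<^sup>2 / ((g + 1) * N) * L powr (3 * E + g + 1)" using L by (simp add: powr_add)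
      finally show ?thesis .
    qed
    define R where "R = (1 / (sinh_ratio g w1)\<^sup>2 - 1 / (sinh_ratio g w2)\<^sup>2) / (g\<^sup>2 - 1)"
    have Rl: "u\<^sup>2 / (16 * L ^ 6 * N\<^sup>2) / (384 * g\<^sup>2) \<le> R"
      using sinh_ratio_inverse_square_diff_bounds(1)[OF g W] Wl divide_right_mono[OF Wl, of "384 * g\<^sup>2"] by (simp add: R_def)
    have Ru: "R \<le> 64 * (L ^ 4 * u\<^sup>2 / (4 * N\<^sup>2)) / g\<^sup>2"
      using sinh_ratio_inverse_square_diff_bounds(2)[OF g W] divide_right_mono[OF mult_left_mono[OF Wu, of 64], of "g\<^sup>2"] by (simp add: R_def)
    have R0: "R \<ge> 0" using Rl u N L by (smt (verit) divide_nonneg_nonneg zero_le_power2 mult_nonneg_nonneg zero_le_power)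
    have F0: "F > 0" using XYZ g by (simp add: F_def)
    have \<Psi>FR: "\<Psi>'' y / (g\<^sup>2 - 1) = F * R" by (simp add: e F_def R_def)
    \<comment> \<open>The exponent \<open>c\<close> collects 3 E from \<open>X\<close> squared and
      \<open>Y\<close>, g from \<open>Z\<close>, and 6 from the lower bound on w2^2 - w1^2.\<close>
    have "u\<^sup>2 / (6144 * (g + 1) * N ^ 3 * L powr c) =
        (g\<^sup>2 / ((g + 1) * N) * L powr (- (3 * E + g))) * (u\<^sup>2 / (16 * L ^ 6 * N\<^sup>2) / (384 * g\<^sup>2))"
    proof -
      have "L powr c = L powr (3 * E + g) * L ^ 6" using L by (simp add: c_def E_def powr_add powr_numeral)
      moreover have "L powr (- (3 * E + g)) = 1 / L powr (3 * E + g)" by (simp only: powr_minus_divide)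
      moreover have "u\<^sup>2 / (6144 * k * N ^ 3 * (B * C)) = g\<^sup>2 / (k * N) * (1 / B) * (u\<^sup>2 / (16 * C * N\<^sup>2) / (384 * g\<^sup>2))"
        if "B > 0" "C > 0" "k > 0" for B C k :: real
        using that g N by (simp add: divide_simps power2_eq_square power3_eq_cube)
      moreover have "L ^ 6 > 0" using L by simp
      ultimately show ?thesis using Lp gg by (simp only:)
    qed
    also have "\<dots> \<le> F * R" by (rule mult_mono[OF Fl Rl]) (use F0 u N L in auto)
    finally have 1: "u\<^sup>2 / (6144 * (g + 1) * N ^ 3 * L powr c) \<le> F * R" .
    have "F * R \<le> (g\<^sup>2 / ((g + 1) * N) * L powr (3 * E + g + 1)) * (64 * (L ^ 4 * u\<^sup>2 / (4 * N\<^sup>2)) / g\<^sup>2)"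
      by (rule mult_mono[OF Fu Ru]) (use R0 g N gg in auto)
    also have "\<dots> = 16 * u\<^sup>2 * (L powr (3 * E + g + 1) * L ^ 4) / ((g + 1) * N ^ 3)"
    proof -
      have "g\<^sup>2 / (k * N) * B * (64 * (C * u\<^sup>2 / (4 * N\<^sup>2)) / g\<^sup>2) = 16 * u\<^sup>2 * (B * C) / (k * N ^ 3)"
        if "k > 0" for B C k :: real
        using that g N by (simp add: divide_simps power2_eq_square power3_eq_cube)
      then show ?thesis using gg by (simp only:)
    qed
    also have "L powr (3 * E + g + 1) * L ^ 4 = L powr (c - 1)"
      using L by (simp add: c_def E_def powr_numeral[symmetric] del: powr_numeral flip: powr_add)
    finally have "F * R \<le> 16 * u\<^sup>2 * L powr (c - 1) / ((g + 1) * N ^ 3)" .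
    also have "\<dots> \<le> 16 * u\<^sup>2 * L powr c / ((g + 1) * N ^ 3)"
      using g N gg L by (intro divide_right_mono mult_left_mono powr_mono) auto
    finally show ?thesis using 1 \<Psi>FR by simp
  qed
  have A: "N / L \<le> \<Psi> y \<and> \<Psi> y + u \<le> N * L \<and> incr (g + 1) u (\<Psi> y) = incr (g + 1) v y" if "y \<in> {a..b}" for y
    using P[OF that] pos[OF that] by auto
  show ?thesis by (rule that[OF A D1 D2 B])
qed

section \<open>Integer points near a curve\<close>

text \<open>The Fejer kernel, the squared modulus of the sum of ee (q x) over q < Q, is at least Q^2
  / 4 when x is within 1 / (6 Q) of an integer, and nonnegative elsewhere. Summing it over M and
  expanding the square leaves exponential sums with frequencies h < Q.\<close>

lemma fejer_count:
  fixes \<Psi> :: "nat \<Rightarrow> real"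
  assumes M: "finite M" "B \<subseteq> M" and Q: "Q \<ge> 1"
    and B: "\<And>m. m \<in> B \<Longrightarrow> \<exists>k::int. \<bar>\<Psi> m - of_int k\<bar> \<le> 1 / (6 * real Q)"
  shows "real (card B) \<le> 4 / real Q * (real (card M) + 2 * (\<Sum>h\<in>{1..<Q}. norm (\<Sum>m\<in>M. ee (real h * \<Psi> m))))"
proof -
  define F where "F m = (norm (\<Sum>q<Q. ee (real q * \<Psi> m)))\<^sup>2" for m
  define c where "c h = norm (\<Sum>m\<in>M. ee (real h * \<Psi> m))" for h :: nat
  have low: "(real Q / 2)\<^sup>2 \<le> F m" if m: "m \<in> B" for m
  proof -
    from B[OF m] obtain k :: int where k: "\<bar>\<Psi> m - of_int k\<bar> \<le> 1 / (6 * real Q)" by blast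
    \<comment> \<open>Each angle 2 pi q (\<Psi> m - k) is at most 60 degrees, whence the 6 in the
      hypothesis.\<close>
    have "1 / 2 \<le> Re (ee (real q * \<Psi> m))" if q: "q < Q" for q
    proof -
      define x where "x = 2 * pi * (real q * (\<Psi> m - of_int k))"
      have "ee (real q * \<Psi> m) = ee (real q * (\<Psi> m - of_int k)) * ee (of_int (int q * k))"
        unfolding ee_add[symmetric] by (simp add: algebra_simps)
      then have "Re (ee (real q * \<Psi> m)) = cos x" by (simp only: ee_int) (simp add: ee_def x_def)
      also have "\<dots> = cos \<bar>x\<bar>" by simp
      also have "cos (pi / 3) \<le> cos \<bar>x\<bar>"
      proof (rule cos_monotone_0_pi_le)
        have "real q * \<bar>\<Psi> m - of_int k\<bar> \<le> real Q * (1 / (6 * real Q))"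
          using q k by (intro mult_mono) auto
        also have "\<dots> = 1 / 6" using Q by simp
        finally have "2 * pi * (real q * \<bar>\<Psi> m - of_int k\<bar>) \<le> 2 * pi * (1 / 6)" by (intro mult_left_mono) auto
        then show "\<bar>x\<bar> \<le> pi / 3" by (simp add: x_def abs_mult)
      qed auto
      finally show ?thesis by (simp add: cos_60)
    qed
    then have "(\<Sum>q<Q. 1 / 2) \<le> (\<Sum>q<Q. Re (ee (real q * \<Psi> m)))" by (intro sum_mono) auto
    also have "\<dots> = Re (\<Sum>q<Q. ee (real q * \<Psi> m))" by simp
    also have "\<dots> \<le> norm (\<Sum>q<Q. ee (real q * \<Psi> m))" by (rule complex_Re_le_cmod)
    finally have "real Q / 2 \<le> norm (\<Sum>q<Q. ee (real q * \<Psi> m))" by simp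
    then show ?thesis unfolding F_def by (intro power_mono) auto
  qed
  have corr: "norm (\<Sum>m\<in>M. ee (real k * \<Psi> m) * cnj (ee (real k' * \<Psi> m))) = c (if k' \<le> k then k - k' else k' - k)" for k k'
  proof (cases "k' \<le> k")
    case True
    then show ?thesis unfolding c_def cnj_ee ee_add[symmetric]
      by (simp add: of_nat_diff algebra_simps)
  next
    case False
    have "(\<Sum>m\<in>M. ee (real k * \<Psi> m) * cnj (ee (real k' * \<Psi> m))) = (\<Sum>m\<in>M. ee (- (real (k' - k) * \<Psi> m)))"
      unfolding cnj_ee ee_add[symmetric] using False by (simp add: of_nat_diff algebra_simps)
    then show ?thesis using False unfolding c_def by (simp only: norm_sum_ee_minus if_False)
  qed
  have sw: "(\<Sum>m\<in>M. \<Sum>k<Q. f m k) = (\<Sum>k<Q. \<Sum>m\<in>M. f m k)" for f :: "nat \<Rightarrow> nat \<Rightarrow> complex"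
    by (rule sum.swap)
  have "complex_of_real (\<Sum>m\<in>M. F m) = (\<Sum>m\<in>M. (\<Sum>k<Q. ee (real k * \<Psi> m)) * cnj (\<Sum>k<Q. ee (real k * \<Psi> m)))"
    by (simp only: of_real_sum F_def complex_norm_square)
  also have "\<dots> = (\<Sum>m\<in>M. \<Sum>k<Q. \<Sum>k'<Q. ee (real k * \<Psi> m) * cnj (ee (real k' * \<Psi> m)))"
    by (simp add: sum_product)
  also have "\<dots> = (\<Sum>k<Q. \<Sum>k'<Q. \<Sum>m\<in>M. ee (real k * \<Psi> m) * cnj (ee (real k' * \<Psi> m)))"
    by (simp only: sw)
  finally have "norm (complex_of_real (\<Sum>m\<in>M. F m)) = norm (\<Sum>k<Q. \<Sum>k'<Q. \<Sum>m\<in>M. ee (real k * \<Psi> m) * cnj (ee (real k' * \<Psi> m)))"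
    by (rule arg_cong)
  then have "\<bar>\<Sum>m\<in>M. F m\<bar> = norm (\<Sum>k<Q. \<Sum>k'<Q. \<Sum>m\<in>M. ee (real k * \<Psi> m) * cnj (ee (real k' * \<Psi> m)))"
    by (simp only: norm_of_real)
  also have "\<dots> \<le> (\<Sum>k<Q. \<Sum>k'<Q. norm (\<Sum>m\<in>M. ee (real k * \<Psi> m) * cnj (ee (real k' * \<Psi> m))))"
    by (intro order_trans[OF norm_sum] sum_mono norm_sum)
  also have "\<dots> = (\<Sum>k<Q. \<Sum>k'<Q. c (if k' \<le> k then k - k' else k' - k))" by (simp only: corr)
  also have "\<dots> \<le> real Q * (c 0 + 2 * (\<Sum>h\<in>{1..<Q}. c h))"
    by (rule sum_abs_diff_le) (simp add: c_def)
  finally have 1: "(\<Sum>m\<in>M. F m) \<le> real Q * (c 0 + 2 * (\<Sum>h\<in>{1..<Q}. c h))" by linarith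
  have c0: "c 0 \<le> real (card M)" unfolding c_def using norm_sum[of "\<lambda>m. ee (real 0 * \<Psi> m)" M] by simp
  have "real (card B) * (real Q / 2)\<^sup>2 = (\<Sum>m\<in>B. (real Q / 2)\<^sup>2)" by simp
  also have "\<dots> \<le> (\<Sum>m\<in>B. F m)" by (intro sum_mono low)
  also have "\<dots> \<le> (\<Sum>m\<in>M. F m)" using M by (intro sum_mono2) (auto simp: F_def)
  also have "\<dots> \<le> real Q * (real (card M) + 2 * (\<Sum>h\<in>{1..<Q}. c h))"
    using 1 mult_left_mono[OF c0, of "real Q"] by (simp add: algebra_simps)
  finally have "real Q * (real (card B) * real Q) \<le> real Q * (4 * (real (card M) + 2 * (\<Sum>h\<in>{1..<Q}. c h)))"
    by (simp add: power2_eq_square algebra_simps)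
  then have "real (card B) * real Q \<le> 4 * (real (card M) + 2 * (\<Sum>h\<in>{1..<Q}. c h))"
    using Q by (simp only: mult_le_cancel_left_pos of_nat_0_less_iff)
  then show ?thesis using Q by (simp add: c_def field_simps)
qed

lemma sum_sqrt_le: "(\<Sum>h\<in>{1..<Q}. sqrt (real h)) \<le> real Q * sqrt (real Q)"
proof -
  have "(\<Sum>h\<in>{1..<Q}. sqrt (real h)) \<le> (\<Sum>h\<in>{1..<Q}. sqrt (real Q))" by (intro sum_mono) auto
  also have "\<dots> \<le> real Q * sqrt (real Q)" by (simp add: mult_right_mono)
  finally show ?thesis .
qed

text \<open>This is \<open>fejer_count\<close> with the second derivative test at each frequency h,
  where the phase has curvature between h \<open>lo\<close> and h \<open>hi\<close>. The sign
  \<open>s\<close> admits concave \<Psi> as well, at the price of conjugating the sums.\<close>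

lemma near_integer_pairs:
  fixes \<Psi> \<Psi>' \<Psi>'' :: "real \<Rightarrow> real" and s lo hi \<beta> :: real
  assumes lo: "0 < lo" "lo \<le> hi" and s: "s = 1 \<or> s = -1"
    and d1: "\<And>y. y \<in> {real A..real (Suc N)} \<Longrightarrow> (\<Psi> has_real_derivative \<Psi>' y) (at y)"
    and d2: "\<And>y. y \<in> {real A..real (Suc N)} \<Longrightarrow> (\<Psi>' has_real_derivative \<Psi>'' y) (at y)"
    and bd: "\<And>y. y \<in> {real A..real (Suc N)} \<Longrightarrow> lo \<le> s * \<Psi>'' y \<and> s * \<Psi>'' y \<le> hi"
    and S: "finite S" "\<And>n m. (n, m) \<in> S \<Longrightarrow> A \<le> m \<and> m \<le> N \<and> \<bar>real n - \<Psi> (real m)\<bar> \<le> 1 / \<beta>"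
    and \<beta>: "\<beta> > 0" and N: "N \<ge> 1"
  shows "real (card S) \<le> 100 * (N / \<beta> + N * (hi / sqrt lo) * sqrt \<beta> + 8 / (sqrt lo * sqrt \<beta>))"
proof (cases "\<beta> \<ge> 6")
  case False
  have nn: "0 \<le> N * (hi / sqrt lo) * sqrt \<beta>" "0 \<le> 8 / (sqrt lo * sqrt \<beta>)"
    using lo \<beta> by (auto intro!: mult_nonneg_nonneg divide_nonneg_nonneg)
  \<comment> \<open>For \<beta> < 6 a vertical fibre has at most 2 / \<beta> + 1 points, and 1 < 6 /
    \<beta>; adding up over all m is then enough.\<close>
  have fib: "real (card {n. (n, m) \<in> S}) \<le> 8 / \<beta>" for m
  proof (cases "{n. (n, m) \<in> S} = {}")
    case ne: False
    have fin: "finite {n. (n, m) \<in> S}" 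
      using finite_imageI[OF S(1), of fst] by (rule finite_subset[rotated]) force
    obtain a b where ab: "(a, m) \<in> S" "(b, m) \<in> S" "{n. (n, m) \<in> S} \<subseteq> {a..b}"
      using Min_in[OF fin ne] Max_in[OF fin ne] Min_le[OF fin] Max_ge[OF fin] that by (metis (no_types, lifting) atLeastAtMost_iff mem_Collect_eq subsetI)
    have "card {n. (n, m) \<in> S} \<le> Suc b - a" using card_mono[OF _ ab(3)] by simp
    moreover have "real b - real a \<le> 2 / \<beta>" using S(2)[OF ab(1)] S(2)[OF ab(2)] by auto
    moreover have "1 \<le> 6 / \<beta>" using False \<beta> by simp
    moreover have "a \<le> b" using ab by auto
    ultimately have "real (card {n. (n, m) \<in> S}) \<le> 2 / \<beta> + 6 / \<beta>" by linarith
    then show ?thesis by simp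
  qed (use \<beta> in auto)
  have "S \<subseteq> (\<lambda>(m, n). (n, m)) ` (SIGMA m:{..N}. {n. (n, m) \<in> S})" using S(2) by force
  moreover have fin: "finite {n. (n, m) \<in> S}" for m
    using finite_imageI[OF S(1), of fst] by (rule finite_subset[rotated]) force
  ultimately have "card S \<le> card ((\<lambda>(m, n). (n, m)) ` (SIGMA m:{..N}. {n. (n, m) \<in> S}))"
    by (intro card_mono finite_imageI finite_SigmaI) auto
  also have "\<dots> \<le> card (SIGMA m:{..N}. {n. (n, m) \<in> S})" using fin by (intro card_image_le finite_SigmaI) auto
  also have "\<dots> = (\<Sum>m\<le>N. card {n. (n, m) \<in> S})" using fin by (intro card_SigmaI) auto
  finally have "real (card S) \<le> (\<Sum>m\<le>N. real (card {n. (n, m) \<in> S}))"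
    by (metis of_nat_le_iff of_nat_sum)
  also have "\<dots> \<le> (\<Sum>m\<le>N. 8 / \<beta>)" by (intro sum_mono fib)
  also have "\<dots> = (real N + 1) * (8 / \<beta>)" by simp
  also have "\<dots> \<le> (2 * real N) * (8 / \<beta>)" using N \<beta> by (intro mult_right_mono) auto
  also have "\<dots> \<le> 100 * (N / \<beta>)" using \<beta> by (simp add: field_simps)
  finally show ?thesis using nn by argo
next
  case True
  \<comment> \<open>The largest Q with 1 / \<beta> \<le> 1 / (6 Q), as \<open>fejer_count\<close>
    asks.\<close>
  define Q where "Q = nat \<lfloor>\<beta> / 6\<rfloor>"
  have Q: "Q \<ge> 1" "real Q \<le> \<beta> / 6" "\<beta> / 12 \<le> real Q"
  proof -
    have "\<lfloor>\<beta> / 6\<rfloor> \<ge> 1" using True by simp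
    then show Q1: "Q \<ge> 1" unfolding Q_def by linarith
    have q: "real Q = of_int \<lfloor>\<beta> / 6\<rfloor>" using \<open>\<lfloor>\<beta> / 6\<rfloor> \<ge> 1\<close> by (simp add: Q_def)
    show "real Q \<le> \<beta> / 6" unfolding q by (rule of_int_floor_le)
    have "\<beta> / 6 < real Q + 1" unfolding q by linarith
    moreover have "real Q \<ge> 1" using Q1 by simp
    ultimately show "\<beta> / 12 \<le> real Q" by linarith
  qed
  define M where "M = {A..<Suc N}"
  \<comment> \<open>The window reaches less than 1/2 to either side, so m determines n.\<close>
  have inj: "inj_on snd S"
  proof (rule inj_onI, clarify)
    fix n m n' m' assume *: "(n, m) \<in> S" "(n', m') \<in> S" "snd (n, m) = snd (n', m')"
    define r where "r = 1 / \<beta>"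
    have "r < 1 / 2" using True by (simp add: r_def field_simps)
    moreover have "\<bar>real n - \<Psi> (real m)\<bar> \<le> r" "\<bar>real n' - \<Psi> (real m)\<bar> \<le> r"
      using S(2)[OF *(1)] S(2)[OF *(2)] *(3) by (auto simp: r_def)
    ultimately have "\<bar>real n - real n'\<bar> < 1" by linarith
    then show "n = n' \<and> m = m'" using *(3) by auto
  qed
  have E: "norm (\<Sum>m\<in>M. ee (real h * \<Psi> (real m))) \<le> 10 * real N * (hi / sqrt lo) * sqrt h + 10 / sqrt lo * (1 / sqrt h)"
    if h: "h \<in> {1..<Q}" for h
  proof -
    have h0: "real h > 0" using h by auto
    define f where "f y = real h * s * \<Psi> y" for y
    have "norm (\<Sum>m\<in>M. ee (real h * \<Psi> (real m))) = norm (\<Sum>m\<in>M. ee (f (real m)))"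
      using s norm_sum_ee_minus[of "\<lambda>m. real h * \<Psi> (real m)" M] by (auto simp: f_def)
    also have "\<dots> \<le> 5 * (real (Suc N - A) * (h * hi) + 2) / sqrt (h * lo)" unfolding M_def
    proof (rule second_derivative_test[where f' = "\<lambda>y. real h * s * \<Psi>' y" and f'' = "\<lambda>y. real h * s * \<Psi>'' y"])
      fix y assume y: "y \<in> {real A..real (Suc N)}"
      show "(f has_real_derivative real h * s * \<Psi>' y) (at y)" unfolding f_def by (intro DERIV_cmult d1[OF y])
      show "((\<lambda>y. real h * s * \<Psi>' y) has_real_derivative real h * s * \<Psi>'' y) (at y)" by (intro DERIV_cmult d2[OF y])
      have "real h * lo \<le> real h * (s * \<Psi>'' y)" "real h * (s * \<Psi>'' y) \<le> real h * hi"
        using bd[OF y] h0 by (auto intro!: mult_left_mono)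
      then show "real h * lo \<le> real h * s * \<Psi>'' y \<and> real h * s * \<Psi>'' y \<le> real h * hi" by (simp add: mult.assoc)
    qed (use h0 lo in auto)
    also have "\<dots> \<le> 5 * ((2 * real N) * (h * hi) + 2) / sqrt (h * lo)"
      using h0 lo N by (intro divide_right_mono mult_left_mono add_mono mult_right_mono) auto
    also have "\<dots> = 10 * real N * (hi / sqrt lo) * sqrt h + 10 / sqrt lo * (1 / sqrt h)"
    proof -
      define p q where "p = sqrt (real h)" and "q = sqrt lo"
      have pq: "p > 0" "q > 0" "real h = p * p" using h0 lo by (auto simp: p_def q_def)
      have "sqrt (h * lo) = p * q" by (simp add: p_def q_def real_sqrt_mult)
      then show ?thesis unfolding p_def[symmetric] q_def[symmetric] 
        using pq(1,2) by (simp only: pq(3)) (simp add: field_simps)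
    qed
    finally show ?thesis .
  qed
  have sumE: "(\<Sum>h\<in>{1..<Q}. norm (\<Sum>m\<in>M. ee (real h * \<Psi> (real m))))
    \<le> 10 * real N * (hi / sqrt lo) * (Q * sqrt Q) + 10 / sqrt lo * (2 * sqrt Q)"
  proof -
    have "(\<Sum>h\<in>{1..<Q}. norm (\<Sum>m\<in>M. ee (real h * \<Psi> (real m))))
      \<le> (\<Sum>h\<in>{1..<Q}. 10 * real N * (hi / sqrt lo) * sqrt (real h) + 10 / sqrt lo * (1 / sqrt (real h)))"
      by (rule sum_mono[OF E])
    also have "\<dots> = 10 * real N * (hi / sqrt lo) * (\<Sum>h\<in>{1..<Q}. sqrt (real h)) + 10 / sqrt lo * (\<Sum>h\<in>{1..<Q}. 1 / sqrt (real h))"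
      by (simp only: sum.distrib sum_distrib_left)
    also have "\<dots> \<le> 10 * real N * (hi / sqrt lo) * (Q * sqrt Q) + 10 / sqrt lo * (2 * sqrt Q)"
    proof (intro add_mono mult_left_mono)
      have "(\<Sum>h\<in>{1..<Q}. 1 / sqrt (real h)) \<le> (\<Sum>h\<in>{1..Q}. 1 / sqrt (real h))" by (intro sum_mono2) auto
      then show "(\<Sum>h\<in>{1..<Q}. 1 / sqrt (real h)) \<le> 2 * sqrt Q" using sum_inverse_sqrt_le[of Q] by linarith
    qed (use lo sum_sqrt_le in auto)
    finally show ?thesis .
  qed
  have "card S = card (snd ` S)" using card_image[OF inj] by simp
  also have "real \<dots> \<le> 4 / real Q * (real (card M) + 2 * (\<Sum>h\<in>{1..<Q}. norm (\<Sum>m\<in>M. ee (real h * \<Psi> (real m)))))"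
  proof (rule fejer_count)
    fix m assume "m \<in> snd ` S"
    then obtain n where "(n, m) \<in> S" by auto
    then have "\<bar>\<Psi> (real m) - of_int (int n)\<bar> \<le> 1 / \<beta>" using S(2) by (auto simp: abs_minus_commute)
    also have "1 / \<beta> \<le> 1 / (6 * real Q)" using Q True by (intro divide_left_mono) auto
    finally show "\<exists>k. \<bar>\<Psi> (real m) - real_of_int k\<bar> \<le> 1 / (6 * real Q)" by blast
  qed (use S Q in \<open>force simp: M_def\<close>)+
  also have "\<dots> \<le> 4 / real Q * (2 * real N + 2 * (10 * real N * (hi / sqrt lo) * (Q * sqrt Q) + 10 / sqrt lo * (2 * sqrt Q)))"
    using sumE N Q by (intro mult_left_mono add_mono) (auto simp: M_def)
  also have "\<dots> = 8 * real N / Q + 80 * real N * (hi / sqrt lo) * sqrt Q + 160 / (sqrt lo * sqrt Q)"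
  proof -
    define p q where "p = sqrt (real Q)" and "q = sqrt lo"
    have pq: "p > 0" "q > 0" "real Q = p * p" using Q lo by (auto simp: p_def q_def)
    show ?thesis unfolding p_def[symmetric] q_def[symmetric]
      using pq(1,2) by (simp only: pq(3)) (simp add: field_simps)
  qed
  also have "\<dots> \<le> 100 * (N / \<beta>) + 100 * (N * (hi / sqrt lo) * sqrt \<beta>) + 100 * (8 / (sqrt lo * sqrt \<beta>))"
  proof (intro add_mono)
    have "8 * real N / Q \<le> 8 * real N / (\<beta> / 12)" using Q \<beta> by (intro divide_left_mono) auto
    also have "\<dots> \<le> 100 * (N / \<beta>)" using \<beta> by (simp add: field_simps)
    finally show "8 * real N / Q \<le> 100 * (N / \<beta>)" .
    have "sqrt Q \<le> sqrt \<beta>" using Q \<beta> by simp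
    then have "N * (hi / sqrt lo) * sqrt Q \<le> N * (hi / sqrt lo) * sqrt \<beta>" using lo by (intro mult_left_mono) auto
    moreover have "0 \<le> N * (hi / sqrt lo) * sqrt \<beta>" using lo \<beta> by auto
    ultimately show "80 * real N * (hi / sqrt lo) * sqrt Q \<le> 100 * (N * (hi / sqrt lo) * sqrt \<beta>)" by argo
    have "sqrt (\<beta> / 16) \<le> sqrt Q" using Q \<beta> by (intro real_sqrt_le_mono) auto
    then have "sqrt \<beta> / 4 \<le> sqrt Q" by (simp add: real_sqrt_divide)
    then have "160 / (sqrt lo * sqrt Q) \<le> 160 / (sqrt lo * (sqrt \<beta> / 4))"
      using lo \<beta> Q by (intro divide_left_mono mult_left_mono mult_pos_pos) auto
    also have "\<dots> \<le> 100 * (8 / (sqrt lo * sqrt \<beta>))" using lo \<beta> by (simp add: divide_right_mono)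
    finally show "160 / (sqrt lo * sqrt Q) \<le> 100 * (8 / (sqrt lo * sqrt \<beta>))" .
  qed
  finally show ?thesis by argo
qed

section \<open>Near solutions with fixed increments\<close>

lemma incr_diff_mvt:
  assumes g: "g > 0" and u: "u > 0" and y: "0 < y" "y < z"
  obtains \<xi> where "y < \<xi>" "\<xi> < z" "incr (g + 1) u z - incr (g + 1) u y = (z - y) * ((g + 1) * incr g u \<xi>)"
proof -
  have "\<exists>\<xi>. y < \<xi> \<and> \<xi> < z \<and> incr (g + 1) u z - incr (g + 1) u y = (z - y) * ((g + 1) * incr g u \<xi>)"
  proof (rule MVT2[OF y(2)])
    fix x assume "y \<le> x" "x \<le> z"
    then show "(incr (g + 1) u has_real_derivative (g + 1) * incr g u x) (at x)"
      using incr_deriv[of x u "g + 1"] y u by (simp add: incr_def[abs_def])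
  qed
  then show ?thesis using that by blast
qed

lemma incr_mvt':
  assumes "y > 0" "u > 0"
  obtains \<xi> where "y < \<xi>" "\<xi> < y + u" "incr (g + 1) u y = (g + 1) * u * \<xi> powr g"
  using incr_mvt[OF assms, of "g + 1"] that by auto

text \<open>Membership says that (n, m) and (n + u, m + v) have differences of (g + 1)-st powers
  closer than N^(g - 1). Sorting the four terms by variable makes u and v the parameters of a curve
  in the (n, m)-plane.\<close>

definition near_sol :: "real \<Rightarrow> real \<Rightarrow> nat \<Rightarrow> real \<Rightarrow> real \<Rightarrow> (nat \<times> nat) set" where
  "near_sol g P N u v = {(n, m). P \<le> real m \<and> real m + P \<le> real n \<and> real n + u \<le> real N \<and> real m + v \<le> real N
     \<and> \<bar>incr (g + 1) u n - incr (g + 1) v m\<bar> < real N powr (g - 1)}"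

lemma finite_near_sol:
  assumes "u \<ge> 0" "v \<ge> 0"
  shows "finite (near_sol g P N u v)"
proof (rule finite_subset)
  show "near_sol g P N u v \<subseteq> {..N} \<times> {..N}"
  proof clarify
    fix n m assume "(n, m) \<in> near_sol g P N u v"
    then have "real n + u \<le> real N" "real m + v \<le> real N" by (simp_all add: near_sol_def)
    then have "n \<le> N" "m \<le> N" using assms by linarith+
    then show "n \<in> {..N} \<and> m \<in> {..N}" by simp
  qed
qed simp

text \<open>The increments are (g + 1) u z^g with z at most N and (g + 1) v x^g with x at least N /
  \<Lambda>; the tolerance N^(g - 1) is absorbed into the factor 2.\<close>

lemma near_sol_v_le:
  assumes g: "g > 0" and \<Lambda>: "\<Lambda> \<ge> 1" and N: "N \<ge> 1" and u: "u \<ge> 1" "v \<ge> 1"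
    and nm: "(n, m) \<in> near_sol g (N / \<Lambda>) N u v"
  shows "v \<le> 2 * \<Lambda> powr g * u"
proof -
  have P: "N / \<Lambda> > 0" using \<Lambda> N by simp
  have h: "N / \<Lambda> \<le> m" "m + N / \<Lambda> \<le> n" "n + u \<le> N" "m + v \<le> N"
      "\<bar>incr (g + 1) u n - incr (g + 1) v m\<bar> < N powr (g - 1)"
    using nm unfolding near_sol_def by simp_all
  obtain x where x: "real m < x" "x < m + v" "incr (g + 1) v m = (g + 1) * v * x powr g"
    proof -
          have pp: "0 < real m" "0 < v" using h(1-4) P u by linarith+
          show thesis by (rule incr_mvt'[OF pp, where g = g], rule that; assumption)
        qed
  obtain z where z: "real n < z" "z < n + u" "incr (g + 1) u n = (g + 1) * u * z powr g"
    proof -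
          have pp: "0 < real n" "0 < u" using h(1-4) P u by linarith+
          show thesis by (rule incr_mvt'[OF pp, where g = g], rule that; assumption)
        qed
  have "(g + 1) * v * (N / \<Lambda>) powr g \<le> (g + 1) * v * x powr g"
    using x h(1-4) g u P by (intro mult_left_mono powr_mono2) auto
  also have "\<dots> \<le> (g + 1) * u * z powr g + N powr (g - 1)" using h(5) x(3) z(3) by linarith
  also have "\<dots> \<le> (g + 1) * u * N powr g + u * N powr g"
  proof (rule add_mono)
    show "(g + 1) * u * z powr g \<le> (g + 1) * u * N powr g" using z h(1-4) g u P by (intro mult_left_mono powr_mono2) auto
    have "1 * real N powr (g - 1) \<le> u * N powr g" using u N by (intro mult_mono powr_mono) auto
    then show "N powr (g - 1) \<le> u * N powr g" by simp
  qed
  also have "\<dots> = (g + 2) * u * N powr g" by (simp add: algebra_simps)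
  also have "\<dots> \<le> (2 * (g + 1)) * u * N powr g" using g u by (intro mult_right_mono) auto
  finally have "(g + 1) * v * (N / \<Lambda>) powr g \<le> (2 * (g + 1)) * u * N powr g" .
  moreover have "(g + 1) * v * (N / \<Lambda>) powr g = (g + 1) * N powr g * (v / \<Lambda> powr g)"
    using \<Lambda> by (simp add: powr_divide)
  moreover have "(2 * (g + 1)) * u * N powr g = (g + 1) * N powr g * (2 * u)" by (simp only: mult_ac)
  ultimately have "(g + 1) * N powr g * (v / \<Lambda> powr g) \<le> (g + 1) * N powr g * (2 * u)" by (simp only:)
  then have "v / \<Lambda> powr g \<le> 2 * u" using g N by (subst (asm) mult_le_cancel_left_pos) auto
  then show ?thesis using \<Lambda> by (simp add: field_simps)
qed

text \<open>Since n - m is at least N / \<Lambda>, the same increment u yields a larger power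
  difference at n than at m, by an amount of order u N^g up to powers of \<Lambda>; v must exceed u
  in proportion to make up for it. This supplies the hypothesis \<open>low\<close> of
  \<open>incr_curve\<close>.\<close>

lemma near_sol_v_ge:
  assumes g: "g > 0" and \<Lambda>: "\<Lambda> \<ge> 1" and N: "N \<ge> 1" and u: "u \<ge> 1" "v \<ge> 1"
    and big: "2 * \<Lambda> powr (\<bar>g - 1\<bar> + 1) \<le> (g + 1) * g * N"
    and nm: "(n, m) \<in> near_sol g (N / \<Lambda>) N u v"
  shows "g * \<Lambda> powr (- (\<bar>g - 1\<bar> + 1)) / 2 * u \<le> v - u"
proof -
  define e where "e = \<bar>g - 1\<bar>"
  have P: "N / \<Lambda> > 0" using \<Lambda> N by simp
  have N0: "real N > 0" using N by simp
  have h: "N / \<Lambda> \<le> m" "m + N / \<Lambda> \<le> n" "n + u \<le> N" "m + v \<le> N"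
      "\<bar>incr (g + 1) u n - incr (g + 1) v m\<bar> < N powr (g - 1)"
    using nm unfolding near_sol_def by simp_all
  have N1: "real N \<le> N * \<Lambda>" using \<Lambda> N by simp
  obtain x where x: "real m < x" "x < n" "incr (g + 1) u n - incr (g + 1) u m = (real n - real m) * ((g + 1) * incr g u x)"
    using incr_diff_mvt[OF g, of u m n] h(1-4) P u by (metis (no_types, opaque_lifting) add_strict_increasing less_add_same_cancel1 order_less_le_trans zero_less_one)
  have "g * u * (N powr (g - 1) * \<Lambda> powr (- e)) \<le> incr g u x"
  proof -
    have xb: "N / \<Lambda> \<le> x" "x + u \<le> N * \<Lambda>" using h(1-4) x(1,2) N1 by linarith+
    show ?thesis unfolding e_def by (rule incr_bounds(1)[OF N0 \<Lambda> xb]) (use u g in auto)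
  qed
  then have "(N / \<Lambda>) * ((g + 1) * (g * u * (N powr (g - 1) * \<Lambda> powr (- e)))) \<le> (real n - real m) * ((g + 1) * incr g u x)"
    using h(1-4) P g u by (intro mult_mono) (auto intro!: mult_nonneg_nonneg)
  also have "\<dots> = incr (g + 1) u n - incr (g + 1) u m" using x by simp
  finally have "(N / \<Lambda>) * ((g + 1) * (g * u * (N powr (g - 1) * \<Lambda> powr (- e)))) \<le> incr (g + 1) u n - incr (g + 1) u m" .
  moreover have "\<Lambda> powr (- (e + 1)) = \<Lambda> powr (- e) / \<Lambda>" using \<Lambda> powr_diff[of \<Lambda> "- e" 1] by simp
  moreover have "real N powr g = N powr (g - 1) * N" using N0 powr_add[of N "g - 1" 1] by simp
  ultimately have 1: "(g + 1) * g * u * (N powr g * \<Lambda> powr (- (e + 1))) \<le> incr (g + 1) u n - incr (g + 1) u m"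
    by (simp add: mult_ac)
  \<comment> \<open>By \<open>big\<close> the tolerance is at most half of the lower bound just
    found.\<close>
  have 2: "N powr (g - 1) \<le> (g + 1) * g * u * (N powr g * \<Lambda> powr (- (e + 1))) / 2"
  proof -
    have Lp: "\<Lambda> powr (e + 1) > 0" using \<Lambda> by simp
    have "2 * \<Lambda> powr (e + 1) * 1 \<le> (g + 1) * g * N * u"
      unfolding e_def by (rule mult_mono[OF big u(1)]) (use g in auto)
    moreover have "1 \<le> W * (1 / R) / 2" if "2 * R * 1 \<le> W" "R > 0" for W R :: real
      using that by (simp add: field_simps)
    ultimately have "1 \<le> (g + 1) * g * N * u * \<Lambda> powr (- (e + 1)) / 2"
      unfolding powr_minus_divide using Lp by blast
    then have "N powr (g - 1) * 1 \<le> N powr (g - 1) * ((g + 1) * g * N * u * \<Lambda> powr (- (e + 1)) / 2)"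
      by (intro mult_left_mono) auto
    moreover have "N powr g = N powr (g - 1) * N" using N0 powr_add[of N "g - 1" 1] by simp
    ultimately show ?thesis by (simp add: mult_ac)
  qed
  have 3: "(g + 1) * g * u * (N powr g * \<Lambda> powr (- (e + 1))) / 2 < incr (g + 1) v m - incr (g + 1) u m"
    using 1 2 h(5) by linarith
  have "0 < (g + 1) * g * u * (N powr g * \<Lambda> powr (- (e + 1))) / 2" using g u N0 \<Lambda> by simp
  with 3 have 4: "incr (g + 1) u m < incr (g + 1) v m" by linarith
  have uv: "u < v"
  proof (rule ccontr)
    assume "\<not> u < v"
    then have "incr (g + 1) v m \<le> incr (g + 1) u m" using g u h(1-4) P by (intro incr_mono_u) auto
    then show False using 4 by simp
  qed
  obtain z :: real where z: "m + u < z" "z < m + u + (v - u)" "incr (g + 1) (v - u) (m + u) = (g + 1) * (v - u) * z powr g"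
    proof -
          have pp: "0 < real m + u" "0 < v - u" using u uv by linarith+
          show thesis by (rule incr_mvt'[OF pp, where g = g], rule that; assumption)
        qed
  have "incr (g + 1) v m - incr (g + 1) u m = incr (g + 1) (v - u) (m + u)" by (simp add: incr_def)
  also have "\<dots> \<le> (g + 1) * (v - u) * N powr g" unfolding z(3)
    using z h(1-4) u g uv by (intro mult_left_mono powr_mono2) auto
  finally have "(g + 1) * N powr g * (g * \<Lambda> powr (- (e + 1)) / 2 * u) \<le> (g + 1) * N powr g * (v - u)"
    using 3 by (simp add: mult_ac)
  then show ?thesis unfolding e_def using g N by (subst (asm) mult_le_cancel_left_pos) auto
qed

text \<open>The curve has curvature of order u^2 / N^3 and the points lie within about 1 / u of it.
  With these values \<open>near_integer_pairs\<close> gives the three terms in order: the expected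
  number of points, the contribution of the slope range to the exponential sums, and that of the end
  classes. The powers of \<Lambda> stay unspecified, as \<Lambda> will be a small power of
  N.\<close>

lemma near_sol_card_le:
  fixes g :: real
  assumes g: "g > 0" "g \<noteq> 1"
  obtains C c :: real where "C \<ge> 1" "c \<ge> 0"
    "\<And>N \<Lambda> u v. N \<ge> 1 \<Longrightarrow> \<Lambda> \<ge> 1 \<Longrightarrow> u \<ge> 1 \<Longrightarrow> v \<ge> 1 \<Longrightarrow> C * \<Lambda> powr c * u \<le> real N \<Longrightarrow>
       real (card (near_sol g (N / \<Lambda>) N u v))
        \<le> C * \<Lambda> powr c * (N / u + u * sqrt u / sqrt N + N * sqrt N / (u * sqrt u))"
proof -
  define e where "e = \<bar>g - 1\<bar>"
  define k where "k = 2 * e + g + 2"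
  \<comment> \<open>The first summand serves \<open>low\<close>, the second \<open>upp\<close>, and
    the 3 ensures \<open>L\<close> \<ge> 3.\<close>
  define K where "K = 2 * 4 powr e + 6 * 2 powr (1 / g) + 3"
  have e0: "e \<ge> 0" by (simp add: e_def)
  have k0: "k \<ge> 1" "k > 0" using g e0 by (auto simp: k_def)
  have K3: "K \<ge> 3" by (simp add: K_def)
  define c1 where "c1 = 3 * e + g + 6"
  have c10: "c1 > 0" using g e0 by (simp add: c1_def)
  define a1 a2 where "a1 = \<bar>g\<^sup>2 - 1\<bar> / (6144 * (g + 1))" and "a2 = 16 * \<bar>g\<^sup>2 - 1\<bar> / (g + 1)"
  have g1: "g\<^sup>2 - 1 \<noteq> 0" using g by (simp add: power2_eq_1_iff)
  have a: "a1 > 0" "a2 > 0" "a1 \<le> a2" using g g1 by (auto simp: a1_def a2_def intro!: frac_le)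
  define b where "b = (g + 1) * g"
  have b: "b > 0" using g by (simp add: b_def)
  define c2 where "c2 = 2 * c1 + e"
  define A where "A = 100 * (1 / b + a2 / sqrt a1 * sqrt b + 8 / (sqrt a1 * sqrt b))"
  have A0: "A \<ge> 0" using a b by (simp add: A_def)
  \<comment> \<open>After the 1, the summands cover in order the smallness of \<open>L\<close>
    squared times u, the hypothesis \<open>big\<close> of \<open>near_sol_v_ge\<close>, and the
    final constant.\<close>
  define C where "C = 1 + K\<^sup>2 * (2 + g) + 2 * (1 + 1 / b) + A * K powr c2"
  define c where "c = 2 * k + e + 1 + g + k * c2"
  have c20: "c2 \<ge> 0" using c10 e0 by (simp add: c2_def)
  have Cc: "C \<ge> 1" "c \<ge> 0" using A0 g b K3 k0 e0 c20 by (auto simp: C_def c_def intro!: add_nonneg_nonneg mult_nonneg_nonneg)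
  have main: "real (card (near_sol g (N / \<Lambda>) N u v))
        \<le> C * \<Lambda> powr c * (N / u + u * sqrt u / sqrt N + N * sqrt N / (u * sqrt u))"
    if N: "N \<ge> 1" and \<Lambda>: "\<Lambda> \<ge> 1" and u: "u \<ge> 1" "v \<ge> 1" and big: "C * \<Lambda> powr c * u \<le> real N" for N :: nat and \<Lambda> u v :: real
  proof (cases "near_sol g (N / \<Lambda>) N u v = {}")
    case True
    then show ?thesis using Cc u by simp
  next
    case False
    define S where "S = near_sol g (N / \<Lambda>) N u v"
    obtain n0 m0 where nm0: "(n0, m0) \<in> near_sol g (N / \<Lambda>) N u v" using False by auto
    have N0: "real N > 0" using N by simp
    have P: "N / \<Lambda> > 0" using \<Lambda> N by simp
    have Lmono: "\<Lambda> powr x \<le> \<Lambda> powr y" if "x \<le> y" for x y using \<Lambda> that by (intro powr_mono) auto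
    have L1: "\<Lambda> powr x \<ge> 1" if "x \<ge> 0" for x using \<Lambda> that by (rule ge_one_powr_ge_zero)
    have big': "B * \<Lambda> powr x * u \<le> N" if "B \<le> C" "x \<le> c" "B \<ge> 0" for B x
    proof -
      have "B * \<Lambda> powr x * u \<le> C * \<Lambda> powr c * u" using that u Lmono Cc by (intro mult_right_mono mult_mono) auto
      then show ?thesis using big by linarith
    qed
    have Cge: "2 * (1 + 1 / b) \<le> C" "K\<^sup>2 * (2 + g) \<le> C" "2 \<le> C"
      using A0 b K3 g by (auto simp: C_def intro!: add_nonneg_nonneg mult_nonneg_nonneg)
    have v1: "v \<le> 2 * \<Lambda> powr g * u" using near_sol_v_le[OF g(1) \<Lambda> N u nm0] .
    have v2: "g * \<Lambda> powr (- (e + 1)) / 2 * u \<le> v - u"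
      unfolding e_def
    proof (rule near_sol_v_ge[OF g(1) \<Lambda> N u _ nm0])
      have "2 * (1 + 1 / b) * \<Lambda> powr (e + 1) * u \<le> N" using Cge b k0 g c20 by (intro big') (auto simp: c_def)
      moreover have "2 * (1 + 1 / b) * \<Lambda> powr (e + 1) * 1 \<le> 2 * (1 + 1 / b) * \<Lambda> powr (e + 1) * u"
        using u b by (intro mult_left_mono) auto
      moreover have "2 / b * \<Lambda> powr (e + 1) \<le> 2 * (1 + 1 / b) * \<Lambda> powr (e + 1)" using b by (intro mult_right_mono) auto
      ultimately have "2 / b * \<Lambda> powr (e + 1) \<le> N" by linarith
      then show "2 * \<Lambda> powr (\<bar>g - 1\<bar> + 1) \<le> (g + 1) * g * N"
        unfolding b_def[symmetric] e_def[symmetric] using b by (simp add: field_simps)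
    qed
    have uv: "u \<le> v" using v2 g u \<Lambda> by (smt (verit) divide_nonneg_pos mult_nonneg_nonneg powr_ge_zero)
    \<comment> \<open>The exponent k = 2 e + g + 2 is dictated by \<open>low\<close>: the losses
      there are \<Lambda>^e, \<Lambda>^(e + 1) and \<Lambda>^g, with one factor \<Lambda> to
      spare.\<close>
    define L where "L = K * \<Lambda> powr k"
    have LK: "L \<ge> K" using L1[of k] k0 K3 by (simp add: L_def)
    have L3: "L \<ge> 3" using LK K3 by simp
    have L\<Lambda>: "L \<ge> 4 * \<Lambda> powr g" 
    proof -
      have "4 * \<Lambda> powr g \<le> K * \<Lambda> powr k"
      proof (intro mult_mono Lmono)
        have "(2::real) powr (1 / g) \<ge> 1" using g by (intro ge_one_powr_ge_zero) auto
        then show "4 \<le> K" by (simp add: K_def) (smt (verit) powr_ge_zero)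
      qed (use K3 e0 in \<open>auto simp: k_def\<close>)
      then show ?thesis by (simp add: L_def)
    qed
    have LL: "L \<ge> \<Lambda>" using mult_mono[of 1 K "\<Lambda> powr 1" "\<Lambda> powr k"] Lmono[of 1 k] k0 K3 \<Lambda> by (simp add: L_def)
    have L2u: "L\<^sup>2 * u * (2 + g) \<le> N"
    proof -
      have "K\<^sup>2 * (2 + g) * \<Lambda> powr (2 * k) * u \<le> N" using Cge K3 g e0 k0 c20 by (intro big') (auto simp: c_def)
      moreover have "L\<^sup>2 = K\<^sup>2 * \<Lambda> powr (2 * k)" using \<Lambda> by (simp add: L_def power_mult_distrib powr_powr[symmetric] powr_numeral mult.commute[of 2])
      ultimately show ?thesis by (simp add: mult_ac)
    qed
    have L2pos: "L\<^sup>2 * u \<ge> 0" using u by simp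
    have L2N: "L\<^sup>2 * u \<le> 2 * real N" "g * (L\<^sup>2 * u) \<le> 2 * real N"
    proof -
      have "L\<^sup>2 * u * (2 + g) = 2 * (L\<^sup>2 * u) + g * (L\<^sup>2 * u)" by (simp add: algebra_simps)
      moreover have "g * (L\<^sup>2 * u) \<ge> 0" using g L2pos by simp
      ultimately show "L\<^sup>2 * u \<le> 2 * real N" "g * (L\<^sup>2 * u) \<le> 2 * real N" using L2u L2pos N0 by linarith+
    qed
    have uN: "9 * u \<le> 2 * real N"
    proof -
      have "9 * u \<le> L\<^sup>2 * u" using power_mono[of 3 L 2] L3 u by (intro mult_right_mono) auto
      then show ?thesis using L2N by linarith
    qed
    have vL: "v \<le> L * u"
    proof -
      have "2 * \<Lambda> powr g * u \<le> 4 * \<Lambda> powr g * u" using u by (intro mult_right_mono) auto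
      also have "\<dots> \<le> L * u" using u by (intro mult_right_mono L\<Lambda>) auto
      finally show ?thesis using v1 by linarith
    qed
    have vN: "v \<le> N"
    proof -
      have "L * u \<le> L\<^sup>2 * u / 3" using L3 u mult_right_mono[of 3 L "L * u"] by (simp add: power2_eq_square mult.assoc)
      then show ?thesis using vL L2N N0 by linarith
    qed
    define A0' where "A0' = nat \<lceil>N / \<Lambda>\<rceil>"
    have A0': "N / \<Lambda> \<le> real A0'" unfolding A0'_def using real_nat_ceiling_ge by blast
    have NLle: "N / L \<le> N / \<Lambda>" using LL \<Lambda> by (intro divide_left_mono) auto
    have NL3: "3 * real N \<le> N * L" using L3 N0 by simp
    have N1: "1 \<le> real N" using N by simp
    have dom: "N / \<Lambda> \<le> y" "N / L \<le> y" "y + v \<le> 3 * real N" "y > 0" "y \<le> 2 * real N" if "y \<in> {real A0'..real (Suc N)}" for y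
      using that A0' NLle vN P N1 by auto
    have "\<Lambda> > 0" using \<Lambda> by simp
    \<comment> \<open>Moving y by N / L costs at most a multiple of u N^g / L, while passing from u
      to v gains a multiple of u N^g, up to powers of \<Lambda>; the choice of \<open>L\<close>
      makes the cost the smaller.\<close>
    have low: "incr (g + 1) u (y + N / L) \<le> incr (g + 1) v y" if y: "y \<in> {real A0'..real (Suc N)}" for y
    proof -
      have h0: "N / L > 0" using N0 L3 by simp
      have "N / L \<le> N / 3" by (rule divide_left_mono) (use N0 L3 in auto)
      note h0 = h0 this
      obtain x where x: "y < x" "x < y + N / L" "incr (g + 1) u (y + N / L) - incr (g + 1) u y = (y + N / L - y) * ((g + 1) * incr g u x)"
        using incr_diff_mvt[OF g(1), of u y "y + N / L"] u dom[OF y] h0 by auto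
      have "incr g u x \<le> g * u * (N powr (g - 1) * (4 * \<Lambda>) powr e)"
        unfolding e_def
      proof (rule incr_bounds(2))
        have "real N / (4 * \<Lambda>) \<le> N / \<Lambda>" using \<Lambda> N0 by (intro divide_left_mono) auto
        then show "N / (4 * \<Lambda>) \<le> x" using dom[OF y] x by linarith
        have "x + u \<le> 4 * real N" using x dom[OF y] h0 uN by linarith
        also have "\<dots> \<le> N * (4 * \<Lambda>)" using \<Lambda> N0 by simp
        finally show "x + u \<le> N * (4 * \<Lambda>)" .
      qed (use N0 \<Lambda> u g in auto)
      then have "incr (g + 1) u (y + N / L) - incr (g + 1) u y \<le> N / L * ((g + 1) * (g * u * (N powr (g - 1) * (4 * \<Lambda>) powr e)))"
        unfolding x(3) add_diff_cancel_left' using h0 g by (intro mult_left_mono) auto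
      also have "\<dots> = (g + 1) * u * N powr g * (g * (4 * \<Lambda>) powr e / L)"
        using N0 powr_add[of N "g - 1" 1] by (simp add: mult_ac)
      also have "\<dots> \<le> (g + 1) * u * N powr g * (g * \<Lambda> powr (- (e + 1)) / 2 * \<Lambda> powr (- g))"
      proof (intro mult_left_mono)
        have "2 * 4 powr e * \<Lambda> powr k \<le> L" unfolding L_def by (intro mult_right_mono) (auto simp: K_def)
        moreover have "\<Lambda> powr k = \<Lambda> powr e * (\<Lambda> powr (e + 1) * \<Lambda> powr g) * \<Lambda>"
          using \<open>\<Lambda> > 0\<close> by (simp add: k_def powr_add[symmetric] powr_mult_base algebra_simps)
        moreover have "2 * 4 powr e * (\<Lambda> powr e * (\<Lambda> powr (e + 1) * \<Lambda> powr g)) * 1 \<le> 2 * 4 powr e * (\<Lambda> powr e * (\<Lambda> powr (e + 1) * \<Lambda> powr g)) * \<Lambda>"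
          using \<Lambda> by (intro mult_left_mono) auto
        ultimately have le: "2 * 4 powr e * (\<Lambda> powr e * (\<Lambda> powr (e + 1) * \<Lambda> powr g)) * 1 \<le> L"
          by (simp only: mult.assoc order_trans)
        have "2 * (4 * \<Lambda>) powr e * (\<Lambda> powr (e + 1) * \<Lambda> powr g) = 2 * 4 powr e * (\<Lambda> powr e * (\<Lambda> powr (e + 1) * \<Lambda> powr g)) * 1"
          using \<Lambda> by (simp add: powr_mult)
        with le have "2 * (4 * \<Lambda>) powr e * (\<Lambda> powr (e + 1) * \<Lambda> powr g) \<le> L" by (simp only:)
        then have "(4 * \<Lambda>) powr e / L \<le> 1 / (2 * (\<Lambda> powr (e + 1) * \<Lambda> powr g))"
          using L3 \<open>\<Lambda> > 0\<close> by (simp add: field_simps)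
        then have "g * ((4 * \<Lambda>) powr e / L) \<le> g * (1 / (2 * (\<Lambda> powr (e + 1) * \<Lambda> powr g)))"
          using g by (intro mult_left_mono) auto
        then show "g * (4 * \<Lambda>) powr e / L \<le> g * \<Lambda> powr (- (e + 1)) / 2 * \<Lambda> powr (- g)"
          unfolding powr_minus_divide by simp
      qed (use g u in auto)
      also have "\<dots> = (g + 1) * (g * \<Lambda> powr (- (e + 1)) / 2 * u) * (N / \<Lambda>) powr g"
        using \<open>\<Lambda> > 0\<close> N0 by (simp add: powr_divide powr_minus_divide)
      also have "\<dots> \<le> (g + 1) * (v - u) * (N / \<Lambda>) powr g"
        using v2 g by (intro mult_right_mono mult_left_mono) auto
      also have "\<dots> \<le> incr (g + 1) v y - incr (g + 1) u y"
      proof (cases "u = v")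
        case False
        obtain z where z: "y + u < z" "z < y + u + (v - u)" "incr (g + 1) (v - u) (y + u) = (g + 1) * (v - u) * z powr g"
          proof -
          have pp: "0 < (y + u)" "0 < v - u" using u uv False dom[OF y] by linarith+
          show thesis by (rule incr_mvt'[OF pp, where g = g], rule that; assumption)
        qed
        have "(g + 1) * (v - u) * (N / \<Lambda>) powr g \<le> (g + 1) * (v - u) * z powr g"
          using z u uv g dom[OF y] P by (intro mult_left_mono powr_mono2) auto
        then show ?thesis using z(3) by (simp add: incr_def)
      qed auto
      finally show ?thesis by simp
    qed
    \<comment> \<open>The left side is at most a multiple of v (3 N)^g and the right side at least
      the same multiple of u (N L / 2)^g; \<open>L\<close> absorbs v / u \<le> 2
      \<Lambda>^g.\<close>
    have upp: "incr (g + 1) v y \<le> incr (g + 1) u (N * L - u)" if y: "y \<in> {real A0'..real (Suc N)}" for y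
    proof -
      obtain x where x: "y < x" "x < y + v" "incr (g + 1) v y = (g + 1) * v * x powr g"
        proof -
          have pp: "0 < y" "0 < v" using u dom[OF y] by linarith+
          show thesis by (rule incr_mvt'[OF pp, where g = g], rule that; assumption)
        qed
      have uNL: "u \<le> N * L / 2" using uN NL3 by linarith
      have NLu: "N * L - u > 0" using uNL NL3 N0 by linarith
      obtain z :: real where z: "N * L - u < z" "z < N * L - u + u" "incr (g + 1) u (N * L - u) = (g + 1) * u * z powr g"
        proof -
          have pp: "0 < (N * L - u)" "0 < u" using u NLu by linarith+
          show thesis by (rule incr_mvt'[OF pp, where g = g], rule that; assumption)
        qed
      have "incr (g + 1) v y \<le> (g + 1) * v * (3 * real N) powr g"
        unfolding x(3) using x dom[OF y] g u by (intro mult_left_mono powr_mono2) auto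
      also have "\<dots> \<le> (g + 1) * (2 * \<Lambda> powr g * u) * (3 * real N) powr g"
        using v1 g by (intro mult_right_mono mult_left_mono) auto
      also have "\<dots> = (g + 1) * u * ((2 powr (1 / g) * 3 * \<Lambda> * N) powr g)"
        using g \<open>\<Lambda> > 0\<close> N0 by (simp add: powr_mult powr_powr mult_ac)
      also have "\<dots> \<le> (g + 1) * u * ((N * L / 2) powr g)"
      proof (intro mult_left_mono powr_mono2)
        have "6 * 2 powr (1 / g) * \<Lambda> powr 1 \<le> K * \<Lambda> powr k"
          using Lmono[of 1 k] k0 K3 by (intro mult_mono) (auto simp: K_def)
        then have "N * (6 * 2 powr (1 / g) * \<Lambda>) \<le> N * L" using \<open>\<Lambda> > 0\<close> unfolding L_def by (intro mult_left_mono) auto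
        then show "2 powr (1 / g) * 3 * \<Lambda> * N \<le> N * L / 2" by (simp add: mult_ac)
      qed (use g u \<Lambda> N0 in auto)
      also have "\<dots> \<le> (g + 1) * u * z powr g"
        using z uNL g u N0 L3 by (intro mult_left_mono powr_mono2) auto
      finally show ?thesis unfolding z(3) .
    qed
    have uNL': "u < N * L / 2" using uN NL3 N0 by linarith
    have dom': "N / L \<le> y \<and> y + v \<le> N * L" if "y \<in> {real A0'..real (Suc N)}" for y
      using dom[OF that] NL3 by linarith
    obtain \<Psi> \<Psi>' \<Psi>'' where \<Psi>:
      "\<And>y. y \<in> {real A0'..real (Suc N)} \<Longrightarrow> N / L \<le> \<Psi> y \<and> \<Psi> y + u \<le> N * L \<and> incr (g + 1) u (\<Psi> y) = incr (g + 1) v y"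
      "\<And>y. y \<in> {real A0'..real (Suc N)} \<Longrightarrow> (\<Psi> has_real_derivative \<Psi>' y) (at y)"
      "\<And>y. y \<in> {real A0'..real (Suc N)} \<Longrightarrow> (\<Psi>' has_real_derivative \<Psi>'' y) (at y)"
      "\<And>y. y \<in> {real A0'..real (Suc N)} \<Longrightarrow> u\<^sup>2 / (6144 * (g + 1) * real N ^ 3 * L powr c1) \<le> \<Psi>'' y / (g\<^sup>2 - 1) \<and>
        \<Psi>'' y / (g\<^sup>2 - 1) \<le> 16 * u\<^sup>2 * L powr c1 / ((g + 1) * real N ^ 3)"
    proof -
      have "2 \<le> L" "0 < u" using L3 u by auto
      from incr_curve[OF g N0 this uv vL dom' low upp uNL' L2N, folded e_def, folded c1_def]
      show ?thesis using that by blast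
    qed
    \<comment> \<open>The curve is convex or concave according to the sign of g^2 - 1.\<close>
    define s where "s = (if g\<^sup>2 - 1 > 0 then 1 else - 1 :: real)"
    have s: "s = 1 \<or> s = -1" "\<bar>g\<^sup>2 - 1\<bar> = s * (g\<^sup>2 - 1)" using g1 by (auto simp: s_def)
    define lo hi where "lo = a1 * u\<^sup>2 / (real N ^ 3 * L powr c1)" and "hi = a2 * u\<^sup>2 * L powr c1 / real N ^ 3"
    have Lp: "L powr x > 0" for x using L3 by simp
    have L1': "L powr x \<le> L powr y" if "x \<le> y" for x y using L3 that by (intro powr_mono) auto
    have lo0: "lo > 0" using a u N0 Lp by (simp add: lo_def)
    have bd: "lo \<le> s * \<Psi>'' y \<and> s * \<Psi>'' y \<le> hi" if y: "y \<in> {real A0'..real (Suc N)}" for y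
    proof -
      have e1: "s * \<Psi>'' y = \<bar>g\<^sup>2 - 1\<bar> * (\<Psi>'' y / (g\<^sup>2 - 1))" unfolding s(2) using g1 by simp
      have "\<bar>g\<^sup>2 - 1\<bar> * (u\<^sup>2 / (6144 * (g + 1) * real N ^ 3 * L powr c1)) = lo"
        by (simp add: lo_def a1_def)
      moreover have "\<bar>g\<^sup>2 - 1\<bar> * (16 * u\<^sup>2 * L powr c1 / ((g + 1) * real N ^ 3)) = hi"
        by (simp add: hi_def a2_def)
      ultimately show ?thesis unfolding e1 using \<Psi>(4)[OF y] by (metis abs_ge_zero mult_left_mono)
    qed
    have lohi: "lo \<le> hi" using bd[of "real (Suc N)"] vN u N1 A0' unfolding A0'_def
    proof -
      have "real A0' \<le> real (Suc N)"
      proof -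
        have "N / \<Lambda> \<le> N" using \<Lambda> N0 by (simp add: field_simps)
        then have "A0' \<le> N" unfolding A0'_def by (simp add: nat_le_iff ceiling_le_iff)
        then show ?thesis by simp
      qed
      then show ?thesis using bd[of "real (Suc N)"] by auto
    qed
    \<comment> \<open>A lower bound for the slope of \<open>incr (g + 1) u\<close> in units of N^(g
      - 1): a tolerance N^(g - 1) in the value moves the argument by at most 1 / \<beta>.\<close>
    define \<beta> where "\<beta> = b * u * L powr (- e)"
    have \<beta>: "\<beta> > 0" using b u Lp by (simp add: \<beta>_def)
    have Sm: "A0' \<le> m \<and> m \<le> N \<and> \<bar>real n - \<Psi> (real m)\<bar> \<le> 1 / \<beta>" if nm: "(n, m) \<in> S" for n m
    proof -
      have h: "N / \<Lambda> \<le> m" "m + N / \<Lambda> \<le> n" "n + u \<le> N" "m + v \<le> N"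
          "\<bar>incr (g + 1) u n - incr (g + 1) v m\<bar> < N powr (g - 1)"
        using nm unfolding S_def near_sol_def by simp_all
      have m: "A0' \<le> m" "m \<le> N" using h(1-4) u unfolding A0'_def by (auto simp: nat_le_iff ceiling_le_iff)
      then have m': "real m \<in> {real A0'..real (Suc N)}" by auto
      define p where "p = \<Psi> (real m)"
      have p: "N / L \<le> p" "p + u \<le> N * L" "incr (g + 1) u p = incr (g + 1) v m" using \<Psi>(1)[OF m'] by (auto simp: p_def)
      have n: "N / L \<le> n" "n + u \<le> N * L" using h(1-4) NLle NL3 N0 by linarith+
      have NL0: "N / L > 0" using N0 L3 by simp
      have mv: "\<bar>z - y\<bar> * (N powr (g - 1) * \<beta>) \<le> \<bar>incr (g + 1) u z - incr (g + 1) u y\<bar>"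
        if "y < z" "N / L \<le> y" "z + u \<le> N * L" for y z
      proof -
        note yz = that
        have y0: "y > 0" using yz NL0 by linarith
        obtain x where x: "y < x" "x < z" "incr (g + 1) u z - incr (g + 1) u y = (z - y) * ((g + 1) * incr g u x)"
          using incr_diff_mvt[OF g(1), of u y z] u y0 yz(1) by auto
        have "g * u * (N powr (g - 1) * L powr (- e)) \<le> incr g u x"
          unfolding e_def using g N0 u x that L3 by (intro incr_bounds(1)) auto
        then have "(z - y) * ((g + 1) * (g * u * (N powr (g - 1) * L powr (- e)))) \<le> (z - y) * ((g + 1) * incr g u x)"
          using that g by (intro mult_left_mono) auto
        then show ?thesis unfolding x(3)[symmetric] using that by (simp add: \<beta>_def b_def mult_ac abs_if)
      qed
      have "\<bar>real n - p\<bar> * (N powr (g - 1) * \<beta>) \<le> N powr (g - 1)"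
      proof (cases "real n" p rule: linorder_cases)
        case less
        from mv[OF less n(1) p(2)] show ?thesis using h(5) p(3) by (simp add: abs_minus_commute)
      next
        case greater
        from mv[OF greater p(1) n(2)] show ?thesis using h(5) p(3) by simp
      qed auto
      then have "N powr (g - 1) * (\<bar>real n - p\<bar> * \<beta>) \<le> N powr (g - 1) * 1" by (simp add: mult_ac)
      then have "\<bar>real n - p\<bar> * \<beta> \<le> 1" using N0 by (subst (asm) mult_le_cancel_left_pos) auto
      then show ?thesis using m \<beta> by (simp add: p_def field_simps)
    qed
    have "real (card S) \<le> 100 * (N / \<beta> + N * (hi / sqrt lo) * sqrt \<beta> + 8 / (sqrt lo * sqrt \<beta>))"
      by (rule near_integer_pairs[OF lo0 lohi s(1) \<Psi>(2,3) bd _ Sm \<beta> N]) (use finite_near_sol u in \<open>auto simp: S_def\<close>)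
    also have "\<dots> \<le> A * L powr c2 * (N / u + u * sqrt u / sqrt N + N * sqrt N / (u * sqrt u))"
    proof -
      \<comment> \<open>Taking the square roots of u, N and the powers of \<open>L\<close> as
        variables makes the three estimates rational.\<close>
      define p q r where "p = sqrt u" and "q = sqrt N" and "r = L powr (c1 / 2)"
      have pq: "p > 0" "q > 0" "r > 0" "u = p * p" "real N = q * q" "L powr c1 = r * r"
        using u N0 Lp by (auto simp: p_def q_def r_def simp flip: powr_add)
      define t where "t = L powr (e / 2)"
      have t: "t > 0" "L powr e = t * t" using Lp by (auto simp: t_def simp flip: powr_add)
      define \<alpha> \<sigma> where "\<alpha> = sqrt a1" and "\<sigma> = sqrt b"
      have as: "\<alpha> > 0" "\<sigma> > 0" "b = \<sigma> * \<sigma>" "a1 = \<alpha> * \<alpha>" using a b by (auto simp: \<alpha>_def \<sigma>_def)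
      have lo': "sqrt lo = \<alpha> * (p * p) / (q ^ 3 * r)"
        unfolding lo_def pq(5,6) using pq(1-3) u
        by (simp add: real_sqrt_divide real_sqrt_mult real_sqrt_power \<alpha>_def flip: pq(4))
      have be: "\<beta> = \<sigma> * \<sigma> * (p * p) / (t * t)" unfolding \<beta>_def powr_minus_divide t(2) as(3) pq(4) by simp
      have sb: "sqrt \<beta> = \<sigma> * p / t" unfolding be using as pq t by (simp add: real_sqrt_divide real_sqrt_mult)
      have hi': "hi = a2 * (p * p)\<^sup>2 * (r * r) / (q * q) ^ 3" unfolding hi_def pq(4-6) ..
      have L2: "t * t \<le> L powr c2" "r ^ 3 / t \<le> L powr c2" "r * t \<le> L powr c2"
      proof -
        show "t * t \<le> L powr c2" unfolding t(2)[symmetric] using c10 by (intro L1') (simp add: c2_def)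
        have "r ^ 3 / t = L powr (c1 / 2 + c1 / 2 + c1 / 2 - e / 2)"
          unfolding r_def t_def power3_eq_cube by (simp only: powr_add powr_diff)
        also have "\<dots> \<le> L powr c2" using c10 e0 by (intro L1') (simp add: c2_def)
        finally show "r ^ 3 / t \<le> L powr c2" .
        have "r * t = L powr (c1 / 2 + e / 2)" by (simp add: r_def t_def powr_add)
        also have "\<dots> \<le> L powr c2" using c10 e0 by (intro L1') (simp add: c2_def)
        finally show "r * t \<le> L powr c2" .
      qed
      define X1 X2 X3 where "X1 = q * q / (p * p)" and "X2 = p ^ 3 / q" and "X3 = q ^ 3 / p ^ 3"
      have X: "X1 > 0" "X2 > 0" "X3 > 0" using pq by (auto simp: X1_def X2_def X3_def)
      have k1: "N / \<beta> \<le> 1 / b * X1 * L powr c2"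
      proof -
        have "N / \<beta> = 1 / b * X1 * (t * t)" unfolding be pq(5) X1_def as(3) using pq(1) t(1) as by simp
        also have "\<dots> \<le> 1 / b * X1 * L powr c2" using L2 X b by (intro mult_left_mono) auto
        finally show ?thesis .
      qed
      have k2: "N * (hi / sqrt lo) * sqrt \<beta> \<le> a2 / \<alpha> * \<sigma> * X2 * L powr c2"
      proof -
        have "N * (hi / sqrt lo) * sqrt \<beta> = a2 / \<alpha> * \<sigma> * X2 * (r ^ 3 / t)"
          unfolding lo' sb hi' pq(5) X2_def using pq(1-3) t(1) as(1,2)
          by (simp add: divide_simps power2_eq_square power3_eq_cube)
        also have "\<dots> \<le> a2 / \<alpha> * \<sigma> * X2 * L powr c2" using L2 X a as by (intro mult_left_mono) auto
        finally show ?thesis .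
      qed
      have k3: "8 / (sqrt lo * sqrt \<beta>) \<le> 8 / (\<alpha> * \<sigma>) * X3 * L powr c2"
      proof -
        have "8 / (sqrt lo * sqrt \<beta>) = 8 / (\<alpha> * \<sigma>) * X3 * (r * t)"
          unfolding lo' sb X3_def using pq(1-3) t(1) as(1,2) by (simp add: divide_simps power3_eq_cube)
        also have "\<dots> \<le> 8 / (\<alpha> * \<sigma>) * X3 * L powr c2" using L2 X as by (intro mult_left_mono) auto
        finally show ?thesis .
      qed
      have co: "0 \<le> 1 / b" "0 \<le> a2 / \<alpha> * \<sigma>" "0 \<le> 8 / (\<alpha> * \<sigma>)" using a b as by auto
      have "N / \<beta> + N * (hi / sqrt lo) * sqrt \<beta> + 8 / (sqrt lo * sqrt \<beta>)
         \<le> 1 / b * X1 * L powr c2 + a2 / \<alpha> * \<sigma> * X2 * L powr c2 + 8 / (\<alpha> * \<sigma>) * X3 * L powr c2"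
        using k1 k2 k3 by linarith
      also have "\<dots> \<le> (1 / b + a2 / \<alpha> * \<sigma> + 8 / (\<alpha> * \<sigma>)) * L powr c2 * (X1 + X2 + X3)"
      proof -
        have "x * X1 * l + y * X2 * l + z * X3 * l \<le> (x + y + z) * l * (X1 + X2 + X3)"
          if "0 \<le> x" "0 \<le> y" "0 \<le> z" "0 \<le> l" for x y z l :: real
        proof -
          have "0 \<le> l * (x * X2 + x * X3 + y * X1 + y * X3 + z * X1 + z * X2)" using that X
            by (intro mult_nonneg_nonneg add_nonneg_nonneg) auto
          then show ?thesis by (simp add: algebra_simps)
        qed
        from this[OF co less_imp_le[OF Lp]] show ?thesis .
      qed
      also have "X1 + X2 + X3 = N / u + u * sqrt u / sqrt N + N * sqrt N / (u * sqrt u)"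
        unfolding X1_def X2_def X3_def p_def[symmetric] q_def[symmetric] pq(4,5)
        using pq(1,2) by (simp add: power3_eq_cube)
      finally have "100 * (N / \<beta> + N * (hi / sqrt lo) * sqrt \<beta> + 8 / (sqrt lo * sqrt \<beta>))
        \<le> 100 * ((1 / b + a2 / \<alpha> * \<sigma> + 8 / (\<alpha> * \<sigma>)) * L powr c2 *
           (N / u + u * sqrt u / sqrt N + N * sqrt N / (u * sqrt u)))" by (rule mult_left_mono) simp
      then show ?thesis unfolding A_def \<alpha>_def \<sigma>_def by (simp only: mult.assoc)
    qed
    also have "\<dots> \<le> C * \<Lambda> powr c * (N / u + u * sqrt u / sqrt N + N * sqrt N / (u * sqrt u))"
    proof (rule mult_right_mono)
      have "L powr c2 = K powr c2 * \<Lambda> powr (k * c2)" using K3 by (simp add: L_def powr_mult powr_powr)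
      then have "A * L powr c2 = A * K powr c2 * \<Lambda> powr (k * c2)" by simp
      also have "\<dots> \<le> C * \<Lambda> powr c"
        using A0 b K3 g e0 k0 by (intro mult_mono Lmono) (auto simp: C_def c_def)
      finally show "A * L powr c2 \<le> C * \<Lambda> powr c" .
    qed (use u in auto)
    finally show ?thesis by (simp add: S_def)
  qed
  show ?thesis by (rule that[OF Cc main])
qed

section \<open>Energy of differences of powers\<close>

lemma card_pairs_same:
  assumes "finite G"
  shows "real (card {(p, q) \<in> G \<times> G. f p = f q}) = (\<Sum>b\<in>f ` G. (real (card {p \<in> G. f p = b}))\<^sup>2)"
proof -
  have "{(p, q) \<in> G \<times> G. f p = f q} = (\<Union>b\<in>f ` G. {p \<in> G. f p = b} \<times> {p \<in> G. f p = b})" by auto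
  also have "card \<dots> = (\<Sum>b\<in>f ` G. card ({p \<in> G. f p = b} \<times> {p \<in> G. f p = b}))"
    using assms by (intro card_UN_disjoint) auto
  finally show ?thesis by (simp add: card_cartesian_product power2_eq_square)
qed

text \<open>Cauchy-Schwarz inside each fibre of \<open>f\<close>, split by the at most M values of
  \<open>h\<close>: a second coincidence is bought at the price of a factor M.\<close>

lemma card_pairs_same_refine:
  assumes G: "finite G" and M: "card (h ` G) \<le> M"
  shows "real (card {(p, q) \<in> G \<times> G. f p = f q}) \<le> real M * real (card {(p, q) \<in> G \<times> G. f p = f q \<and> h p = h q})"
proof -
  define r where "r b c = real (card {p \<in> G. f p = b \<and> h p = c})" for b c
  have split: "real (card {p \<in> G. f p = b}) = (\<Sum>c\<in>h ` G. r b c)" for b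
  proof -
    have "{p \<in> G. f p = b} = (\<Union>c\<in>h ` G. {p \<in> G. f p = b \<and> h p = c})" by auto
    also have "card \<dots> = (\<Sum>c\<in>h ` G. card {p \<in> G. f p = b \<and> h p = c})"
      using G by (intro card_UN_disjoint) auto
    finally show ?thesis by (simp add: r_def)
  qed
  have sq: "(real (card {p \<in> G. f p = b}))\<^sup>2 \<le> real M * (\<Sum>c\<in>h ` G. (r b c)\<^sup>2)" for b
  proof -
    have "(\<Sum>c\<in>h ` G. 1 * r b c)\<^sup>2 \<le> (\<Sum>c\<in>h ` G. 1\<^sup>2) * (\<Sum>c\<in>h ` G. (r b c)\<^sup>2)"
      by (rule Cauchy_Schwarz_ineq_sum)
    also have "\<dots> \<le> real M * (\<Sum>c\<in>h ` G. (r b c)\<^sup>2)" using M by (intro mult_right_mono) (auto intro: sum_nonneg)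
    finally show ?thesis by (simp add: split)
  qed
  have "real (card {(p, q) \<in> G \<times> G. f p = f q \<and> h p = h q}) = (\<Sum>bc\<in>(\<lambda>p. (f p, h p)) ` G. (r (fst bc) (snd bc))\<^sup>2)"
    using card_pairs_same[OF G, of "\<lambda>p. (f p, h p)"] by (simp add: r_def prod_eq_iff)
  also have "\<dots> = (\<Sum>bc\<in>f ` G \<times> h ` G. (r (fst bc) (snd bc))\<^sup>2)"
  proof (intro sum.mono_neutral_left)
    show "\<forall>i\<in>f ` G \<times> h ` G - (\<lambda>p. (f p, h p)) ` G. (r (fst i) (snd i))\<^sup>2 = 0"
    proof
      fix i assume i: "i \<in> f ` G \<times> h ` G - (\<lambda>p. (f p, h p)) ` G"
      then have "{p \<in> G. f p = fst i \<and> h p = snd i} = {}" by (auto simp: image_iff prod_eq_iff)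
      then show "(r (fst i) (snd i))\<^sup>2 = 0" unfolding r_def by (simp only: card.empty) simp
    qed
  qed (use G in auto)
  also have "\<dots> = (\<Sum>b\<in>f ` G. \<Sum>c\<in>h ` G. (r b c)\<^sup>2)" by (simp add: sum.cartesian_product split_def)
  finally have e: "real (card {(p, q) \<in> G \<times> G. f p = f q \<and> h p = h q}) = (\<Sum>b\<in>f ` G. \<Sum>c\<in>h ` G. (r b c)\<^sup>2)" .
  show ?thesis unfolding e sum_distrib_left card_pairs_same[OF G] by (rule sum_mono[OF sq[unfolded sum_distrib_left]])
qed

definition good_pairs :: "real \<Rightarrow> nat \<Rightarrow> (nat \<times> nat) set" where
  "good_pairs P N = {(n, m). P \<le> real m \<and> real m + P \<le> real n \<and> n \<le> N}"

definition pdiff :: "real \<Rightarrow> nat \<times> nat \<Rightarrow> real" where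
  "pdiff t p = real (fst p) powr t - real (snd p) powr t"

lemma good_pairs_sub: "P > 0 \<Longrightarrow> good_pairs P N \<subseteq> {1..N} \<times> {1..N}"
  unfolding good_pairs_def by (auto simp: Suc_le_eq)

lemma finite_good_pairs: "P > 0 \<Longrightarrow> finite (good_pairs P N)"
  by (rule finite_subset[OF good_pairs_sub]) auto

lemma card_good_pairs_le: "P > 0 \<Longrightarrow> card (good_pairs P N) \<le> N * N"
  using card_mono[OF _ good_pairs_sub[where P = P and N = N]] by (simp add: card_cartesian_product)

text \<open>By the mean value theorem powers of distinct integers above P are P^g apart. This
  spacing makes equal n force equal m among close pairs, and later separates the differences in one
  variable.\<close>

lemma powr_diff_ge:
  fixes a b :: nat and g P :: real
  assumes "g > 0" "P > 0" "P \<le> real a" "a < b"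
  shows "P powr g \<le> real b powr (g + 1) - real a powr (g + 1)"
proof -
  have ab: "0 < real a" "0 < real b - real a" using assms by auto
  obtain \<xi> :: real where x: "real a < \<xi>" "incr (g + 1) (real b - real a) (real a) = (g + 1) * (real b - real a) * \<xi> powr g"
    by (rule incr_mvt'[OF ab, where g = g], rule that; assumption)
  have "1 * P powr g \<le> ((g + 1) * (real b - real a)) * \<xi> powr g"
  proof (rule mult_mono)
    have "1 * 1 \<le> (g + 1) * (real b - real a)" using assms by (intro mult_mono) auto
    then show "1 \<le> (g + 1) * (real b - real a)" by simp
    show "P powr g \<le> \<xi> powr g" using x assms by (intro powr_mono2) auto
  qed (use assms in auto)
  also have "\<dots> = real b powr (g + 1) - real a powr (g + 1)" using x(2) by (simp add: incr_def)
  finally show ?thesis by simp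
qed

section \<open>Solutions of a b = c d\<close>

lemma sum_inverse_le: "(\<Sum>r\<in>{1..M}. 1 / real r) \<le> 1 + ln (real M)" if "M \<ge> 1"
  using that
proof (induction M rule: dec_induct)
  case (step M)
  have "ln (real M / real (Suc M)) \<le> real M / real (Suc M) - 1" using step by (intro ln_le_minus_one) auto
  also have "\<dots> = - (1 / real (Suc M))" by (simp add: field_simps)
  finally have "1 / real (Suc M) \<le> ln (real (Suc M)) - ln (real M)" using step by (simp add: ln_div)
  then show ?case using step by simp
qed simp

lemma card_mult_le: "real (card {(r, s). 1 \<le> r \<and> 1 \<le> s \<and> r * s \<le> M}) \<le> real M * (1 + ln (real M))" if "M \<ge> 1" for M :: nat
proof -
  have sub: "{(r, s). 1 \<le> r \<and> 1 \<le> s \<and> r * s \<le> M} \<subseteq> (SIGMA r:{1..M}. {1..M div r})"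
  proof clarify
    fix r s assume *: "1 \<le> r" "1 \<le> s" "r * s \<le> M"
    have "r * 1 \<le> r * s" using * by (intro mult_left_mono) auto
    then have "r \<le> M" using *(3) by linarith
    moreover have "s \<le> M div r" using * by (simp add: less_eq_div_iff_mult_less_eq mult.commute)
    ultimately show "r \<in> {1..M} \<and> s \<in> {1..M div r}" using * by auto
  qed
  have "card {(r, s). 1 \<le> r \<and> 1 \<le> s \<and> r * s \<le> M} \<le> card (SIGMA r:{1..M}. {1..M div r})"
    by (rule card_mono[OF _ sub]) auto
  also have "\<dots> = (\<Sum>r\<in>{1..M}. M div r)" by (subst card_SigmaI) auto
  finally have "real (card {(r, s). 1 \<le> r \<and> 1 \<le> s \<and> r * s \<le> M}) \<le> real (\<Sum>r\<in>{1..M}. M div r)"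
    by (simp only: of_nat_le_iff)
  also have "\<dots> = (\<Sum>r\<in>{1..M}. real (M div r))" by (rule of_nat_sum)
  also have "\<dots> \<le> (\<Sum>r\<in>{1..M}. real M * (1 / real r))"
  proof (intro sum_mono)
    fix r assume r: "r \<in> {1..M}"
    have "M div r * r \<le> M" by simp
    then have "real (M div r) * real r \<le> real M" by (metis of_nat_le_iff of_nat_mult)
    then show "real (M div r) \<le> real M * (1 / real r)" using r by (simp add: field_simps)
  qed
  also have "\<dots> = real M * (\<Sum>r\<in>{1..M}. 1 / real r)" by (simp only: sum_distrib_left)
  also have "\<dots> \<le> real M * (1 + ln (real M))" by (intro mult_left_mono sum_inverse_le that) auto
  finally show ?thesis .
qed

text \<open>With r the gcd of a and c, the coprime cofactors divide d and b crosswise.\<close>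

lemma mult_eq_param:
  fixes a b c d :: nat
  assumes "a * b = c * d" "a > 0" "b > 0" "c > 0" "d > 0"
  obtains r s t w where "a = r * s" "b = t * w" "c = r * t" "d = s * w"
proof -
  define r where "r = gcd a c"
  have r: "r > 0" using assms by (simp add: r_def)
  obtain s t where st: "a = r * s" "c = r * t" "coprime s t"
    using gcd_coprime_exists[of a c] assms unfolding r_def by (metis gcd_eq_0_iff mult.commute neq0_conv)
  have "r * (s * b) = r * (t * d)" using assms(1) st by (simp add: mult.assoc)
  then have e: "s * b = t * d" using r by simp
  then have "t dvd b" using st(3) by (metis coprime_commute coprime_dvd_mult_right_iff dvd_triv_left)
  then obtain w where w: "b = t * w" by (elim dvdE)
  have "t > 0" using st assms by (cases t) auto
  then have "d = s * w" using e w by simp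
  then show ?thesis using that st w by blast
qed

text \<open>By \<open>mult_eq_param\<close> a solution is determined by two pairs (r, s) and (t, w)
  with products a and b at most M, so the square of the number of such pairs is an upper
  bound.\<close>

lemma card_mult_eq_le:
  fixes M :: nat
  assumes M: "M \<ge> 1"
  shows "real (card {((a, b), (c, d)). {a, b, c, d} \<subseteq> {1..M} \<and> a * b = c * d}) \<le> (real M * (1 + ln (real M)))\<^sup>2"
proof -
  define T where "T = {(r, s). 1 \<le> r \<and> 1 \<le> s \<and> r * s \<le> M}"
  have finT: "finite T"
  proof (rule finite_subset)
    show "T \<subseteq> {..M} \<times> {..M}"
    proof clarify
      fix r s assume "(r, s) \<in> T"
      then have *: "1 \<le> r" "1 \<le> s" "r * s \<le> M" by (simp_all add: T_def)
      have "r * 1 \<le> r * s" by (rule mult_left_mono) (use * in auto)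
      moreover have "1 * s \<le> r * s" by (rule mult_right_mono) (use * in auto)
      ultimately have "r \<le> M" "s \<le> M" using *(3) by linarith+
      then show "r \<in> {..M} \<and> s \<in> {..M}" by simp
    qed
  qed simp
  define F where "F = (\<lambda>((r, s), (t, w)). ((r * s, t * w), (r * t, s * w :: nat)))"
  have "{((a, b), (c, d)). {a, b, c, d} \<subseteq> {1..M} \<and> a * b = c * d} \<subseteq> F ` (T \<times> T)"
  proof clarify
    fix a b c d assume *: "{a, b, c, d} \<subseteq> {1..M}" "a * b = c * d"
    then have pos: "a > 0" "b > 0" "c > 0" "d > 0" by auto
    obtain r s t w where rs: "a = r * s" "b = t * w" "c = r * t" "d = s * w"
      using mult_eq_param[OF *(2) pos] .
    then have "((r, s), (t, w)) \<in> T \<times> T" using pos * by (auto simp: T_def Suc_le_eq)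
    moreover have "((a, b), (c, d)) = F ((r, s), (t, w))" using rs by (simp add: F_def)
    ultimately show "((a, b), (c, d)) \<in> F ` (T \<times> T)" by blast
  qed
  then have "card {((a, b), (c, d)). {a, b, c, d} \<subseteq> {1..M} \<and> a * b = c * d} \<le> card (F ` (T \<times> T))"
    using finT by (intro card_mono) auto
  also have "\<dots> \<le> card (T \<times> T)" using finT by (intro card_image_le) auto
  also have "\<dots> = card T * card T" by (rule card_cartesian_product)
  finally have "real (card {((a, b), (c, d)). {a, b, c, d} \<subseteq> {1..M} \<and> a * b = c * d}) \<le> real (card T * card T)"
    by (simp only: of_nat_le_iff)
  also have "\<dots> = (real (card T))\<^sup>2" by (simp add: power2_eq_square)
  also have "\<dots> \<le> (real M * (1 + ln (real M)))\<^sup>2"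
    using card_mult_le[OF M] by (intro power_mono) (auto simp: T_def)
  finally show ?thesis .
qed

text \<open>For \<open>\<theta> = 2\<close> the curve degenerates to a line; there the energy counts solutions of \<open>a b = c d\<close>.\<close>

lemma energy_bound_square:
  obtains C :: real where "C \<ge> 1" "\<And>N P. N \<ge> 1 \<Longrightarrow> P > 0 \<Longrightarrow>
    real (card {(p, q) \<in> good_pairs P N \<times> good_pairs P N. \<lfloor>pdiff 2 p\<rfloor> = \<lfloor>pdiff 2 q\<rfloor>}) \<le> C * real N powr (23/10)"
proof (rule that)
  fix N :: nat and P :: real assume N: "N \<ge> 1" and P: "P > 0"
  define M where "M = 2 * N"
  define S where "S = {(p, q) \<in> good_pairs P N \<times> good_pairs P N. \<lfloor>pdiff 2 p\<rfloor> = \<lfloor>pdiff 2 q\<rfloor>}"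
  \<comment> \<open>n^2 - m^2 = (n - m) (n + m) has factors at most 2 N, and the factors determine n
    and m.\<close>
  define F where "F = (\<lambda>((n, m), (n', m')). ((n - m, n + m), (n' - m', n' + m')) :: (nat \<times> nat) \<times> (nat \<times> nat))"
  have fl: "\<lfloor>pdiff 2 (n, m)\<rfloor> = int ((n - m) * (n + m))" "m < n" "1 \<le> m" "n \<le> N" if "(n, m) \<in> good_pairs P N" for n m
  proof -
    show "m < n" using that P by (auto simp: good_pairs_def)
    show "1 \<le> m" "n \<le> N" using that good_pairs_sub[OF P, of N] by auto
    have "pdiff 2 (n, m) = real_of_int (int ((n - m) * (n + m)))"
    proof -
      have "real_of_int (int ((n - m) * (n + m))) = (real n - real m) * (real n + real m)"
        using \<open>m < n\<close> by (simp add: of_nat_diff)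
      then show ?thesis using \<open>m < n\<close> \<open>1 \<le> m\<close> by (simp add: pdiff_def power2_eq_square algebra_simps)
    qed
    then show "\<lfloor>pdiff 2 (n, m)\<rfloor> = int ((n - m) * (n + m))" by (simp only: floor_of_int)
  qed
  have inj: "inj_on F S"
  proof (rule inj_onI)
    fix x y assume xy: "x \<in> S" "y \<in> S" "F x = F y"
    obtain n m n' m' where x: "x = ((n, m), (n', m'))" by (metis surj_pair)
    obtain k l k' l' where y: "y = ((k, l), (k', l'))" by (metis surj_pair)
    have "m < n" "m' < n'" "l < k" "l' < k'" using xy fl(2) by (auto simp: x y S_def)
    moreover have "n - m = k - l" "n + m = k + l" "n' - m' = k' - l'" "n' + m' = k' + l'"
      using xy(3) by (auto simp: x y F_def)
    ultimately show "x = y" unfolding x y by auto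
  qed
  have sub: "F ` S \<subseteq> {((a, b), (c, d)). {a, b, c, d} \<subseteq> {1..M} \<and> a * b = c * d}"
  proof clarify
    fix n m n' m' a b c d
    assume *: "((n, m), (n', m')) \<in> S" "((a, b), (c, d)) = F ((n, m), (n', m'))"
    then have g: "(n, m) \<in> good_pairs P N" "(n', m') \<in> good_pairs P N" and e: "\<lfloor>pdiff 2 (n, m)\<rfloor> = \<lfloor>pdiff 2 (n', m')\<rfloor>"
      by (auto simp: S_def)
    have "(n - m) * (n + m) = (n' - m') * (n' + m')" using e unfolding fl(1)[OF g(1)] fl(1)[OF g(2)] by (simp only: of_nat_eq_iff)
    then show "{a, b, c, d} \<subseteq> {1..M} \<and> a * b = c * d"
      using *(2) fl(2-4)[OF g(1)] fl(2-4)[OF g(2)] by (auto simp: F_def M_def)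
  qed
  have "finite {((a, b), (c, d)). {a, b, c, d} \<subseteq> {1..M} \<and> a * b = c * d}"
    by (rule finite_subset[of _ "({1..M} \<times> {1..M}) \<times> ({1..M} \<times> {1..M})"]) auto
  from card_mono[OF this sub] have "card S \<le> card {((a, b), (c, d)). {a, b, c, d} \<subseteq> {1..M} \<and> a * b = c * d}"
    by (simp add: card_image[OF inj])
  then have "real (card S) \<le> (real M * (1 + ln (real M)))\<^sup>2"
    using card_mult_eq_le[of M] N by (simp add: M_def)
  also have "\<dots> \<le> (real M * (21 * real M powr (1/20)))\<^sup>2"
  proof (intro power_mono mult_left_mono)
    have M1: "real M \<ge> 1" using N by (simp add: M_def)
    \<comment> \<open>The logarithm is absorbed by the power 1/20. The resulting exponent 21/10 is
      below 23/10, which is kept to match the curved case.\<close>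
    have "ln (real M) = 20 * ln (real M powr (1/20))" using M1 by (simp add: ln_powr)
    also have "\<dots> \<le> 20 * real M powr (1/20)" using M1 ln_le_minus_one[of "real M powr (1/20)"] by simp
    finally have "ln (real M) \<le> 20 * real M powr (1/20)" .
    moreover have "1 \<le> real M powr (1/20)" using M1 by (intro ge_one_powr_ge_zero) auto
    ultimately show "1 + ln (real M) \<le> 21 * real M powr (1/20)" by linarith
    show "0 \<le> real M * (1 + ln (real M))" using M1 by simp
  qed auto
  also have "\<dots> = 441 * (real M)\<^sup>2 * real M powr (1/10)"
    by (simp add: power_mult_distrib power2_eq_square flip: powr_add)
  also have "\<dots> = 441 * real M powr (21/10)"
    using N powr_add[of "real M" 2 "1/10"] by (simp add: M_def)
  also have "\<dots> = 441 * 2 powr (21/10) * real N powr (21/10)" by (simp add: M_def powr_mult)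
  also have "\<dots> \<le> 441 * 2 powr 3 * real N powr (23/10)"
    using N by (intro mult_mono powr_mono) auto
  finally show "real (card {(p, q) \<in> good_pairs P N \<times> good_pairs P N. \<lfloor>pdiff 2 p\<rfloor> = \<lfloor>pdiff 2 q\<rfloor>}) \<le> 3528 * real N powr (23/10)"
    by (simp add: S_def)
qed simp

text \<open>The weight u stands for the number of v admissible for a given u, which
  \<open>near_sol_v_le\<close> makes proportional to u.\<close>

lemma sum_gap_terms_le:
  fixes N :: nat and K :: real
  assumes N: "N \<ge> 1" and K: "K \<ge> 1"
  shows "(\<Sum>u\<in>{1..nat \<lfloor>K\<rfloor>}. real u * (N / real u + real u * sqrt (real u) / sqrt N + N * sqrt N / (real u * sqrt (real u))))
    \<le> N * K + K ^ 3 * sqrt K / sqrt N + 2 * N * sqrt N * sqrt K"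
proof -
  define U where "U = nat \<lfloor>K\<rfloor>"
  have U: "real U \<le> K" using K by (simp add: U_def)
  have K0: "K \<ge> 0" using K by simp
  have "(\<Sum>u\<in>{1..U}. real u * (N / real u + real u * sqrt (real u) / sqrt N + N * sqrt N / (real u * sqrt (real u))))
    \<le> (\<Sum>u\<in>{1..U}. real N + K\<^sup>2 * sqrt K / sqrt N + N * sqrt N * (1 / sqrt (real u)))"
  proof (intro sum_mono)
    fix u assume u: "u \<in> {1..U}"
    then have u0: "real u > 0" "real u \<le> K" using U by auto
    have "real u * (real u * sqrt (real u)) \<le> K * (K * sqrt K)" using u0 by (intro mult_mono) auto
    then have "real u * (real u * sqrt (real u)) / sqrt N \<le> K\<^sup>2 * sqrt K / sqrt N"
      by (intro divide_right_mono) (auto simp: power2_eq_square)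
    moreover have "real u * (N / real u + real u * sqrt (real u) / sqrt N + N * sqrt N / (real u * sqrt (real u)))
       = N + real u * (real u * sqrt (real u)) / sqrt N + N * sqrt N * (1 / sqrt (real u))"
      using u0 by (simp add: distrib_left)
    ultimately show "real u * (N / real u + real u * sqrt (real u) / sqrt N + N * sqrt N / (real u * sqrt (real u)))
      \<le> real N + K\<^sup>2 * sqrt K / sqrt N + N * sqrt N * (1 / sqrt (real u))" by linarith
  qed
  also have "\<dots> = real U * (real N + K\<^sup>2 * sqrt K / sqrt N) + N * sqrt N * (\<Sum>u\<in>{1..U}. 1 / sqrt (real u))"
    by (simp only: sum.distrib sum_distrib_left[symmetric] sum_constant card_atLeastAtMost) (simp add: distrib_left)
  also have "\<dots> \<le> K * (real N + K\<^sup>2 * sqrt K / sqrt N) + N * sqrt N * (2 * sqrt K)"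
  proof (intro add_mono mult_left_mono mult_right_mono U)
    have "sqrt (real U) \<le> sqrt K" using U by simp
    then show "(\<Sum>u\<in>{1..U}. 1 / sqrt (real u)) \<le> 2 * sqrt K" using sum_inverse_sqrt_le[of U] by linarith
  qed (use K0 in auto)
  also have "\<dots> = N * K + K ^ 3 * sqrt K / sqrt N + 2 * N * sqrt N * sqrt K"
    by (simp add: power2_eq_square power3_eq_cube distrib_left)
  finally show ?thesis unfolding U_def .
qed

lemma sqrt_powr: "x > 0 \<Longrightarrow> sqrt (x powr a) = x powr (a / 2)"
  by (simp add: powr_half_sqrt[symmetric] powr_powr)

text \<open>A close pair of pairs is recorded by its increments u = n' - n, v = m' - m and its base
  point, and \<open>near_sol_card_le\<close> is summed over u up to N^(7/10). The largest term is
  N^(39/20), which leaves a margin N^(1/20) for the powers of \<Lambda>.\<close>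

lemma close_pairs_bound:
  fixes g :: real
  assumes g: "g > 0" "g \<noteq> 1"
  obtains C c :: real where "C \<ge> 1" "c \<ge> 0"
    "\<And>N \<Lambda>. N \<ge> 1 \<Longrightarrow> \<Lambda> \<ge> 1 \<Longrightarrow> C * \<Lambda> powr c \<le> real N powr (1/20) \<Longrightarrow>
      real (card {((n, m), (n', m')). (n, m) \<in> good_pairs (N / \<Lambda>) N \<and> (n', m') \<in> good_pairs (N / \<Lambda>) N \<and> n < n' \<and>
          real n' - real n \<le> real N powr (7/10) \<and>
          \<bar>pdiff (g + 1) (n, m) - pdiff (g + 1) (n', m')\<bar> < real N powr (g - 1)}) \<le> C * (real N)\<^sup>2"
proof -
  obtain C1 c1 :: real where C1: "C1 \<ge> 1" "c1 \<ge> 0" and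
    ns: "\<And>N \<Lambda> u v. N \<ge> 1 \<Longrightarrow> \<Lambda> \<ge> 1 \<Longrightarrow> u \<ge> 1 \<Longrightarrow> v \<ge> 1 \<Longrightarrow> C1 * \<Lambda> powr c1 * u \<le> real N \<Longrightarrow>
       real (card (near_sol g (N / \<Lambda>) N u v))
        \<le> C1 * \<Lambda> powr c1 * (N / u + u * sqrt u / sqrt N + N * sqrt N / (u * sqrt u))"
    using near_sol_card_le[OF g] by blast
  define C where "C = 8 * C1"
  define c where "c = c1 + g"
  have Cc: "C \<ge> 1" "c \<ge> 0" using C1 g by (auto simp: C_def c_def)
  have main: "real (card {((n, m), (n', m')). (n, m) \<in> good_pairs (N / \<Lambda>) N \<and> (n', m') \<in> good_pairs (N / \<Lambda>) N \<and> n < n' \<and>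
          real n' - real n \<le> real N powr (7/10) \<and>
          \<bar>pdiff (g + 1) (n, m) - pdiff (g + 1) (n', m')\<bar> < real N powr (g - 1)}) \<le> C * (real N)\<^sup>2"
    if N: "N \<ge> 1" and \<Lambda>: "\<Lambda> \<ge> 1" and big: "C * \<Lambda> powr c \<le> real N powr (1/20)" for N :: nat and \<Lambda> :: real
  proof -
    define P where "P = real N / \<Lambda>"
    have N0: "real N > 0" "real N \<ge> 1" using N by auto
    have P: "P > 0" using \<Lambda> N0 by (simp add: P_def)
    define K where "K = real N powr (7/10)"
    have K: "K \<ge> 1" unfolding K_def using N0 by (intro ge_one_powr_ge_zero) auto
    define S where "S = {((n, m), (n', m')). (n, m) \<in> good_pairs P N \<and> (n', m') \<in> good_pairs P N \<and> n < n' \<and>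
          real n' - real n \<le> K \<and> \<bar>pdiff (g + 1) (n, m) - pdiff (g + 1) (n', m')\<bar> < real N powr (g - 1)}"
    define V where "V u = nat \<lfloor>2 * \<Lambda> powr g * real u\<rfloor>" for u :: nat
    define T where "T = (SIGMA uv:(SIGMA u:{1..nat \<lfloor>K\<rfloor>}. {1..V u}). near_sol g P N (real (fst uv)) (real (snd uv)))"
    define F where "F = (\<lambda>((n, m), (n', m')). ((n' - n, m' - m), (n, m)) :: (nat \<times> nat) \<times> (nat \<times> nat))"
    have \<Lambda>g: "1 \<le> \<Lambda> powr c1" "1 \<le> \<Lambda> powr g" "1 \<le> \<Lambda> powr c" using \<Lambda> C1 g Cc by (auto intro: ge_one_powr_ge_zero)
    have Nle: "real N powr (1/20) \<le> real N powr 1" using N0 by (intro powr_mono) auto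
    have \<Lambda>gN: "\<Lambda> powr g \<le> real N"
    proof -
      have "\<Lambda> powr g \<le> \<Lambda> powr c" unfolding c_def using \<Lambda> C1 by (intro powr_mono) auto
      also have "\<dots> \<le> C * \<Lambda> powr c" using mult_right_mono[OF Cc(1), of "\<Lambda> powr c"] by simp
      finally show ?thesis using big Nle N0 by simp
    qed
    \<comment> \<open>The tolerance does not exceed the spacing of the powers, so n < n' forces m <
      m' and both increments are positive.\<close>
    have gap: "real N powr (g - 1) \<le> P powr g"
    proof -
      have "real N powr (g - 1) = real N powr g / N" using N0 by (simp add: powr_diff)
      also have "\<dots> \<le> real N powr g / \<Lambda> powr g" using \<Lambda>gN \<Lambda> N0 by (intro divide_left_mono) auto
      finally show ?thesis using \<Lambda> by (simp add: P_def powr_divide)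
    qed
    have inS: "m < m' \<and> (n, m) \<in> near_sol g P N (real (n' - n)) (real (m' - m)) \<and> 1 \<le> n' - n \<and> real (n' - n) \<le> K
       \<and> 1 \<le> m' - m \<and> m' - m \<le> V (n' - n)"
      if S: "((n, m), (n', m')) \<in> S" for n m n' m'
    proof -
      have h: "P \<le> real m" "real m + P \<le> real n" "n \<le> N" "P \<le> real m'" "real m' + P \<le> real n'" "n' \<le> N" "n < n'"
          "real n' - real n \<le> K" and close: "\<bar>pdiff (g + 1) (n, m) - pdiff (g + 1) (n', m')\<bar> < real N powr (g - 1)"
        using S unfolding S_def good_pairs_def by simp_all
      have "P \<le> real n" using h(1,2) P by linarith
      from powr_diff_ge[OF g(1) P this h(7)] gap
      have "real N powr (g - 1) \<le> real n' powr (g + 1) - real n powr (g + 1)" by linarith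
      with close have lt: "real m powr (g + 1) < real m' powr (g + 1)" unfolding pdiff_def by simp
      have mm: "m < m'"
      proof (rule ccontr)
        assume "\<not> m < m'"
        then have "real m' powr (g + 1) \<le> real m powr (g + 1)" using g by (intro powr_mono2) auto
        then show False using lt by simp
      qed
      have e: "real n + real (n' - n) = real n'" "real m + real (m' - m) = real m'" using h(7) mm by auto
      have ne: "(n, m) \<in> near_sol g P N (real (n' - n)) (real (m' - m))"
      proof -
        have "pdiff (g + 1) (n, m) - pdiff (g + 1) (n', m') =
           - ((real n' powr (g + 1) - real n powr (g + 1)) - (real m' powr (g + 1) - real m powr (g + 1)))"
          by (simp add: pdiff_def)
        then have cl: "\<bar>(real n' powr (g + 1) - real n powr (g + 1)) - (real m' powr (g + 1) - real m powr (g + 1))\<bar> < real N powr (g - 1)"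
          using close by (simp only: abs_minus_cancel)
        have "real n' \<le> real N" "real m' \<le> real N" using h P by auto
        then show ?thesis unfolding near_sol_def incr_def mem_Collect_eq prod.case e using h(1,2) cl by blast
      qed
      have u1: "1 \<le> n' - n" "1 \<le> m' - m" using h(7) mm by auto
      have "real (m' - m) \<le> 2 * \<Lambda> powr g * real (n' - n)"
        using ne u1 unfolding P_def by (intro near_sol_v_le[OF g(1) \<Lambda> N]) auto
      then have "m' - m \<le> V (n' - n)" unfolding V_def by (simp add: le_nat_floor)
      then show ?thesis using mm ne u1 h(7,8) by auto
    qed
    have inj: "inj_on F S"
    proof (rule inj_onI)
      fix x y assume xy: "x \<in> S" "y \<in> S" "F x = F y"
      obtain n m n' m' where x: "x = ((n, m), (n', m'))" by (metis surj_pair)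
      obtain k l k' l' where y: "y = ((k, l), (k', l'))" by (metis surj_pair)
      have "m < m'" "l < l'" "1 \<le> n' - n" "1 \<le> k' - k"
        using inS[of n m n' m'] inS[of k l k' l'] xy(1,2) unfolding x y by blast+
      moreover have "n = k" "m = l" "n' - n = k' - k" "m' - m = l' - l" using xy(3) by (auto simp: x y F_def)
      ultimately show "x = y" unfolding x y by auto
    qed
    have sub: "F ` S \<subseteq> T"
    proof (rule image_subsetI)
      fix x assume xS: "x \<in> S"
      obtain n m n' m' where x: "x = ((n, m), (n', m'))" by (metis surj_pair)
      have "n' - n \<le> nat \<lfloor>K\<rfloor>" using inS[of n m n' m'] xS x by (auto simp: le_nat_floor)
      then show "F x \<in> T" using inS[of n m n' m'] xS by (auto simp: x F_def T_def)
    qed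
    have finT: "finite T" unfolding T_def by (auto intro!: finite_SigmaI finite_near_sol)
    have "card S = card (F ` S)" by (simp add: card_image[OF inj])
    also have "\<dots> \<le> card T" by (rule card_mono[OF finT sub])
    also have "\<dots> = (\<Sum>uv\<in>(SIGMA u:{1..nat \<lfloor>K\<rfloor>}. {1..V u}). card (near_sol g P N (real (fst uv)) (real (snd uv))))"
      unfolding T_def by (intro card_SigmaI) (auto intro!: finite_near_sol)
    finally have "real (card S) \<le> real (\<Sum>uv\<in>(SIGMA u:{1..nat \<lfloor>K\<rfloor>}. {1..V u}). card (near_sol g P N (real (fst uv)) (real (snd uv))))"
      by (simp only: of_nat_le_iff)
    also have "\<dots> = (\<Sum>uv\<in>(SIGMA u:{1..nat \<lfloor>K\<rfloor>}. {1..V u}). real (card (near_sol g P N (real (fst uv)) (real (snd uv)))))"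
      by (rule of_nat_sum)
    also have "\<dots> = (\<Sum>u\<in>{1..nat \<lfloor>K\<rfloor>}. \<Sum>v\<in>{1..V u}. real (card (near_sol g P N (real u) (real v))))"
      by (subst sum.Sigma) (auto simp: split_def)
    also have "\<dots> \<le> (\<Sum>u\<in>{1..nat \<lfloor>K\<rfloor>}. 2 * \<Lambda> powr g * C1 * \<Lambda> powr c1 * (real u * (N / real u + real u * sqrt (real u) / sqrt N + N * sqrt N / (real u * sqrt (real u)))))"
    proof (rule sum_mono)
      fix u assume u: "u \<in> {1..nat \<lfloor>K\<rfloor>}"
      then have u1: "1 \<le> real u" "real u \<le> K" using K by (auto simp: le_nat_iff le_floor_iff)
      define X where "X = N / real u + real u * sqrt (real u) / sqrt N + N * sqrt N / (real u * sqrt (real u))"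
      have X0: "X \<ge> 0" by (simp add: X_def)
      have cond: "C1 * \<Lambda> powr c1 * real u \<le> real N"
      proof -
        have "C1 * \<Lambda> powr c1 \<le> C * \<Lambda> powr c" unfolding C_def c_def using C1 \<Lambda> g by (intro mult_mono powr_mono) auto
        then have "C1 * \<Lambda> powr c1 \<le> real N powr (1/20)" using big by linarith
        then have "C1 * \<Lambda> powr c1 * real u \<le> real N powr (1/20) * real N powr (7/10)"
          using u1 C1 unfolding K_def by (intro mult_mono) auto
        also have "\<dots> \<le> real N powr 1" unfolding powr_add[symmetric] using N0 by (intro powr_mono) auto
        finally show ?thesis using N0 by simp
      qed
      have "(\<Sum>v\<in>{1..V u}. real (card (near_sol g P N (real u) (real v)))) \<le> (\<Sum>v\<in>{1..V u}. C1 * \<Lambda> powr c1 * X)"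
        unfolding P_def X_def using ns[OF N \<Lambda> u1(1) _ cond] by (intro sum_mono) auto
      also have "\<dots> = real (V u) * (C1 * \<Lambda> powr c1 * X)" by simp
      also have "\<dots> \<le> (2 * \<Lambda> powr g * real u) * (C1 * \<Lambda> powr c1 * X)"
        using X0 C1 by (intro mult_right_mono) (auto simp: V_def)
      finally show "(\<Sum>v\<in>{1..V u}. real (card (near_sol g P N (real u) (real v)))) \<le>
         2 * \<Lambda> powr g * C1 * \<Lambda> powr c1 * (real u * (N / real u + real u * sqrt (real u) / sqrt N + N * sqrt N / (real u * sqrt (real u))))"
        unfolding X_def[symmetric] by (simp add: mult_ac)
    qed
    also have "\<dots> = 2 * \<Lambda> powr g * C1 * \<Lambda> powr c1 * (\<Sum>u\<in>{1..nat \<lfloor>K\<rfloor>}. real u * (N / real u + real u * sqrt (real u) / sqrt N + N * sqrt N / (real u * sqrt (real u))))"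
      by (simp only: sum_distrib_left)
    also have "\<dots> \<le> 2 * \<Lambda> powr g * C1 * \<Lambda> powr c1 * (N * K + K ^ 3 * sqrt K / sqrt N + 2 * N * sqrt N * sqrt K)"
      using C1 by (intro mult_left_mono sum_gap_terms_le N K) auto
    \<comment> \<open>For K = N^(7/10) the three exponents are 17/10, 39/20 and 37/20.\<close>
    also have "\<dots> \<le> 2 * \<Lambda> powr g * C1 * \<Lambda> powr c1 * (4 * real N powr (39/20))"
    proof (rule mult_left_mono)
      have mono: "real N powr a \<le> real N powr (39/20)" if "a \<le> 39/20" for a using N0 that by (intro powr_mono) auto
      have 1: "real N * K \<le> real N powr (39/20)"
      proof -
        have "real N * K = real N powr (1 + 7/10)" unfolding K_def powr_add using N0 by simp
        also have "\<dots> \<le> real N powr (39/20)" by (rule mono) simp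
        finally show ?thesis .
      qed
      have sK: "sqrt K = real N powr (7/20)" unfolding K_def using sqrt_powr[of N "7/10"] N0 by simp
      have sN: "sqrt (real N) = real N powr (1/2)" using N0 by (simp add: powr_half_sqrt)
      have 2: "K ^ 3 * sqrt K / sqrt N \<le> real N powr (39/20)"
      proof -
        have "K ^ 3 = real N powr (21/10)" using N0 by (simp add: K_def powr_power)
        then have "K ^ 3 * sqrt K / sqrt N = real N powr (21/10 + 7/20 - 1/2)" unfolding sK sN by (simp only: powr_add powr_diff)
        then show ?thesis by simp
      qed
      have 3: "2 * N * sqrt N * sqrt K \<le> 2 * real N powr (39/20)"
      proof -
        have "real N * sqrt N * sqrt K = real N powr 1 * real N powr (1/2) * real N powr (7/20)" unfolding sK sN using N0 by simp
        also have "\<dots> = real N powr (1 + 1/2 + 7/20)" by (simp only: powr_add)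
        also have "\<dots> \<le> real N powr (39/20)" by (rule mono) simp
        finally show ?thesis by (simp add: mult_ac)
      qed
      show "N * K + K ^ 3 * sqrt K / sqrt N + 2 * N * sqrt N * sqrt K \<le> 4 * real N powr (39/20)"
        using 1 2 3 by simp
    qed (use C1 in auto)
    also have "\<dots> = C * \<Lambda> powr c * real N powr (39/20)" by (simp add: C_def c_def powr_add mult_ac)
    also have "\<dots> \<le> real N powr (1/20) * real N powr (39/20)" using big by (intro mult_right_mono) auto
    also have "\<dots> = (real N)\<^sup>2" using N0 by (simp flip: powr_add)
    also have "\<dots> \<le> C * (real N)\<^sup>2" using Cc mult_right_mono[of 1 C "(real N)\<^sup>2"] by simp
    finally show ?thesis unfolding S_def P_def K_def .
  qed
  show ?thesis by (rule that[OF Cc main])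
qed

text \<open>The gap principle: splitting the range of \<open>n\<close> into intervals of length \<open>K = N\<^bsup>7/10\<^esup>\<close> costs
  a factor \<open>N / K\<close> in the energy, by Cauchy--Schwarz, and leaves only pairs with \<open>|n - n'| \<le> K\<close>.\<close>

lemma energy_bound_curved:
  fixes g :: real
  assumes g: "g > 0" "g \<noteq> 1"
  obtains C c :: real where "C \<ge> 1" "c \<ge> 0"
    "\<And>N \<Lambda>. N \<ge> 1 \<Longrightarrow> \<Lambda> \<ge> 1 \<Longrightarrow> C * \<Lambda> powr c \<le> real N powr (1/20) \<Longrightarrow>
      real (card {(p, q) \<in> good_pairs (N / \<Lambda>) N \<times> good_pairs (N / \<Lambda>) N.
         \<lfloor>pdiff (g + 1) p / real N powr (g - 1)\<rfloor> = \<lfloor>pdiff (g + 1) q / real N powr (g - 1)\<rfloor>}) \<le> C * real N powr (23/10)"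
proof -
  obtain C1 c1 :: real where C1: "C1 \<ge> 1" "c1 \<ge> 0" and
    cp: "\<And>N \<Lambda>. N \<ge> 1 \<Longrightarrow> \<Lambda> \<ge> 1 \<Longrightarrow> C1 * \<Lambda> powr c1 \<le> real N powr (1/20) \<Longrightarrow>
      real (card {((n, m), (n', m')). (n, m) \<in> good_pairs (N / \<Lambda>) N \<and> (n', m') \<in> good_pairs (N / \<Lambda>) N \<and> n < n' \<and>
          real n' - real n \<le> real N powr (7/10) \<and>
          \<bar>pdiff (g + 1) (n, m) - pdiff (g + 1) (n', m')\<bar> < real N powr (g - 1)}) \<le> C1 * (real N)\<^sup>2"
    using close_pairs_bound[OF g] by blast
  define C where "C = 6 * C1"
  define c where "c = c1 + g"
  have Cc: "C \<ge> 1" "c \<ge> 0" using C1 g by (auto simp: C_def c_def)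
  have main: "real (card {(p, q) \<in> good_pairs (N / \<Lambda>) N \<times> good_pairs (N / \<Lambda>) N.
         \<lfloor>pdiff (g + 1) p / real N powr (g - 1)\<rfloor> = \<lfloor>pdiff (g + 1) q / real N powr (g - 1)\<rfloor>}) \<le> C * real N powr (23/10)"
    if N: "N \<ge> 1" and \<Lambda>: "\<Lambda> \<ge> 1" and big: "C * \<Lambda> powr c \<le> real N powr (1/20)" for N :: nat and \<Lambda> :: real
  proof -
    define P where "P = real N / \<Lambda>"
    have N0: "real N > 0" "real N \<ge> 1" using N by auto
    have P: "P > 0" using \<Lambda> N0 by (simp add: P_def)
    define K where "K = real N powr (7/10)"
    have K: "K > 0" using N0 by (simp add: K_def)
    define D where "D = real N powr (g - 1)"
    have D: "D > 0" using N0 by (simp add: D_def)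
    define G where "G = good_pairs P N"
    have finG: "finite G" unfolding G_def by (rule finite_good_pairs[OF P])
    define bin where "bin p = \<lfloor>pdiff (g + 1) p / D\<rfloor>" for p
    define box where "box p = nat \<lfloor>real (fst p) / K\<rfloor>" for p :: "nat \<times> nat"
    have cond: "C1 * \<Lambda> powr c1 \<le> real N powr (1/20)"
    proof -
      have "C1 * \<Lambda> powr c1 \<le> C * \<Lambda> powr c" unfolding C_def c_def using C1 \<Lambda> g by (intro mult_mono powr_mono) auto
      then show ?thesis using big by linarith
    qed
    have \<Lambda>gN: "\<Lambda> powr g \<le> real N"
    proof -
      have "\<Lambda> powr g \<le> \<Lambda> powr c" unfolding c_def using \<Lambda> C1 by (intro powr_mono) auto
      also have "\<dots> \<le> C * \<Lambda> powr c" using mult_right_mono[OF Cc(1), of "\<Lambda> powr c"] by simp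
      also have "\<dots> \<le> real N powr (1/20)" by (rule big)
      also have "\<dots> \<le> real N powr 1" using N0 by (intro powr_mono) auto
      finally show ?thesis using N0 by simp
    qed
    have gap: "D \<le> P powr g"
    proof -
      have "D = real N powr g / N" using N0 by (simp add: D_def powr_diff)
      also have "\<dots> \<le> real N powr g / \<Lambda> powr g" using \<Lambda>gN \<Lambda> N0 by (intro divide_left_mono) auto
      finally show ?thesis using \<Lambda> by (simp add: P_def powr_divide)
    qed
    have binD: "\<bar>pdiff (g + 1) p - pdiff (g + 1) q\<bar> < D" if "bin p = bin q" for p q
    proof -
      have "\<bar>pdiff (g + 1) p / D - pdiff (g + 1) q / D\<bar> < 1" using that unfolding bin_def by linarith
      then have "\<bar>(pdiff (g + 1) p - pdiff (g + 1) q) / D\<bar> < 1" by (simp add: diff_divide_distrib)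
      then show ?thesis using D by (simp add: abs_divide)
    qed
    have boxK: "real (fst q) - real (fst p) \<le> K" if "box p = box q" for p q
    proof -
      have "0 \<le> real (fst p) / K" "0 \<le> real (fst q) / K" using K by auto
      then have "\<lfloor>real (fst p) / K\<rfloor> = \<lfloor>real (fst q) / K\<rfloor>" using that unfolding box_def by (simp add: nat_eq_iff2)
      then have "real (fst q) / K - real (fst p) / K \<le> 1" by linarith
      then have "(real (fst q) - real (fst p)) / K \<le> 1" by (simp add: diff_divide_distrib)
      then show ?thesis using K by (simp add: field_simps)
    qed
    define W where "W = {((n, m), (n', m')). (n, m) \<in> G \<and> (n', m') \<in> G \<and> n < n' \<and>
          real n' - real n \<le> K \<and> \<bar>pdiff (g + 1) (n, m) - pdiff (g + 1) (n', m')\<bar> < D}"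
    have finW: "finite W" by (rule finite_subset[of _ "G \<times> G"]) (auto simp: W_def finG)
    have W: "real (card W) \<le> C1 * (real N)\<^sup>2" unfolding W_def G_def P_def K_def D_def by (rule cp[OF N \<Lambda> cond])
    \<comment> \<open>Close pairs with equal n coincide by the spacing of powers; all others lie in
      \<open>W\<close> up to order.\<close>
    have sub: "{(p, q) \<in> G \<times> G. bin p = bin q \<and> box p = box q} \<subseteq> (\<lambda>p. (p, p)) ` G \<union> W \<union> (\<lambda>(p, q). (q, p)) ` W"
    proof clarify
      fix n m n' m'
      assume *: "(n, m) \<in> G" "(n', m') \<in> G" "bin (n, m) = bin (n', m')" "box (n, m) = box (n', m')"
        "((n, m), n', m') \<notin> (\<lambda>(p, q). (q, p)) ` W" "((n, m), n', m') \<notin> W"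
      have nW: "\<not> n < n'" using * binD[OF *(3)] boxK[OF *(4)] by (auto simp: W_def)
      have nW': "\<not> n' < n"
      proof
        assume "n' < n"
        then have "((n', m'), (n, m)) \<in> W" using * binD[OF *(3)[symmetric]] boxK[OF *(4)[symmetric]] by (auto simp: W_def)
        then show False using *(5) by force
      qed
      then have n: "n = n'" using nW by simp
      have mP: "P \<le> real m" "P \<le> real m'" using * by (auto simp: G_def good_pairs_def)
      have cl: "\<bar>real m powr (g + 1) - real m' powr (g + 1)\<bar> < D" using binD[OF *(3)] n by (simp add: pdiff_def abs_minus_commute)
      have "m = m'"
      proof (cases m m' rule: linorder_cases)
        case less
        from powr_diff_ge[OF g(1) P mP(1) less] gap cl show ?thesis by linarith
      next
        case greater
        from powr_diff_ge[OF g(1) P mP(2) greater] gap cl show ?thesis by linarith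
      qed
      then show "((n, m), n', m') \<in> (\<lambda>p. (p, p)) ` G" using n * by auto
    qed
    have "card {(p, q) \<in> G \<times> G. bin p = bin q \<and> box p = box q} \<le> card ((\<lambda>p. (p, p)) ` G \<union> W \<union> (\<lambda>(p, q). (q, p)) ` W)"
      using finG finW by (intro card_mono sub) auto
    also have "\<dots> \<le> card ((\<lambda>p. (p, p)) ` G) + card W + card ((\<lambda>(p, q). (q, p)) ` W)"
      by (intro order_trans[OF card_Un_le] add_mono card_Un_le order_refl)
    also have "\<dots> \<le> card G + card W + card W" using finG finW by (intro add_mono card_image_le order_refl)
    finally have "real (card {(p, q) \<in> G \<times> G. bin p = bin q \<and> box p = box q}) \<le> real (card G) + 2 * real (card W)" by linarith
    also have "\<dots> \<le> (real N)\<^sup>2 + 2 * (C1 * (real N)\<^sup>2)"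
    proof (intro add_mono mult_left_mono W)
      have "real (card G) \<le> real (N * N)" unfolding G_def by (simp only: of_nat_le_iff card_good_pairs_le[OF P])
      then show "real (card G) \<le> (real N)\<^sup>2" by (simp add: power2_eq_square)
    qed simp
    also have "\<dots> \<le> 3 * C1 * (real N)\<^sup>2" using C1 mult_right_mono[of 1 C1 "(real N)\<^sup>2"] by simp
    finally have E1: "real (card {(p, q) \<in> G \<times> G. bin p = bin q \<and> box p = box q}) \<le> 3 * C1 * (real N)\<^sup>2" .
    define M where "M = Suc (nat \<lfloor>real N / K\<rfloor>)"
    have cardbox: "card (box ` G) \<le> M"
    proof -
      have "box ` G \<subseteq> {..nat \<lfloor>real N / K\<rfloor>}"
        using K by (auto simp: box_def G_def good_pairs_def intro!: nat_mono floor_mono divide_right_mono)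
      from card_mono[OF _ this] show ?thesis by (simp add: M_def)
    qed
    have M: "real M \<le> 2 * real N powr (3/10)"
    proof -
      have NK: "real N / K = real N powr (3/10)" using N0 powr_diff[of N 1 "7/10"] by (simp add: K_def)
      have "real M \<le> real N powr (3/10) + 1" unfolding M_def NK by simp
      moreover have "1 \<le> real N powr (3/10)" using N0 by (intro ge_one_powr_ge_zero) auto
      ultimately show ?thesis by linarith
    qed
    have "real (card {(p, q) \<in> G \<times> G. bin p = bin q}) \<le> real M * real (card {(p, q) \<in> G \<times> G. bin p = bin q \<and> box p = box q})"
      by (rule card_pairs_same_refine[OF finG cardbox])
    also have "\<dots> \<le> (2 * real N powr (3/10)) * (3 * C1 * (real N)\<^sup>2)" using M E1 by (intro mult_mono) auto
    also have "\<dots> = C * (real N powr (3/10) * real N powr 2)" using N0 by (simp add: C_def)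
    also have "\<dots> = C * real N powr (23/10)" unfolding powr_add[symmetric] by simp
    finally show ?thesis unfolding bin_def D_def G_def P_def .
  qed
  show ?thesis by (rule that[OF Cc main])
qed

lemma energy_bound:
  fixes g :: real
  assumes g: "g > 0"
  obtains C c :: real where "C \<ge> 1" "c \<ge> 0"
    "\<And>N \<Lambda>. N \<ge> 1 \<Longrightarrow> \<Lambda> \<ge> 1 \<Longrightarrow> C * \<Lambda> powr c \<le> real N powr (1/20) \<Longrightarrow>
      real (card {(p, q) \<in> good_pairs (N / \<Lambda>) N \<times> good_pairs (N / \<Lambda>) N.
         \<lfloor>pdiff (g + 1) p / real N powr (g - 1)\<rfloor> = \<lfloor>pdiff (g + 1) q / real N powr (g - 1)\<rfloor>}) \<le> C * real N powr (23/10)"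
proof (cases "g = 1")
  case True
  obtain C :: real where C: "C \<ge> 1" "\<And>N P. N \<ge> 1 \<Longrightarrow> P > 0 \<Longrightarrow>
    real (card {(p, q) \<in> good_pairs P N \<times> good_pairs P N. \<lfloor>pdiff 2 p\<rfloor> = \<lfloor>pdiff 2 q\<rfloor>}) \<le> C * real N powr (23/10)"
    using energy_bound_square by blast
  show ?thesis
  proof (rule that[of C 0])
    fix N :: nat and \<Lambda> :: real assume "N \<ge> 1" "\<Lambda> \<ge> 1"
    then show "real (card {(p, q) \<in> good_pairs (N / \<Lambda>) N \<times> good_pairs (N / \<Lambda>) N.
         \<lfloor>pdiff (g + 1) p / real N powr (g - 1)\<rfloor> = \<lfloor>pdiff (g + 1) q / real N powr (g - 1)\<rfloor>}) \<le> C * real N powr (23/10)"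
      using C(2)[of N "N / \<Lambda>"] True by simp
  qed (use C in auto)
next
  case False
  show ?thesis by (rule energy_bound_curved[OF g False], rule that)
qed

section \<open>Gaussian averages of Dirichlet blocks\<close>

lemma normal_density_cos:
  assumes "\<sigma> > 0"
  shows "integrable lborel (\<lambda>t. normal_density 0 \<sigma> t * cos (z * t))"
    and "(\<integral>t. normal_density 0 \<sigma> t * cos (z * t) \<partial>lborel) = exp (- (\<sigma> * z)\<^sup>2 / 2)"
proof -
  show int: "integrable lborel (\<lambda>t. normal_density 0 \<sigma> t * cos (z * t))" for z
    by (rule Bochner_Integration.integrable_bound[OF integrable_normal_density[OF assms, of 0]])
       (auto simp: abs_mult intro!: AE_I2 mult_left_le)
  have std: "(\<integral>x. std_normal_density x * cos (s * x) \<partial>lborel) = exp (- s\<^sup>2 / 2)" for s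
  proof -
    have i: "integrable std_normal_distribution (\<lambda>x. iexp (s * x))"
      using real_dist_normal_dist unfolding real_distribution_def prob_space_def
      by (intro finite_measure.integrable_const_bound[where B = 1]) auto
    have "complex_of_real (exp (- (s\<^sup>2) / 2)) = (CLINT x|std_normal_distribution. iexp (s * x))"
      using char_std_normal_distribution by (simp add: char_def fun_eq_iff)
    then have "exp (- s\<^sup>2 / 2) = Re (CLINT x|std_normal_distribution. iexp (s * x))" by (metis Re_complex_of_real)
    also have "\<dots> = (LINT x|std_normal_distribution. cos (s * x))"
      using integral_Re[OF i] by (simp add: Re_exp)
    also have "\<dots> = (\<integral>x. std_normal_density x * cos (s * x) \<partial>lborel)"
      by (subst integral_density) auto
    finally show ?thesis by simp
  qed
  have "(\<integral>t. normal_density 0 \<sigma> t * cos (z * t) \<partial>lborel) = \<bar>\<sigma>\<bar> *\<^sub>R (\<integral>x. normal_density 0 \<sigma> (0 + \<sigma> * x) * cos (z * (0 + \<sigma> * x)) \<partial>lborel)"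
    using assms by (intro lborel_integral_real_affine) auto
  also have "\<dots> = \<bar>\<sigma>\<bar> *\<^sub>R (\<integral>x. 1 / \<sigma> * (std_normal_density x * cos (\<sigma> * z * x)) \<partial>lborel)"
    using assms by (simp add: normal_density_def real_sqrt_mult power_mult_distrib mult_ac del: Bochner_Integration.integral_mult_right_zero Bochner_Integration.integral_divide_zero Bochner_Integration.integral_mult_left_zero)
  also have "\<dots> = (\<integral>x. std_normal_density x * cos (\<sigma> * z * x) \<partial>lborel)"
    using assms by (subst integral_mult_right_zero) simp
  also have "\<dots> = exp (- (\<sigma> * z)\<^sup>2 / 2)" by (rule std)
  finally show "(\<integral>t. normal_density 0 \<sigma> t * cos (z * t) \<partial>lborel) = exp (- (\<sigma> * z)\<^sup>2 / 2)" .
qed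

text \<open>By \<open>gauss_pair_sum_integral\<close> this is the mean of the squared modulus of the
  sum of cis (t y_i) over a normal t of deviation \<sigma>. It acts as a smooth count of pairs
  within 1 / \<sigma>.\<close>

definition gauss_pair_sum :: "real \<Rightarrow> ('a \<Rightarrow> real) \<Rightarrow> 'a set \<Rightarrow> real" where
  "gauss_pair_sum \<sigma> y A = (\<Sum>i\<in>A. \<Sum>k\<in>A. exp (- (\<sigma> * (y i - y k))\<^sup>2 / 2))"

lemma norm_sum_cis_squared:
  "(norm (\<Sum>i\<in>A. cis (f i)))\<^sup>2 = (\<Sum>i\<in>A. \<Sum>k\<in>A. cos (f i - f k))"
proof -
  have "complex_of_real ((norm (\<Sum>i\<in>A. cis (f i)))\<^sup>2) = (\<Sum>i\<in>A. \<Sum>k\<in>A. cis (f i - f k))"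
    unfolding complex_norm_square by (simp add: sum_product cis_cnj cis_mult)
  then have "Re (complex_of_real ((norm (\<Sum>i\<in>A. cis (f i)))\<^sup>2)) = Re (\<Sum>i\<in>A. \<Sum>k\<in>A. cis (f i - f k))"
    by (rule arg_cong)
  then show ?thesis by simp
qed

lemma gauss_pair_sum_integral:
  assumes "\<sigma> > 0"
  shows "integrable lborel (\<lambda>t. normal_density 0 \<sigma> t * (norm (\<Sum>i\<in>A. cis (t * y i)))\<^sup>2)"
    and "(\<integral>t. normal_density 0 \<sigma> t * (norm (\<Sum>i\<in>A. cis (t * y i)))\<^sup>2 \<partial>lborel) = gauss_pair_sum \<sigma> y A"
proof -
  have e: "normal_density 0 \<sigma> t * (norm (\<Sum>i\<in>A. cis (t * y i)))\<^sup>2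
     = (\<Sum>i\<in>A. \<Sum>k\<in>A. normal_density 0 \<sigma> t * cos ((y i - y k) * t))" for t
    by (simp add: norm_sum_cis_squared sum_distrib_left algebra_simps)
  show "integrable lborel (\<lambda>t. normal_density 0 \<sigma> t * (norm (\<Sum>i\<in>A. cis (t * y i)))\<^sup>2)"
    unfolding e using normal_density_cos(1)[OF assms] by (intro Bochner_Integration.integrable_sum)
  show "(\<integral>t. normal_density 0 \<sigma> t * (norm (\<Sum>i\<in>A. cis (t * y i)))\<^sup>2 \<partial>lborel) = gauss_pair_sum \<sigma> y A"
    unfolding e gauss_pair_sum_def using normal_density_cos[OF assms]
    by (subst Bochner_Integration.integral_sum, force intro: Bochner_Integration.integrable_sum,
        subst Bochner_Integration.integral_sum) auto
qed

text \<open>Over a product set the exponential sum factorises, so a pointwise majorant of density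
  times the squared first factor can be inserted under the integral, leaving mean squares of the
  second factor alone.\<close>

lemma gauss_pair_sum_product_le:
  fixes a :: "'a \<Rightarrow> real" and b :: "'b \<Rightarrow> real"
  assumes T: "T > 0" "t1 > 0" "T2 > 0" and c: "c1 \<ge> 0" "c2 \<ge> 0"
    and bd: "\<And>t. normal_density 0 T t * (norm (\<Sum>j\<in>A. cis (t * a j)))\<^sup>2 \<le> c1 * normal_density 0 t1 t + c2 * normal_density 0 T2 t"
  shows "gauss_pair_sum T (\<lambda>(j, p). a j + b p) (A \<times> G) \<le> c1 * gauss_pair_sum t1 b G + c2 * gauss_pair_sum T2 b G"
proof -
  define P where "P t = (norm (\<Sum>p\<in>G. cis (t * b p)))\<^sup>2" for t
  have sp: "(norm (\<Sum>i\<in>A \<times> G. cis (t * (case i of (j, p) \<Rightarrow> a j + b p))))\<^sup>2 = (norm (\<Sum>j\<in>A. cis (t * a j)))\<^sup>2 * P t" for t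
  proof -
    have "(\<Sum>i\<in>A \<times> G. cis (t * (case i of (j, p) \<Rightarrow> a j + b p))) = (\<Sum>j\<in>A. cis (t * a j)) * (\<Sum>p\<in>G. cis (t * b p))"
      by (simp add: sum_product sum.cartesian_product cis_mult distrib_left split_def)
    then show ?thesis by (simp add: norm_mult power_mult_distrib P_def)
  qed
  have "gauss_pair_sum T (\<lambda>(j, p). a j + b p) (A \<times> G) = (\<integral>t. normal_density 0 T t * ((norm (\<Sum>j\<in>A. cis (t * a j)))\<^sup>2 * P t) \<partial>lborel)"
    using gauss_pair_sum_integral(2)[OF T(1), of "\<lambda>(j, p). a j + b p" "A \<times> G"] by (simp add: sp)
  also have "\<dots> \<le> (\<integral>t. c1 * (normal_density 0 t1 t * P t) + c2 * (normal_density 0 T2 t * P t) \<partial>lborel)"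
  proof (rule integral_mono)
    show "integrable lborel (\<lambda>t. normal_density 0 T t * ((norm (\<Sum>j\<in>A. cis (t * a j)))\<^sup>2 * P t))"
      using gauss_pair_sum_integral(1)[OF T(1), of "\<lambda>(j, p). a j + b p" "A \<times> G"] by (simp add: sp)
    show "integrable lborel (\<lambda>t. c1 * (normal_density 0 t1 t * P t) + c2 * (normal_density 0 T2 t * P t))"
      unfolding P_def by (intro Bochner_Integration.integrable_add integrable_mult_right gauss_pair_sum_integral(1) T)
    fix t
    have "normal_density 0 T t * (norm (\<Sum>j\<in>A. cis (t * a j)))\<^sup>2 * P t \<le> (c1 * normal_density 0 t1 t + c2 * normal_density 0 T2 t) * P t"
      by (intro mult_right_mono bd) (simp add: P_def)
    then show "normal_density 0 T t * ((norm (\<Sum>j\<in>A. cis (t * a j)))\<^sup>2 * P t) \<le> c1 * (normal_density 0 t1 t * P t) + c2 * (normal_density 0 T2 t * P t)"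
      by (simp add: algebra_simps)
  qed
  also have "\<dots> = c1 * gauss_pair_sum t1 b G + c2 * gauss_pair_sum T2 b G"
    unfolding P_def
    by (subst Bochner_Integration.integral_add[OF integrable_mult_right[OF gauss_pair_sum_integral(1)[OF T(2)]] integrable_mult_right[OF gauss_pair_sum_integral(1)[OF T(3)]]])
       (simp add: gauss_pair_sum_integral(2) T)
  finally show ?thesis .
qed

text \<open>A bound for the Gaussian kernel at points whose bins differ by k, with r the ratio of
  bin width to Gaussian width. Such points are at least |k| - 1 bin widths apart; for equal bins
  this is negative, hence the truncation at 0.\<close>

definition bin_kernel :: "real \<Rightarrow> int \<Rightarrow> real" where
  "bin_kernel r k = exp (- (max (real_of_int \<bar>k\<bar> - 1) 0 * r)\<^sup>2 / 2)"

text \<open>The arctangent serves as a bounded telescoping majorant: exp (- z^2 / 2) \<le> 2 / (1 +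
  z^2), twice the derivative of arctan.\<close>

lemma sum_exp_square_le:
  assumes r: "r > 0"
  shows "(\<Sum>j\<in>{1..n::nat}. exp (- (real j * r)\<^sup>2 / 2)) \<le> 4 / r"
proof -
  have step: "exp (- (real (Suc j) * r)\<^sup>2 / 2) \<le> 2 / r * (arctan (real (Suc j) * r) - arctan (real j * r))" for j
  proof -
    define z where "z = real (Suc j) * r"
    have lt: "real j * r < z" using r by (simp add: z_def)
    obtain x where x: "real j * r < x" "x < z" "arctan z - arctan (real j * r) = (z - real j * r) * inverse (1 + x\<^sup>2)"
      using MVT2[OF lt, of arctan "\<lambda>x. inverse (1 + x\<^sup>2)"] DERIV_arctan by blast
    have "1 + z\<^sup>2 / 2 \<le> exp (z\<^sup>2 / 2)" by (rule exp_ge_add_one_self)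
    moreover have "(1 + z\<^sup>2) / 2 = 1 / 2 + z\<^sup>2 / 2" by (rule add_divide_distrib)
    ultimately have "(1 + z\<^sup>2) / 2 \<le> exp (z\<^sup>2 / 2)" by linarith
    then have "inverse (exp (z\<^sup>2 / 2)) \<le> inverse ((1 + z\<^sup>2) / 2)" by (intro le_imp_inverse_le) (auto intro: add_pos_nonneg)
    then have "exp (- z\<^sup>2 / 2) \<le> 2 * inverse (1 + z\<^sup>2)" by (simp add: exp_minus inverse_eq_divide)
    also have "0 \<le> real j * r" using r by simp
    then have "x\<^sup>2 \<le> z\<^sup>2" using x by (intro power_mono) auto
    then have "2 * inverse (1 + z\<^sup>2) \<le> 2 * inverse (1 + x\<^sup>2)" by (intro mult_left_mono le_imp_inverse_le) (auto intro: add_pos_nonneg)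
    also have "\<dots> = 2 / r * (arctan z - arctan (real j * r))" unfolding x(3) using r by (simp add: z_def algebra_simps)
    finally show ?thesis by (simp add: z_def)
  qed
  have "(\<Sum>j\<in>{1..n}. exp (- (real j * r)\<^sup>2 / 2)) \<le> 2 / r * arctan (real n * r)"
  proof (induction n)
    case (Suc n)
    then show ?case using step[of n] by (simp add: right_diff_distrib)
  qed simp
  also have "\<dots> \<le> 2 / r * 2" using r arctan_ubound[of "real n * r"] pi_less_4 by (intro mult_left_mono) auto
  finally show ?thesis by simp
qed

text \<open>The bins -1, 0, 1 contribute 1 each, the others two copies of
  \<open>sum_exp_square_le\<close>.\<close>

lemma sum_bin_kernel_le:
  assumes r: "r > 0" and B: "finite B"
  shows "(\<Sum>k\<in>B. bin_kernel r k) \<le> 8 * (1 + 1 / r)"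
proof -
  obtain n :: nat where n: "\<And>k. k \<in> B \<Longrightarrow> \<bar>k\<bar> \<le> int n + 1"
  proof -
    have "\<bar>k\<bar> \<le> int (nat (Max ((\<lambda>k. \<bar>k\<bar>) ` insert 0 B))) + 1" if "k \<in> B" for k
    proof -
      have "\<bar>k\<bar> \<le> Max ((\<lambda>k. \<bar>k\<bar>) ` insert 0 B)" using B that by (intro Max_ge) auto
      then show ?thesis by linarith
    qed
    then show ?thesis using that by blast
  qed
  have k0: "bin_kernel r k \<ge> 0" for k by (simp add: bin_kernel_def)
  define Ep where "Ep = (\<lambda>j::nat. int j + 1) ` {1..n}"
  define Em where "Em = (\<lambda>j::nat. - (int j + 1)) ` {1..n}"
  have sub: "B \<subseteq> {-1, 0, 1} \<union> (Ep \<union> Em)"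
  proof
    fix k assume "k \<in> B"
    then have k: "\<bar>k\<bar> \<le> int n + 1" by (rule n)
    show "k \<in> {-1, 0, 1} \<union> (Ep \<union> Em)"
    proof (cases "\<bar>k\<bar> \<le> 1")
      case False
      then have "k = int (nat (\<bar>k\<bar> - 1)) + 1 \<or> k = - (int (nat (\<bar>k\<bar> - 1)) + 1)" "nat (\<bar>k\<bar> - 1) \<in> {1..n}" using k by auto
      then show ?thesis unfolding Ep_def Em_def by blast
    qed auto
  qed
  have e: "bin_kernel r (int j + 1) = exp (- (real j * r)\<^sup>2 / 2)" "bin_kernel r (- (int j + 1)) = exp (- (real j * r)\<^sup>2 / 2)" for j :: nat
    by (simp_all add: bin_kernel_def)
  have un: "(\<Sum>k\<in>X \<union> Y. bin_kernel r k) \<le> (\<Sum>k\<in>X. bin_kernel r k) + (\<Sum>k\<in>Y. bin_kernel r k)" if "finite X" "finite Y" for X Y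
    using sum.union_inter[OF that, of "bin_kernel r"] sum_nonneg[of "X \<inter> Y" "bin_kernel r"] k0 by auto
  have 1: "(\<Sum>k\<in>B. bin_kernel r k) \<le> (\<Sum>k\<in>{-1, 0, 1} \<union> (Ep \<union> Em). bin_kernel r k)"
    by (rule sum_mono2[OF _ sub]) (auto simp: Ep_def Em_def k0)
  have 2: "(\<Sum>k\<in>{-1, 0, 1} \<union> (Ep \<union> Em). bin_kernel r k) \<le> (\<Sum>k\<in>{-1, 0, 1}. bin_kernel r k) + (\<Sum>k\<in>Ep \<union> Em. bin_kernel r k)"
    by (rule un) (auto simp: Ep_def Em_def)
  have 3: "(\<Sum>k\<in>Ep \<union> Em. bin_kernel r k) \<le> (\<Sum>k\<in>Ep. bin_kernel r k) + (\<Sum>k\<in>Em. bin_kernel r k)"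
    by (rule un) (auto simp: Ep_def Em_def)
  have 4: "(\<Sum>k\<in>Ep. bin_kernel r k) = (\<Sum>j\<in>{1..n}. exp (- (real j * r)\<^sup>2 / 2))"
    unfolding Ep_def by (subst sum.reindex) (auto simp: inj_on_def e)
  have 5: "(\<Sum>k\<in>Em. bin_kernel r k) = (\<Sum>j\<in>{1..n}. exp (- (real j * r)\<^sup>2 / 2))"
    unfolding Em_def by (subst sum.reindex) (auto simp: inj_on_def e simp del: minus_add_distrib)
  have 6: "(\<Sum>k\<in>{-1, 0, 1::int}. bin_kernel r k) = 3" by (simp add: bin_kernel_def)
  have "(\<Sum>k\<in>B. bin_kernel r k) \<le> 3 + 2 * (4 / r)"
    using 1 2 3 4 5 6 sum_exp_square_le[OF r, of n] by linarith
  then show ?thesis by simp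
qed

lemma exp_le_bin_kernel:
  fixes x y D w :: real
  assumes D: "D > 0" and w: "w > 0"
  shows "exp (- ((x - y) / w)\<^sup>2 / 2) \<le> bin_kernel (D / w) (\<lfloor>x / D\<rfloor> - \<lfloor>y / D\<rfloor>)"
proof -
  have "real_of_int \<bar>\<lfloor>x / D\<rfloor> - \<lfloor>y / D\<rfloor>\<bar> - 1 \<le> \<bar>x / D - y / D\<bar>" by linarith
  then have "max (real_of_int \<bar>\<lfloor>x / D\<rfloor> - \<lfloor>y / D\<rfloor>\<bar> - 1) 0 \<le> \<bar>x - y\<bar> / D"
    using D by (simp add: diff_divide_distrib[symmetric] abs_divide)
  then have "max (real_of_int \<bar>\<lfloor>x / D\<rfloor> - \<lfloor>y / D\<rfloor>\<bar> - 1) 0 * (D / w) \<le> \<bar>x - y\<bar> / D * (D / w)"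
    using D w by (intro mult_right_mono) auto
  also have "\<dots> = \<bar>(x - y) / w\<bar>" using D w by (simp add: abs_divide)
  finally have "(max (real_of_int \<bar>\<lfloor>x / D\<rfloor> - \<lfloor>y / D\<rfloor>\<bar> - 1) 0 * (D / w))\<^sup>2 \<le> \<bar>(x - y) / w\<bar>\<^sup>2"
    using D w by (intro power_mono) auto
  then show ?thesis unfolding bin_kernel_def power2_abs by simp
qed

text \<open>Schur's test: after grouping by bins, r_k r_l \<le> (r_k^2 + r_l^2) / 2 and symmetry
  reduce the double sum to the sum of r_k^2, the number of coinciding pairs, times a row sum of the
  kernel.\<close>

lemma gauss_pairs_le_bins:
  fixes x :: "'a \<Rightarrow> real"
  assumes G: "finite G" and D: "D > 0" and w: "w > 0"
  shows "(\<Sum>p\<in>G. \<Sum>q\<in>G. exp (- ((x p - x q) / w)\<^sup>2 / 2))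
     \<le> 8 * (1 + w / D) * real (card {(p, q) \<in> G \<times> G. \<lfloor>x p / D\<rfloor> = \<lfloor>x q / D\<rfloor>})"
proof -
  define b where "b p = \<lfloor>x p / D\<rfloor>" for p
  define B where "B = b ` G"
  have finB: "finite B" using G by (simp add: B_def)
  define r where "r k = real (card {p \<in> G. b p = k})" for k
  have grp: "(\<Sum>p\<in>G. f (b p)) = (\<Sum>k\<in>B. r k * f k)" for f :: "int \<Rightarrow> real"
  proof -
    have "(\<Sum>p\<in>G. f (b p)) = (\<Sum>k\<in>B. \<Sum>p\<in>{p \<in> G. b p = k}. f (b p))"
      unfolding B_def by (rule sum.image_gen[OF G])
    also have "\<dots> = (\<Sum>k\<in>B. r k * f k)" by (intro sum.cong refl) (simp add: r_def)
    finally show ?thesis .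
  qed
  have "(\<Sum>p\<in>G. \<Sum>q\<in>G. exp (- ((x p - x q) / w)\<^sup>2 / 2)) \<le> (\<Sum>p\<in>G. \<Sum>q\<in>G. bin_kernel (D / w) (b p - b q))"
    unfolding b_def by (intro sum_mono exp_le_bin_kernel D w)
  also have "\<dots> = (\<Sum>k\<in>B. \<Sum>l\<in>B. r k * r l * bin_kernel (D / w) (k - l))"
    by (simp add: grp[of "\<lambda>l. bin_kernel (D / w) (b _ - l)"] grp[of "\<lambda>k. \<Sum>l\<in>B. r l * bin_kernel (D / w) (k - l)"] sum_distrib_left mult.assoc)
  also have "\<dots> \<le> (\<Sum>k\<in>B. \<Sum>l\<in>B. ((r k)\<^sup>2 / 2 + (r l)\<^sup>2 / 2) * bin_kernel (D / w) (k - l))"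
  proof (intro sum_mono mult_right_mono)
    fix k l
    have "0 \<le> (r k - r l)\<^sup>2" by simp
    then show "r k * r l \<le> (r k)\<^sup>2 / 2 + (r l)\<^sup>2 / 2" by (simp add: power2_diff)
  qed (simp add: bin_kernel_def)
  also have "\<dots> = (\<Sum>k\<in>B. \<Sum>l\<in>B. (r k)\<^sup>2 / 2 * bin_kernel (D / w) (k - l)) + (\<Sum>k\<in>B. \<Sum>l\<in>B. (r l)\<^sup>2 / 2 * bin_kernel (D / w) (k - l))"
    by (simp only: distrib_right sum.distrib)
  also have "(\<Sum>k\<in>B. \<Sum>l\<in>B. (r l)\<^sup>2 / 2 * bin_kernel (D / w) (k - l)) = (\<Sum>l\<in>B. \<Sum>k\<in>B. (r l)\<^sup>2 / 2 * bin_kernel (D / w) (k - l))"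
    by (rule sum.swap)
  also have "\<dots> = (\<Sum>k\<in>B. \<Sum>l\<in>B. (r k)\<^sup>2 / 2 * bin_kernel (D / w) (k - l))"
    by (intro sum.cong refl) (simp add: bin_kernel_def abs_minus_commute)
  also have "(\<Sum>k\<in>B. \<Sum>l\<in>B. (r k)\<^sup>2 / 2 * bin_kernel (D / w) (k - l)) + \<dots> = (\<Sum>k\<in>B. (r k)\<^sup>2 * (\<Sum>l\<in>B. bin_kernel (D / w) (k - l)))"
    by (simp add: sum_distrib_left flip: sum.distrib)
  also have "\<dots> \<le> (\<Sum>k\<in>B. (r k)\<^sup>2 * (8 * (1 + w / D)))"
  proof (intro sum_mono mult_left_mono)
    fix k
    have "(\<Sum>l\<in>B. bin_kernel (D / w) (k - l)) = (\<Sum>j\<in>(\<lambda>l. k - l) ` B. bin_kernel (D / w) j)"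
      by (subst sum.reindex) (auto simp: inj_on_def)
    also have "\<dots> \<le> 8 * (1 + 1 / (D / w))" using D w finB by (intro sum_bin_kernel_le) auto
    finally show "(\<Sum>l\<in>B. bin_kernel (D / w) (k - l)) \<le> 8 * (1 + w / D)" by simp
  qed simp
  also have "\<dots> = 8 * (1 + w / D) * (\<Sum>k\<in>B. (r k)\<^sup>2)" by (simp only: sum_distrib_right[symmetric] mult.commute)
  also have "(\<Sum>k\<in>B. (r k)\<^sup>2) = real (card {(p, q) \<in> G \<times> G. \<lfloor>x p / D\<rfloor> = \<lfloor>x q / D\<rfloor>})"
    using card_pairs_same[OF G, of b] by (simp add: B_def r_def b_def)
  finally show ?thesis .
qed

text \<open>Bins of width d contain at most one of the points each.\<close>

lemma gauss_separated_le:
  fixes x :: "'a \<Rightarrow> real"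
  assumes A: "finite A" and d: "d > 0" and w: "w > 0"
    and sep: "\<And>i k. i \<in> A \<Longrightarrow> k \<in> A \<Longrightarrow> i \<noteq> k \<Longrightarrow> d \<le> \<bar>x i - x k\<bar>"
  shows "(\<Sum>i\<in>A. exp (- ((c - x i) / w)\<^sup>2 / 2)) \<le> 8 * (1 + w / d)"
proof -
  define b where "b i = \<lfloor>c / d\<rfloor> - \<lfloor>x i / d\<rfloor>" for i
  have inj: "inj_on b A"
  proof (rule inj_onI, rule ccontr)
    fix i k assume *: "i \<in> A" "k \<in> A" "b i = b k" "i \<noteq> k"
    then have "\<bar>x i / d - x k / d\<bar> < 1" unfolding b_def by linarith
    then have "\<bar>x i - x k\<bar> < d" using d by (simp add: diff_divide_distrib[symmetric] abs_divide)
    then show False using sep[OF *(1,2,4)] by simp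
  qed
  have "(\<Sum>i\<in>A. exp (- ((c - x i) / w)\<^sup>2 / 2)) \<le> (\<Sum>i\<in>A. bin_kernel (d / w) (b i))"
    unfolding b_def by (intro sum_mono exp_le_bin_kernel d w)
  also have "\<dots> = (\<Sum>j\<in>b ` A. bin_kernel (d / w) j)" by (simp add: sum.reindex[OF inj])
  also have "\<dots> \<le> 8 * (1 + 1 / (d / w))" using d w A by (intro sum_bin_kernel_le) auto
  finally show ?thesis by simp
qed

text \<open>Three ranges: blocks up to length N^(2/5) are bounded trivially; for |t| \<le> J
  N^(17/25) the second derivative test suffices; beyond that one differencing step is used. The
  factor 1 + |t| / (J N^(1 + \<eta>)) extends the bound to all large t, its growth being harmless
  against the Gaussian weight.\<close>

lemma dirichlet_block_bound:
  fixes N J :: nat and t :: real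
  assumes N: "N \<ge> 1" and J: "J \<ge> 1" and t: "\<bar>t\<bar> \<ge> real N powr (2/5)" and \<eta>: "\<eta> \<le> 1/50"
  shows "(norm (dirichlet_block J t))\<^sup>2 \<le> 20000 * (J * max J N * real N powr (-8/25)) * (1 + \<bar>t\<bar> / (J * real N powr (1 + \<eta>)))"
proof -
  define \<tau> where "\<tau> = \<bar>t\<bar>"
  have "norm (dirichlet_block J t) = norm (dirichlet_block J \<tau>)"
    using dirichlet_block_uminus[of J t] by (auto simp: \<tau>_def abs_if)
  have N1: "real N \<ge> 1" "real N > 0" "real J \<ge> 1" "real J > 0" using N J by auto
  define X where "X a = real N powr a" for a
  have X: "X a > 0" "X a * X b = X (a + b)" for a b using N1 by (auto simp: X_def powr_add)
  have Xm: "X a \<le> X b" if "a \<le> b" for a b unfolding X_def using N1 that by (intro powr_mono) auto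
  have X1: "X 1 = real N" "X 0 = 1" using N1 by (auto simp: X_def)
  have \<tau>: "\<tau> \<ge> X (2/5)" "\<tau> > 0" using t X(1)[of "2/5"] unfolding \<tau>_def X_def by linarith+
  define M where "M = real (max J N)"
  have M: "real J \<le> M" "real N \<le> M" by (auto simp: M_def)
  define B where "B = real J * M * X (-8/25)"
  have B0: "B \<ge> 0" using M N1 X by (auto simp: B_def intro!: mult_nonneg_nonneg less_imp_le)
  define T where "T = real J * X (1 + \<eta>)"
  have T: "T > 0" using N1 X by (simp add: T_def)
  have z0: "0 \<le> \<tau> / T" using \<tau> T by simp
  have JN: "real J * X (17/25) \<le> B"
  proof -
    have "real J * X (17/25) = real J * (X 1 * X (-8/25))" unfolding X(2) by simp
    also have "\<dots> \<le> B" unfolding B_def X1 mult.assoc using M X(1)[of "-8/25"] by (intro mult_left_mono mult_right_mono) auto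
    finally show ?thesis .
  qed
  have JJ: "(real J)\<^sup>2 * X a \<le> B" if "a \<le> -8/25" for a
  proof -
    have "(real J)\<^sup>2 * X a \<le> (real J)\<^sup>2 * X (-8/25)" using Xm[OF that] by (intro mult_left_mono) auto
    also have "\<dots> \<le> B" unfolding B_def power2_eq_square using M X(1)[of "-8/25"] by (intro mult_right_mono mult_left_mono) auto
    finally show ?thesis .
  qed
  have "(norm (dirichlet_block J \<tau>))\<^sup>2 \<le> 20000 * B * (1 + \<tau> / T)"
  proof -
    consider "real J \<le> X (2/5)" | "\<tau> \<le> real J * X (17/25)" | "X (2/5) < real J" "real J * X (17/25) < \<tau>" by linarith
    then show ?thesis
    proof cases
      case 1
      have "(norm (dirichlet_block J \<tau>))\<^sup>2 \<le> (real J)\<^sup>2" using norm_dirichlet_block_le by (intro power_mono) auto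
      also have "\<dots> \<le> real J * X (17/25)" unfolding power2_eq_square using 1 Xm[of "2/5" "17/25"] by (intro mult_left_mono) auto
      also have "\<dots> \<le> B" by (rule JN)
      also have "\<dots> \<le> 20000 * B * (1 + \<tau> / T)" using B0 z0 mult_left_mono[of 0 "\<tau> / T" "20000 * B"] by (simp add: distrib_left)
      finally show ?thesis .
    next
      case 2
      have "(norm (dirichlet_block J \<tau>))\<^sup>2 \<le> (60 * (sqrt \<tau> + real J / sqrt \<tau>))\<^sup>2"
        by (intro power_mono dirichlet_block_second \<tau> J) auto
      also have "\<dots> \<le> 7200 * (\<tau> + (real J)\<^sup>2 / \<tau>)"
      proof -
        have "(a + b)\<^sup>2 \<le> 2 * (a\<^sup>2 + b\<^sup>2)" for a b :: real using zero_le_power2[of "a - b"] by (simp add: power2_sum power2_diff)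
        from this[of "sqrt \<tau>" "real J / sqrt \<tau>"] show ?thesis using \<tau> unfolding power_mult_distrib by (simp add: power_divide)
      qed
      also have "\<dots> \<le> 7200 * (B + B)"
      proof (intro mult_left_mono add_mono)
        show "\<tau> \<le> B" using 2 JN by linarith
        have "(real J)\<^sup>2 / \<tau> \<le> (real J)\<^sup>2 / X (2/5)" using \<tau> X by (intro divide_left_mono) auto
        also have "\<dots> = (real J)\<^sup>2 * X (-2/5)" unfolding X_def by (simp add: powr_minus_divide[of _ "2/5"])
        also have "\<dots> \<le> B" by (rule JJ) simp
        finally show "(real J)\<^sup>2 / \<tau> \<le> B" .
      qed simp
      also have "\<dots> \<le> 20000 * B * (1 + \<tau> / T)" using B0 z0 mult_left_mono[of 0 "\<tau> / T" "20000 * B"] by (simp add: distrib_left)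
      finally show ?thesis .
    next
      case 3
      \<comment> \<open>For t = J N and J = N the terms J^2 / H and sqrt (t H J) balance at N^(1/3);
        the smaller exponent 8/25 leaves room for \<eta>.\<close>
      define H where "H = nat \<lfloor>X (8/25)\<rfloor>"
      have X8: "X (8/25) \<ge> 1" using Xm[of 0 "8/25"] X1 by simp
      have H: "1 \<le> H" "real H \<le> X (8/25)" "X (8/25) / 2 \<le> real H"
      proof -
        have f: "\<lfloor>X (8/25)\<rfloor> \<ge> 1" using X8 by simp
        then show "1 \<le> H" unfolding H_def by linarith
        have h: "real H = of_int \<lfloor>X (8/25)\<rfloor>" using f by (simp add: H_def)
        show "real H \<le> X (8/25)" unfolding h by (rule of_int_floor_le)
        have "X (8/25) < real H + 1" "1 \<le> real H" using f unfolding h by linarith+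
        then show "X (8/25) / 2 \<le> real H" by linarith
      qed
      have HJ: "H \<le> J" using H(2) 3(1) Xm[of "8/25" "2/5"] by linarith
      have "(norm (dirichlet_block J \<tau>))\<^sup>2 \<le> 2 * (real J)\<^sup>2 / H + 360 * sqrt (\<tau> * H * J) + 720 * (real J)\<^sup>2 * sqrt J / sqrt (\<tau> * H)"
        by (rule dirichlet_block_third[OF \<tau>(2) H(1) HJ])
      also have "\<dots> \<le> 4 * B + 360 * (B * (1 + \<tau> / T)) + 1440 * B"
      proof (intro add_mono)
        have "2 * (real J)\<^sup>2 / H \<le> 2 * (real J)\<^sup>2 / (X (8/25) / 2)" using H X by (intro divide_left_mono) auto
        also have "\<dots> = 4 * ((real J)\<^sup>2 * X (-8/25))" unfolding X_def by (simp add: powr_minus_divide[of _ "8/25"])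
        also have "\<dots> \<le> 4 * B" using JJ[of "-8/25"] by simp
        finally show "2 * (real J)\<^sup>2 / H \<le> 4 * B" .
        have "sqrt (\<tau> * H * J) \<le> sqrt ((real J * X (17/25) * (1 + \<tau> / T))\<^sup>2)"
        proof (rule real_sqrt_le_mono)
          have "\<tau> * H * J \<le> \<tau> * X (8/25) * J" using H \<tau> by (intro mult_right_mono mult_left_mono) auto
          also have "\<dots> = (real J)\<^sup>2 * (X (1 + \<eta>) * X (8/25)) * (\<tau> / T)" using T N1 X(1)[of "1 + \<eta>"] by (simp add: T_def power2_eq_square)
          also have "\<dots> \<le> (real J)\<^sup>2 * (X (17/25) * X (17/25)) * (1 + \<tau> / T)\<^sup>2"
          proof (rule mult_mono[OF mult_left_mono])
            show "X (1 + \<eta>) * X (8/25) \<le> X (17/25) * X (17/25)" unfolding X(2) using \<eta> by (intro Xm) simp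
            have "0 \<le> (\<tau> / T)\<^sup>2" by simp
            moreover have "(1 + \<tau> / T)\<^sup>2 = 1 + (\<tau> / T)\<^sup>2 + 2 * (\<tau> / T)" by (simp add: power2_sum)
            ultimately show "\<tau> / T \<le> (1 + \<tau> / T)\<^sup>2" using z0 by linarith
          qed (use X(1)[of "17/25"] z0 in auto)
          also have "\<dots> = (real J * X (17/25) * (1 + \<tau> / T))\<^sup>2" by (simp add: power2_eq_square mult_ac)
          finally show "\<tau> * H * J \<le> (real J * X (17/25) * (1 + \<tau> / T))\<^sup>2" .
        qed
        also have "\<dots> = real J * X (17/25) * (1 + \<tau> / T)" using X(1)[of "17/25"] z0 N1 by (simp add: abs_mult)
        also have "\<dots> \<le> B * (1 + \<tau> / T)" using JN z0 by (intro mult_right_mono) auto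
        finally show "360 * sqrt (\<tau> * H * J) \<le> 360 * (B * (1 + \<tau> / T))" by simp
        have "real J * real N \<le> 4 * (\<tau> * H)"
        proof -
          have "real J * real N = (real J * X (17/25)) * X (8/25)" using X(2)[of "17/25" "8/25"] X1 by simp
          also have "\<dots> \<le> \<tau> * (2 * H)" using 3 H X N1 \<tau> by (intro mult_mono) auto
          also have "\<dots> = 2 * (\<tau> * H)" by simp
          also have "\<dots> \<le> 4 * (\<tau> * H)" using \<tau> by (intro mult_right_mono) auto
          finally show ?thesis .
        qed
        then have "sqrt (real J * real N) \<le> sqrt (4 * (\<tau> * H))" by (rule real_sqrt_le_mono)
        then have "sqrt J * sqrt N \<le> 2 * sqrt (\<tau> * H)" by (simp add: real_sqrt_mult)
        then have "sqrt J / sqrt (\<tau> * H) \<le> 2 / sqrt N"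
          using \<tau> H N1 by (simp add: field_simps)
        then have "(real J)\<^sup>2 * (sqrt J / sqrt (\<tau> * H)) \<le> (real J)\<^sup>2 * (2 / sqrt N)" by (intro mult_left_mono) auto
        also have "2 / sqrt N = 2 * X (-1/2)" unfolding X_def using N1 by (simp add: powr_minus_divide[of _ "1/2"] powr_half_sqrt)
        finally show "720 * (real J)\<^sup>2 * sqrt J / sqrt (\<tau> * H) \<le> 1440 * B" using JJ[of "-1/2"] by simp
      qed
      also have "\<dots> \<le> 20000 * B * (1 + \<tau> / T)"
        using B0 z0 mult_nonneg_nonneg[OF B0 z0] by (simp add: distrib_left)
      finally show ?thesis .
    qed
  qed
  then show ?thesis unfolding \<open>norm (dirichlet_block J t) = norm (dirichlet_block J \<tau>)\<close>
    by (simp add: B_def M_def X_def T_def \<tau>_def mult.assoc)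
qed

section \<open>Between the logarithmic and the linear scale\<close>

lemma ln_diff_le:
  fixes a b m :: real
  assumes "m > 0" "m \<le> a" "m \<le> b"
  shows "m * \<bar>ln a - ln b\<bar> \<le> \<bar>a - b\<bar>"
proof -
  have "m * (ln v - ln u) \<le> v - u" if "m \<le> u" "u \<le> v" for u v
  proof -
    have p: "0 < u" "0 < v" using that assms(1) by linarith+
    have "ln v - ln u = ln (v / u)" using p by (simp add: ln_div)
    also have "\<dots> \<le> v / u - 1" using p by (intro ln_le_minus_one) auto
    finally have l: "ln v - ln u \<le> (v - u) / u" using p by (simp add: diff_divide_distrib)
    have "m * (ln v - ln u) \<le> u * ((v - u) / u)" using l that p assms(1) by (intro mult_mono) auto
    then show ?thesis using p by simp
  qed
  from this[of a b] this[of b a] show ?thesis using assms by (cases "a \<le> b") auto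
qed

lemma ln_diff_ge:
  fixes a b M :: real
  assumes "0 < a" "0 < b" "a \<le> M" "b \<le> M"
  shows "\<bar>a - b\<bar> \<le> M * \<bar>ln a - ln b\<bar>"
proof -
  have "v - u \<le> M * (ln v - ln u)" if p: "0 < u" "u \<le> v" "v \<le> M" for u v
  proof -
    have "ln u - ln v = ln (u / v)" using p by (simp add: ln_div)
    also have "\<dots> \<le> u / v - 1" using p by (intro ln_le_minus_one) auto
    finally have l: "(v - u) / v \<le> ln v - ln u" using p by (simp add: diff_divide_distrib)
    have "v * ((v - u) / v) \<le> M * (ln v - ln u)" using l p by (intro mult_mono) auto
    then show ?thesis using p by simp
  qed
  from this[of a b] this[of b a] show ?thesis using assms by (cases "a \<le> b") auto
qed

text \<open>The logarithms of numbers up to M are at least 1 / M times as far apart as the numbers,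
  so the logarithmic scale 1 / s becomes the width M / s on the linear scale.\<close>

lemma gauss_pair_sum_ln_le:
  assumes s: "s > 0" and M: "M > 0" and x: "\<And>p. p \<in> G \<Longrightarrow> 0 < x p \<and> x p \<le> M"
  shows "gauss_pair_sum s (\<lambda>p. ln (x p)) G \<le> (\<Sum>p\<in>G. \<Sum>q\<in>G. exp (- ((x p - x q) / (M / s))\<^sup>2 / 2))"
  unfolding gauss_pair_sum_def
proof (intro sum_mono)
  fix p q assume "p \<in> G" "q \<in> G"
  then have "\<bar>x p - x q\<bar> \<le> M * \<bar>ln (x p) - ln (x q)\<bar>" using x by (intro ln_diff_ge) auto
  then have "\<bar>x p - x q\<bar> * (s / M) \<le> M * \<bar>ln (x p) - ln (x q)\<bar> * (s / M)" using s M by (intro mult_right_mono) auto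
  then have "\<bar>(x p - x q) / (M / s)\<bar> \<le> \<bar>s * (ln (x p) - ln (x q))\<bar>"
    using s M by (simp add: abs_mult abs_divide mult.commute)
  then have "((x p - x q) / (M / s))\<^sup>2 \<le> (s * (ln (x p) - ln (x q)))\<^sup>2" by (simp only: abs_le_square_iff)
  then show "exp (- (s * (ln (x p) - ln (x q)))\<^sup>2 / 2) \<le> exp (- ((x p - x q) / (M / s))\<^sup>2 / 2)" by simp
qed

text \<open>Below \<open>t1\<close> the density of deviation T is at most 2 t1 / T times that of
  deviation \<open>t1\<close>, because exp (-1/2) \<ge> 1/2. Above \<open>t1\<close> the linear
  growth of the bound is absorbed by doubling the deviation.\<close>

lemma normal_density_split:
  assumes T: "T > 0" "t1 > 0" and B: "B \<ge> 0" and F0: "F \<ge> 0"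
    and F1: "\<bar>t\<bar> < t1 \<Longrightarrow> F \<le> A" and F2: "\<bar>t\<bar> \<ge> t1 \<Longrightarrow> F \<le> B * (1 + \<bar>t\<bar> / T)" and A: "A \<ge> 0"
  shows "normal_density 0 T t * F \<le> 2 * A * t1 / T * normal_density 0 t1 t + 4 * B * normal_density 0 (2 * T) t"
proof (cases "\<bar>t\<bar> < t1")
  case True
  have "t\<^sup>2 \<le> t1\<^sup>2" using True by (intro abs_le_square_iff[THEN iffD1]) auto
  then have "t\<^sup>2 / (2 * t1\<^sup>2) \<le> 1 / 2" using T by (simp add: field_simps)
  then have e1: "exp (- (1/2)) \<le> exp (- (t\<^sup>2 / (2 * t1\<^sup>2)))" by simp
  have "exp (1/2::real) \<le> 1 / (1 - 1/2)" by (rule exp_ge_one_plus_x_over_n_power_n[of 1 1] | insert exp_ge_add_one_self[of "-(1/2)::real"], simp add: exp_minus field_simps)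
  then have e2: "1 \<le> 2 * exp (- (1/2::real))" by (simp add: exp_minus field_simps)
  have e3: "exp (- (t\<^sup>2 / (2 * T\<^sup>2))) \<le> 2 * exp (- (t\<^sup>2 / (2 * t1\<^sup>2)))"
    using e1 e2 by (smt (verit) exp_le_one_iff zero_le_divide_iff zero_le_power2)
  have "normal_density 0 T t = exp (- (t\<^sup>2 / (2 * T\<^sup>2))) * (1 / (sqrt (2 * pi) * T))"
    using T by (simp add: normal_density_def real_sqrt_mult)
  also have "\<dots> \<le> 2 * exp (- (t\<^sup>2 / (2 * t1\<^sup>2))) * (1 / (sqrt (2 * pi) * T))"
    using T by (intro mult_right_mono e3) auto
  also have "\<dots> = 2 * t1 / T * normal_density 0 t1 t"
    using T by (simp add: normal_density_def real_sqrt_mult)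
  finally have "normal_density 0 T t * F \<le> 2 * t1 / T * normal_density 0 t1 t * A"
    using F1[OF True] F0 T by (intro mult_mono) auto
  moreover have "0 \<le> 4 * B * normal_density 0 (2 * T) t" using B T by simp
  ultimately show ?thesis by (simp add: mult_ac)
next
  case False
  define z where "z = \<bar>t\<bar> / T"
  have z: "z \<ge> 0" using T by (simp add: z_def)
  \<comment> \<open>This square gives 1 + z \<le> 2 (1 + 3 z^2 / 8); here 3/8 is the gap between the
    exponents 1/2 and 1/8 of the two densities.\<close>
  have "0 \<le> (z - 2/3)\<^sup>2" by simp
  then have "1 + z \<le> 2 * (1 + 3 * z\<^sup>2 / 8)" by (simp add: power2_eq_square algebra_simps)
  also have "1 + 3 * z\<^sup>2 / 8 \<le> exp (3 * z\<^sup>2 / 8)" by (rule exp_ge_add_one_self)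
  finally have "exp (- (z\<^sup>2 / 2)) * (1 + z) \<le> exp (- (z\<^sup>2 / 2)) * (2 * exp (3 * z\<^sup>2 / 8))" by (intro mult_left_mono) auto
  also have "\<dots> = 2 * exp (- (z\<^sup>2 / 8))" by (simp add: exp_add[symmetric])
  finally have e: "exp (- (z\<^sup>2 / 2)) * (1 + z) \<le> 2 * exp (- (z\<^sup>2 / 8))" .
  have n1: "normal_density 0 T t = exp (- (z\<^sup>2 / 2)) * (1 / (sqrt (2 * pi) * T))"
    using T by (simp add: normal_density_def real_sqrt_mult z_def power_divide)
  have n2: "4 * normal_density 0 (2 * T) t = 2 * exp (- (z\<^sup>2 / 8)) * (1 / (sqrt (2 * pi) * T))"
  proof -
    have "sqrt (2 * pi * (2 * T)\<^sup>2) = 2 * (sqrt (2 * pi) * T)" using T by (subst real_sqrt_mult, subst real_sqrt_abs) simp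
    then show ?thesis using T by (simp add: normal_density_def z_def power_divide power_mult_distrib mult.commute)
  qed
  have "normal_density 0 T t * F \<le> normal_density 0 T t * (B * (1 + z))"
    unfolding z_def using False F2 T by (intro mult_left_mono) auto
  also have "\<dots> = B * (exp (- (z\<^sup>2 / 2)) * (1 + z) * (1 / (sqrt (2 * pi) * T)))" unfolding n1 by simp
  also have "\<dots> \<le> B * (2 * exp (- (z\<^sup>2 / 8)) * (1 / (sqrt (2 * pi) * T)))"
    using e T B by (intro mult_left_mono mult_right_mono) auto
  also have "\<dots> = 4 * B * normal_density 0 (2 * T) t" unfolding n2[symmetric] by simp
  finally have "normal_density 0 T t * F \<le> 4 * B * normal_density 0 (2 * T) t" .
  moreover have "0 \<le> 2 * A * t1 / T * normal_density 0 t1 t" using A T by simp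
  ultimately show ?thesis by linarith
qed

text \<open>For fixed p and fixed second entry m of q the values are P^g-separated in n, so
  \<open>gauss_separated_le\<close> bounds each of the at most N^3 inner sums.\<close>

lemma gauss_pair_sum_pdiff_le:
  fixes g w \<epsilon> :: real and N :: nat
  assumes g: "g > 0" and w: "w > 0" and P: "P > 0"
  shows "(\<Sum>p\<in>good_pairs P N. \<Sum>q\<in>good_pairs P N. exp (- ((pdiff (g + 1) p - pdiff (g + 1) q) / w)\<^sup>2 / 2))
     \<le> real N ^ 3 * (8 * (1 + w / P powr g))"
proof -
  let ?G = "good_pairs P N"
  let ?F = "\<lambda>p q. exp (- ((pdiff (g + 1) p - pdiff (g + 1) q) / w)\<^sup>2 / 2)"
  let ?K = "8 * (1 + w / P powr g)"
  have K0: "?K \<ge> 0" using w by simp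
  have inner: "(\<Sum>q\<in>?G. ?F p q) \<le> real N * ?K" for p
  proof -
    define A where "A m = {n. (n, m) \<in> ?G}" for m
    have finA: "finite (A m)" for m
      using finite_imageI[OF finite_good_pairs[OF P, of N], of fst] by (rule finite_subset[rotated]) (force simp: A_def)
    have G: "?G = (\<lambda>(m, n). (n, m)) ` (SIGMA m:{1..N}. A m)"
      using good_pairs_sub[OF P, of N] by (auto simp: A_def image_def)
    have "(\<Sum>q\<in>?G. ?F p q) = (\<Sum>(m, n)\<in>(SIGMA m:{1..N}. A m). ?F p (n, m))"
      unfolding G by (subst sum.reindex) (auto simp: inj_on_def split_def)
    also have "\<dots> = (\<Sum>m\<in>{1..N}. \<Sum>n\<in>A m. ?F p (n, m))"
      using finA by (subst sum.Sigma) auto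
    also have "\<dots> \<le> (\<Sum>m\<in>{1..N}. ?K)"
    proof (rule sum_mono)
      fix m
      have sep: "P powr g \<le> real n' powr (g + 1) - real n powr (g + 1)" if "n \<in> A m" "n < n'" for n n'
        using that P by (intro powr_diff_ge g P) (auto simp: A_def good_pairs_def)
      show "(\<Sum>n\<in>A m. ?F p (n, m)) \<le> ?K"
      proof (rule gauss_separated_le[OF finA _ w])
        fix i k assume "i \<in> A m" "k \<in> A m" "i \<noteq> k"
        then show "P powr g \<le> \<bar>pdiff (g + 1) (i, m) - pdiff (g + 1) (k, m)\<bar>"
          using sep[of i k] sep[of k i] by (cases "i < k") (auto simp: pdiff_def)
      qed (use P in simp)
    qed
    finally show ?thesis by simp
  qed
  have "(\<Sum>p\<in>?G. \<Sum>q\<in>?G. ?F p q) \<le> (\<Sum>p\<in>?G. real N * ?K)" by (intro sum_mono inner)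
  also have "\<dots> = real (card ?G) * (real N * ?K)" by simp
  also have "\<dots> \<le> real (N * N) * (real N * ?K)"
  proof (rule mult_right_mono)
    show "real (card ?G) \<le> real (N * N)" by (simp only: of_nat_le_iff card_good_pairs_le[OF P])
  qed (use K0 in simp)
  also have "\<dots> = real N ^ 3 * ?K" by (simp add: power3_eq_cube)
  finally show ?thesis .
qed

lemma pdiff_bounds:
  assumes g: "g > 0" and P: "P > 0" and p: "p \<in> good_pairs P N"
  shows "P powr (g + 1) \<le> pdiff (g + 1) p" and "pdiff (g + 1) p \<le> real N powr (g + 1)"
proof -
  obtain n m where nm: "p = (n, m)" by (cases p)
  have *: "P \<le> real m" "real m + P \<le> real n" "n \<le> N" using p by (auto simp: nm good_pairs_def)
  have pos: "real m > 0" "real n > 0" using * P by linarith+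
  have "P * P powr g \<le> (real n - real m) * real m powr g"
    using * P g by (intro mult_mono powr_mono2) auto
  also have "\<dots> = real n * real m powr g - real m powr (g + 1)" using pos by (simp add: powr_add left_diff_distrib)
  also have "real n * real m powr g \<le> real n * real n powr g"
    using * P g pos by (intro mult_left_mono powr_mono2) auto
  finally have "P * P powr g \<le> real n * real n powr g - real m powr (g + 1)" by simp
  then show "P powr (g + 1) \<le> pdiff (g + 1) p" using pos P by (simp add: nm pdiff_def powr_add mult.commute)
  have "real n powr (g + 1) \<le> real N powr (g + 1)" using * g by (intro powr_mono2) auto
  then show "pdiff (g + 1) p \<le> real N powr (g + 1)" by (simp add: nm pdiff_def add_increasing2 diff_le_eq)
qed

text \<open>For nonnegative x and coefficients at most 1 this dominates the second moment, over a
  standard Gaussian \<alpha>, of the sum of cos (2 pi j x_p \<alpha>) over a block: the exponential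
  is the characteristic function at the difference of two frequencies.\<close>

definition dilated_pair_sum :: "nat \<Rightarrow> ('a \<Rightarrow> real) \<Rightarrow> 'a set \<Rightarrow> real" where
  "dilated_pair_sum J x G = (\<Sum>i\<in>{J..<2 * J} \<times> G. \<Sum>k\<in>{J..<2 * J} \<times> G.
     exp (- 2 * pi\<^sup>2 * (real (fst i) * x (snd i) - real (fst k) * x (snd k))\<^sup>2))"

text \<open>All j x_p are at least J m, where the logarithm shrinks distances by the factor 1 / (J
  m) or more; a smaller T in place of J m only enlarges the Gaussian.\<close>

lemma dilated_pair_sum_le_gauss_pair_sum:
  assumes J: "J \<ge> 1" and x: "\<And>p. p \<in> G \<Longrightarrow> x p \<ge> m" and m: "m > 0" and T: "0 < T" "T \<le> real J * m"
  shows "dilated_pair_sum J x G \<le> gauss_pair_sum T (\<lambda>(j, p). ln (real j) + ln (x p)) ({J..<2 * J} \<times> G)"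
  unfolding dilated_pair_sum_def gauss_pair_sum_def
proof (intro sum_mono)
  fix i k assume ik: "i \<in> {J..<2 * J} \<times> G" "k \<in> {J..<2 * J} \<times> G"
  define a where "a = real (fst i) * x (snd i)"
  define b where "b = real (fst k) * x (snd k)"
  have ij: "real J \<le> real (fst i)" "real J \<le> real (fst k)" "x (snd i) \<ge> m" "x (snd k) \<ge> m" using ik x by auto
  have ab: "real J * m \<le> a" "real J * m \<le> b" unfolding a_def b_def using ij m J by (auto intro!: mult_mono)
  have Jm: "real J * m > 0" using J m by simp
  have "T * \<bar>ln a - ln b\<bar> \<le> real J * m * \<bar>ln a - ln b\<bar>" using T by (intro mult_right_mono) auto
  also have "\<dots> \<le> \<bar>a - b\<bar>" by (rule ln_diff_le[OF Jm ab])
  finally have "\<bar>T * (ln a - ln b)\<bar> \<le> \<bar>a - b\<bar>" using T by (simp add: abs_mult)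
  then have q: "(T * (ln a - ln b))\<^sup>2 \<le> (a - b)\<^sup>2" by (simp add: abs_le_square_iff)
  have "1 * 1 \<le> pi * pi" using pi_ge_two by (intro mult_mono) auto
  then have "1 * (a - b)\<^sup>2 \<le> 4 * pi\<^sup>2 * (a - b)\<^sup>2" by (intro mult_right_mono) (auto simp: power2_eq_square)
  then have "exp (- 2 * pi\<^sup>2 * (a - b)\<^sup>2) \<le> exp (- (T * (ln a - ln b))\<^sup>2 / 2)" using q by simp
  also have "ln a - ln b = (case i of (j, p) \<Rightarrow> ln (real j) + ln (x p)) - (case k of (j, p) \<Rightarrow> ln (real j) + ln (x p))"
    unfolding a_def b_def using ij J m by (subst (1 2) ln_mult) (auto simp: split_def)
  finally show "exp (- 2 * pi\<^sup>2 * (real (fst i) * x (snd i) - real (fst k) * x (snd k))\<^sup>2)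
    \<le> exp (- (T * ((case i of (j, p) \<Rightarrow> ln (real j) + ln (x p)) - (case k of (j, p) \<Rightarrow> ln (real j) + ln (x p))))\<^sup>2 / 2)"
    by (simp add: a_def b_def)
qed

text \<open>Serves the small N, which the energy bound does not reach.\<close>

lemma dilated_pair_sum_trivial: "dilated_pair_sum J x G \<le> (real J * real (card G))\<^sup>2"
proof -
  have "dilated_pair_sum J x G \<le> (\<Sum>i\<in>{J..<2 * J} \<times> G. \<Sum>k\<in>{J..<2 * J} \<times> G. 1)"
    unfolding dilated_pair_sum_def by (intro sum_mono) auto
  then show ?thesis by (simp add: card_cartesian_product power2_eq_square)
qed

text \<open>\<open>normal_density_split\<close> separates the frequencies. The low part pairs the
  trivial bound J^2 for the block with \<open>gauss_pair_sum_pdiff_le\<close>, the high part pairs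
  the saving of \<open>dirichlet_block_bound\<close> with the energy bound.\<close>

lemma block_bound_aux:
  fixes g \<eta> \<epsilon> E :: real and N J :: nat
  assumes g: "g > 0" and N: "N \<ge> 1" and J: "J \<ge> 1"
    and \<eta>: "0 < \<eta>" "\<eta> \<le> g / 2" "\<eta> \<le> 1/50" and \<epsilon>: "0 < \<epsilon>" "\<epsilon> * (g + 1) \<le> g / 2" "\<epsilon> * g \<le> \<eta> / 2"
    and P: "P = real N powr (1 - \<epsilon>)" and G: "G = good_pairs P N"
    and E: "real (card {(p, q) \<in> G \<times> G. \<lfloor>pdiff (g + 1) p / real N powr (g - 1)\<rfloor> = \<lfloor>pdiff (g + 1) q / real N powr (g - 1)\<rfloor>}) \<le> E * real N powr (23/10)"
    and E0: "E \<ge> 0"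
  shows "dilated_pair_sum J (pdiff (g + 1)) G \<le> (32 + 1280000 * E) * (real (max J N))\<^sup>2 * real N powr (2 - \<eta> / 2)"
proof -
  define X where "X a = real N powr a" for a
  have N1: "real N \<ge> 1" "real N > 0" "real J \<ge> 1" "real J > 0" using N J by auto
  have X: "X a > 0" "X a * X b = X (a + b)" "X a / X b = X (a - b)" for a b using N1 by (auto simp: X_def powr_add powr_diff)
  have Xm: "X a \<le> X b" if "a \<le> b" for a b unfolding X_def using N1 that by (intro powr_mono) auto
  have X1: "X 1 = real N" "X 0 = 1" using N1 by (auto simp: X_def)
  have Xp: "X a powr b = X (a * b)" for a b by (simp add: X_def powr_powr)
  have PX: "P = X (1 - \<epsilon>)" by (simp add: P X_def)
  have P0: "P > 0" using X(1) by (simp add: PX)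
  define M where "M = real (max J N)"
  have M: "real J \<le> M" "real N \<le> M" "M \<ge> 1" using N1 by (auto simp: M_def)
  \<comment> \<open>The excess \<eta> over the exponent 1 is the source of the saving in the
    low-frequency part; the high-frequency part tolerates it as long as \<eta> is small.\<close>
  define T where "T = real J * X (1 + \<eta>)"
  have T: "T > 0" using N1 X by (simp add: T_def)
  define t1 where "t1 = X (2/5)"
  have t1: "t1 > 0" using X by (simp add: t1_def)
  define B where "B = 20000 * (real J * M * X (-8/25))"
  have B0: "B \<ge> 0" using M N1 X(1)[of "-8/25"] by (auto simp: B_def)
  let ?x = "pdiff (g + 1)"
  have finG: "finite G" unfolding G by (rule finite_good_pairs[OF P0])
  have xlo: "?x p \<ge> P powr (g + 1)" and xhi: "?x p \<le> X (g + 1)" if "p \<in> G" for p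
    using pdiff_bounds[OF g P0, of p N] that by (auto simp: G X_def)
  have Pg: "P powr (g + 1) = X ((1 - \<epsilon>) * (g + 1))" by (simp add: PX Xp)
  have xpos: "0 < ?x p \<and> ?x p \<le> X (g + 1)" if "p \<in> G" for p
    using xlo[OF that] xhi[OF that] X(1)[of "(1 - \<epsilon>) * (g + 1)"] unfolding Pg by auto
  have "(1 - \<epsilon>) * (g + 1) = g + 1 - \<epsilon> * (g + 1)" by (simp add: algebra_simps)
  \<comment> \<open>Here \<theta> > 1 enters: with \<eta> \<le> g / 2 and small \<epsilon> every
    good difference is at least N^(1 + \<eta>), which makes \<open>T\<close> admissible.\<close>
  then have "1 + \<eta> \<le> (1 - \<epsilon>) * (g + 1)" using \<epsilon>(2) \<eta>(2) by linarith
  then have TP: "T \<le> real J * P powr (g + 1)" unfolding T_def Pg by (intro mult_left_mono Xm) auto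
  have "dilated_pair_sum J ?x G \<le> gauss_pair_sum T (\<lambda>(j, p). ln (real j) + ln (?x p)) ({J..<2 * J} \<times> G)"
    using xlo by (rule dilated_pair_sum_le_gauss_pair_sum[OF J _ _ T TP]) (use P0 in auto)
  also have "\<dots> \<le> 2 * (real J)\<^sup>2 * t1 / T * gauss_pair_sum t1 (\<lambda>p. ln (?x p)) G + 4 * B * gauss_pair_sum (2 * T) (\<lambda>p. ln (?x p)) G"
  proof (rule gauss_pair_sum_product_le)
    fix t
    show "normal_density 0 T t * (norm (\<Sum>j\<in>{J..<2 * J}. cis (t * ln (real j))))\<^sup>2
      \<le> 2 * (real J)\<^sup>2 * t1 / T * normal_density 0 t1 t + 4 * B * normal_density 0 (2 * T) t"
    proof (rule normal_density_split[OF T t1 B0])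
      show "(norm (\<Sum>j\<in>{J..<2 * J}. cis (t * ln (real j))))\<^sup>2 \<le> (real J)\<^sup>2"
        using norm_dirichlet_block_le[of J t] unfolding dirichlet_block_def by (intro power_mono) auto
      assume "t1 \<le> \<bar>t\<bar>"
      then have "(norm (dirichlet_block J t))\<^sup>2 \<le> 20000 * (J * max J N * real N powr (-8/25)) * (1 + \<bar>t\<bar> / (J * real N powr (1 + \<eta>)))"
        unfolding t1_def X_def by (intro dirichlet_block_bound N J \<eta>)
      then show "(norm (\<Sum>j\<in>{J..<2 * J}. cis (t * ln (real j))))\<^sup>2 \<le> B * (1 + \<bar>t\<bar> / T)"
        by (simp add: dirichlet_block_def B_def T_def X_def M_def)
    qed auto
  qed (use T t1 B0 in auto)
  finally have V: "dilated_pair_sum J ?x G \<le> 2 * (real J)\<^sup>2 * t1 / T * gauss_pair_sum t1 (\<lambda>p. ln (?x p)) G + 4 * B * gauss_pair_sum (2 * T) (\<lambda>p. ln (?x p)) G" .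
  \<comment> \<open>The powers of \<open>t1\<close> cancel: the weight t1 / T meets a pair sum of
    size N^(4 + \<epsilon> g) / t1.\<close>
  have one: "2 * (real J)\<^sup>2 * t1 / T * gauss_pair_sum t1 (\<lambda>p. ln (?x p)) G \<le> 32 * M\<^sup>2 * X (2 - \<eta> / 2)"
  proof -
    have "gauss_pair_sum t1 (\<lambda>p. ln (?x p)) G \<le> (\<Sum>p\<in>G. \<Sum>q\<in>G. exp (- ((?x p - ?x q) / (X (g + 1) / t1))\<^sup>2 / 2))"
      by (rule gauss_pair_sum_ln_le[OF t1 X(1) xpos])
    also have "\<dots> \<le> real N ^ 3 * (8 * (1 + (X (g + 1) / t1) / P powr g))"
      unfolding G using X(1) t1 by (intro gauss_pair_sum_pdiff_le g P0) auto
    also have "(X (g + 1) / t1) / P powr g = X (3/5 + \<epsilon> * g)"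
      unfolding t1_def PX Xp X(3) by (simp add: algebra_simps)
    also have "real N ^ 3 * (8 * (1 + X (3/5 + \<epsilon> * g))) \<le> X 3 * (8 * (X (3/5 + \<epsilon> * g) + X (3/5 + \<epsilon> * g)))"
    proof -
      have "1 \<le> X (3/5 + \<epsilon> * g)" using Xm[of 0 "3/5 + \<epsilon> * g"] X1 \<epsilon> g by simp
      moreover have "real N ^ 3 = X 3" using N1 by (simp add: X_def)
      ultimately show ?thesis using X(1)[of 3] by simp
    qed
    also have "\<dots> = 16 * X (18/5 + \<epsilon> * g)" using X(2)[of 3 "3/5 + \<epsilon> * g"] by simp
    finally have g1: "gauss_pair_sum t1 (\<lambda>p. ln (?x p)) G \<le> 16 * X (18/5 + \<epsilon> * g)" .
    have "2 * (real J)\<^sup>2 * t1 / T * gauss_pair_sum t1 (\<lambda>p. ln (?x p)) G \<le> 2 * (real J)\<^sup>2 * t1 / T * (16 * X (18/5 + \<epsilon> * g))"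
      using g1 t1 T by (intro mult_left_mono) auto
    also have "\<dots> = 32 * real J * (X (2/5) / X (1 + \<eta>) * X (18/5 + \<epsilon> * g))"
      unfolding t1_def T_def using N1 by (simp add: power2_eq_square)
    also have "X (2/5) / X (1 + \<eta>) * X (18/5 + \<epsilon> * g) = X (3 - \<eta> + \<epsilon> * g)" unfolding X(3) X(2) by (simp add: algebra_simps)
    also have "32 * real J * X (3 - \<eta> + \<epsilon> * g) \<le> 32 * real J * X (1 + (2 - \<eta> / 2))"
      using \<epsilon>(3) by (intro mult_left_mono Xm) auto
    also have "\<dots> = 32 * (real J * real N * X (2 - \<eta> / 2))" unfolding X(2)[symmetric] X1 by simp
    also have "\<dots> \<le> 32 * (M * M * X (2 - \<eta> / 2))" using M X(1)[of "2 - \<eta> / 2"] by (intro mult_left_mono mult_right_mono mult_mono) auto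
    finally show ?thesis by (simp add: power2_eq_square)
  qed
  \<comment> \<open>The exponent is 23/10 - 8/25 = 99/50, below 2 - \<eta> / 2 because \<eta> \<le>
    1/50. The width relative to the bins costs M / J, which the factor J M in \<open>B\<close> turns
    into M^2.\<close>
  have two: "4 * B * gauss_pair_sum (2 * T) (\<lambda>p. ln (?x p)) G \<le> 1280000 * E * M\<^sup>2 * X (2 - \<eta> / 2)"
  proof -
    have T2: "2 * T > 0" using T by simp
    have X0: "X (g + 1) / (2 * T) > 0" using X(1) T by simp
    have "gauss_pair_sum (2 * T) (\<lambda>p. ln (?x p)) G \<le> (\<Sum>p\<in>G. \<Sum>q\<in>G. exp (- ((?x p - ?x q) / (X (g + 1) / (2 * T)))\<^sup>2 / 2))"
      by (rule gauss_pair_sum_ln_le[OF T2 X(1) xpos])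
    also have "\<dots> \<le> 8 * (1 + (X (g + 1) / (2 * T)) / X (g - 1)) * real (card {(p, q) \<in> G \<times> G. \<lfloor>?x p / X (g - 1)\<rfloor> = \<lfloor>?x q / X (g - 1)\<rfloor>})"
      by (rule gauss_pairs_le_bins[OF finG X(1) X0])
    also have "\<dots> \<le> 8 * (2 * M / real J) * (E * X (23/10))"
    proof (rule mult_mono)
      have "(X (g + 1) / (2 * T)) / X (g - 1) = X (g + 1) / X (1 + \<eta>) / X (g - 1) / (2 * real J)" by (simp add: T_def)
      also have "X (g + 1) / X (1 + \<eta>) / X (g - 1) = X (1 - \<eta>)" unfolding X(3) by simp
      also have "X (1 - \<eta>) / (2 * real J) \<le> X 1 / real J" using \<eta> N1 X(1) by (intro frac_le Xm) (auto intro: less_imp_le)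
      also have "\<dots> \<le> M / real J" unfolding X1 using M N1 by (intro divide_right_mono) auto
      finally have "(X (g + 1) / (2 * T)) / X (g - 1) \<le> M / real J" .
      moreover have "1 \<le> M / real J" using M N1 by simp
      ultimately show "8 * (1 + (X (g + 1) / (2 * T)) / X (g - 1)) \<le> 8 * (2 * M / real J)" by simp
    qed (use E M N1 in \<open>auto simp: X_def\<close>)
    finally have g2: "gauss_pair_sum (2 * T) (\<lambda>p. ln (?x p)) G \<le> 8 * (2 * M / real J) * (E * X (23/10))" .
    have "4 * B * gauss_pair_sum (2 * T) (\<lambda>p. ln (?x p)) G \<le> 4 * B * (8 * (2 * M / real J) * (E * X (23/10)))"
      using g2 B0 by (intro mult_left_mono) auto
    also have "\<dots> = 1280000 * E * M\<^sup>2 * (X (-8/25) * X (23/10))" unfolding B_def using N1 by (simp add: power2_eq_square)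
    also have "\<dots> \<le> 1280000 * E * M\<^sup>2 * X (2 - \<eta> / 2)" unfolding X(2) using E0 \<eta> by (intro mult_left_mono Xm) auto
    finally show ?thesis .
  qed
  have "dilated_pair_sum J ?x G \<le> 32 * M\<^sup>2 * X (2 - \<eta> / 2) + 1280000 * E * M\<^sup>2 * X (2 - \<eta> / 2)" using V one two by linarith
  then show ?thesis by (simp add: M_def X_def algebra_simps)
qed

lemma block_bound:
  fixes g :: real
  assumes g: "g > 0"
  obtains C \<delta> \<epsilon> :: real where "C \<ge> 0" "0 < \<delta>" "\<delta> \<le> 1" "0 < \<epsilon>" "\<epsilon> \<le> 1/2"
    "\<And>N J. N \<ge> 1 \<Longrightarrow> J \<ge> 1 \<Longrightarrow>
       dilated_pair_sum J (pdiff (g + 1)) (good_pairs (real N powr (1 - \<epsilon>)) N) \<le> C * (real (max J N))\<^sup>2 * real N powr (2 - \<delta>)"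
proof -
  obtain C c :: real where C: "C \<ge> 1" "c \<ge> 0" and E:
    "\<And>N \<Lambda>. N \<ge> 1 \<Longrightarrow> \<Lambda> \<ge> 1 \<Longrightarrow> C * \<Lambda> powr c \<le> real N powr (1/20) \<Longrightarrow>
      real (card {(p, q) \<in> good_pairs (N / \<Lambda>) N \<times> good_pairs (N / \<Lambda>) N.
         \<lfloor>pdiff (g + 1) p / real N powr (g - 1)\<rfloor> = \<lfloor>pdiff (g + 1) q / real N powr (g - 1)\<rfloor>}) \<le> C * real N powr (23/10)"
    using energy_bound[OF g] by blast
  define \<eta> where "\<eta> = min (g / 2) (1/50)"
  \<comment> \<open>The bounds provide, in order, a global cap, room for C \<Lambda>^c with
    \<Lambda> = N^\<epsilon>, the admissibility of \<open>T\<close>, and a loss of at most half the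
    saving \<eta>.\<close>
  define \<epsilon> where "\<epsilon> = min (1/2) (min (1 / (40 * (c + 1))) (min (g / 2 / (g + 1)) (\<eta> / 2 / g)))"
  have \<eta>: "0 < \<eta>" "\<eta> \<le> g / 2" "\<eta> \<le> 1/50" using g by (auto simp: \<eta>_def)
  have \<epsilon>0: "0 < \<epsilon>" using g C \<eta> by (auto simp: \<epsilon>_def)
  have \<epsilon>2: "\<epsilon> \<le> 1/2" unfolding \<epsilon>_def by (rule min.cobounded1)
  have "\<epsilon> \<le> g / 2 / (g + 1)" "\<epsilon> \<le> \<eta> / 2 / g" "\<epsilon> \<le> 1 / (40 * (c + 1))" by (auto simp: \<epsilon>_def)
  then have \<epsilon>: "\<epsilon> * (g + 1) \<le> g / 2" "\<epsilon> * g \<le> \<eta> / 2" "\<epsilon> * (40 * (c + 1)) \<le> 1"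
    using g C pos_le_divide_eq[of "g + 1" \<epsilon> "g / 2"] pos_le_divide_eq[of g \<epsilon> "\<eta> / 2"] pos_le_divide_eq[of "40 * (c + 1)" \<epsilon> 1] by auto
  have \<epsilon>c: "\<epsilon> * c \<le> 1/40" using \<epsilon>(3) \<epsilon>0 by (simp add: algebra_simps)
  \<comment> \<open>The last summand covers small N: if N^(1/40) < C then N^3 < C^120, and the
    trivial bound suffices.\<close>
  define K where "K = 32 + 1280000 * C + C ^ 120"
  show ?thesis
  proof (rule that[of K "\<eta> / 2" \<epsilon>])
    fix N J :: nat assume N: "N \<ge> 1" and J: "J \<ge> 1"
    define P where "P = real N powr (1 - \<epsilon>)"
    have N1: "real N \<ge> 1" using N by simp
    have P0: "P > 0" using N1 by (simp add: P_def)
    let ?v = "dilated_pair_sum J (pdiff (g + 1)) (good_pairs P N)"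
    define W where "W = (real (max J N))\<^sup>2 * real N powr (2 - \<eta> / 2)"
    have W0: "W \<ge> 0" by (simp add: W_def)
    have "?v \<le> K * W"
    proof (cases "C \<le> real N powr (1/40)")
      case True
      have "C * (real N powr \<epsilon>) powr c \<le> real N powr (1/40) * real N powr (1/40)"
        unfolding powr_powr using True C N1 \<epsilon>c by (intro mult_mono powr_mono) auto
      then have h: "C * (real N powr \<epsilon>) powr c \<le> real N powr (1/20)" unfolding powr_add[symmetric] by simp
      have h1: "real N powr \<epsilon> \<ge> 1" using N1 \<epsilon>0 by (simp add: ge_one_powr_ge_zero)
      have PP: "real N / real N powr \<epsilon> = P" using N1 by (simp add: P_def powr_diff)
      have "?v \<le> (32 + 1280000 * C) * (real (max J N))\<^sup>2 * real N powr (2 - \<eta> / 2)"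
        by (rule block_bound_aux[OF g N J \<eta> \<epsilon>0 \<epsilon>(1,2) P_def refl E[OF N h1 h, unfolded PP]]) (use C in simp)
      also have "\<dots> = (32 + 1280000 * C) * W" by (simp add: W_def)
      also have "\<dots> \<le> K * W" using W0 C by (intro mult_right_mono) (auto simp: K_def)
      finally show ?thesis .
    next
      case False
      have "(real N powr (1/40)) ^ 120 \<le> C ^ 120" using False by (intro power_mono) auto
      moreover have "(real N powr (1/40)) ^ 120 = real N powr 3" using N1 by (simp only: powr_power) simp
      ultimately have N3: "real N powr 3 \<le> C ^ 120" by linarith
      have "?v \<le> (real J * real (card (good_pairs P N)))\<^sup>2" by (rule dilated_pair_sum_trivial)
      also have "\<dots> \<le> (real J * real (N * N))\<^sup>2"
      proof (intro power_mono mult_left_mono)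
        show "real (card (good_pairs P N)) \<le> real (N * N)" by (simp only: of_nat_le_iff card_good_pairs_le[OF P0])
      qed auto
      also have "\<dots> = (real J)\<^sup>2 * (real N powr (2 - \<eta> / 2) * real N powr (2 + \<eta> / 2))"
        unfolding powr_add[symmetric] using N1 by (simp add: power2_eq_square power4_eq_xxxx)
      also have "\<dots> \<le> (real (max J N))\<^sup>2 * (real N powr (2 - \<eta> / 2) * C ^ 120)"
      proof (intro mult_mono power_mono)
        have "real N powr (2 + \<eta> / 2) \<le> real N powr 3" using \<eta> N1 by (intro powr_mono) auto
        also have "\<dots> \<le> C ^ 120" by (rule N3)
        finally show "real N powr (2 + \<eta> / 2) \<le> C ^ 120" .
      qed auto
      also have "\<dots> = C ^ 120 * W" by (simp add: W_def)
      also have "\<dots> \<le> K * W" using W0 C by (intro mult_right_mono) (auto simp: K_def)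
      finally show ?thesis .
    qed
    then show "dilated_pair_sum J (pdiff (g + 1)) (good_pairs (real N powr (1 - \<epsilon>)) N) \<le> K * (real (max J N))\<^sup>2 * real N powr (2 - \<eta> / 2)"
      by (simp add: P_def W_def mult.assoc)
  qed (use C \<eta> \<epsilon>0 \<epsilon>2 in \<open>auto simp: K_def\<close>)
qed

section \<open>Fourier series of a trapezoid\<close>

text \<open>On [0, 1] this is pi^2 times the second Bernoulli polynomial x^2 - x + 1/6. The weight 1
  / n^2 gives absolute convergence, and second differences of a parabola produce tents.\<close>

definition clausen :: "real \<Rightarrow> real" where
  "clausen x = (\<Sum>n. cos (2 * pi * real (Suc n) * x) / (real (Suc n))\<^sup>2)"

lemma clausen_summable_even:
  shows "summable (\<lambda>n. cos (2 * pi * real (Suc n) * x) / (real (Suc n))\<^sup>2)"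
    and "clausen (- x) = clausen x"
proof -
  have s: "summable (\<lambda>n. 1 / (real (Suc n))\<^sup>2)"
    using inverse_squares_sums by (simp add: sums_iff add.commute)
  show "summable (\<lambda>n. cos (2 * pi * real (Suc n) * x) / (real (Suc n))\<^sup>2)"
    by (rule summable_comparison_test'[OF s, of 0]) (auto simp: divide_simps)
qed (simp add: clausen_def)

lemma clausen_sums: "(\<lambda>n. cos (2 * pi * real (Suc n) * x) / (real (Suc n))\<^sup>2) sums clausen x"
  unfolding clausen_def by (rule summable_sums[OF clausen_summable_even(1)])

lemma power_div_square_continuous:
  fixes c :: "nat \<Rightarrow> 'a::topological_space \<Rightarrow> real"
  assumes c: "\<And>n. continuous_on A (c n)" and b: "\<And>n x. x \<in> A \<Longrightarrow> \<bar>c n x\<bar> \<le> 1"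
  shows "continuous_on A (\<lambda>x. \<Sum>n. c n x / (real (Suc n))\<^sup>2)"
proof (rule uniform_limit_theorem)
  show "uniform_limit A (\<lambda>n x. \<Sum>i<n. c i x / (real (Suc i))\<^sup>2) (\<lambda>x. \<Sum>n. c n x / (real (Suc n))\<^sup>2) sequentially"
  proof (rule Weierstrass_m_test)
    show "norm (c n x / (real (Suc n))\<^sup>2) \<le> 1 / (real (Suc n))\<^sup>2" if "x \<in> A" for n x
      using b[OF that, of n] by (simp add: divide_right_mono)
    show "summable (\<lambda>n. 1 / (real (Suc n))\<^sup>2)"
      using inverse_squares_sums by (simp add: sums_iff add.commute)
  qed
  show "\<forall>\<^sub>F n in sequentially. continuous_on A (\<lambda>x. \<Sum>i<n. c i x / (real (Suc i))\<^sup>2)"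
    by (intro always_eventually allI continuous_on_sum continuous_on_divide c continuous_intros) auto
qed simp

lemma continuous_on_clausen: "continuous_on UNIV clausen"
  unfolding clausen_def by (rule power_div_square_continuous) (auto intro!: continuous_intros)

text \<open>Abel means: the series of derivatives of \<open>clausen\<close> does not converge
  absolutely, but with the factor r^n, r < 1, it can be differentiated termwise and summed as a
  logarithm.\<close>

definition clausen_abel :: "real \<Rightarrow> real \<Rightarrow> real" where
  "clausen_abel r x = (\<Sum>n. r ^ Suc n * cos (2 * pi * real (Suc n) * x) / (real (Suc n))\<^sup>2)"

lemma clausen_abel_tendsto:
  assumes r: "r \<longlonglongrightarrow> 1" "\<And>k. r k \<in> {0..1}"
  shows "(\<lambda>k. clausen_abel (r k) x) \<longlonglongrightarrow> clausen x"
proof -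
  have "continuous_on {0..1} (\<lambda>r. clausen_abel r x)"
    unfolding clausen_abel_def
  proof (rule power_div_square_continuous)
    fix n and r :: real assume "r \<in> {0..1}"
    then have "\<bar>r ^ Suc n\<bar> \<le> 1" by (auto simp: power_le_one power_abs simp del: power_Suc)
    then have "\<bar>r ^ Suc n\<bar> * \<bar>cos (2 * pi * real (Suc n) * x)\<bar> \<le> 1 * 1" by (intro mult_mono) auto
    then show "\<bar>r ^ Suc n * cos (2 * pi * real (Suc n) * x)\<bar> \<le> 1" by (simp add: abs_mult)
  qed (auto intro!: continuous_intros)
  then have "(\<lambda>k. clausen_abel (r k) x) \<longlonglongrightarrow> clausen_abel 1 x"
    by (rule continuous_on_tendsto_compose[OF _ r(1)]) (use r(2) in \<open>auto intro: always_eventually\<close>)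
  then show ?thesis by (simp add: clausen_abel_def clausen_def)
qed

lemma sin_series_Ln:
  assumes "0 \<le> r" "r < 1"
  shows "(\<lambda>n. r ^ Suc n * sin (2 * pi * real (Suc n) * x) / real (Suc n)) sums - Im (Ln (1 - complex_of_real r * cis (2 * pi * x)))"
proof -
  define z where "z = complex_of_real r * cis (2 * pi * x)"
  have "norm (- z) < 1" using assms by (simp add: z_def norm_mult)
  from Ln_series[OF this] have "(\<lambda>n. (- 1) ^ Suc n / of_nat n * (- z) ^ n) sums Ln (1 - z)" by simp
  from sums_Im[OF this] have "(\<lambda>n. Im ((- 1) ^ Suc n / of_nat n * (- z) ^ n)) sums Im (Ln (1 - z))" .
  then have "(\<lambda>n. Im ((- 1) ^ Suc (Suc n) / of_nat (Suc n) * (- z) ^ Suc n)) sums Im (Ln (1 - z))"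
    by (subst sums_Suc_iff) simp
  moreover have "(- 1) ^ Suc (Suc n) / of_nat (Suc n) * (- z) ^ Suc n = - (z ^ Suc n / of_nat (Suc n))" for n
    by (cases "even n") simp_all
  moreover have "Im (z ^ Suc n / of_nat (Suc n)) = r ^ Suc n * sin (2 * pi * real (Suc n) * x) / real (Suc n)" for n
  proof -
    have "z ^ Suc n = complex_of_real (r ^ Suc n) * cis (2 * pi * real (Suc n) * x)"
      unfolding z_def power_mult_distrib Complex.DeMoivre by (simp add: mult_ac)
    then show ?thesis by (simp add: Im_divide_of_nat del: power_Suc of_nat_Suc)
  qed
  ultimately have "(\<lambda>n. - (r ^ Suc n * sin (2 * pi * real (Suc n) * x) / real (Suc n))) sums Im (Ln (1 - z))"
    by (simp only: uminus_complex.sel)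
  from sums_minus[OF this] show ?thesis by (simp add: z_def)
qed

lemma clausen_abel_deriv:
  assumes r: "0 \<le> r" "r < 1"
  shows "(clausen_abel r has_field_derivative 2 * pi * Im (Ln (1 - complex_of_real r * cis (2 * pi * x)))) (at x)"
proof -
  define f where "f n x = r ^ Suc n * cos (2 * pi * real (Suc n) * x) / (real (Suc n))\<^sup>2" for n x
  define f' where "f' n x = - (2 * pi) * (r ^ Suc n * sin (2 * pi * real (Suc n) * x) / real (Suc n))" for n x
  have sg: "summable (\<lambda>n. r ^ Suc n)"
    using r by (subst summable_Suc_iff) (simp add: summable_geometric)
  have d: "(f n has_field_derivative f' n x) (at x within UNIV)" for n x
    unfolding f_def f'_def by (auto intro!: derivative_eq_intros simp: power2_eq_square simp del: of_nat_Suc power_Suc)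
  have u: "uniform_limit UNIV (\<lambda>n x. \<Sum>i<n. f' i x) (\<lambda>x. \<Sum>i. f' i x) sequentially"
  proof (rule Weierstrass_m_test)
    fix n :: nat and x :: real
    have "\<bar>sin (2 * pi * real (Suc n) * x)\<bar> / real (Suc n) \<le> 1"
      using abs_sin_le_one[of "2 * pi * real (Suc n) * x"] by (subst divide_le_eq_1_pos) (auto simp del: abs_sin_le_one)
    then have "2 * pi * (r ^ Suc n * (\<bar>sin (2 * pi * real (Suc n) * x)\<bar> / real (Suc n))) \<le> 2 * pi * (r ^ Suc n * 1)"
      using r by (intro mult_left_mono) auto
    then show "norm (f' n x) \<le> 2 * pi * r ^ Suc n" unfolding f'_def using r by (simp add: abs_mult abs_divide power_abs del: power_Suc of_nat_Suc)
  next
    show "summable (\<lambda>n. 2 * pi * r ^ Suc n)" by (rule summable_mult[OF sg])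
  qed
  have s0: "summable (\<lambda>n. f n 0)"
  proof (rule summable_comparison_test'[OF sg, of 0])
    fix n :: nat
    have "1 * 1 \<le> real (Suc n) * real (Suc n)" by (intro mult_mono) auto
    then have "r ^ Suc n / (real (Suc n))\<^sup>2 \<le> r ^ Suc n / 1"
      using r by (intro divide_left_mono) (auto simp: power2_eq_square)
    then show "norm (f n 0) \<le> r ^ Suc n" using r by (simp add: f_def abs_mult del: power_Suc of_nat_Suc)
  qed
  have "((\<lambda>x. \<Sum>n. f n x) has_field_derivative (\<Sum>n. f' n x)) (at x)"
    by (rule has_field_derivative_series'(2)[OF convex_UNIV d uniformly_convergentI[OF u] UNIV_I s0]) auto
  moreover have "(\<Sum>n. f' n x) = - (2 * pi) * - Im (Ln (1 - complex_of_real r * cis (2 * pi * x)))"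
    unfolding f'_def by (rule sums_unique[symmetric], rule sums_mult, rule sin_series_Ln[OF r])
  ultimately show ?thesis by (simp add: clausen_abel_def[abs_def] f_def)
qed

text \<open>From 1 - ee x = 2 sin (pi x) exp (i pi (x - 1/2)). The result is the sawtooth, which is
  the derivative of \<open>clausen\<close> up to the factor 2 pi.\<close>

lemma Arg_one_minus_cis:
  assumes x: "0 < x" "x < 1"
  shows "1 - cis (2 * pi * x) \<notin> \<real>\<^sub>\<le>\<^sub>0" and "Im (Ln (1 - cis (2 * pi * x))) = pi * x - pi / 2"
proof -
  have s: "sin (pi * x) > 0" using x by (intro sin_gt_zero) auto
  have a: "sin (2 * pi * x) = 2 * sin (pi * x) * cos (pi * x)" "cos (2 * pi * x) = 1 - 2 * (sin (pi * x))\<^sup>2"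
    using sin_double[of "pi * x"] cos_double_sin[of "pi * x"] by (simp_all add: mult.assoc)
  have e: "1 - cis (2 * pi * x) = complex_of_real (2 * sin (pi * x)) * exp (\<i> * complex_of_real (pi * x - pi / 2))"
    unfolding cis_conv_exp[symmetric] using a by (simp add: complex_eq_iff sin_diff cos_diff power2_eq_square)
  have "Re (1 - cis (2 * pi * x)) > 0" using s a by simp
  then show n: "1 - cis (2 * pi * x) \<notin> \<real>\<^sub>\<le>\<^sub>0" by (auto simp: complex_nonpos_Reals_iff)
  then have "1 - cis (2 * pi * x) \<noteq> 0" by auto
  then have "Im (Ln (1 - cis (2 * pi * x))) = Arg (1 - cis (2 * pi * x))" by (simp add: Arg_eq_Im_Ln)
  also have "\<dots> = pi * x - pi / 2"
  proof (rule Arg_unique[OF e[symmetric]])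
    show "- pi < pi * x - pi / 2" using x pi_gt_zero mult_pos_pos[of pi x] by linarith
    have "pi * x < pi * 1" using x by (intro mult_strict_left_mono) auto
    then show "pi * x - pi / 2 \<le> pi" using pi_gt_zero by linarith
  qed (use s in simp)
  finally show "Im (Ln (1 - cis (2 * pi * x))) = pi * x - pi / 2" .
qed

text \<open>The derivatives of the Abel means tend pointwise to 2 pi (pi t - pi / 2) and are bounded
  by 2 pi^2, since |Im Ln| \<le> pi; dominated convergence passes to the limit in the
  integral.\<close>

lemma clausen_diff:
  assumes xy: "0 < x" "x \<le> y" "y < 1"
  shows "clausen y - clausen x = pi\<^sup>2 * (y\<^sup>2 - y) - pi\<^sup>2 * (x\<^sup>2 - x)"
proof -
  define r where "r k = 1 - 1 / (real k + 2)" for k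
  have r: "0 \<le> r k" "r k < 1" for k by (auto simp: r_def field_simps)
  have rl: "r \<longlonglongrightarrow> 1" unfolding r_def by real_asymp
  define G where "G k t = 2 * pi * Im (Ln (1 - complex_of_real (r k) * cis (2 * pi * t)))" for k t
  have hG: "(G k has_integral clausen_abel (r k) y - clausen_abel (r k) x) {x..y}" for k
  proof (rule fundamental_theorem_of_calculus[OF xy(2)])
    show "(clausen_abel (r k) has_vector_derivative G k t) (at t within {x..y})" for t
      unfolding G_def has_real_derivative_iff_has_vector_derivative[symmetric]
      by (rule has_field_derivative_at_within[OF clausen_abel_deriv[OF r]])
  qed
  have lim: "(\<lambda>k. G k t) \<longlonglongrightarrow> 2 * pi * (pi * t - pi / 2)" if "t \<in> {x..y}" for t
  proof -
    have t: "0 < t" "t < 1" using that xy by auto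
    have "(\<lambda>k. 1 - complex_of_real (r k) * cis (2 * pi * t)) \<longlonglongrightarrow> 1 - complex_of_real 1 * cis (2 * pi * t)"
      by (intro tendsto_intros rl)
    then have "(\<lambda>k. Ln (1 - complex_of_real (r k) * cis (2 * pi * t))) \<longlonglongrightarrow> Ln (1 - complex_of_real 1 * cis (2 * pi * t))"
      using Arg_one_minus_cis(1)[OF t] by (intro tendsto_Ln) auto
    then have "(\<lambda>k. G k t) \<longlonglongrightarrow> 2 * pi * Im (Ln (1 - complex_of_real 1 * cis (2 * pi * t)))"
      unfolding G_def by (intro tendsto_mult tendsto_const tendsto_Im)
    then show ?thesis using Arg_one_minus_cis(2)[OF t] by (simp only: of_real_1 mult_1_left)
  qed
  have bd: "norm (G k t) \<le> 2 * pi * pi" if "t \<in> {x..y}" for k t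
  proof -
    have "norm (complex_of_real (r k) * cis (2 * pi * t)) < 1" using r[of k] by (simp add: norm_mult)
    then have "1 - complex_of_real (r k) * cis (2 * pi * t) \<noteq> 0" by auto
    then have "\<bar>Im (Ln (1 - complex_of_real (r k) * cis (2 * pi * t)))\<bar> \<le> pi"
      using mpi_less_Im_Ln Im_Ln_le_pi by (smt (verit))
    then show ?thesis by (simp add: G_def abs_mult)
  qed
  have hi: "((\<lambda>t. 2 * pi * (pi * t - pi / 2)) has_integral pi\<^sup>2 * (y\<^sup>2 - y) - pi\<^sup>2 * (x\<^sup>2 - x)) {x..y}"
  proof (rule fundamental_theorem_of_calculus[OF xy(2)])
    show "((\<lambda>t. pi\<^sup>2 * (t\<^sup>2 - t)) has_vector_derivative 2 * pi * (pi * t - pi / 2)) (at t within {x..y})" for t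
      unfolding has_real_derivative_iff_has_vector_derivative[symmetric]
      by (auto intro!: derivative_eq_intros simp: power2_eq_square algebra_simps)
  qed
  have "(\<lambda>k. integral {x..y} (G k)) \<longlonglongrightarrow> integral {x..y} (\<lambda>t. 2 * pi * (pi * t - pi / 2))"
    by (rule dominated_convergence(2)[where h = "\<lambda>_. 2 * pi * pi"]) (use hG bd lim in auto)
  moreover have "integral {x..y} (G k) = clausen_abel (r k) y - clausen_abel (r k) x" for k
    using hG by (rule integral_unique)
  moreover have "integral {x..y} (\<lambda>t. 2 * pi * (pi * t - pi / 2)) = pi\<^sup>2 * (y\<^sup>2 - y) - pi\<^sup>2 * (x\<^sup>2 - x)"
    using hi by (rule integral_unique)
  ultimately have "(\<lambda>k. clausen_abel (r k) y - clausen_abel (r k) x) \<longlonglongrightarrow> pi\<^sup>2 * (y\<^sup>2 - y) - pi\<^sup>2 * (x\<^sup>2 - x)"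
    by (simp only:)
  moreover have "(\<lambda>k. clausen_abel (r k) y - clausen_abel (r k) x) \<longlonglongrightarrow> clausen y - clausen x"
    using r rl by (intro tendsto_diff clausen_abel_tendsto) (auto intro: less_imp_le)
  ultimately show ?thesis by (rule LIMSEQ_unique[rotated])
qed

text \<open>Differences determine the function up to a constant on the open interval, continuity
  then on the closed one. The constant is left abstract because the second differences in
  \<open>tent_series\<close> cancel it.\<close>

lemma clausen_eq:
  obtains K where "\<And>x. 0 \<le> x \<Longrightarrow> x \<le> 1 \<Longrightarrow> clausen x = pi\<^sup>2 * (x\<^sup>2 - x) + K"
proof -
  define D where "D x = clausen x - pi\<^sup>2 * (x\<^sup>2 - x)" for x
  have D: "D x = D (1/2)" if "0 < x" "x < 1" for x
    using clausen_diff[of x "1/2"] clausen_diff[of "1/2" x] that by (cases "x \<le> 1/2") (auto simp: D_def)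
  define K where "K = D (1/2)"
  have DK: "D x = K" if "x \<in> {0<..<1}" for x
    unfolding K_def by (rule D) (use that in auto)
  have "continuous_on (closure {0<..<1}) D"
    unfolding D_def by (intro continuous_intros continuous_on_subset[OF continuous_on_clausen]) auto
  then have "D x = K" if "x \<in> closure {0<..<1}" for x
    by (rule continuous_constant_on_closure[OF _ DK that])
  then have "D x = K" if "0 \<le> x" "x \<le> 1" for x using that by simp
  then show ?thesis by (intro that[of K]) (simp add: D_def algebra_simps)
qed

section \<open>Tents and trapezoids\<close>

definition tent :: "real \<Rightarrow> real \<Rightarrow> real" where
  "tent c x = max 0 (c - \<bar>x - of_int (round x)\<bar>)"

definition tent_coeff :: "real \<Rightarrow> nat \<Rightarrow> real" where
  "tent_coeff c j = 2 * (sin (pi * real j * c))\<^sup>2 / (pi\<^sup>2 * (real j)\<^sup>2)"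

text \<open>A tent is minus half the second difference, with step c, of a periodic parabola with a
  kink at the integers: away from the kink only the constant - c^2 is left, across it the tent
  appears. On the Fourier side this multiplies the coefficients by 2 sin^2 (pi j c).\<close>

lemma tent_series:
  assumes c: "0 < c" "c \<le> 1/2"
  shows "(\<lambda>n. tent_coeff c (Suc n) * cos (2 * pi * real (Suc n) * x)) sums (tent c x - c\<^sup>2)"
proof -
  obtain K where K: "\<And>x. 0 \<le> x \<Longrightarrow> x \<le> 1 \<Longrightarrow> clausen x = pi\<^sup>2 * (x\<^sup>2 - x) + K"
    using clausen_eq by blast
  define y where "y = \<bar>x - of_int (round x)\<bar>"
  have y: "0 \<le> y" "y \<le> 1/2" using of_int_round_abs_le[of x] by (auto simp: y_def abs_minus_commute)
  have cy: "cos (2 * pi * real n * x) = cos (2 * pi * real n * y)" for n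
  proof -
    have "cos (2 * pi * real n * y) = cos \<bar>2 * pi * real n * (x - of_int (round x))\<bar>"
      unfolding y_def by (simp add: abs_mult)
    also have "\<dots> = cos (2 * pi * real n * (x - of_int (round x)))" by (rule cos_abs_real)
    also have "2 * pi * real n * (x - of_int (round x)) = 2 * pi * real n * x + 2 * pi * of_int (- int n * round x)"
      by (simp add: algebra_simps)
    also have "cos \<dots> = cos (2 * pi * real n * x)" 
      by (subst cos_add) (simp only: cos_int_2pin sin_int_2pin mult_1_right mult_zero_right diff_zero)
    finally show ?thesis ..
  qed
  let ?t = "\<lambda>z n. cos (2 * pi * real (Suc n) * z) / (real (Suc n))\<^sup>2"
  have "(\<lambda>n. (1 / pi\<^sup>2) * (?t y n - (1/2) * (?t (y + c) n + ?t (y - c) n))) sums ((1 / pi\<^sup>2) * (clausen y - (1/2) * (clausen (y + c) + clausen (y - c))))"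
    by (intro sums_mult sums_diff sums_add clausen_sums)
  moreover have "(1 / pi\<^sup>2) * (?t y n - (1/2) * (?t (y + c) n + ?t (y - c) n)) = tent_coeff c (Suc n) * cos (2 * pi * real (Suc n) * x)" for n
  proof -
    define u where "u = 2 * pi * real (Suc n) * y"
    define v where "v = pi * real (Suc n) * c"
    have a: "2 * pi * real (Suc n) * (y + c) = u + 2 * v" "2 * pi * real (Suc n) * (y - c) = u - 2 * v"
      unfolding u_def v_def by (simp_all add: algebra_simps del: of_nat_Suc)
    have "cos (u + 2 * v) + cos (u - 2 * v) = 2 * cos u * (1 - 2 * (sin v)\<^sup>2)"
      by (simp add: cos_add cos_diff cos_double_sin)
    then have "cos u - (1/2) * (cos (u + 2 * v) + cos (u - 2 * v)) = 2 * (sin v)\<^sup>2 * cos u" by (simp add: algebra_simps)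
    moreover have "(1 / pi\<^sup>2) * (?t y n - (1/2) * (?t (y + c) n + ?t (y - c) n)) = (cos u - (1/2) * (cos (u + 2 * v) + cos (u - 2 * v))) / (pi\<^sup>2 * (real (Suc n))\<^sup>2)"
      unfolding a u_def[symmetric] by (simp add: field_simps del: of_nat_Suc)
    ultimately show ?thesis unfolding tent_coeff_def cy u_def[symmetric] v_def[symmetric] by simp
  qed
  moreover have "(1 / pi\<^sup>2) * (clausen y - (1/2) * (clausen (y + c) + clausen (y - c))) = tent c x - c\<^sup>2"
  proof (cases "c \<le> y")
    case True
    have "clausen y - (1/2) * (clausen (y + c) + clausen (y - c)) = pi\<^sup>2 * (- c\<^sup>2)"
      using True y c by (simp add: K power2_eq_square algebra_simps)
    then show ?thesis using True by (simp add: tent_def y_def)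
  next
    case False
    have "clausen (y - c) = clausen (c - y)" using clausen_summable_even(2)[of "c - y"] by simp
    then have "clausen y - (1/2) * (clausen (y + c) + clausen (y - c)) = pi\<^sup>2 * (c - y - c\<^sup>2)"
      using False y c by (simp add: K power2_eq_square algebra_simps)
    then show ?thesis using False by (simp add: tent_def y_def)
  qed
  ultimately show ?thesis by simp
qed

text \<open>Two tents differ by the constant b - a out to distance a from the integers, so for 0 < a
  < b the quotient has plateau height 1 there and vanishes beyond distance b; for b \<le> 1/2 its
  mean is a + b.\<close>

definition trapezoid :: "real \<Rightarrow> real \<Rightarrow> real \<Rightarrow> real" where
  "trapezoid a b x = (tent b x - tent a x) / (b - a)"

definition trapezoid_coeff :: "real \<Rightarrow> real \<Rightarrow> nat \<Rightarrow> real" where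
  "trapezoid_coeff a b j = (tent_coeff b j - tent_coeff a j) / (b - a)"

lemma trap_series:
  assumes "0 < a" "a < b" "b \<le> 1/2"
  shows "(\<lambda>n. trapezoid_coeff a b (Suc n) * cos (2 * pi * real (Suc n) * x)) sums (trapezoid a b x - (a + b))"
proof -
  have "(\<lambda>n. (tent_coeff b (Suc n) * cos (2 * pi * real (Suc n) * x) - tent_coeff a (Suc n) * cos (2 * pi * real (Suc n) * x)) / (b - a)) sums
    (((tent b x - b\<^sup>2) - (tent a x - a\<^sup>2)) / (b - a))"
    using assms by (intro sums_divide sums_diff tent_series) auto
  moreover have "((tent b x - b\<^sup>2) - (tent a x - a\<^sup>2)) / (b - a) = trapezoid a b x - (a + b)"
    using assms by (simp add: trapezoid_def field_simps power2_eq_square)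
  ultimately show ?thesis by (simp add: trapezoid_coeff_def left_diff_distrib[symmetric])
qed

text \<open>The first bound comes from sin^2 u - sin^2 v = sin (u + v) sin (u - v), the second is
  the decay 1 / j^2 of a piecewise linear function. For a, b and b - a of order 1 / N they cross
  over near j = N.\<close>

lemma trap_coeff_le:
  assumes ab: "0 < a" "a < b"
  shows "\<bar>trapezoid_coeff a b j\<bar> \<le> 2 * (a + b)" and "\<bar>trapezoid_coeff a b j\<bar> \<le> 2 / (pi\<^sup>2 * (real j)\<^sup>2 * (b - a))"
proof -
  define u where "u = pi * real j * b"
  define v where "v = pi * real j * a"
  have uv: "0 \<le> v" "v \<le> u" using ab by (auto simp: u_def v_def intro!: mult_left_mono)
  have e: "trapezoid_coeff a b j = 2 * ((sin u)\<^sup>2 - (sin v)\<^sup>2) / (pi\<^sup>2 * (real j)\<^sup>2) / (b - a)"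
    by (simp add: trapezoid_coeff_def tent_coeff_def u_def v_def diff_divide_distrib)
  have sq: "0 \<le> (sin u)\<^sup>2" "(sin u)\<^sup>2 \<le> 1" "0 \<le> (sin v)\<^sup>2" "(sin v)\<^sup>2 \<le> 1"
    by (auto simp: abs_square_le_1)
  have ae: "\<bar>trapezoid_coeff a b j\<bar> = 2 * \<bar>(sin u)\<^sup>2 - (sin v)\<^sup>2\<bar> / (pi\<^sup>2 * (real j)\<^sup>2) / (b - a)"
    using ab unfolding e abs_divide abs_mult by simp
  have "\<bar>(sin u)\<^sup>2 - (sin v)\<^sup>2\<bar> \<le> 1" using sq by linarith
  then have "2 * \<bar>(sin u)\<^sup>2 - (sin v)\<^sup>2\<bar> / (pi\<^sup>2 * (real j)\<^sup>2) / (b - a) \<le> 2 * 1 / (pi\<^sup>2 * (real j)\<^sup>2) / (b - a)"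
    using ab by (intro divide_right_mono) auto
  then show "\<bar>trapezoid_coeff a b j\<bar> \<le> 2 / (pi\<^sup>2 * (real j)\<^sup>2 * (b - a))" unfolding ae by simp
  show "\<bar>trapezoid_coeff a b j\<bar> \<le> 2 * (a + b)"
  proof (cases "j = 0")
    case False
    have "(sin u)\<^sup>2 - (sin v)\<^sup>2 = sin (u + v) * sin (u - v)"
    proof -
      have "sin (u + v) * sin (u - v) = (sin u)\<^sup>2 * (cos v)\<^sup>2 - (cos u)\<^sup>2 * (sin v)\<^sup>2"
        by (simp add: sin_add sin_diff power2_eq_square algebra_simps)
      then show ?thesis by (simp add: cos_squared_eq algebra_simps)
    qed
    then have "\<bar>(sin u)\<^sup>2 - (sin v)\<^sup>2\<bar> = \<bar>sin (u + v)\<bar> * \<bar>sin (u - v)\<bar>" by (simp add: abs_mult)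
    also have "\<dots> \<le> \<bar>u + v\<bar> * \<bar>u - v\<bar>" by (intro mult_mono abs_sin_x_le_abs_x) auto
    also have "\<dots> = pi\<^sup>2 * (real j)\<^sup>2 * (b - a) * (a + b)"
    proof -
      have "\<bar>u + v\<bar> = u + v" "\<bar>u - v\<bar> = u - v" using uv by auto
      moreover have "u + v = pi * real j * (a + b)" "u - v = pi * real j * (b - a)"
        unfolding u_def v_def by (simp_all add: distrib_left right_diff_distrib)
      ultimately have "\<bar>u + v\<bar> = pi * real j * (a + b)" "\<bar>u - v\<bar> = pi * real j * (b - a)" by (simp_all only:)
      then show ?thesis by (simp add: power2_eq_square)
    qed
    finally have "2 * \<bar>(sin u)\<^sup>2 - (sin v)\<^sup>2\<bar> / (pi\<^sup>2 * (real j)\<^sup>2) / (b - a) \<le> 2 * (pi\<^sup>2 * (real j)\<^sup>2 * (b - a) * (a + b)) / (pi\<^sup>2 * (real j)\<^sup>2) / (b - a)"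
      using ab by (intro divide_right_mono mult_left_mono) auto
    then show ?thesis unfolding ae using False ab by simp
  qed (use ab in \<open>simp add: trapezoid_coeff_def tent_coeff_def\<close>)
qed

lemma trap_bounds:
  assumes "0 < a" "a < b"
  shows "indicator {-a..a} (x - of_int (round x)) \<le> trapezoid a b x"
    and "trapezoid a b x \<le> indicator {-b..b} (x - of_int (round x))"
    and "0 \<le> trapezoid a b x"
proof -
  define d where "d = \<bar>x - of_int (round x)\<bar>"
  have i: "indicator {-c..c} (x - of_int (round x)) = (if d \<le> c then 1 else 0 :: real)" for c
    by (auto simp: d_def indicator_def)
  have t: "tent c x = max 0 (c - d)" for c by (simp add: tent_def d_def)
  consider "d \<le> a" | "a < d" "d \<le> b" | "b < d" by linarith
  then have "indicator {-a..a} (x - of_int (round x)) \<le> trapezoid a b x \<and> trapezoid a b x \<le> indicator {-b..b} (x - of_int (round x)) \<and> 0 \<le> trapezoid a b x"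
  proof cases
    case 1
    then show ?thesis using assms unfolding trapezoid_def i t by simp
  next
    case 2
    then have "0 \<le> (b - d) / (b - a)" "(b - d) / (b - a) \<le> 1" using assms by auto
    then show ?thesis using 2 assms unfolding trapezoid_def i t by simp
  next
    case 3
    then show ?thesis using assms unfolding trapezoid_def i t by simp
  qed
  then show "indicator {-a..a} (x - of_int (round x)) \<le> trapezoid a b x"
    "trapezoid a b x \<le> indicator {-b..b} (x - of_int (round x))" "0 \<le> trapezoid a b x" by blast+
qed

section \<open>Means over a Gaussian variable\<close>

lemma real_distribution_std_normal: "finite_measure std_normal_distribution" "prob_space std_normal_distribution"
  using real_dist_normal_dist by (auto simp: real_distribution_def prob_space_def)

lemma integrable_std_normal_bounded:
  fixes f :: "real \<Rightarrow> real"
  assumes "f \<in> borel_measurable borel" "\<And>x. \<bar>f x\<bar> \<le> B"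
  shows "integrable std_normal_distribution f"
  using assms by (intro finite_measure.integrable_const_bound[OF real_distribution_std_normal(1), where B = B]) auto

lemma integral_std_normal_cos: "(\<integral>\<alpha>. cos (z * \<alpha>) \<partial>std_normal_distribution) = exp (- z\<^sup>2 / 2)"
  using normal_density_cos(2)[of 1 z] by (subst integral_density) auto

text \<open>Product to sum; for nonnegative u and v the term with u + v is dominated by the one with
  u - v.\<close>

lemma integral_std_normal_cos_cos:
  assumes "u \<ge> 0" "v \<ge> 0"
  shows "\<bar>\<integral>\<alpha>. cos (u * \<alpha>) * cos (v * \<alpha>) \<partial>std_normal_distribution\<bar> \<le> exp (- (u - v)\<^sup>2 / 2)"
proof -
  have i: "integrable std_normal_distribution (\<lambda>\<alpha>. cos (z * \<alpha>))" for z :: real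
    by (rule integrable_std_normal_bounded[where B = 1]) auto
  have "cos (u * \<alpha>) * cos (v * \<alpha>) = (cos ((u - v) * \<alpha>) + cos ((u + v) * \<alpha>)) / 2" for \<alpha>
    by (simp add: cos_times_cos algebra_simps)
  then have "(\<integral>\<alpha>. cos (u * \<alpha>) * cos (v * \<alpha>) \<partial>std_normal_distribution) = (\<integral>\<alpha>. (cos ((u - v) * \<alpha>) + cos ((u + v) * \<alpha>)) / 2 \<partial>std_normal_distribution)"
    by (simp only:)
  also have "\<dots> = (exp (- (u - v)\<^sup>2 / 2) + exp (- (u + v)\<^sup>2 / 2)) / 2"
    using i by (simp add: integral_std_normal_cos)
  finally have e: "(\<integral>\<alpha>. cos (u * \<alpha>) * cos (v * \<alpha>) \<partial>std_normal_distribution) = (exp (- (u - v)\<^sup>2 / 2) + exp (- (u + v)\<^sup>2 / 2)) / 2" .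
  have "(u - v)\<^sup>2 \<le> (u + v)\<^sup>2" using assms by (intro abs_le_square_iff[THEN iffD1]) auto
  then have "exp (- (u + v)\<^sup>2 / 2) \<le> exp (- (u - v)\<^sup>2 / 2)" by simp
  moreover have "\<bar>(p + q) / 2\<bar> \<le> p" if "q \<le> p" "0 \<le> q" for p q :: real using that by auto
  ultimately show ?thesis unfolding e by simp
qed

lemma cos_sum_second_moment:
  assumes u: "\<And>i. i \<in> A \<Longrightarrow> u i \<ge> 0" and c: "\<And>i. i \<in> A \<Longrightarrow> \<bar>c i\<bar> \<le> \<beta>"
  shows "(\<integral>\<alpha>. (\<Sum>i\<in>A. c i * cos (u i * \<alpha>))\<^sup>2 \<partial>std_normal_distribution) \<le> \<beta>\<^sup>2 * (\<Sum>i\<in>A. \<Sum>k\<in>A. exp (- (u i - u k)\<^sup>2 / 2))"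
proof -
  have e: "(\<Sum>i\<in>A. c i * cos (u i * \<alpha>))\<^sup>2 = (\<Sum>i\<in>A. \<Sum>k\<in>A. c i * c k * (cos (u i * \<alpha>) * cos (u k * \<alpha>)))" for \<alpha>
    by (simp add: power2_eq_square sum_product mult_ac)
  have i: "integrable std_normal_distribution (\<lambda>\<alpha>. c i * c k * (cos (u i * \<alpha>) * cos (u k * \<alpha>)))" for i k
    by (intro integrable_mult_right integrable_std_normal_bounded[where B = 1]) (auto simp: abs_mult intro!: mult_le_one)
  have "(\<integral>\<alpha>. (\<Sum>i\<in>A. c i * cos (u i * \<alpha>))\<^sup>2 \<partial>std_normal_distribution)
     = (\<Sum>i\<in>A. \<Sum>k\<in>A. c i * c k * (\<integral>\<alpha>. cos (u i * \<alpha>) * cos (u k * \<alpha>) \<partial>std_normal_distribution))"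
    unfolding e using i by (simp add: Bochner_Integration.integral_sum Bochner_Integration.integrable_sum)
  also have "\<dots> \<le> (\<Sum>i\<in>A. \<Sum>k\<in>A. \<beta>\<^sup>2 * exp (- (u i - u k)\<^sup>2 / 2))"
  proof (intro sum_mono)
    fix i k assume ik: "i \<in> A" "k \<in> A"
    have "\<bar>c i * c k\<bar> * \<bar>\<integral>\<alpha>. cos (u i * \<alpha>) * cos (u k * \<alpha>) \<partial>std_normal_distribution\<bar> \<le> \<beta>\<^sup>2 * exp (- (u i - u k)\<^sup>2 / 2)"
    proof (rule mult_mono)
      show "\<bar>c i * c k\<bar> \<le> \<beta>\<^sup>2" unfolding abs_mult power2_eq_square using c ik by (intro mult_mono) (auto intro: order_trans[OF abs_ge_zero])
      show "\<bar>\<integral>\<alpha>. cos (u i * \<alpha>) * cos (u k * \<alpha>) \<partial>std_normal_distribution\<bar> \<le> exp (- (u i - u k)\<^sup>2 / 2)"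
        using u ik by (intro integral_std_normal_cos_cos)
    qed auto
    then show "c i * c k * (\<integral>\<alpha>. cos (u i * \<alpha>) * cos (u k * \<alpha>) \<partial>std_normal_distribution) \<le> \<beta>\<^sup>2 * exp (- (u i - u k)\<^sup>2 / 2)"
      unfolding abs_mult[symmetric] by linarith
  qed
  finally show ?thesis by (simp add: sum_distrib_left)
qed

text \<open>The inequality 2 |Y| \<le> Y^2 / D + D takes the place of Cauchy-Schwarz in passing from
  the second to the first moment, D being a bound for the root mean square.\<close>

lemma block_first_moment:
  assumes x: "\<And>p. p \<in> G \<Longrightarrow> x p \<ge> 0" and c: "\<And>j. J \<le> j \<Longrightarrow> \<bar>c j\<bar> \<le> \<beta>"
    and D: "D > 0" "\<beta>\<^sup>2 * dilated_pair_sum J x G \<le> D\<^sup>2"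
  shows "(\<integral>\<alpha>. \<bar>\<Sum>j\<in>{J..<2 * J}. \<Sum>p\<in>G. c j * cos (2 * pi * real j * (x p * \<alpha>))\<bar> \<partial>std_normal_distribution) \<le> D"
proof -
  define Z where "Z \<alpha> = (\<Sum>j\<in>{J..<2 * J}. \<Sum>p\<in>G. c j * cos (2 * pi * real j * (x p * \<alpha>)))" for \<alpha>
  let ?Y = Z
  have Zm: "Z \<in> borel_measurable borel" unfolding Z_def by measurable
  let ?A = "{J..<2 * J} \<times> G"
  define u where "u i = 2 * pi * real (fst i) * x (snd i)" for i
  have Y: "?Y \<alpha> = (\<Sum>i\<in>?A. c (fst i) * cos (u i * \<alpha>))" for \<alpha>
    unfolding Z_def by (simp add: sum.cartesian_product u_def split_def mult.assoc)
  have "(\<integral>\<alpha>. (?Y \<alpha>)\<^sup>2 \<partial>std_normal_distribution) \<le> \<beta>\<^sup>2 * (\<Sum>i\<in>?A. \<Sum>k\<in>?A. exp (- (u i - u k)\<^sup>2 / 2))"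
    unfolding Y by (rule cos_sum_second_moment) (use x c in \<open>auto simp: u_def\<close>)
  also have "(\<Sum>i\<in>?A. \<Sum>k\<in>?A. exp (- (u i - u k)\<^sup>2 / 2)) = dilated_pair_sum J x G"
    unfolding dilated_pair_sum_def
  proof (intro sum.cong refl)
    fix i k
    have "u i - u k = 2 * pi * (real (fst i) * x (snd i) - real (fst k) * x (snd k))" by (simp add: u_def algebra_simps)
    then show "exp (- (u i - u k)\<^sup>2 / 2) = exp (- 2 * pi\<^sup>2 * (real (fst i) * x (snd i) - real (fst k) * x (snd k))\<^sup>2)"
      by (simp add: power_mult_distrib)
  qed
  finally have sq: "(\<integral>\<alpha>. (?Y \<alpha>)\<^sup>2 \<partial>std_normal_distribution) \<le> D\<^sup>2" using D by linarith
  have bd: "\<bar>?Y \<alpha>\<bar> \<le> (\<Sum>i\<in>?A. \<bar>c (fst i)\<bar>)" for \<alpha>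
    unfolding Y by (rule order_trans[OF sum_abs sum_mono]) (auto simp: abs_mult intro: mult_left_le)
  have i1: "integrable std_normal_distribution (\<lambda>\<alpha>. \<bar>?Y \<alpha>\<bar>)"
    by (rule integrable_std_normal_bounded[where B = "\<Sum>i\<in>?A. \<bar>c (fst i)\<bar>"]) (use bd Zm in auto)
  have i2: "integrable std_normal_distribution (\<lambda>\<alpha>. (?Y \<alpha>)\<^sup>2)"
  proof (rule integrable_std_normal_bounded[where B = "(\<Sum>i\<in>?A. \<bar>c (fst i)\<bar>)\<^sup>2"])
    fix \<alpha>
    have "\<bar>?Y \<alpha>\<bar>\<^sup>2 \<le> (\<Sum>i\<in>?A. \<bar>c (fst i)\<bar>)\<^sup>2" by (intro power_mono bd) simp
    then show "\<bar>(?Y \<alpha>)\<^sup>2\<bar> \<le> (\<Sum>i\<in>?A. \<bar>c (fst i)\<bar>)\<^sup>2" by simp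
  qed (use Zm in simp)
  have i3: "integrable std_normal_distribution (\<lambda>\<alpha>. D)" by (rule integrable_std_normal_bounded[where B = D]) (use D in auto)
  have "(\<integral>\<alpha>. \<bar>?Y \<alpha>\<bar> \<partial>std_normal_distribution) \<le> (\<integral>\<alpha>. (1 / (2 * D)) * (?Y \<alpha>)\<^sup>2 + D / 2 \<partial>std_normal_distribution)"
  proof (rule integral_mono)
    show "integrable std_normal_distribution (\<lambda>\<alpha>. (1 / (2 * D)) * (?Y \<alpha>)\<^sup>2 + D / 2)"
      using i2 i3 by (intro Bochner_Integration.integrable_add integrable_mult_right) auto
    fix \<alpha>
    have "0 \<le> (\<bar>?Y \<alpha>\<bar> - D)\<^sup>2" by simp
    then have "2 * D * \<bar>?Y \<alpha>\<bar> \<le> (?Y \<alpha>)\<^sup>2 + D\<^sup>2" by (simp add: power2_diff mult_ac)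
    then have "2 * D * \<bar>?Y \<alpha>\<bar> / (2 * D) \<le> ((?Y \<alpha>)\<^sup>2 + D\<^sup>2) / (2 * D)" using D by (intro divide_right_mono) auto
    then show "\<bar>?Y \<alpha>\<bar> \<le> (1 / (2 * D)) * (?Y \<alpha>)\<^sup>2 + D / 2" using D by (simp add: add_divide_distrib power2_eq_square)
  qed (rule i1)
  also have "\<dots> = (1 / (2 * D)) * (\<integral>\<alpha>. (?Y \<alpha>)\<^sup>2 \<partial>std_normal_distribution) + D / 2"
    using i2 i3 prob_space.prob_space[OF real_distribution_std_normal(2)]
    by (subst Bochner_Integration.integral_add) (auto intro!: integrable_mult_right)
  also have "\<dots> \<le> (1 / (2 * D)) * D\<^sup>2 + D / 2" using sq D by (intro add_right_mono mult_left_mono) auto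
  also have "\<dots> = D" using D by (simp add: power2_eq_square)
  finally show ?thesis unfolding Z_def .
qed

lemma sum_inverse_square_le:
  assumes "m \<ge> 1"
  shows "(\<Sum>j\<in>{m..<L}. 1 / (real j)\<^sup>2) \<le> 2 / real m"
proof -
  have "(\<Sum>j\<in>{m..<L}. 1 / (real j)\<^sup>2) \<le> 2 / real m - 2 / real L" if "m \<le> L" for L
    using that
  proof (induction L rule: dec_induct)
    case (step L)
    have L: "real L \<ge> 1" using step assms by simp
    have "real L * (real L + 1) \<le> real L * (2 * real L)" using L by (intro mult_left_mono) auto
    then have "2 / (real L * (2 * real L)) \<le> 2 / (real L * (real L + 1))" using L by (intro divide_left_mono) auto
    also have "\<dots> = 2 / real L - 2 / real (Suc L)" using L by (simp add: field_simps)
    finally have "1 / (real L)\<^sup>2 \<le> 2 / real L - 2 / real (Suc L)" by (simp add: power2_eq_square)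
    then show ?case using step by simp
  qed simp
  from this[of L] show ?thesis by (cases "m \<le> L") (auto intro: order_trans)
qed

text \<open>The coefficient decay bounds the tail uniformly in x, so a finite trigonometric
  polynomial can replace the trapezoid under the integral.\<close>

lemma trap_truncate:
  assumes ab: "0 < a" "a < b" "b \<le> 1/2" and m: "m \<ge> 1"
  shows "\<bar>trapezoid a b x - (a + b) - (\<Sum>j\<in>{1..<m}. trapezoid_coeff a b j * cos (2 * pi * real j * x))\<bar> \<le> 1 / ((b - a) * real m)"
proof -
  let ?F = "\<lambda>j. trapezoid_coeff a b j * cos (2 * pi * real j * x)"
  have "(\<lambda>L. \<Sum>n<L. ?F (Suc n)) \<longlonglongrightarrow> trapezoid a b x - (a + b)"
    using trap_series[OF ab, of x] unfolding sums_def .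
  moreover have shift: "(\<Sum>n<L. F (Suc n)) = (\<Sum>j\<in>{1..<Suc L}. F j)" for L and F :: "nat \<Rightarrow> real"
    by (simp only: sum_bounds_lt_plus1 atLeastLessThanSuc_atLeastAtMost)
  ultimately have "(\<lambda>L. \<Sum>j\<in>{1..<Suc L}. ?F j) \<longlonglongrightarrow> trapezoid a b x - (a + b)"
    using shift[of ?F] by (simp only:)
  then have "(\<lambda>L. (\<Sum>j\<in>{1..<Suc L}. ?F j) - (\<Sum>j\<in>{1..<m}. ?F j)) \<longlonglongrightarrow> trapezoid a b x - (a + b) - (\<Sum>j\<in>{1..<m}. ?F j)"
    by (intro tendsto_diff tendsto_const)
  then have lim: "(\<lambda>L. \<bar>(\<Sum>j\<in>{1..<Suc L}. ?F j) - (\<Sum>j\<in>{1..<m}. ?F j)\<bar>) \<longlonglongrightarrow> \<bar>trapezoid a b x - (a + b) - (\<Sum>j\<in>{1..<m}. ?F j)\<bar>"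
    by (rule tendsto_rabs)
  have "\<bar>(\<Sum>j\<in>{1..<Suc L}. ?F j) - (\<Sum>j\<in>{1..<m}. ?F j)\<bar> \<le> 1 / ((b - a) * real m)" if L: "L \<ge> m" for L
  proof -
    have "(\<Sum>j\<in>{1..<Suc L}. ?F j) = (\<Sum>j\<in>{1..<m}. ?F j) + (\<Sum>j\<in>{m..<Suc L}. ?F j)"
      using m L by (intro sum.atLeastLessThan_concat[symmetric]) auto
    then have "\<bar>(\<Sum>j\<in>{1..<Suc L}. ?F j) - (\<Sum>j\<in>{1..<m}. ?F j)\<bar> = \<bar>\<Sum>j\<in>{m..<Suc L}. ?F j\<bar>" by (simp only: add_diff_cancel_left')
    also have "\<dots> \<le> (\<Sum>j\<in>{m..<Suc L}. (1 / (2 * (b - a))) * (1 / (real j)\<^sup>2))"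
    proof (rule order_trans[OF sum_abs sum_mono])
      fix j assume "j \<in> {m..<Suc L}"
      then have j: "real j > 0" using m by auto
      have "4 \<le> pi * pi" using mult_mono[OF pi_ge_two pi_ge_two] by simp
      then have "4 * ((real j)\<^sup>2 * (b - a)) \<le> pi\<^sup>2 * ((real j)\<^sup>2 * (b - a))"
        unfolding power2_eq_square[of pi] using ab by (intro mult_right_mono) auto
      then have "2 / (pi\<^sup>2 * (real j)\<^sup>2 * (b - a)) \<le> 2 / (4 * ((real j)\<^sup>2 * (b - a)))"
        using j ab by (intro divide_left_mono) (auto simp: mult.assoc)
      then have t: "\<bar>trapezoid_coeff a b j\<bar> \<le> (1 / (2 * (b - a))) * (1 / (real j)\<^sup>2)"
      proof -
        have "2 / (4 * ((real j)\<^sup>2 * (b - a))) = (1 / (2 * (b - a))) * (1 / (real j)\<^sup>2)" by simp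
        then show ?thesis using trap_coeff_le(2)[OF ab(1,2), of j] \<open>2 / _ \<le> _\<close> by linarith
      qed
      have "\<bar>?F j\<bar> \<le> \<bar>trapezoid_coeff a b j\<bar>" by (simp add: abs_mult mult_left_le)
      then show "\<bar>?F j\<bar> \<le> (1 / (2 * (b - a))) * (1 / (real j)\<^sup>2)" using t by linarith
    qed
    also have "\<dots> = (1 / (2 * (b - a))) * (\<Sum>j\<in>{m..<Suc L}. 1 / (real j)\<^sup>2)" by (simp only: sum_distrib_left)
    also have "\<dots> \<le> (1 / (2 * (b - a))) * (2 / real m)" using ab by (intro mult_left_mono sum_inverse_square_le m) auto
    finally have "\<bar>(\<Sum>j\<in>{1..<Suc L}. ?F j) - (\<Sum>j\<in>{1..<m}. ?F j)\<bar> \<le> (1 / (2 * (b - a))) * (2 / real m)" .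
    moreover have "1 / (2 * d) * (2 / r) = 1 / (d * r)" for d r :: real by simp
    ultimately show ?thesis by (simp only:)
  qed
  then show ?thesis by (intro LIMSEQ_le_const2[OF lim]) blast
qed

lemma sum_dyadic: "(\<Sum>j\<in>{1..<2 ^ I}. f j) = (\<Sum>i<I. \<Sum>j\<in>{2 ^ i..<2 * 2 ^ i}. f j)" for f :: "nat \<Rightarrow> 'a::comm_monoid_add"
proof (induction I)
  case (Suc I)
  have "(\<Sum>j\<in>{1..<2 ^ Suc I}. f j) = (\<Sum>j\<in>{1..<2 ^ I}. f j) + (\<Sum>j\<in>{2 ^ I..<2 ^ Suc I}. f j)"
    by (intro sum.atLeastLessThan_concat[symmetric]) auto
  then show ?case using Suc by simp
qed simp

section \<open>Good and bad pairs\<close>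

definition all_pairs :: "nat \<Rightarrow> (nat \<times> nat) set" where
  "all_pairs N = {(n, m). 1 \<le> m \<and> m < n \<and> n \<le> N}"

lemma finite_all_pairs: "finite (all_pairs N)"
  by (rule finite_subset[of _ "{..N} \<times> {..N}"]) (auto simp: all_pairs_def)

lemma card_all_pairs: "2 * real (card (all_pairs N)) = real N * real N - real N"
proof (induction N)
  case (Suc N)
  have "all_pairs (Suc N) = all_pairs N \<union> {Suc N} \<times> {1..N}" by (auto simp: all_pairs_def)
  moreover have "all_pairs N \<inter> {Suc N} \<times> {1..N} = {}" by (auto simp: all_pairs_def)
  ultimately have "card (all_pairs (Suc N)) = card (all_pairs N) + N"
    using card_Un_disjoint[OF finite_all_pairs, of "{Suc N} \<times> {1..N}" N] by (simp add: card_cartesian_product)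
  then show ?case using Suc by (simp add: algebra_simps)
next
  case 0
  have "all_pairs 0 = {}" by (auto simp: all_pairs_def)
  then show ?case by simp
qed

lemma good_pairs_sub_all: "P > 0 \<Longrightarrow> good_pairs P N \<subseteq> all_pairs N"
  using good_pairs_sub[of P N] by (auto simp: good_pairs_def all_pairs_def)

text \<open>A bad pair has m < P or n - m < P, and each condition leaves at most N (P + 1)
  pairs.\<close>

lemma card_bad_pairs_le:
  assumes P: "P > 0"
  shows "real (card (all_pairs N - good_pairs P N)) \<le> 2 * real N * (P + 1)"
proof -
  define q where "q = nat \<lfloor>P\<rfloor>"
  have q: "real q \<le> P" using P by (simp add: q_def)
  have le_q: "k \<le> q" if "real k < P" for k :: nat using that P unfolding q_def by linarith
  have "all_pairs N - good_pairs P N \<subseteq> {1..N} \<times> {0..q} \<union> (\<lambda>(m, d). (m + d, m)) ` ({1..N} \<times> {0..q})"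
  proof clarify
    fix n m assume h: "(n, m) \<in> all_pairs N" "(n, m) \<notin> good_pairs P N"
      "(n, m) \<notin> (\<lambda>(m, d). (m + d, m)) ` ({1..N} \<times> {0..q})"
    have nm: "1 \<le> m" "m < n" "n \<le> N" using h(1) by (auto simp: all_pairs_def)
    have "real (n - m) \<ge> P"
    proof (rule ccontr)
      assume "\<not> P \<le> real (n - m)"
      then have "n - m \<le> q" by (intro le_q) auto
      then have "(n, m) = (\<lambda>(m, d). (m + d, m)) (m, n - m) \<and> (m, n - m) \<in> {1..N} \<times> {0..q}" using nm by auto
      then show False using h(3) by blast
    qed
    then have "real m < P" using h(2) nm by (auto simp: good_pairs_def of_nat_diff)
    then show "n \<in> {1..N} \<and> m \<in> {0..q}" using nm le_q by auto
  qed
  then have "card (all_pairs N - good_pairs P N) \<le> card ({1..N} \<times> {0..q} \<union> (\<lambda>(m, d). (m + d, m)) ` ({1..N} \<times> {0..q}))"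
    by (intro card_mono) auto
  also have "\<dots> \<le> card ({1..N} \<times> {0..q}) + card ((\<lambda>(m, d). (m + d, m)) ` ({1..N} \<times> {0..q}))" by (rule card_Un_le)
  also have "\<dots> \<le> card ({1..N} \<times> {0..q}) + card ({1..N} \<times> {0..q})" by (intro add_left_mono card_image_le) auto
  also have "\<dots> = 2 * (N * Suc q)" by (simp add: card_cartesian_product)
  finally have "real (card (all_pairs N - good_pairs P N)) \<le> real (2 * (N * Suc q))" by (simp only: of_nat_le_iff)
  also have "\<dots> = 2 * real N * (real q + 1)" by (simp add: algebra_simps)
  also have "\<dots> \<le> 2 * real N * (P + 1)" using q by (intro mult_left_mono) auto
  finally show ?thesis .
qed

lemma trap_measurable [measurable]: "trapezoid a b \<in> borel_measurable borel"
  unfolding trapezoid_def[abs_def] tent_def round_def by measurable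

lemma trap_le_1: "0 < a \<Longrightarrow> a < b \<Longrightarrow> trapezoid a b x \<le> 1"
  by (rule order_trans[OF trap_bounds(2)]) (auto simp: indicator_def)

lemma integrable_trap:
  assumes "0 < a" "a < b"
  shows "integrable std_normal_distribution (\<lambda>\<alpha>. trapezoid a b (x * \<alpha>))"
proof (rule integrable_std_normal_bounded[where B = 1])
  show "\<bar>trapezoid a b (x * \<alpha>)\<bar> \<le> 1" for \<alpha>
    using trap_bounds(3)[OF assms, of "x * \<alpha>"] trap_le_1[OF assms, of "x * \<alpha>"] by simp
qed measurable

text \<open>For the bad pairs only the order of the mean matters. When x \<ge> 1 the frequency j
  averages to at most exp (- 2 pi^2 j^2), and these values sum to less than 1, so together they at
  most triple the main term a + b.\<close>

lemma integral_trap_le: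
  assumes ab: "0 < a" "a < b" "b \<le> 1/2" and x: "x \<ge> 1" and m: "m \<ge> 1"
  shows "(\<integral>\<alpha>. trapezoid a b (x * \<alpha>) \<partial>std_normal_distribution) \<le> 3 * (a + b) + 1 / ((b - a) * real m)"
proof -
  let ?M = std_normal_distribution
  let ?e = "1 / ((b - a) * real m)"
  have i: "integrable ?M (\<lambda>\<alpha>. trapezoid_coeff a b j * cos (2 * pi * real j * (x * \<alpha>)))" for j
    by (intro integrable_mult_right integrable_std_normal_bounded[where B = 1]) auto
  have ic: "integrable ?M (\<lambda>\<alpha>. c)" for c :: real by (rule integrable_std_normal_bounded[where B = "\<bar>c\<bar>"]) auto
  have isum: "integrable ?M (\<lambda>\<alpha>. \<Sum>j\<in>{1..<m}. trapezoid_coeff a b j * cos (2 * pi * real j * (x * \<alpha>)))"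
    by (intro Bochner_Integration.integrable_sum i)
  have "(\<integral>\<alpha>. trapezoid a b (x * \<alpha>) \<partial>?M) \<le> (\<integral>\<alpha>. (a + b + ?e) + (\<Sum>j\<in>{1..<m}. trapezoid_coeff a b j * cos (2 * pi * real j * (x * \<alpha>))) \<partial>?M)"
  proof (rule integral_mono)
    show "trapezoid a b (x * \<alpha>) \<le> (a + b + ?e) + (\<Sum>j\<in>{1..<m}. trapezoid_coeff a b j * cos (2 * pi * real j * (x * \<alpha>)))" for \<alpha>
      using trap_truncate[OF ab m, of "x * \<alpha>"] by linarith
  qed (intro integrable_trap ab Bochner_Integration.integrable_add ic isum)+
  also have "\<dots> = (a + b + ?e) + (\<Sum>j\<in>{1..<m}. trapezoid_coeff a b j * exp (- (2 * pi * real j * x)\<^sup>2 / 2))"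
  proof (subst Bochner_Integration.integral_add[OF ic isum], subst Bochner_Integration.integral_sum[OF i])
    have "(\<integral>\<alpha>. trapezoid_coeff a b j * cos (2 * pi * real j * (x * \<alpha>)) \<partial>?M) = trapezoid_coeff a b j * exp (- (2 * pi * real j * x)\<^sup>2 / 2)" for j
      using integral_std_normal_cos[of "2 * pi * real j * x"] by (simp add: mult.assoc)
    then show "(\<integral>\<alpha>. a + b + ?e \<partial>?M) + (\<Sum>j\<in>{1..<m}. \<integral>\<alpha>. trapezoid_coeff a b j * cos (2 * pi * real j * (x * \<alpha>)) \<partial>?M) =
      (a + b + ?e) + (\<Sum>j\<in>{1..<m}. trapezoid_coeff a b j * exp (- (2 * pi * real j * x)\<^sup>2 / 2))"
      using prob_space.prob_space[OF real_distribution_std_normal(2)] by (simp only:) simp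
  qed
  also have "\<dots> \<le> (a + b + ?e) + (\<Sum>j\<in>{1..<m}. (2 * (a + b)) * exp (- (real j * (2 * pi))\<^sup>2 / 2))"
  proof (intro add_left_mono sum_mono mult_mono)
    fix j
    show "trapezoid_coeff a b j \<le> 2 * (a + b)" using trap_coeff_le(1)[OF ab(1,2), of j] by linarith
    have "real j * (2 * pi) * 1 \<le> real j * (2 * pi) * x" using x by (intro mult_left_mono) auto
    then have "(real j * (2 * pi))\<^sup>2 \<le> (2 * pi * real j * x)\<^sup>2" by (intro power_mono) (auto simp: mult_ac)
    then show "exp (- (2 * pi * real j * x)\<^sup>2 / 2) \<le> exp (- (real j * (2 * pi))\<^sup>2 / 2)" by simp
  qed (use ab in auto)
  also have "\<dots> = (a + b + ?e) + (2 * (a + b)) * (\<Sum>j\<in>{1..<m}. exp (- (real j * (2 * pi))\<^sup>2 / 2))" by (simp only: sum_distrib_left)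
  also have "\<dots> \<le> (a + b + ?e) + (2 * (a + b)) * 1"
  proof (intro add_left_mono mult_left_mono)
    have "(\<Sum>j\<in>{1..<m}. exp (- (real j * (2 * pi))\<^sup>2 / 2)) \<le> (\<Sum>j\<in>{1..m}. exp (- (real j * (2 * pi))\<^sup>2 / 2))"
      by (intro sum_mono2) auto
    also have "\<dots> \<le> 4 / (2 * pi)" by (rule sum_exp_square_le) simp
    also have "\<dots> \<le> 1" using pi_ge_two by simp
    finally show "(\<Sum>j\<in>{1..<m}. exp (- (real j * (2 * pi))\<^sup>2 / 2)) \<le> 1" .
  qed (use ab in auto)
  finally show ?thesis by simp
qed

text \<open>Coefficient bound and pair sum bound are shaped so that every dyadic block costs the
  same; only the number \<open>I\<close> of blocks enters.\<close>

lemma trap_main_part_le: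
  fixes x :: "'a \<Rightarrow> real" and s1 s2 K C \<delta> :: real
  assumes s: "0 < s1" "s1 < s2" "2 * s2 \<le> real N" and N: "N \<ge> 1"
    and K: "2 * (s1 + s2) \<le> K" "1 / (s2 - s1) \<le> K" and C: "C \<ge> 1"
    and x: "\<And>p. p \<in> G \<Longrightarrow> x p \<ge> 0"
    and V: "\<And>J. J \<ge> 1 \<Longrightarrow> dilated_pair_sum J x G \<le> C * (real (max J N))\<^sup>2 * real N powr (2 - \<delta>)"
  shows "(\<integral>\<alpha>. \<bar>\<Sum>j\<in>{1..<2 ^ I}. \<Sum>p\<in>G. trapezoid_coeff (s1 / N) (s2 / N) j * cos (2 * pi * real j * (x p * \<alpha>))\<bar> \<partial>std_normal_distribution)
    \<le> real I * (K * C * real N powr (1 - \<delta> / 2))"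
proof -
  let ?M = std_normal_distribution
  define c where "c = trapezoid_coeff (s1 / N) (s2 / N)"
  define Y where "Y J \<alpha> = (\<Sum>j\<in>{J..<2 * J}. \<Sum>p\<in>G. c j * cos (2 * pi * real j * (x p * \<alpha>)))" for J and \<alpha> :: real
  define D where "D = K * C * real N powr (1 - \<delta> / 2)"
  have N1: "real N \<ge> 1" using N by simp
  have "0 < 2 * (s1 + s2)" using s by simp
  then have K0: "K > 0" using K(1) by linarith
  have D0: "D > 0" using K0 C N1 by (simp add: D_def)
  have ab: "0 < s1 / N" "s1 / N < s2 / N" using s N1 by (auto simp: divide_strict_right_mono)
  have blk: "(\<integral>\<alpha>. \<bar>Y J \<alpha>\<bar> \<partial>?M) \<le> D" if J: "J \<ge> 1" for J
  proof -
    \<comment> \<open>One bound for both ranges: K / N from the size of the coefficients when J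
      \<le> N, and K N / J^2 from their decay when J > N.\<close>
    define \<beta> where "\<beta> = K * real N / (real (max J N))\<^sup>2"
    have M: "real (max J N) \<ge> real N" "real (max J N) \<ge> 1" using N1 by auto
    have J1: "real J \<ge> 1" using J by simp
    have cb: "\<bar>c j\<bar> \<le> \<beta>" if j: "J \<le> j" for j
    proof (cases "J \<le> N")
      case True
      have "\<bar>c j\<bar> \<le> 2 * (s1 / N + s2 / N)" unfolding c_def by (rule trap_coeff_le(1)[OF ab])
      also have "\<dots> = 2 * (s1 + s2) / N" by (simp add: add_divide_distrib)
      also have "\<dots> \<le> K / N" using K by (intro divide_right_mono) auto
      also have "\<dots> = \<beta>" using True N1 by (simp add: \<beta>_def max_def power2_eq_square)
      finally show ?thesis .
    next
      case False
      have j1: "real J \<le> real j" using j by simp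
      have "4 \<le> pi * pi" using mult_mono[OF pi_ge_two pi_ge_two] by simp
      then have p: "2 \<le> pi\<^sup>2" by (simp add: power2_eq_square)
      have J2: "(real J)\<^sup>2 \<le> (real j)\<^sup>2" using j1 by (intro power_mono) auto
      have le: "2 * (real J)\<^sup>2 * ((s2 - s1) / N) \<le> pi\<^sup>2 * (real j)\<^sup>2 * ((s2 - s1) / N)"
        using p J2 s N1 by (intro mult_right_mono mult_mono) auto
      have pos: "0 < 2 * (real J)\<^sup>2 * ((s2 - s1) / N)" using J1 s N1 by simp
      have "2 / (pi\<^sup>2 * (real j)\<^sup>2 * ((s2 - s1) / N)) \<le> 2 / (2 * (real J)\<^sup>2 * ((s2 - s1) / N))"
        by (rule frac_le[OF _ order_refl pos le]) simp
      also have "\<dots> = (1 / (s2 - s1)) * (real N / (real J)\<^sup>2)" using s N1 by simp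
      also have "\<dots> \<le> K * (real N / (real J)\<^sup>2)" using K by (intro mult_right_mono) auto
      also have "\<dots> = \<beta>" using False by (simp add: \<beta>_def max_def)
      finally show ?thesis using trap_coeff_le(2)[OF ab, of j] by (simp add: c_def diff_divide_distrib)
    qed
    have "\<beta>\<^sup>2 * dilated_pair_sum J x G \<le> \<beta>\<^sup>2 * (C * (real (max J N))\<^sup>2 * real N powr (2 - \<delta>))" by (intro mult_left_mono V J) auto
    also have "\<dots> = C * K\<^sup>2 * ((real N)\<^sup>2 / (real (max J N))\<^sup>2) * real N powr (2 - \<delta>)"
      using M by (simp add: \<beta>_def power2_eq_square)
    also have "\<dots> \<le> C * K\<^sup>2 * 1 * real N powr (2 - \<delta>)"
    proof (intro mult_right_mono mult_left_mono)
      have "(real N)\<^sup>2 \<le> (real (max J N))\<^sup>2" using M by (intro power_mono) auto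
      then show "(real N)\<^sup>2 / (real (max J N))\<^sup>2 \<le> 1" using M by (simp add: divide_le_eq)
    qed (use C in auto)
    \<comment> \<open>Since C \<ge> 1, enlarging C to its square makes the bound the square of
      \<open>D\<close>.\<close>
    also have "\<dots> \<le> C\<^sup>2 * K\<^sup>2 * 1 * real N powr (2 - \<delta>)" using C self_le_power[of C 2] by (intro mult_right_mono) auto
    also have "real N powr (2 - \<delta>) = real N powr (1 - \<delta> / 2) * real N powr (1 - \<delta> / 2)" unfolding powr_add[symmetric] by simp
    also have "C\<^sup>2 * K\<^sup>2 * 1 * (real N powr (1 - \<delta> / 2) * real N powr (1 - \<delta> / 2)) = D\<^sup>2" by (simp add: D_def power2_eq_square)
    finally have "\<beta>\<^sup>2 * dilated_pair_sum J x G \<le> D\<^sup>2" .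
    from block_first_moment[OF x cb D0 this] show ?thesis unfolding Y_def by simp
  qed
  have iY: "integrable ?M (\<lambda>\<alpha>. \<bar>Y J \<alpha>\<bar>)" for J
    unfolding Y_def by (intro integrable_abs Bochner_Integration.integrable_sum integrable_mult_right integrable_std_normal_bounded[where B = 1]) auto
  have "(\<integral>\<alpha>. \<bar>\<Sum>j\<in>{1..<2 ^ I}. \<Sum>p\<in>G. c j * cos (2 * pi * real j * (x p * \<alpha>))\<bar> \<partial>?M) = (\<integral>\<alpha>. \<bar>\<Sum>i<I. Y (2 ^ i) \<alpha>\<bar> \<partial>?M)"
    unfolding sum_dyadic Y_def ..
  also have "\<dots> \<le> (\<integral>\<alpha>. (\<Sum>i<I. \<bar>Y (2 ^ i) \<alpha>\<bar>) \<partial>?M)"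
  proof (rule integral_mono)
    show "integrable ?M (\<lambda>\<alpha>. \<bar>\<Sum>i<I. Y (2 ^ i) \<alpha>\<bar>)"
      unfolding Y_def by (intro integrable_abs Bochner_Integration.integrable_sum integrable_mult_right integrable_std_normal_bounded[where B = 1]) auto
  qed (auto intro!: Bochner_Integration.integrable_sum iY)
  also have "\<dots> = (\<Sum>i<I. (\<integral>\<alpha>. \<bar>Y (2 ^ i) \<alpha>\<bar> \<partial>?M))" by (rule Bochner_Integration.integral_sum[OF iY])
  also have "\<dots> \<le> (\<Sum>i<I. D)" by (intro sum_mono blk) simp
  finally show ?thesis by (simp add: c_def D_def)
qed

section \<open>Almost everywhere convergence\<close>

text \<open>Summable first moments make the series of |X_k| integrable, hence finite almost
  everywhere, and the terms of a convergent series tend to 0.\<close>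

lemma AE_tendsto_0_of_summable:
  fixes X :: "nat \<Rightarrow> 'a \<Rightarrow> real"
  assumes i: "\<And>k. integrable M (X k)" and s: "summable (\<lambda>k. \<integral>x. \<bar>X k x\<bar> \<partial>M)"
  shows "AE x in M. (\<lambda>k. X k x) \<longlonglongrightarrow> 0"
proof -
  have m: "(\<lambda>x. ennreal \<bar>X k x\<bar>) \<in> borel_measurable M" for k
    using borel_measurable_integrable[OF i[of k]] by simp
  have "(\<integral>\<^sup>+x. (\<Sum>k. ennreal \<bar>X k x\<bar>) \<partial>M) = (\<Sum>k. \<integral>\<^sup>+x. ennreal \<bar>X k x\<bar> \<partial>M)"
    by (rule nn_integral_suminf[OF m])
  also have "\<dots> = (\<Sum>k. ennreal (\<integral>x. \<bar>X k x\<bar> \<partial>M))"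
    using i by (simp add: nn_integral_eq_integral)
  also have "\<dots> = ennreal (\<Sum>k. \<integral>x. \<bar>X k x\<bar> \<partial>M)" by (rule suminf_ennreal2[OF _ s]) simp
  finally have fin: "(\<integral>\<^sup>+x. (\<Sum>k. ennreal \<bar>X k x\<bar>) \<partial>M) \<noteq> \<infinity>" by simp
  have "AE x in M. (\<Sum>k. ennreal \<bar>X k x\<bar>) \<noteq> \<infinity>"
    by (rule nn_integral_PInf_AE[OF _ fin]) (rule borel_measurable_suminf_order[OF m])
  then show ?thesis
  proof (rule AE_mp, intro AE_I2 impI)
    fix x assume "(\<Sum>k. ennreal \<bar>X k x\<bar>) \<noteq> \<infinity>"
    then have "summable (\<lambda>k. \<bar>X k x\<bar>)" by (intro summable_suminf_not_top) auto
    then have "(\<lambda>k. \<bar>X k x\<bar>) \<longlonglongrightarrow> 0" by (rule summable_LIMSEQ_zero)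
    then show "(\<lambda>k. X k x) \<longlonglongrightarrow> 0" by (simp add: tendsto_rabs_zero_iff)
  qed
qed

lemma strict_mono_between:
  fixes L :: "nat \<Rightarrow> nat"
  assumes L: "strict_mono L" and N: "L k0 \<le> N"
  obtains k where "k \<ge> k0" "L k \<le> N" "N \<le> L (Suc k)"
proof -
  have "\<exists>k\<ge>k0. L k \<le> N \<and> N < L (Suc k)"
    using N
  proof (induction N rule: dec_induct)
    case base
    then show ?case using L by (intro exI[of _ k0]) (simp add: strict_mono_Suc_iff)
  next
    case (step N)
    then obtain k where k: "k \<ge> k0" "L k \<le> N" "N < L (Suc k)" by blast
    have "L (Suc k) < L (Suc (Suc k))" using L by (simp add: strict_mono_Suc_iff)
    then show ?case
      using k by (cases "Suc N < L (Suc k)") (intro exI[of _ k], simp, intro exI[of _ "Suc k"], simp)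
  qed
  then show ?thesis using that less_imp_le by blast
qed

text \<open>The counts are monotone in both arguments, so convergence along a subsequence of ratio tending
  to 1 for the smoothed counts with rational parameters is enough.\<close>

lemma count_interpolation:
  fixes Q :: "nat \<Rightarrow> real \<Rightarrow> real" and F :: "real \<Rightarrow> real \<Rightarrow> nat \<Rightarrow> real" and L :: "nat \<Rightarrow> nat"
  assumes Q: "\<And>N N' r r'. N \<le> N' \<Longrightarrow> r \<le> r' \<Longrightarrow> Q N r \<le> Q N' r'" "\<And>N r. Q N r \<ge> 0"
    and L: "strict_mono L" "\<And>k. L k \<ge> 1" "(\<lambda>k. real (L (Suc k)) / real (L k)) \<longlonglongrightarrow> 1"
    and F: "\<And>s1 s2. s1 \<in> \<rat> \<Longrightarrow> s2 \<in> \<rat> \<Longrightarrow> 0 < s1 \<Longrightarrow> s1 < s2 \<Longrightarrow> (\<lambda>k. 2 / real (L k) * F s1 s2 (L k)) \<longlonglongrightarrow> s1 + s2"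
    and FQ: "\<And>s1 s2 N. 0 < s1 \<Longrightarrow> s1 < s2 \<Longrightarrow> N \<ge> 1 \<Longrightarrow> Q N (s1 / real N) \<le> F s1 s2 N"
      "\<And>s1 s2 N. 0 < s1 \<Longrightarrow> s1 < s2 \<Longrightarrow> N \<ge> 1 \<Longrightarrow> F s1 s2 N \<le> Q N (s2 / real N)"
    and s: "s \<ge> 0"
  shows "(\<lambda>N. 2 / real N * Q N (s / real N)) \<longlonglongrightarrow> 2 * s"
proof -
  define \<rho> where "\<rho> k = real (L (Suc k)) / real (L k)" for k
  have \<rho>: "\<rho> \<longlonglongrightarrow> 1" using L(3) by (simp add: \<rho>_def[abs_def])
  have Lp: "real (L k) > 0" for k using L(2)[of k] by simp
  have ev: "eventually P sequentially"
    if E: "eventually (\<lambda>k. \<forall>N. L k \<le> N \<longrightarrow> N \<le> L (Suc k) \<longrightarrow> P N) sequentially" for P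
  proof -
    obtain k0 where k0: "\<forall>k\<ge>k0. \<forall>N. L k \<le> N \<longrightarrow> N \<le> L (Suc k) \<longrightarrow> P N"
      using E unfolding eventually_sequentially by blast
    have "P N" if "N \<ge> L k0" for N
      using strict_mono_between[OF L(1) that] k0 by metis
    then show ?thesis unfolding eventually_sequentially by blast
  qed
  show ?thesis
  proof (rule order_tendstoI)
    fix u assume u: "2 * s < u"
    then have "s < u / 2" by simp
    \<comment> \<open>Placing both parameters below u / 2 keeps the limit s1 + s2 below u.\<close>
    then obtain s1 where s1: "s1 \<in> \<rat>" "s < s1" "s1 < u / 2" using Rats_dense_in_real by blast
    obtain s2 where s2: "s2 \<in> \<rat>" "s1 < s2" "s2 < u / 2" using Rats_dense_in_real[OF s1(3)] by blast
    have pos: "0 < s1" using s s1 by simp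
    have "(\<lambda>k. s * \<rho> k) \<longlonglongrightarrow> s * 1" by (intro tendsto_intros \<rho>)
    then have e1: "eventually (\<lambda>k. s * \<rho> k < s1) sequentially" by (rule order_tendstoD) (use s1 in simp)
    have "(\<lambda>k. \<rho> k * (2 / real (L (Suc k)) * F s1 s2 (L (Suc k)))) \<longlonglongrightarrow> 1 * (s1 + s2)"
      by (intro tendsto_mult \<rho> LIMSEQ_Suc[OF F[OF s1(1) s2(1) pos s2(2)]])
    then have e2: "eventually (\<lambda>k. \<rho> k * (2 / real (L (Suc k)) * F s1 s2 (L (Suc k))) < u) sequentially"
      by (rule order_tendstoD) (use s1 s2 in simp)
    show "eventually (\<lambda>N. 2 / real N * Q N (s / real N) < u) sequentially"
    proof (rule ev, use e1 e2 in eventually_elim, intro allI impI)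
      fix k N assume h: "s * \<rho> k < s1" "\<rho> k * (2 / real (L (Suc k)) * F s1 s2 (L (Suc k))) < u" "L k \<le> N" "N \<le> L (Suc k)"
      have N: "real (L k) \<le> real N" "real N > 0" using h(3) Lp[of k] by linarith+
      \<comment> \<open>Enlarging N to \<open>L (Suc k)\<close> raises the count, and the radius s /
        N, at most s / \<open>L k\<close>, stays below s1 / \<open>L (Suc k)\<close> once
        \<open>s * \<rho> k < s1\<close>.\<close>
      have "s / real N \<le> s / real (L k)" using N Lp[of k] s by (intro divide_left_mono) auto
      also have "\<dots> = s * \<rho> k / real (L (Suc k))" using Lp[of k] Lp[of "Suc k"] by (simp add: \<rho>_def)
      also have "\<dots> \<le> s1 / real (L (Suc k))" using h(1) by (intro divide_right_mono) auto
      finally have "Q N (s / real N) \<le> Q (L (Suc k)) (s1 / real (L (Suc k)))" by (intro Q(1) h(4))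
      also have "\<dots> \<le> F s1 s2 (L (Suc k))" by (intro FQ(1) pos s2(2) L(2))
      finally have "2 / real N * Q N (s / real N) \<le> 2 / real (L k) * F s1 s2 (L (Suc k))"
        using N Lp[of k] Q(2) by (intro mult_mono divide_left_mono) auto
      also have "\<dots> = \<rho> k * (2 / real (L (Suc k)) * F s1 s2 (L (Suc k)))"
        using Lp[of k] Lp[of "Suc k"] by (simp add: \<rho>_def)
      finally show "2 / real N * Q N (s / real N) < u" using h(2) by linarith
    qed
  next
    fix l assume l: "l < 2 * s"
    show "eventually (\<lambda>N. l < 2 / real N * Q N (s / real N)) sequentially"
    proof (cases "l < 0")
      case True
      \<comment> \<open>This case includes s = 0, where no positive rational lies below s.\<close>
      have "l < 2 / real N * Q N (s / real N)" for N
      proof -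
        have "0 \<le> 2 / real N * Q N (s / real N)" by (intro mult_nonneg_nonneg Q(2)) simp
        then show ?thesis using True by linarith
      qed
      then show ?thesis by simp
    next
      case False
      then have "l / 2 < s" using l by simp
      then obtain s2 where s2: "s2 \<in> \<rat>" "l / 2 < s2" "s2 < s" using Rats_dense_in_real by blast
      obtain s1 where s1: "s1 \<in> \<rat>" "l / 2 < s1" "s1 < s2" using Rats_dense_in_real[OF s2(2)] by blast
      have pos: "0 < s1" using False s1 by simp
      have "(\<lambda>k. s2 * \<rho> k) \<longlonglongrightarrow> s2 * 1" by (intro tendsto_intros \<rho>)
      then have e1: "eventually (\<lambda>k. s2 * \<rho> k < s) sequentially" by (rule order_tendstoD) (use s2 in simp)
      have "(\<lambda>k. (2 / real (L k) * F s1 s2 (L k)) / \<rho> k) \<longlonglongrightarrow> (s1 + s2) / 1"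
        by (intro tendsto_divide \<rho> F s1 s2 pos) simp
      then have e2: "eventually (\<lambda>k. l < (2 / real (L k) * F s1 s2 (L k)) / \<rho> k) sequentially"
        by (rule order_tendstoD) (use s1 s2 in simp)
      show ?thesis
      proof (rule ev, use e1 e2 in eventually_elim, intro allI impI)
        fix k N assume h: "s2 * \<rho> k < s" "l < (2 / real (L k) * F s1 s2 (L k)) / \<rho> k" "L k \<le> N" "N \<le> L (Suc k)"
        have N: "real (L k) \<le> real N" "real N > 0" using h(3) Lp[of k] by linarith+
        have "s2 / real (L k) = s2 * \<rho> k / real (L (Suc k))" using Lp[of k] Lp[of "Suc k"] by (simp add: \<rho>_def)
        also have "\<dots> \<le> s / real (L (Suc k))" using h(1) by (intro divide_right_mono) auto
        also have "\<dots> \<le> s / real N" using N h(4) s by (intro divide_left_mono) auto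
        finally have "Q (L k) (s2 / real (L k)) \<le> Q N (s / real N)" by (intro Q(1) h(3))
        moreover have "F s1 s2 (L k) \<le> Q (L k) (s2 / real (L k))" by (intro FQ(2) pos s1(3) L(2))
        ultimately have q: "F s1 s2 (L k) \<le> Q N (s / real N)" by linarith
        have "(2 / real (L k) * F s1 s2 (L k)) / \<rho> k = 2 / real (L (Suc k)) * F s1 s2 (L k)"
          using Lp[of k] Lp[of "Suc k"] by (simp add: \<rho>_def)
        also have "\<dots> \<le> 2 / real (L (Suc k)) * Q N (s / real N)" using q by (intro mult_left_mono) auto
        also have "\<dots> \<le> 2 / real N * Q N (s / real N)" using N h(4) Q(2) by (intro mult_right_mono divide_left_mono) auto
        finally show "l < 2 / real N * Q N (s / real N)" using h(2) by linarith
      qed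
    qed
  qed
qed

text \<open>Bad pairs are controlled by their mean alone, good pairs by truncating the Fourier
  series and applying \<open>trap_main_part_le\<close>. For fixed s1, s2 every error is smaller than
  the main term by a power of N.\<close>

lemma pair_average_L1:
  fixes g :: real
  assumes g: "g > 0"
  obtains d where "d > 0" "\<And>s1 s2. 0 < s1 \<Longrightarrow> s1 < s2 \<Longrightarrow> \<exists>C. \<forall>N. 1 \<le> N \<longrightarrow> 2 * s2 \<le> real N \<longrightarrow>
    (\<integral>\<alpha>. \<bar>2 / real N * (\<Sum>p\<in>all_pairs N. trapezoid (s1 / real N) (s2 / real N) (pdiff (g + 1) p * \<alpha>)) - (s1 + s2)\<bar> \<partial>std_normal_distribution)
      \<le> C * real N powr (- d)"
proof -
  obtain C0 \<delta> \<epsilon> :: real where C0: "C0 \<ge> 0" and de: "0 < \<delta>" "\<delta> \<le> 1" "0 < \<epsilon>" "\<epsilon> \<le> 1/2" and V: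
    "\<And>N J. N \<ge> 1 \<Longrightarrow> J \<ge> 1 \<Longrightarrow> dilated_pair_sum J (pdiff (g + 1)) (good_pairs (real N powr (1 - \<epsilon>)) N) \<le> C0 * (real (max J N))\<^sup>2 * real N powr (2 - \<delta>)"
    using block_bound[OF g] by blast
  define C where "C = max 1 C0"
  \<comment> \<open>Half of the exponent \<delta> / 2 saved in each block pays for the logarithmic
    number of blocks.\<close>
  define \<kappa> where "\<kappa> = \<delta> / 4"
  define d where "d = min \<epsilon> \<kappa>"
  have \<kappa>: "0 < \<kappa>" "\<kappa> \<le> 1" using de by (auto simp: \<kappa>_def)
  have d: "d > 0" "d \<le> \<epsilon>" "d \<le> \<kappa>" "d \<le> 1" using de \<kappa> by (auto simp: d_def)
  let ?M = std_normal_distribution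
  let ?x = "pdiff (g + 1)"
  show ?thesis
  proof (rule that[OF d(1)])
    fix s1 s2 :: real assume s: "0 < s1" "s1 < s2"
    define K where "K = max (2 * (s1 + s2)) (1 / (s2 - s1))"
    have K: "2 * (s1 + s2) \<le> K" "1 / (s2 - s1) \<le> K" by (auto simp: K_def)
    have "0 < 2 * (s1 + s2)" using s by simp
    then have K0: "K > 0" using K(1) by linarith
    define B where "B = 35 * K + 2 * (8 / \<kappa> + 1) * K * C"
    show "\<exists>C. \<forall>N. 1 \<le> N \<longrightarrow> 2 * s2 \<le> real N \<longrightarrow>
      (\<integral>\<alpha>. \<bar>2 / real N * (\<Sum>p\<in>all_pairs N. trapezoid (s1 / real N) (s2 / real N) (?x p * \<alpha>)) - (s1 + s2)\<bar> \<partial>?M) \<le> C * real N powr (- d)"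
    proof (intro exI[of _ B] allI impI)
      fix N :: nat assume N: "1 \<le> N" and sN: "2 * s2 \<le> real N"
      have N1: "real N \<ge> 1" "real N > 0" using N by auto
      define X where "X a = real N powr a" for a
      have X: "X a > 0" "X a * X b = X (a + b)" for a b using N1 by (auto simp: X_def powr_add)
      have Xm: "X a \<le> X b" if "a \<le> b" for a b unfolding X_def using N1 that by (intro powr_mono) auto
      have X1: "X 1 = real N" "X 0 = 1" using N1 by (auto simp: X_def)
      have Xinv: "1 / real N = X (- 1)" using N1 by (simp add: X_def powr_minus_divide)
      define P where "P = X (1 - \<epsilon>)"
      have P: "P \<ge> 1" "P > 0" using Xm[of 0 "1 - \<epsilon>"] X1 de by (auto simp: P_def)
      define G where "G = good_pairs P N"
      define R where "R = all_pairs N - G"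
      define a where "a = s1 / real N"
      define b where "b = s2 / real N"
      have ab: "0 < a" "a < b" "b \<le> 1/2" using s sN N1 by (auto simp: a_def b_def field_simps)
      have absum: "a + b = (s1 + s2) / real N" "b - a = (s2 - s1) / real N" by (auto simp: a_def b_def add_divide_distrib diff_divide_distrib)
      have GA: "G \<subseteq> all_pairs N" unfolding G_def by (rule good_pairs_sub_all[OF P(2)])
      have finG: "finite G" "finite R" using finite_subset[OF GA finite_all_pairs] finite_all_pairs by (auto simp: R_def)
      have xge: "?x p \<ge> 1" if "p \<in> all_pairs N" for p
      proof -
        obtain n m where p: "p = (n, m)" by (cases p)
        have "1 \<le> m" "m < n" using that by (auto simp: p all_pairs_def)
        then have "1 powr g \<le> real n powr (g + 1) - real m powr (g + 1)" by (intro powr_diff_ge g) auto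
        then show ?thesis by (simp add: p pdiff_def)
      qed
      \<comment> \<open>Cutting at m = 2^I \<ge> N^4 leaves a truncation error of order N^(-3) per
        pair, negligible even when added over N^2 pairs.\<close>
      define I where "I = nat \<lceil>4 * log 2 (real N)\<rceil>"
      define m where "m = (2::nat) ^ I"
      have m1: "m \<ge> 1" by (simp add: m_def)
      have lg: "0 \<le> log 2 (real N)" using N1 by simp
      have mN: "real m \<ge> X 4"
      proof -
        have "X 4 = 2 powr (log 2 (real N) * 4)" unfolding X_def powr_powr[symmetric] using N1 by simp
        also have "\<dots> \<le> 2 powr real I" unfolding I_def using lg by (intro powr_mono) linarith+
        also have "\<dots> = real m" by (simp add: m_def powr_realpow)
        finally show ?thesis .
      qed
      have IX: "real I \<le> (8 / \<kappa> + 1) * X \<kappa>"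
      proof -
        have "real I \<le> 4 * log 2 (real N) + 1" unfolding I_def using lg by linarith
        also have "log 2 (real N) \<le> 2 * ln (real N)"
        proof -
          have "ln (real N) / ln 2 \<le> ln (real N) / (1/2)" using ln2_ge_two_thirds N1 by (intro divide_left_mono) auto
          then show ?thesis by (simp add: log_def)
        qed
        also have "ln (real N) \<le> X \<kappa> / \<kappa>" unfolding X_def by (rule ln_powr_bound[OF N1(1) \<kappa>(1)])
        finally have "real I \<le> 8 * (X \<kappa> / \<kappa>) + 1" by simp
        moreover have "1 \<le> X \<kappa>" using Xm[of 0 \<kappa>] \<kappa> X1 by simp
        ultimately show ?thesis by (simp add: distrib_right)
      qed
      define e where "e = 1 / ((b - a) * real m)"
      have e0: "e > 0" using ab m1 by (simp add: e_def)
      have eK: "e \<le> K * X (- 3)"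
      proof -
        have "e = (1 / (s2 - s1)) * (real N / real m)" unfolding e_def absum(2) by simp
        also have "\<dots> \<le> K * (real N / X 4)" using K s mN X(1)[of 4] K0 N1 by (intro mult_mono divide_left_mono) (auto intro!: mult_pos_pos)
        also have "real N / X 4 = X 1 / X 4" by (simp only: X1)
        also have "\<dots> = X (- 3)" unfolding X_def powr_diff[symmetric] by simp
        finally show ?thesis .
      qed
      define f where "f p \<alpha> = trapezoid a b (?x p * \<alpha>)" for p and \<alpha> :: real
      define Z where "Z \<alpha> = (\<Sum>j\<in>{1..<2 ^ I}. \<Sum>p\<in>G. trapezoid_coeff a b j * cos (2 * pi * real j * (?x p * \<alpha>)))" for \<alpha>
      define r where "r = real (card R)"
      define q where "q = real (card G)"
      have r: "0 \<le> r" "r \<le> 4 * X (2 - \<epsilon>)"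
      proof -
        have "r \<le> 2 * real N * (P + 1)" unfolding r_def R_def G_def by (rule card_bad_pairs_le[OF P(2)])
        also have "\<dots> \<le> 2 * real N * (2 * P)" using P by (intro mult_left_mono) auto
        also have "\<dots> = 4 * (X 1 * X (1 - \<epsilon>))" by (simp add: P_def X1)
        finally show "r \<le> 4 * X (2 - \<epsilon>)" unfolding X(2) by simp
      qed (simp add: r_def)
      have qr: "2 * q = real N * real N - real N - 2 * r"
      proof -
        have "card (all_pairs N) = card G + card R" unfolding R_def
          using card_Diff_subset[OF finG(1) GA] card_mono[OF finite_all_pairs GA] by simp
        then show ?thesis using card_all_pairs[of N] by (simp add: q_def r_def)
      qed
      have q: "0 \<le> q" "q \<le> real N * real N" using qr r N1 by (simp_all add: q_def)
      have Zf: "\<bar>(\<Sum>p\<in>G. f p \<alpha>) - q * (a + b) - Z \<alpha>\<bar> \<le> q * e" for \<alpha>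
      proof -
        have "(\<Sum>p\<in>G. f p \<alpha>) - q * (a + b) - Z \<alpha> = (\<Sum>p\<in>G. f p \<alpha> - (a + b) - (\<Sum>j\<in>{1..<m}. trapezoid_coeff a b j * cos (2 * pi * real j * (?x p * \<alpha>))))"
          unfolding Z_def m_def by (subst sum.swap) (simp add: sum_subtractf q_def)
        also have "\<bar>\<dots>\<bar> \<le> (\<Sum>p\<in>G. e)"
          unfolding f_def e_def by (rule order_trans[OF sum_abs sum_mono]) (rule trap_truncate[OF ab m1])
        finally show ?thesis by (simp add: q_def)
      qed
      define E1 where "E1 = q * e"
      \<comment> \<open>The error in the main term: twice the number of good pairs falls short of
        N^2 by N + 2 r.\<close>
      define E2 where "E2 = K * (1 / real N + 2 * r / (real N * real N))"
      have pt: "\<bar>2 / real N * (\<Sum>p\<in>all_pairs N. f p \<alpha>) - (s1 + s2)\<bar> \<le> 2 / real N * ((\<Sum>p\<in>R. f p \<alpha>) + \<bar>Z \<alpha>\<bar> + E1) + E2" for \<alpha>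
      proof -
        define SR where "SR = (\<Sum>p\<in>R. f p \<alpha>)"
        define SG where "SG = (\<Sum>p\<in>G. f p \<alpha>)"
        have "(\<Sum>p\<in>all_pairs N. f p \<alpha>) = SR + SG"
          unfolding SR_def SG_def R_def by (rule sum.subset_diff[OF GA finite_all_pairs])
        then have p1: "2 / real N * (\<Sum>p\<in>all_pairs N. f p \<alpha>) - (s1 + s2) = 2 / real N * (SR + (SG - q * (a + b))) + (2 / real N * (q * (a + b)) - (s1 + s2))"
          by (simp add: algebra_simps)
        have p2: "2 / real N * (q * (a + b)) - (s1 + s2) = - (s1 + s2) * (1 / real N + 2 * r / (real N * real N))"
        proof -
          have "2 / real N * (q * (a + b)) = (2 * q) * (s1 + s2) / (real N * real N)" unfolding absum by simp
          then show ?thesis unfolding qr using N1 by (simp add: field_simps)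
        qed
        have p3: "\<bar>- (s1 + s2) * (1 / real N + 2 * r / (real N * real N))\<bar> \<le> E2"
        proof -
          have p: "0 \<le> 1 / real N + 2 * r / (real N * real N)" using r by simp
          have "\<bar>- (s1 + s2)\<bar> \<le> K" using K s by simp
          then have "\<bar>- (s1 + s2)\<bar> * (1 / real N + 2 * r / (real N * real N)) \<le> E2" unfolding E2_def by (rule mult_right_mono[OF _ p])
          then show ?thesis using p by (simp only: abs_mult abs_of_nonneg)
        qed
        have p4: "\<bar>2 / real N * (SR + (SG - q * (a + b)))\<bar> \<le> 2 / real N * (SR + \<bar>Z \<alpha>\<bar> + E1)"
        proof -
          have "0 \<le> SR" unfolding SR_def f_def by (intro sum_nonneg trap_bounds(3) ab)
          then have "\<bar>SR + (SG - q * (a + b))\<bar> \<le> SR + \<bar>Z \<alpha>\<bar> + E1"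
            using Zf[of \<alpha>] unfolding SG_def E1_def by linarith
          then have "2 / real N * \<bar>SR + (SG - q * (a + b))\<bar> \<le> 2 / real N * (SR + \<bar>Z \<alpha>\<bar> + E1)" by (intro mult_left_mono) auto
          moreover have "\<bar>2 / real N * y\<bar> = 2 / real N * \<bar>y\<bar>" for y :: real by (simp add: abs_mult)
          ultimately show ?thesis by (simp only:)
        qed
        have tri: "\<bar>x\<bar> \<le> u + v" if "x = y + z" "z = w" "\<bar>w\<bar> \<le> v" "\<bar>y\<bar> \<le> u" for x y z w u v :: real
          using that by linarith
        show ?thesis unfolding SR_def[symmetric] by (rule tri[OF p1 p2 p3 p4])
      qed
      have ifp: "integrable ?M (f p)" for p unfolding f_def by (rule integrable_trap[OF ab(1,2)])
      have iR: "integrable ?M (\<lambda>\<alpha>. \<Sum>p\<in>R. f p \<alpha>)" by (intro Bochner_Integration.integrable_sum ifp)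
      have iZ: "integrable ?M (\<lambda>\<alpha>. \<bar>Z \<alpha>\<bar>)"
        unfolding Z_def by (intro integrable_abs Bochner_Integration.integrable_sum integrable_mult_right integrable_std_normal_bounded[where B = 1]) auto
      have ic: "integrable ?M (\<lambda>\<alpha>. c)" for c :: real by (rule integrable_std_normal_bounded[where B = "\<bar>c\<bar>"]) auto
      have cst: "(\<integral>\<alpha>. c \<partial>?M) = c" for c :: real
        using prob_space.prob_space[OF real_distribution_std_normal(2)] by simp
      have "(\<integral>\<alpha>. \<bar>2 / real N * (\<Sum>p\<in>all_pairs N. f p \<alpha>) - (s1 + s2)\<bar> \<partial>?M) \<le> (\<integral>\<alpha>. 2 / real N * ((\<Sum>p\<in>R. f p \<alpha>) + \<bar>Z \<alpha>\<bar> + E1) + E2 \<partial>?M)"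
        by (rule integral_mono[OF _ _ pt])
           (intro integrable_abs Bochner_Integration.integrable_diff Bochner_Integration.integrable_add integrable_mult_right Bochner_Integration.integrable_sum ifp iR iZ ic)+
      also have "\<dots> = 2 / real N * ((\<Sum>p\<in>R. (\<integral>\<alpha>. f p \<alpha> \<partial>?M)) + (\<integral>\<alpha>. \<bar>Z \<alpha>\<bar> \<partial>?M) + E1) + E2"
        by (simp only: Bochner_Integration.integral_add[OF integrable_mult_right[OF Bochner_Integration.integrable_add[OF Bochner_Integration.integrable_add[OF iR iZ] ic]] ic]
          Bochner_Integration.integral_add[OF Bochner_Integration.integrable_add[OF iR iZ] ic] Bochner_Integration.integral_add[OF iR iZ]
          Bochner_Integration.integral_sum[OF ifp] cst integral_mult_right_zero)
      also have "\<dots> \<le> 2 / real N * (r * (3 * K * X (- 1)) + real I * (K * C * X (1 - \<delta> / 2)) + X 2 * (K * X (- 3))) + K * (X (- 1) + 8 * X (- \<epsilon>))"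
      proof (rule add_mono[OF mult_left_mono[OF add_mono[OF add_mono]]])
        have "(\<integral>\<alpha>. f p \<alpha> \<partial>?M) \<le> 3 * K * X (- 1)" if "p \<in> R" for p
        proof -
          have "(\<integral>\<alpha>. f p \<alpha> \<partial>?M) \<le> 3 * (a + b) + e"
            unfolding f_def e_def using that by (intro integral_trap_le ab m1 xge) (simp add: R_def)
          moreover have "2 * (a + b) \<le> K * X (- 1)"
          proof -
            have "2 * (a + b) = 2 * (s1 + s2) * (1 / real N)" unfolding absum by simp
            also have "\<dots> \<le> K * (1 / real N)" using K by (intro mult_right_mono) auto
            finally show ?thesis unfolding Xinv .
          qed
          moreover have "K * X (- 3) \<le> K * X (- 1)" using K0 by (intro mult_left_mono Xm) auto
          moreover have "0 < K * X (- 1)" using K0 X(1) by simp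
          ultimately show ?thesis using eK by linarith
        qed
        then have "(\<Sum>p\<in>R. (\<integral>\<alpha>. f p \<alpha> \<partial>?M)) \<le> (\<Sum>p\<in>R. 3 * K * X (- 1))" by (intro sum_mono)
        then show "(\<Sum>p\<in>R. (\<integral>\<alpha>. f p \<alpha> \<partial>?M)) \<le> r * (3 * K * X (- 1))" by (simp add: r_def)
        show "(\<integral>\<alpha>. \<bar>Z \<alpha>\<bar> \<partial>?M) \<le> real I * (K * C * X (1 - \<delta> / 2))"
          unfolding Z_def a_def b_def X_def
        proof (rule trap_main_part_le[OF s sN N K])
          show "1 \<le> C" by (simp add: C_def)
          show "0 \<le> ?x p" if "p \<in> G" for p using xge[of p] that GA by auto
          fix J :: nat assume J: "J \<ge> 1"
          have "dilated_pair_sum J ?x G \<le> C0 * (real (max J N))\<^sup>2 * real N powr (2 - \<delta>)"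
            unfolding G_def P_def X_def by (rule V[OF N J])
          also have "\<dots> \<le> C * (real (max J N))\<^sup>2 * real N powr (2 - \<delta>)" by (intro mult_right_mono) (auto simp: C_def)
          finally show "dilated_pair_sum J ?x G \<le> C * (real (max J N))\<^sup>2 * real N powr (2 - \<delta>)" .
        qed
        have "X 2 = real N * real N" using X(2)[of 1 1] X1 by simp
        then show "E1 \<le> X 2 * (K * X (- 3))" unfolding E1_def using q eK e0 by (intro mult_mono) auto
        have "1 / real N = X (- 1)" by (rule Xinv)
        moreover have "2 * r / (real N * real N) \<le> 8 * X (- \<epsilon>)"
        proof -
          have "2 * r / (real N * real N) = 2 * r * (X (- 1) * X (- 1))" unfolding Xinv[symmetric] by simp
          also have "\<dots> \<le> 2 * (4 * X (2 - \<epsilon>)) * (X (- 1) * X (- 1))" using r X(1)[of "- 1"] by (intro mult_right_mono) auto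
          also have "\<dots> = 8 * (X (2 - \<epsilon>) * (X (- 1) * X (- 1)))" by simp
          finally show ?thesis unfolding X(2) by simp
        qed
        ultimately show "E2 \<le> K * (X (- 1) + 8 * X (- \<epsilon>))" unfolding E2_def using K0 by (intro mult_left_mono) auto
      qed simp
      also have "\<dots> \<le> B * X (- d)"
      proof -
        have t1: "2 / real N * (r * (3 * K * X (- 1))) \<le> 24 * K * X (- d)"
        proof -
          have "2 / real N * (r * (3 * K * X (- 1))) = 6 * K * (r * (X (- 1) * X (- 1)))" unfolding Xinv[symmetric] by simp
          also have "\<dots> \<le> 6 * K * (4 * X (2 - \<epsilon>) * (X (- 1) * X (- 1)))" using r K0 X(1)[of "- 1"] by (intro mult_left_mono mult_right_mono) auto
          also have "\<dots> = 24 * K * (X (2 - \<epsilon>) * (X (- 1) * X (- 1)))" by simp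
          also have "\<dots> \<le> 24 * K * X (- d)" unfolding X(2) using K0 d by (intro mult_left_mono Xm) auto
          finally show ?thesis .
        qed
        have t2: "2 / real N * (real I * (K * C * X (1 - \<delta> / 2))) \<le> 2 * (8 / \<kappa> + 1) * K * C * X (- d)"
        proof -
          have C1: "C \<ge> 1" by (simp add: C_def)
          have "2 / real N * (real I * (K * C * X (1 - \<delta> / 2))) = real I * (2 * K * C * (X (- 1) * X (1 - \<delta> / 2)))" unfolding Xinv[symmetric] by simp
          also have "\<dots> \<le> (8 / \<kappa> + 1) * X \<kappa> * (2 * K * C * (X (- 1) * X (1 - \<delta> / 2)))"
            using K0 C1 X(1)[of "- 1"] X(1)[of "1 - \<delta> / 2"] by (intro mult_right_mono IX) auto
          also have "\<dots> = 2 * (8 / \<kappa> + 1) * K * C * (X \<kappa> * (X (- 1) * X (1 - \<delta> / 2)))" by simp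
          also have "\<dots> \<le> 2 * (8 / \<kappa> + 1) * K * C * X (- d)"
            unfolding X(2) using K0 C1 \<kappa> d by (intro mult_left_mono Xm) (auto simp: \<kappa>_def)
          finally show ?thesis .
        qed
        have t3: "2 / real N * (X 2 * (K * X (- 3))) \<le> 2 * K * X (- d)"
        proof -
          have "2 / real N * (X 2 * (K * X (- 3))) = 2 * K * (X (- 1) * (X 2 * X (- 3)))" unfolding Xinv[symmetric] by simp
          also have "\<dots> \<le> 2 * K * X (- d)" unfolding X(2) using K0 d by (intro mult_left_mono Xm) auto
          finally show ?thesis .
        qed
        have t4: "K * (X (- 1) + 8 * X (- \<epsilon>)) \<le> K * (X (- d) + 8 * X (- d))"
          using K0 d by (intro mult_left_mono add_mono Xm) auto
        have "2 / real N * (r * (3 * K * X (- 1)) + real I * (K * C * X (1 - \<delta> / 2)) + X 2 * (K * X (- 3)))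
          = 2 / real N * (r * (3 * K * X (- 1))) + 2 / real N * (real I * (K * C * X (1 - \<delta> / 2))) + 2 / real N * (X 2 * (K * X (- 3)))"
          by (simp only: distrib_left)
        moreover have "B * X (- d) = 24 * K * X (- d) + 2 * (8 / \<kappa> + 1) * K * C * X (- d) + 2 * K * X (- d) + K * (X (- d) + 8 * X (- d))"
          by (simp add: B_def distrib_right)
        ultimately show ?thesis using t1 t2 t3 t4 by linarith
      qed
      finally show "(\<integral>\<alpha>. \<bar>2 / real N * (\<Sum>p\<in>all_pairs N. trapezoid (s1 / real N) (s2 / real N) (?x p * \<alpha>)) - (s1 + s2)\<bar> \<partial>?M) \<le> B * real N powr (- d)"
        unfolding f_def a_def b_def X_def .
    qed
  qed
qed

text \<open>Along \<open>L\<close> the first moments are dominated by a multiple of 1 / k^2, so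
  \<open>AE_tendsto_0_of_summable\<close> applies.\<close>

lemma pair_average_AE:
  fixes g d s1 s2 :: real and L :: "nat \<Rightarrow> nat"
  assumes s: "0 < s1" "s1 < s2" and C: "\<And>N. 1 \<le> N \<Longrightarrow> 2 * s2 \<le> real N \<Longrightarrow>
      (\<integral>\<alpha>. \<bar>2 / real N * (\<Sum>p\<in>all_pairs N. trapezoid (s1 / real N) (s2 / real N) (pdiff (g + 1) p * \<alpha>)) - (s1 + s2)\<bar> \<partial>std_normal_distribution)
      \<le> C * real N powr (- d)"
    and L: "\<And>k. real k + 1 \<le> real (L k)" "\<And>k. real (L k) powr (- d) \<le> 1 / (real (Suc k))\<^sup>2"
  shows "AE \<alpha> in std_normal_distribution.
    (\<lambda>k. 2 / real (L k) * (\<Sum>p\<in>all_pairs (L k). trapezoid (s1 / real (L k)) (s2 / real (L k)) (pdiff (g + 1) p * \<alpha>))) \<longlonglongrightarrow> s1 + s2"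
proof -
  let ?M = std_normal_distribution
  define W where "W N \<alpha> = 2 / real N * (\<Sum>p\<in>all_pairs N. trapezoid (s1 / real N) (s2 / real N) (pdiff (g + 1) p * \<alpha>)) - (s1 + s2)" for N and \<alpha> :: real
  \<comment> \<open>Skipping the first \<open>k0\<close> terms ensures 2 s2 \<le>
    \<open>L k\<close>, so that the trapezoid fits into one period.\<close>
  define k0 where "k0 = nat \<lceil>2 * s2\<rceil>"
  have sq: "summable (\<lambda>k. 1 / (real (Suc k))\<^sup>2)"
    using inverse_squares_sums by (simp add: sums_iff add.commute)
  have iW: "integrable ?M (W N)" if "N \<ge> 1" for N
  proof -
    have "0 < s1 / real N" "s1 / real N < s2 / real N" using s that by (auto simp: divide_strict_right_mono)
    then have i: "integrable ?M (\<lambda>\<alpha>. trapezoid (s1 / real N) (s2 / real N) (pdiff (g + 1) p * \<alpha>))" for p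
      by (rule integrable_trap)
    have ic: "integrable ?M (\<lambda>\<alpha>. s1 + s2)" by (rule integrable_std_normal_bounded[where B = "s1 + s2"]) (use s in auto)
    show ?thesis unfolding W_def[abs_def]
      by (intro Bochner_Integration.integrable_diff integrable_mult_right Bochner_Integration.integrable_sum i ic)
  qed
  have "AE \<alpha> in ?M. (\<lambda>k. W (L (k + k0)) \<alpha>) \<longlonglongrightarrow> 0"
  proof (rule AE_tendsto_0_of_summable)
    show "integrable ?M (W (L (k + k0)))" for k using L(1)[of "k + k0"] by (intro iW) linarith
    show "summable (\<lambda>k. \<integral>\<alpha>. \<bar>W (L (k + k0)) \<alpha>\<bar> \<partial>?M)"
    proof (rule summable_comparison_test'[of "\<lambda>k. \<bar>C\<bar> * (1 / (real (Suc (k + k0)))\<^sup>2)" 0])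
      show "summable (\<lambda>k. \<bar>C\<bar> * (1 / (real (Suc (k + k0)))\<^sup>2))"
        using summable_ignore_initial_segment[OF sq, of k0] by (rule summable_mult)
      fix k :: nat
      have l: "1 \<le> L (k + k0)" using L(1)[of "k + k0"] by linarith
      have "2 * s2 \<le> real k0" unfolding k0_def by linarith
      then have l2: "2 * s2 \<le> real (L (k + k0))" using L(1)[of "k + k0"] by simp
      have "(\<integral>\<alpha>. \<bar>W (L (k + k0)) \<alpha>\<bar> \<partial>?M) \<le> C * real (L (k + k0)) powr (- d)"
        unfolding W_def by (rule C[OF l l2])
      also have "\<dots> \<le> \<bar>C\<bar> * (1 / (real (Suc (k + k0)))\<^sup>2)" by (intro mult_mono L(2)) auto
      finally show "norm (\<integral>\<alpha>. \<bar>W (L (k + k0)) \<alpha>\<bar> \<partial>?M) \<le> \<bar>C\<bar> * (1 / (real (Suc (k + k0)))\<^sup>2)" by simp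
    qed
  qed
  then show ?thesis
  proof (rule AE_mp, intro AE_I2 impI)
    fix \<alpha> assume "(\<lambda>k. W (L (k + k0)) \<alpha>) \<longlonglongrightarrow> 0"
    then have "(\<lambda>k. W (L k) \<alpha>) \<longlonglongrightarrow> 0" by (rule LIMSEQ_offset)
    then have "(\<lambda>k. W (L k) \<alpha> + (s1 + s2)) \<longlonglongrightarrow> 0 + (s1 + s2)" by (intro tendsto_add tendsto_const)
    then show "(\<lambda>k. 2 / real (L k) * (\<Sum>p\<in>all_pairs (L k). trapezoid (s1 / real (L k)) (s2 / real (L k)) (pdiff (g + 1) p * \<alpha>))) \<longlonglongrightarrow> s1 + s2"
      by (simp add: W_def)
  qed
qed

text \<open>At half-integers \<open>round (- x)\<close> is not \<open>- round x\<close>, so the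
  absolute differences are compared instead; each rounding minimises the distance to the integers,
  which makes them equal.\<close>

lemma periodic_indicator_uminus: "periodic_indicator r (- x) = periodic_indicator r x"
proof -
  have "\<bar>- x - of_int (round (- x))\<bar> \<le> \<bar>- x - of_int (- round x)\<bar>" by (rule round_diff_minimal)
  moreover have "\<bar>x - of_int (round x)\<bar> \<le> \<bar>x - of_int (- round (- x))\<bar>" by (rule round_diff_minimal)
  ultimately have "\<bar>- x - of_int (round (- x))\<bar> = \<bar>x - of_int (round x)\<bar>" by (simp add: abs_if split: if_splits)
  then have "- x - of_int (round (- x)) \<in> {-r..r} \<longleftrightarrow> x - of_int (round x) \<in> {-r..r}" by (auto simp: abs_if split: if_splits)
  then show ?thesis unfolding periodic_indicator_def signed_dist_nearest_int_def indicator_def by simp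
qed

lemma periodic_indicator_mono: "r \<le> r' \<Longrightarrow> periodic_indicator r x \<le> periodic_indicator r' x"
  by (auto simp: periodic_indicator_def indicator_def)

text \<open>The indicator is even, so (m, n) and (n, m) contribute equally.\<close>

lemma sum_off_diagonal:
  fixes y :: "nat \<Rightarrow> real"
  shows "(\<Sum>(m, n) \<in> {(m, n). m \<in> {1..N} \<and> n \<in> {1..N} \<and> m \<noteq> n}. periodic_indicator r (y n - y m))
    = 2 * (\<Sum>p\<in>all_pairs N. periodic_indicator r (y (fst p) - y (snd p)))"
proof -
  let ?f = "\<lambda>p. periodic_indicator r (y (fst p) - y (snd p))"
  have e: "{(m, n). m \<in> {1..N} \<and> n \<in> {1..N} \<and> m \<noteq> n} = all_pairs N \<union> prod.swap ` all_pairs N"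
  proof (intro set_eqI iffI)
    fix z assume z: "z \<in> {(m, n). m \<in> {1..N} \<and> n \<in> {1..N} \<and> m \<noteq> n}"
    then have "z \<in> all_pairs N \<or> prod.swap z \<in> all_pairs N" by (auto simp: all_pairs_def)
    then show "z \<in> all_pairs N \<union> prod.swap ` all_pairs N" by (metis UnCI image_eqI swap_swap)
  qed (auto simp: all_pairs_def)
  have "(\<Sum>(m, n) \<in> {(m, n). m \<in> {1..N} \<and> n \<in> {1..N} \<and> m \<noteq> n}. periodic_indicator r (y n - y m))
    = (\<Sum>p\<in>all_pairs N \<union> prod.swap ` all_pairs N. ?f p)"
    unfolding e
  proof (intro sum.cong refl)
    fix p
    show "(case p of (m, n) \<Rightarrow> periodic_indicator r (y n - y m)) = ?f p"
      using periodic_indicator_uminus[of r "y (fst p) - y (snd p)"] by (simp add: split_def)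
  qed
  also have "\<dots> = (\<Sum>p\<in>all_pairs N. ?f p) + (\<Sum>p\<in>prod.swap ` all_pairs N. ?f p)"
    by (rule sum.union_disjoint) (use finite_all_pairs in \<open>auto simp: all_pairs_def\<close>)
  also have "(\<Sum>p\<in>prod.swap ` all_pairs N. ?f p) = (\<Sum>p\<in>all_pairs N. ?f (prod.swap p))"
    by (subst sum.reindex) (auto simp: o_def)
  also have "\<dots> = (\<Sum>p\<in>all_pairs N. ?f p)"
  proof (intro sum.cong refl)
    fix p
    show "?f (prod.swap p) = ?f p" using periodic_indicator_uminus[of r "y (fst p) - y (snd p)"] by simp
  qed
  finally show ?thesis by simp
qed

theorem theorem3:
  fixes \<theta> :: real
  assumes "\<theta> > 1"
  shows "AE \<alpha> in lebesgue. poissonian_pair_correlation (\<lambda>n. real n powr \<theta> * \<alpha>)"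
proof -
  define g where "g = \<theta> - 1"
  have g: "g > 0" and \<theta>: "\<theta> = g + 1" using assms by (simp_all add: g_def)
  obtain d where d: "d > 0" and L1: "\<And>s1 s2. 0 < s1 \<Longrightarrow> s1 < s2 \<Longrightarrow> \<exists>C. \<forall>N. 1 \<le> N \<longrightarrow> 2 * s2 \<le> real N \<longrightarrow>
    (\<integral>\<alpha>. \<bar>2 / real N * (\<Sum>p\<in>all_pairs N. trapezoid (s1 / real N) (s2 / real N) (pdiff (g + 1) p * \<alpha>)) - (s1 + s2)\<bar> \<partial>std_normal_distribution)
      \<le> C * real N powr (- d)"
    using pair_average_L1[OF g] by blast
  \<comment> \<open>A d \<ge> 2 makes the bounds (k + 1)^(- A d) summable; since the subsequence is
    polynomial, its successive ratios still tend to 1.\<close>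
  define A where "A = nat \<lceil>2 / d\<rceil>"
  have A: "2 / d \<le> real A" unfolding A_def by linarith
  have A2: "2 \<le> real A * d" using A d by (simp add: divide_le_eq)
  have A1: "A \<ge> 1"
  proof -
    have "0 < 2 / d" using d by simp
    then have "0 < real A" using A by linarith
    then show ?thesis by simp
  qed
  \<comment> \<open>The shift by one keeps \<open>L 0\<close> positive.\<close>
  define L where "L k = Suc k ^ A" for k
  have rL: "real (L k) = (real k + 1) ^ A" for k by (simp add: L_def add.commute)
  have L_mono: "strict_mono L"
    unfolding L_def strict_mono_Suc_iff using A1 by (auto intro!: power_strict_mono simp del: power_Suc)
  have L_ge: "real k + 1 \<le> real (L k)" for k
    unfolding rL using A1 by (intro self_le_power) auto
  have L_ge1: "L k \<ge> 1" for k using L_ge[of k] by linarith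
  have L_powr: "real (L k) powr (- d) \<le> 1 / (real (Suc k))\<^sup>2" for k
  proof -
    have "real (L k) powr (- d) = (real k + 1) powr (- (real A * d))"
      unfolding rL by (simp add: powr_realpow[symmetric] powr_powr)
    also have "\<dots> \<le> (real k + 1) powr (- 2)" using A2 by (intro powr_mono) auto
    also have "\<dots> = 1 / (real (Suc k))\<^sup>2" by (simp add: powr_minus_divide add.commute)
    finally show ?thesis .
  qed
  have L_ratio: "(\<lambda>k. real (L (Suc k)) / real (L k)) \<longlonglongrightarrow> 1"
  proof -
    have "(\<lambda>k. (real k + 2) / (real k + 1)) \<longlonglongrightarrow> 1" by real_asymp
    then have "(\<lambda>k. ((real k + 2) / (real k + 1)) ^ A) \<longlonglongrightarrow> 1 ^ A" by (rule tendsto_power)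
    then show ?thesis by (simp add: rL power_divide add.commute)
  qed
  define F where "F \<alpha> s1 s2 N = (\<Sum>p\<in>all_pairs N. trapezoid (s1 / real N) (s2 / real N) (pdiff (g + 1) p * \<alpha>))" for \<alpha> s1 s2 N
  \<comment> \<open>Rational parameters give countably many limit statements, hence a single
    exceptional null set for all s.\<close>
  define S :: "(real \<times> real) set" where "S = {(s1, s2). s1 \<in> \<rat> \<and> s2 \<in> \<rat> \<and> 0 < s1 \<and> s1 < s2}"
  have "countable S"
    by (rule countable_subset[of _ "\<rat> \<times> \<rat>"]) (auto simp: S_def countable_rat)
  have "AE \<alpha> in std_normal_distribution. \<forall>z\<in>S. (\<lambda>k. 2 / real (L k) * F \<alpha> (fst z) (snd z) (L k)) \<longlonglongrightarrow> fst z + snd z"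
    unfolding AE_ball_countable[OF \<open>countable S\<close>]
  proof
    fix z assume "z \<in> S"
    then have z: "0 < fst z" "fst z < snd z" by (auto simp: S_def)
    obtain C where "\<forall>N. 1 \<le> N \<longrightarrow> 2 * snd z \<le> real N \<longrightarrow>
      (\<integral>\<alpha>. \<bar>2 / real N * (\<Sum>p\<in>all_pairs N. trapezoid (fst z / real N) (snd z / real N) (pdiff (g + 1) p * \<alpha>)) - (fst z + snd z)\<bar> \<partial>std_normal_distribution)
      \<le> C * real N powr (- d)"
      using L1[OF z] by blast
    then show "AE \<alpha> in std_normal_distribution. (\<lambda>k. 2 / real (L k) * F \<alpha> (fst z) (snd z) (L k)) \<longlonglongrightarrow> fst z + snd z"
      unfolding F_def by (intro pair_average_AE[OF z _ L_ge L_powr]) blast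
  qed
  then have "AE \<alpha> in lborel. \<forall>z\<in>S. (\<lambda>k. 2 / real (L k) * F \<alpha> (fst z) (snd z) (L k)) \<longlonglongrightarrow> fst z + snd z"
    by (simp add: AE_density normal_density_pos)
  then have "AE \<alpha> in lebesgue. \<forall>z\<in>S. (\<lambda>k. 2 / real (L k) * F \<alpha> (fst z) (snd z) (L k)) \<longlonglongrightarrow> fst z + snd z"
    by (rule AE_completion)
  then show ?thesis
  proof (rule AE_mp, intro AE_I2 impI)
    fix \<alpha> assume lim: "\<forall>z\<in>S. (\<lambda>k. 2 / real (L k) * F \<alpha> (fst z) (snd z) (L k)) \<longlonglongrightarrow> fst z + snd z"
    define Q where "Q N r = (\<Sum>p\<in>all_pairs N. periodic_indicator r (pdiff (g + 1) p * \<alpha>))" for N r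
    have pi0: "0 \<le> periodic_indicator r x" for r x by (simp add: periodic_indicator_def)
    have lims: "(\<lambda>N. 2 / real N * Q N (s / real N)) \<longlonglongrightarrow> 2 * s" if s: "s \<ge> 0" for s
    proof (rule count_interpolation[where F = "F \<alpha>", OF _ _ L_mono L_ge1 L_ratio _ _ _ s])
      fix N N' :: nat and r r' :: real assume "N \<le> N'" "r \<le> r'"
      then have "Q N r \<le> (\<Sum>p\<in>all_pairs N. periodic_indicator r' (pdiff (g + 1) p * \<alpha>))"
        unfolding Q_def by (intro sum_mono periodic_indicator_mono)
      also have "\<dots> \<le> Q N' r'"
        unfolding Q_def by (rule sum_mono2[OF finite_all_pairs]) (use \<open>N \<le> N'\<close> pi0 in \<open>auto simp: all_pairs_def\<close>)
      finally show "Q N r \<le> Q N' r'" .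
    next
      show "Q N r \<ge> 0" for N r unfolding Q_def by (intro sum_nonneg pi0)
    next
      fix s1 s2 :: real assume "s1 \<in> \<rat>" "s2 \<in> \<rat>" "0 < s1" "s1 < s2"
      then have "(s1, s2) \<in> S" by (simp add: S_def)
      then show "(\<lambda>k. 2 / real (L k) * F \<alpha> s1 s2 (L k)) \<longlonglongrightarrow> s1 + s2" using lim by force
    next
      fix s1 s2 :: real and N :: nat assume *: "0 < s1" "s1 < s2" "N \<ge> 1"
      then have ab: "0 < s1 / real N" "s1 / real N < s2 / real N" by (auto simp: divide_strict_right_mono)
      show "Q N (s1 / real N) \<le> F \<alpha> s1 s2 N" "F \<alpha> s1 s2 N \<le> Q N (s2 / real N)"
        unfolding Q_def F_def periodic_indicator_def signed_dist_nearest_int_def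
        by (intro sum_mono trap_bounds ab)+
    qed
    have eq: "1 / real N * (\<Sum>(m, n) \<in> {(m, n). m \<in> {1..N} \<and> n \<in> {1..N} \<and> m \<noteq> n}.
        periodic_indicator r (real n powr \<theta> * \<alpha> - real m powr \<theta> * \<alpha>)) = 2 / real N * Q N r" for N r
      unfolding sum_off_diagonal[where y = "\<lambda>n. real n powr \<theta> * \<alpha>"] Q_def
      by (simp add: pdiff_def \<theta> left_diff_distrib)
    show "poissonian_pair_correlation (\<lambda>n. real n powr \<theta> * \<alpha>)"
      unfolding poissonian_pair_correlation_def eq using lims by blast
  qed
qed

end
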